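(* Let $\tilde{\boldsymbol w}_i=w^o-\boldsymbol w_i\in\mathbb R^{NM}$ be the network error vector of the group-wise adapt-then-combine diffusion strategy described in the context. Let $\Phi\in\mathbb R^{GM\times GM}$ be the unique solution of the Lyapunov equation $\bar{\mathcal H}\Phi+\Phi\bar{\mathcal H}=\bar{\mathcal R}$, let $\boldsymbol\xi=\mathrm{col}\{\boldsymbol\xi_1,\dots,\boldsymbol\xi_G\}\sim\mathcal N(0,\Phi)$ with $\boldsymbol\xi_m\in\mathbb R^M$, and let $$\boldsymbol\zeta=\mathrm{col}\{\mathbb 1_{N_1^g}\otimes\boldsymbol\xi_1,\dots,\mathbb 1_{N_G^g}\otimes\boldsymbol\xi_G\}\sim\mathcal N(0,\Pi),$$ where $\Pi\in\mathbb R^{NM\times NM}$ is the block matrix whose $(m,r)$-th block ($1\le m,r\le G$) is $(\mathbb 1_{N_m^g}\mathbb 1_{N_r^g}^{\mathsf T})\otimes\Phi_{m,r}$, with $\Phi_{m,r}$ the $(m,r)$-th $M\times M$ block of $\Phi$. Then, as $i\to\infty$ and $\mu_{\max}\to0$, the normalized error sequence $\{\tilde{\boldsymbol w}_i/\sqrt{\mu_{\max}};\,i\ge0\}$ converges in distribution close to the Gaussian random variable $\boldsymbol\zeta$ in the following sense: $$\lim_{\mu_{\max}\to0}\ \limsup_{i\to\infty}\ \mathbb E\left|f\!\left(\frac{\tilde{\boldsymbol w}_i}{\sqrt{\mu_{\max}}}\right)-f(\boldsymbol\zeta)\right|=0$$ for any bounded continuous function $f:\mathbb R^{NM}\to\mathbb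 R$.
   Context: **Network.** There are $N$ agents; agent $k$ has a neighborhood $\mathcal N_k\ni k$ and a cost $J_k:\mathbb R^{M}\to\mathbb R$ with unique minimizer $w_k^o$. Agents are partitioned into $Q\ge 2$ clusters $\mathcal C_1,\dots,\mathcal C_Q$; all agents in $\mathcal C_q$ share the same minimizer $w_k^o=w_q^\star$, and the underlying topology of each cluster is connected (agents of different clusters may also be neighbors). Agents are further partitioned into $G$ groups $\mathcal G_1,\dots,\mathcal G_G$; each group $\mathcal G_m$ is a connected collection of $N_m^g$ agents from a single cluster (agents who know that they belong to the same cluster). Agents are indexed so that agents of the same group are consecutive, and groups of the same cluster are consecutive. **Combination matrix.** $A=[a_{\ell k}]_{\ell,k=1}^N$ with, for $k\in\mathcal G_m$, $a_{\ell k}>0$ if $\ell\in\mathcal N_k\cap\mathcal G_m$, $a_{\ell k}=0$ otherwise, and $\sum_{\ell=1}^N a_{\ell k}=1$. Thus $A=\mathrm{diag}\{A_1,\dots,A_G\}$ with each $A_m$ left-stochastic and primitive. Let $p_m^g\in\mathbb R^{N_m^g}$ be the Perron vector of $A_m$: $A_mp_m^g=p_m^g$, positive entries, entries summing to one; let $p=\mathrm{col}\{p_1^g,\dots,p_G^g\}$ with entries $p_1,\dots,p_N$. **Step-sizes.** $\mu_k>0$ is the step-size of agent $k$, and $\mu_{\max}=\max_k\mu_k$. **Algorithm.** With $\boldsymbol w_{k,-1}=0$, for $i\ge 0$ and $k\in\mathcal G_m$: $$\boldsymbol\psi_{k,i}=\boldsymbol w_{k,i-1}-\mu_k\widehat{\nabla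 J_k}(\boldsymbol w_{k,i-1}),\qquad \boldsymbol w_{k,i}=\sum_{\ell\in\mathcal N_k\cap\mathcal G_m}a_{\ell k}\boldsymbol\psi_{\ell,i},$$ where $\widehat{\nabla J_k}$ is a stochastic approximation of $\nabla J_k$. Stacked vectors: $\boldsymbol w_i=\mathrm{col}\{\boldsymbol w_{1,i},\dots,\boldsymbol w_{N,i}\}\in\mathbb R^{NM}$, $w^o=\mathrm{col}\{w_1^o,\dots,w_N^o\}$. Gradient noise: $\boldsymbol s_{k,i}(\boldsymbol w_{k,i-1})=\widehat{\nabla J_k}(\boldsymbol w_{k,i-1})-\nabla J_k(\boldsymbol w_{k,i-1})$, $\boldsymbol s_i(\boldsymbol w_{i-1})=\mathrm{col}\{\boldsymbol s_{1,i}(\boldsymbol w_{1,i-1}),\dots,\boldsymbol s_{N,i}(\boldsymbol w_{N,i-1})\}$. **Matrices.** $\mathcal M=\mathrm{diag}\{\mu_1,\dots,\mu_N\}\otimes I_M$, $H_k=\nabla^2J_k(w_k^o)$, $\bar H_m=\sum_{k\in\mathcal G_m}\frac{p_k\mu_k}{\mu_{\max}}H_k$, $\bar{\mathcal H}=\mathrm{diag}\{\bar H_1,\dots,\bar H_G\}$, $\mathcal P=\mathrm{diag}\{p_1^g,\dots,p_G^g\}\otimes I_M\in\mathbb R^{NM\times GM}$, $\bar{\mathcal R}=\mu_{\max}^{-2}\mathcal P^{\mathsf T}\mathcal M\mathcal R_s\mathcal M\mathcal P$ ($\mathcal R_s$ defined below). The matrices $\bar{\mathcal H}$ and $\bar{\mathcal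 R}$ are symmetric positive definite, of order $O(\mu_{\max}^0)$, and are taken to be constant matrices as $\mu_{\max}\to0$. $\mathbb 1_n$ is the all-ones vector in $\mathbb R^n$; $\mathcal N(a,B)$ is the Gaussian law with mean $a$ and covariance $B$. **Assumptions on costs.** Each $J_k$ is strictly convex, twice differentiable, with $\lambda_{k,L}I_M\le\nabla^2J_k(w)\le\lambda_{k,U}I_M$, $0\le\lambda_{k,L}\le\lambda_{k,U}<\infty$; in each group at least one cost is strongly convex, i.e. has $\lambda_{k,L}>0$. For $w=\mathrm{col}\{w_1,\dots,w_N\}$ the matrix $\nabla^2J(w)=\mathrm{diag}\{\nabla^2J_1(w_1),\dots,\nabla^2J_N(w_N)\}$ satisfies $\|\nabla^2J(x)-\nabla^2J(y)\|\le\kappa_H\|x-y\|$ for all $x,y\in\mathbb R^{NM}$ and some $\kappa_H\ge 0$. **Assumptions on gradient noise.** There is a filtration $\{\mathbb F_i;i\ge0\}$ (information available up to iteration $i$) such that for any $\boldsymbol w_{i-1}$ in $\mathbb F_{i-1}$, with $\mathcal R_{s,i}(\boldsymbol w_{i-1})=\mathbb E[\boldsymbol s_i(\boldsymbol w_{i-1})\boldsymbol s_i(\boldsymbol w_{i-1})^{\mathsf T}|\mathbb F_{i-1}]$: (1) $\mathbb E[\boldsymbol s_i(\boldsymbol w_{i-1})|\mathbb F_{i-1}]=0$; (2) $\mathbb E[\|\boldsymbol s_i(\boldsymbol w_{i-1})\|^4|\mathbb F_{i-1}]\le\alpha^2\|w^o-\boldsymbol w_{i-1}\|^4+\sigma_s^4$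 for some $\alpha,\sigma_s\ge0$; (3) $\|\mathcal R_{s,i}(w^o)-\mathcal R_{s,i}(\boldsymbol w_{i-1})\|\le\kappa_s\|w^o-\boldsymbol w_{i-1}\|^{\gamma_s}$ for some $\kappa_s\ge0$, $0<\gamma_s\le4$; (4) the limit $\mathcal R_s=\lim_{i\to\infty}\mathcal R_{s,i}(w^o)$ exists and is symmetric positive definite. Norms are Euclidean for vectors and the induced 2-norm for matrices.
   Formalization: The expectation of |f(error) − f(ζ)| is taken under suitable couplings of the two laws, chosen independently of f, since ζ is given only by its law; and all step-sizes are assumed of the same order, μ_k ≥ c·μ_max with a fixed c > 0, as μ_max → 0. *)

theory Defs
  imports "HOL-Probability.Probability"
begin

text \<open>
  Agents are indexed by a finite type \<open>'n\<close>, groups by \<open>'g\<close>, clusters by \<open>'q\<close>, and the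
  coordinates of the parameter space by \<open>'m\<close>.  Stacked vectors in \<open>\<real>\<^sup>N\<^sup>M\<close> are elements of
  \<open>real ^ ('n \<times> 'm)\<close>, whose norm is the Euclidean one.  The group membership is given by a map
  \<open>grp :: 'n \<Rightarrow> 'g\<close>, so block-diagonal and Kronecker matrices are written entrywise and no
  consecutive numbering of the agents is required.
\<close>

definition col :: "('k \<Rightarrow> real^'m) \<Rightarrow> real^('k::finite \<times> 'm::finite)" where
  "col w = (\<chi> a. w (fst a) $ snd a)"

definition blk :: "real^('k::finite \<times> 'm::finite) \<Rightarrow> 'k \<Rightarrow> real^'m" where
  "blk x k = (\<chi> j. x $ (k, j))"

definition blockdiag :: "('k::finite \<Rightarrow> real^'m::finite^'m) \<Rightarrow> real^('k \<times> 'm)^('k \<times> 'm)" where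
  "blockdiag B = (\<chi> a b. if fst a = fst b then B (fst a) $ snd a $ snd b else 0)"

definition opnorm :: "real^'b::finite^'a::finite \<Rightarrow> real" where
  "opnorm B = onorm (\<lambda>v. B *v v)"

definition sym_pos_def :: "real^'a::finite^'a \<Rightarrow> bool" where
  "sym_pos_def B \<longleftrightarrow> transpose B = B \<and> (\<forall>v. v \<noteq> 0 \<longrightarrow> 0 < v \<bullet> (B *v v))"

definition loewner_le :: "real^'a::finite^'a \<Rightarrow> real^'a^'a \<Rightarrow> bool" where
  "loewner_le B C \<longleftrightarrow> transpose (C - B) = C - B \<and> (\<forall>v. 0 \<le> v \<bullet> ((C - B) *v v))"


section \<open>Network\<close>

definition connected_in :: "'n set \<Rightarrow> ('n \<times> 'n) set \<Rightarrow> bool" where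
  "connected_in S E \<longleftrightarrow> (\<forall>k\<in>S. \<forall>l\<in>S. (k, l) \<in> (E \<inter> S \<times> S)\<^sup>*)"

text \<open>
  Links \<open>l \<rightarrow> k\<close> with \<open>l\<close> in the neighborhood of \<open>k\<close>.  Neighborhoods are not assumed symmetric:
  a cluster is connected through its underlying undirected graph, whereas a group is connected
  along directed links, as primitivity of its combination matrix requires.  For symmetric
  neighborhoods both notions are ordinary connectedness.
\<close>

definition links :: "('n \<Rightarrow> 'n set) \<Rightarrow> ('n \<times> 'n) set" where
  "links Nb = {(l, k). l \<in> Nb k}"

definition clustered_network ::
    "('n::finite \<Rightarrow> 'n set) \<Rightarrow> ('n \<Rightarrow> 'q::finite) \<Rightarrow> ('n \<Rightarrow> 'g::finite) \<Rightarrow> bool" where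
  "clustered_network Nb cl grp \<longleftrightarrow>
     (\<forall>k. k \<in> Nb k) \<and>
     2 \<le> CARD('q) \<and> surj cl \<and> surj grp \<and>
     (\<forall>k l. grp k = grp l \<longrightarrow> cl k = cl l) \<and>
     (\<forall>q. connected_in (cl -` {q}) (links Nb \<union> (links Nb)\<inverse>)) \<and>
     (\<forall>m. connected_in (grp -` {m}) (links Nb))"

text \<open>The entry \<open>a\<^bsub>l k\<^esub>\<close> is \<open>A $ l $ k\<close>.\<close>

definition combination_matrix ::
    "('n::finite \<Rightarrow> 'n set) \<Rightarrow> ('n \<Rightarrow> 'g) \<Rightarrow> real^'n^'n \<Rightarrow> bool" where
  "combination_matrix Nb grp A \<longleftrightarrow>
     (\<forall>l k. if l \<in> Nb k \<and> grp l = grp k then 0 < A $ l $ k else A $ l $ k = 0) \<and>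
     (\<forall>k. (\<Sum>l\<in>UNIV. A $ l $ k) = 1)"

definition perron_vectors ::
    "('n::finite \<Rightarrow> 'g) \<Rightarrow> real^'n^'n \<Rightarrow> ('n \<Rightarrow> real) \<Rightarrow> bool" where
  "perron_vectors grp A p \<longleftrightarrow>
     (\<forall>m. \<forall>l\<in>grp -` {m}. (\<Sum>k\<in>grp -` {m}. A $ l $ k * p k) = p l) \<and>
     (\<forall>k. 0 < p k) \<and>
     (\<forall>m. (\<Sum>k\<in>grp -` {m}. p k) = 1)"


section \<open>Costs\<close>

definition gradient :: "(real^'m::finite \<Rightarrow> real) \<Rightarrow> real^'m \<Rightarrow> real^'m" where
  "gradient f x = (\<chi> j. frechet_derivative f (at x) (axis j 1))"

definition hessian :: "(real^'m::finite \<Rightarrow> real) \<Rightarrow> real^'m \<Rightarrow> real^'m^'m" where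
  "hessian f x = matrix (frechet_derivative (gradient f) (at x))"

definition twice_differentiable :: "(real^'m::finite \<Rightarrow> real) \<Rightarrow> bool" where
  "twice_differentiable f \<longleftrightarrow>
     (\<forall>x. f differentiable (at x)) \<and> (\<forall>x. gradient f differentiable (at x))"

definition strictly_convex :: "('v::real_vector \<Rightarrow> real) \<Rightarrow> bool" where
  "strictly_convex f \<longleftrightarrow>
     (\<forall>x y t. x \<noteq> y \<and> 0 < t \<and> t < 1 \<longrightarrow>
        f ((1 - t) *\<^sub>R x + t *\<^sub>R y) < (1 - t) * f x + t * f y)"

definition unique_minimizer :: "('v \<Rightarrow> real) \<Rightarrow> 'v \<Rightarrow> bool" where
  "unique_minimizer f x \<longleftrightarrow> (\<forall>y. y \<noteq> x \<longrightarrow> f x < f y)"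

text \<open>\<open>mat c\<close> is \<open>c\<close> times the identity matrix.\<close>

definition cost_assumptions ::
    "('n::finite \<Rightarrow> real^'m::finite \<Rightarrow> real) \<Rightarrow> ('n \<Rightarrow> 'g) \<Rightarrow>
     ('n \<Rightarrow> real) \<Rightarrow> ('n \<Rightarrow> real) \<Rightarrow> real \<Rightarrow> bool" where
  "cost_assumptions J grp lamL lamU kappaH \<longleftrightarrow>
     (\<forall>k. strictly_convex (J k) \<and> twice_differentiable (J k)) \<and>
     (\<forall>k. 0 \<le> lamL k \<and> lamL k \<le> lamU k) \<and>
     (\<forall>k w. loewner_le (mat (lamL k)) (hessian (J k) w) \<and>
            loewner_le (hessian (J k) w) (mat (lamU k))) \<and>
     (\<forall>m. \<exists>k\<in>grp -` {m}. 0 < lamL k) \<and>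
     0 \<le> kappaH \<and>
     (\<forall>x y. opnorm (blockdiag (\<lambda>k. hessian (J k) (blk x k))
                    - blockdiag (\<lambda>k. hessian (J k) (blk y k))) \<le> kappaH * norm (x - y))"


section \<open>Algorithm\<close>

text \<open>
  \<open>ghat k i \<omega> x\<close> is the stochastic approximation, used by agent \<open>k\<close> at iteration \<open>i\<close>, of the
  gradient of its cost at \<open>x\<close>.  The time index of the iterates is shifted by one:
  \<open>atc \<dots> i\<close> is \<open>w\<^bsub>i-1\<^esub>\<close>, so \<open>atc \<dots> 0\<close> is the initial value \<open>w\<^bsub>-1\<^esub> = 0\<close>.
\<close>

primrec atc ::
    "('n::finite \<Rightarrow> 'n set) \<Rightarrow> ('n \<Rightarrow> 'g) \<Rightarrow> real^'n^'n \<Rightarrow>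
     ('n \<Rightarrow> nat \<Rightarrow> 'a \<Rightarrow> real^'m::finite \<Rightarrow> real^'m) \<Rightarrow> ('n \<Rightarrow> real) \<Rightarrow>
     nat \<Rightarrow> 'a \<Rightarrow> 'n \<Rightarrow> real^'m" where
  "atc Nb grp A ghat mu 0 \<omega> = (\<lambda>k. 0)"
| "atc Nb grp A ghat mu (Suc i) \<omega> =
     (let w = atc Nb grp A ghat mu i \<omega>;
          psi = (\<lambda>l. w l - mu l *\<^sub>R ghat l i \<omega> (w l))
      in (\<lambda>k. \<Sum>l\<in>Nb k \<inter> grp -` {grp k}. A $ l $ k *\<^sub>R psi l))"

definition grad_noise ::
    "('n::finite \<Rightarrow> real^'m::finite \<Rightarrow> real) \<Rightarrow> ('n \<Rightarrow> nat \<Rightarrow> 'a \<Rightarrow> real^'m \<Rightarrow> real^'m) \<Rightarrow>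
     nat \<Rightarrow> real^('n \<times> 'm) \<Rightarrow> 'a \<Rightarrow> real^('n \<times> 'm)" where
  "grad_noise J ghat i x \<omega> = col (\<lambda>k. ghat k i \<omega> (blk x k) - gradient (J k) (blk x k))"

definition cond_second_moment ::
    "'a measure \<Rightarrow> 'a measure \<Rightarrow> ('a \<Rightarrow> real^'d::finite) \<Rightarrow> 'a \<Rightarrow> real^'d^'d" where
  "cond_second_moment M F X \<omega> = (\<chi> a b. real_cond_exp M F (\<lambda>\<omega>'. X \<omega>' $ a * X \<omega>' $ b) \<omega>)"

text \<open>
  With the index shift above, \<open>F i\<close> is the information available up to iteration \<open>i - 1\<close>, and
  \<open>F 0\<close> is the information available before the first iteration.  The fourth-order moment is
  taken with the \<open>ennreal\<close>-valued conditional expectation, as the real-valued one turns an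
  infinite value into 0.
\<close>

definition noise_assumptions ::
    "'a measure \<Rightarrow> (nat \<Rightarrow> 'a measure) \<Rightarrow> ('n::finite \<Rightarrow> real^'m::finite \<Rightarrow> real) \<Rightarrow>
     ('n \<Rightarrow> nat \<Rightarrow> 'a \<Rightarrow> real^'m \<Rightarrow> real^'m) \<Rightarrow> real^('n \<times> 'm) \<Rightarrow>
     real \<Rightarrow> real \<Rightarrow> real \<Rightarrow> real \<Rightarrow> real^('n \<times> 'm)^('n \<times> 'm) \<Rightarrow> bool" where
  "noise_assumptions M F J ghat wo alpha sig kappa gam Rs \<longleftrightarrow>
     (\<forall>i. subalgebra M (F i)) \<and> filtration (space M) F \<and>
     0 \<le> alpha \<and> 0 \<le> sig \<and> 0 \<le> kappa \<and> 0 < gam \<and> gam \<le> 4 \<and>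
     (\<forall>i. \<forall>W\<in>borel_measurable (F i).
        let s = (\<lambda>\<omega>. grad_noise J ghat i (W \<omega>) \<omega>);
            s\<^sub>o = (\<lambda>\<omega>. grad_noise J ghat i wo \<omega>)
        in (\<forall>a. AE \<omega> in M. real_cond_exp M (F i) (\<lambda>\<omega>'. s \<omega>' $ a) \<omega> = 0) \<and>
           (AE \<omega> in M. nn_cond_exp M (F i) (\<lambda>\<omega>'. ennreal (norm (s \<omega>') ^ 4)) \<omega>
              \<le> ennreal (alpha\<^sup>2 * norm (wo - W \<omega>) ^ 4 + sig ^ 4)) \<and>
           (AE \<omega> in M. opnorm (cond_second_moment M (F i) s\<^sub>o \<omega> - cond_second_moment M (F i) s \<omega>)
              \<le> kappa * norm (wo - W \<omega>) powr gam)) \<and>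
     (AE \<omega> in M. (\<lambda>i. cond_second_moment M (F i) (\<lambda>\<omega>'. grad_noise J ghat i wo \<omega>') \<omega>) \<longlonglongrightarrow> Rs) \<and>
     sym_pos_def Rs"


section \<open>Limiting quantities\<close>

text \<open>
  For the limit of vanishing step-sizes one considers a family of step-size vectors
  \<open>mu t\<close> with \<open>mu_max (mu t) = t\<close>, along which \<open>Hbar\<close> and \<open>Rbar\<close> do not depend on \<open>t\<close>;
  the basic case is \<open>mu t k = t * \<tau> k\<close> with fixed ratios \<open>\<tau>\<close>.
\<close>

definition mu_max :: "('n::finite \<Rightarrow> real) \<Rightarrow> real" where
  "mu_max mu = Max (range mu)"

definition Hbar ::
    "('n::finite \<Rightarrow> real^'m::finite \<Rightarrow> real) \<Rightarrow> ('n \<Rightarrow> real^'m) \<Rightarrow> ('n \<Rightarrow> 'g::finite) \<Rightarrow>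
     ('n \<Rightarrow> real) \<Rightarrow> ('n \<Rightarrow> real) \<Rightarrow> real^('g \<times> 'm)^('g \<times> 'm)" where
  "Hbar J wo grp p mu =
     blockdiag (\<lambda>m. \<Sum>k\<in>grp -` {m}. (p k * mu k / mu_max mu) *\<^sub>R hessian (J k) (wo k))"

definition Pmat :: "('n::finite \<Rightarrow> 'g::finite) \<Rightarrow> ('n \<Rightarrow> real) \<Rightarrow> real^('g \<times> 'm::finite)^('n \<times> 'm)" where
  "Pmat grp p = (\<chi> a b. if grp (fst a) = fst b \<and> snd a = snd b then p (fst a) else 0)"

definition Mmat :: "('n::finite \<Rightarrow> real) \<Rightarrow> real^('n \<times> 'm::finite)^('n \<times> 'm)" where
  "Mmat mu = (\<chi> a b. if a = b then mu (fst a) else 0)"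

definition Rbar ::
    "real^('n::finite \<times> 'm::finite)^('n \<times> 'm) \<Rightarrow> ('n \<Rightarrow> 'g::finite) \<Rightarrow>
     ('n \<Rightarrow> real) \<Rightarrow> ('n \<Rightarrow> real) \<Rightarrow> real^('g \<times> 'm)^('g \<times> 'm)" where
  "Rbar Rs grp p mu =
     (1 / (mu_max mu)\<^sup>2) *\<^sub>R
       (transpose (Pmat grp p) ** Mmat mu ** Rs ** Mmat mu ** Pmat grp p)"

text \<open>\<open>col {1 \<otimes> \<xi>\<^sub>1, \<dots>, 1 \<otimes> \<xi>\<^sub>G}\<close>: every agent receives the block of its group.\<close>

definition spread :: "('n::finite \<Rightarrow> 'g::finite) \<Rightarrow> real^('g \<times> 'm::finite) \<Rightarrow> real^('n \<times> 'm)" where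
  "spread grp \<xi> = col (\<lambda>k. blk \<xi> (grp k))"

text \<open>The block matrix with blocks \<open>(1 1\<^sup>T) \<otimes> \<Phi>\<^bsub>m,r\<^esub>\<close>.\<close>

definition Pi_mat ::
    "('n::finite \<Rightarrow> 'g::finite) \<Rightarrow> real^('g \<times> 'm::finite)^('g \<times> 'm) \<Rightarrow> real^('n \<times> 'm)^('n \<times> 'm)" where
  "Pi_mat grp \<Phi> = (\<chi> a b. \<Phi> $ (grp (fst a), snd a) $ (grp (fst b), snd b))"

definition is_lyapunov_solution ::
    "real^'d::finite^'d \<Rightarrow> real^'d^'d \<Rightarrow> real^'d^'d \<Rightarrow> bool" where
  "is_lyapunov_solution H R \<Phi> \<longleftrightarrow> H ** \<Phi> + \<Phi> ** H = R"


section \<open>Gaussian vectors and couplings\<close>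

text \<open>
  The law \<open>N(a, B)\<close> is given by its characteristic function, so that singular covariance
  matrices are covered.
\<close>

definition gaussian_law :: "(real^'d::finite) measure \<Rightarrow> real^'d \<Rightarrow> real^'d^'d \<Rightarrow> bool" where
  "gaussian_law \<nu> a B \<longleftrightarrow> prob_space \<nu> \<and> sets \<nu> = sets borel \<and>
     (\<forall>v. (CLINT x|\<nu>. iexp (v \<bullet> x)) = exp (\<i> * of_real (v \<bullet> a) - of_real (v \<bullet> (B *v v) / 2)))"

text \<open>
  A limit such as \<open>lim E \<bar>f (X\<^sub>n) - f \<zeta>\<bar> = 0\<close>, with \<open>\<zeta>\<close> given only by its law, presupposes a joint
  law of each pair \<open>(X\<^sub>n, \<zeta>)\<close>; it is understood for suitable couplings, chosen independently of
  \<open>f\<close>.  It implies \<open>E (f (X\<^sub>n)) \<longlonglongrightarrow> E (f \<zeta>)\<close>, since \<open>\<bar>E (f (X\<^sub>n)) - E (f \<zeta>)\<bar> \<le> E \<bar>f (X\<^sub>n) - f \<zeta>\<bar>\<close>.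
\<close>

definition is_coupling :: "('b \<times> 'c) measure \<Rightarrow> 'b measure \<Rightarrow> 'c measure \<Rightarrow> bool" where
  "is_coupling C \<mu> \<nu> \<longleftrightarrow>
     prob_space C \<and> sets C = sets (\<mu> \<Otimes>\<^sub>M \<nu>) \<and> distr C \<mu> fst = \<mu> \<and> distr C \<nu> snd = \<nu>"

end

theory Submission
  imports Defs
begin

text \<open>
  Let \<open>t\<close> be the largest step-size, \<open>x\<close> the error vector at iteration \<open>i\<close>, \<open>V x\<close> its squared norm
  weighted by the Perron vectors, \<open>cent x\<close> the weighted centroids of the groups and \<open>dev x\<close> the
  deviation from them.  Averaging with \<open>A\<close> fixes \<open>cent x\<close>, and by the
  defect in Jensen's inequality (self-loops make it positive unless \<open>x\<close> is constant on groups) it contracts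
  \<open>V (dev x)\<close> by a fixed factor; together with the strong convexity of one cost per group this gives, for
  large \<open>i\<close>, \<open>E |x|\<^sup>2 = O(t)\<close> and \<open>E |dev x|\<^sup>2 = O(t\<^sup>2)\<close>.

  The characteristic function \<open>\<phi>\<^sub>i\<close> of \<open>cent x / \<surd>t\<close> then satisfies
  \<open>\<phi>\<^bsub>i+1\<^esub> v = (1 - t (v \<bullet> R v) / 2) \<phi>\<^sub>i (v - t H v) + o(t |v|)\<close>.  By the Lyapunov equation
  \<open>G v = exp (- (v \<bullet> \<Phi> v) / 2)\<close> solves the same relation up to \<open>O(t\<^sup>2 |v|)\<close>, and since \<open>v \<mapsto> v - t H v\<close>
  contracts, \<open>|\<phi>\<^sub>i - G| / |v|\<close> tends to zero on bounded sets.

  Couplings are built by hand: pulling back a fine partition of unity of a torus to \<open>\<real>\<^sup>d\<close> gives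
  functions that are uniform limits of trigonometric polynomials, so their integrals converge; two laws that give
  almost the same mass to each of them are coupled piece by piece.
\<close>

section \<open>Linear algebra and Gaussian laws\<close>

text \<open>Why the discrepancy is divided by |v|: the factor 1 - t (v \<bullet> R v) / 2
  degenerates to 1 as v tends to 0, so the only gain per step that is uniform in v is |v - t H v|
  \<le> (1 - t l) |v|. A bound proportional to |v| turns it into a contraction of the
  proportionality constant, against which errors o(t) |v| per step add up to o(1) |v|. The starting
  discrepancy is of order |v| / \<surd>t: it explodes as t tends to 0 but is forgotten as i grows
  with t fixed, which dictates the order of the limits. A second obstacle is that only second
  moments of the error are bounded uniformly in i; fourth moments are merely finite. Noise estimates
  are therefore split at |x| = \<eta>: Hoelder continuity of the covariance and the cubic Taylor
  bound serve where |x| \<le> \<eta>, and the rest costs E |x|^2 / \<eta>^2. With \<eta> = t^(1/4)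
  both parts vanish. Finally, couplings have to be fixed before f, so closeness is measured by one
  number e per pair (t, i): distance at least e has mass at most e.\<close>

lemma homogeneous_lower_bound:
  fixes q :: "'v::euclidean_space \<Rightarrow> real"
  assumes "continuous_on UNIV q" "\<And>c x. q (c *\<^sub>R x) = c\<^sup>2 * q x" "\<And>x. x \<noteq> 0 \<Longrightarrow> 0 < q x"
  obtains \<eta> where "0 < \<eta>" "\<And>x. \<eta> * (norm x)\<^sup>2 \<le> q x"
proof -
  have "sphere (0::'v) 1 \<noteq> {}" by simp
  moreover have "continuous_on (sphere 0 1) q"
    using assms(1) continuous_on_subset by blast
  ultimately obtain v where v: "norm v = 1" "\<And>u. norm u = 1 \<Longrightarrow> q v \<le> q u"
    using continuous_attains_inf[OF compact_sphere, of "0::'v" 1 q] by (auto simp: dist_norm)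
  have "q v * (norm x)\<^sup>2 \<le> q x" for x
  proof (cases "x = 0")
    case True
    then show ?thesis using assms(2)[of 0 x] by simp
  next
    case False
    have "q v \<le> q ((1 / norm x) *\<^sub>R x)" using False by (intro v(2)) simp
    also have "\<dots> = (1 / norm x)\<^sup>2 * q x" by (rule assms(2))
    finally show ?thesis using False by (simp add: field_simps power2_eq_square)
  qed
  moreover have "0 < q v" using v(1) by (intro assms(3)) auto
  ultimately show ?thesis using that by blast
qed

lemma inner_matrix_sym:
  fixes B :: "real^'a::finite^'a"
  assumes "transpose B = B"
  shows "u \<bullet> (B *v v) = v \<bullet> (B *v u)"
  by (metis assms dot_lmul_matrix inner_commute transpose_matrix_vector)

lemma psd_cauchy_schwarz:
  fixes B :: "real^'a::finite^'a"
  assumes sym: "transpose B = B" and psd: "\<And>v. 0 \<le> v \<bullet> (B *v v)"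
  shows "(u \<bullet> (B *v v))\<^sup>2 \<le> (u \<bullet> (B *v u)) * (v \<bullet> (B *v v))"
proof -
  define a b c where "a = u \<bullet> (B *v u)" and "b = u \<bullet> (B *v v)" and "c = v \<bullet> (B *v v)"
  have q: "0 \<le> a + 2 * t * b + t\<^sup>2 * c" for t
    using psd[of "u + t *\<^sub>R v"] inner_matrix_sym[OF sym, of v u]
    by (simp add: a_def b_def c_def matrix_vector_right_distrib matrix_vector_mult_scaleR
        inner_add_left inner_add_right power2_eq_square algebra_simps)
  have c: "0 \<le> c" unfolding c_def by (rule psd)
  show ?thesis
  proof (cases "c = 0")
    case True
    have "b = 0"
    proof (rule ccontr)
      assume "b \<noteq> 0"
      \<comment> \<open>With c = 0 the quadratic is affine in t, hence unbounded below unless b = 0;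
        this t gives it the value -1.\<close>
      then have "a + 2 * (- (a + 1) / (2 * b)) * b = -1" by (simp add: field_simps)
      then show False using q[of "- (a + 1) / (2 * b)"] True by simp
    qed
    then show ?thesis using True by (simp add: a_def b_def c_def)
  next
    case False
    have "0 \<le> a + 2 * (- b / c) * b + (- b / c)\<^sup>2 * c" by (rule q)
    also have "\<dots> = a - b\<^sup>2 / c" using False by (simp add: power2_eq_square field_simps)
    finally show ?thesis using c False
      by (simp add: a_def[symmetric] b_def[symmetric] c_def[symmetric] field_simps)
  qed
qed

text \<open>Cauchy-Schwarz for the form with u = B v bounds |B v|^4 by a multiple of the vanishing v
  \<bullet> B v. This replaces spectral arguments throughout.\<close>

lemma psd_form_zero_imp_kernel:
  fixes B :: "real^'a::finite^'a"
  assumes sym: "transpose B = B" and psd: "\<And>v. 0 \<le> v \<bullet> (B *v v)" and "v \<bullet> (B *v v) = 0"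
  shows "B *v v = 0"
  using psd_cauchy_schwarz[OF sym psd, of "B *v v" v] assms(3) by simp

text \<open>Symmetric Gaussian elimination. Splitting off the square belonging to a nonzero pivot
  leaves a positive semidefinite matrix with fewer nonzero diagonal entries; a matrix with zero
  diagonal is zero. The vectors b become the images of independent standard normals, so singular
  covariances are covered.\<close>

lemma psd_sum_of_squares:
  fixes B :: "real^'a::finite^'a"
  assumes "transpose B = B" "\<And>v. 0 \<le> v \<bullet> (B *v v)"
  shows "\<exists>b. \<forall>v. v \<bullet> (B *v v) = (\<Sum>i\<in>{i. B $ i $ i \<noteq> 0}. (b i \<bullet> v)\<^sup>2)"
  using assms
proof (induction "card {i. B $ i $ i \<noteq> 0}" arbitrary: B rule: less_induct)
  case (less B)
  note sym = less.prems(1) and psd = less.prems(2)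
  have form: "axis i 1 \<bullet> (B *v v) = (B *v v) $ i" "axis i 1 \<bullet> (B *v axis j 1) = B $ i $ j" for i j v
    by (simp_all add: inner_axis' matrix_vector_mult_basis column_def)
  show ?case
  proof (cases "{i. B $ i $ i \<noteq> 0} = {}")
    case True
    have "(B *v v) $ i = 0" for v i
    proof -
      have "B *v axis i 1 = 0" by (rule psd_form_zero_imp_kernel[OF sym psd]) (use True form in auto)
      then show ?thesis using inner_matrix_sym[OF sym, of "axis i 1" v] form(1)[of i v] by simp
    qed
    then have "B *v v = 0" for v by (simp add: vec_eq_iff)
    then show ?thesis using True by simp
  next
    case False
    then obtain i where i: "B $ i $ i \<noteq> 0" by blast
    have ipos: "0 < B $ i $ i" using psd[of "axis i 1"] form i by simp
    define r where "r = B *v axis i 1"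
    \<comment> \<open>The Schur complement of the pivot i, kept at full size with row and column i
      cleared. It is positive semidefinite by Cauchy-Schwarz against the i-th axis.\<close>
    define B' where "B' = (\<chi> j k. B $ j $ k - r $ j * r $ k / B $ i $ i)"
    have B'v: "B' *v v = B *v v - ((r \<bullet> v) / B $ i $ i) *\<^sub>R r" for v
    proof -
      have "(\<Sum>k\<in>UNIV. r $ j * r $ k / B $ i $ i * v $ k) = (r \<bullet> v) / B $ i $ i * r $ j" for j
        unfolding inner_vec_def sum_divide_distrib sum_distrib_right by (intro sum.cong) auto
      then show ?thesis
        by (simp add: vec_eq_iff B'_def matrix_vector_mult_def left_diff_distrib sum_subtractf)
    qed
    have B'form: "v \<bullet> (B' *v v) = v \<bullet> (B *v v) - (r \<bullet> v)\<^sup>2 / B $ i $ i" for v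
      by (simp add: B'v inner_diff_right power2_eq_square inner_commute)
    have rv: "r \<bullet> v = axis i 1 \<bullet> (B *v v)" for v
      unfolding r_def using inner_matrix_sym[OF sym, of "axis i 1" v] by (simp add: inner_commute)
    have psd': "0 \<le> v \<bullet> (B' *v v)" for v
      using psd_cauchy_schwarz[OF sym psd, of "axis i 1" v] ipos form
      unfolding B'form rv by (simp add: field_simps)
    have sym': "transpose B' = B'"
    proof -
      have "B $ k $ j = B $ j $ k" for j k
        using arg_cong[OF sym, of "\<lambda>B. B $ j $ k"] by (simp add: transpose_def)
      then show ?thesis by (simp add: B'_def transpose_def vec_eq_iff mult.commute)
    qed
    have ri: "r $ j = B $ j $ i" for j
      by (simp add: r_def matrix_vector_mult_basis column_def)
    \<comment> \<open>A zero diagonal entry of a positive semidefinite matrix forces a zero column,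
      so an index that is already cleared stays cleared and the induction measure strictly
      drops.\<close>
    have "j = i \<or> B $ j $ j = 0 \<Longrightarrow> B' $ j $ j = 0" for j
    proof (elim disjE)
      assume "j = i" then show ?thesis using i by (simp add: B'_def ri)
    next
      assume j: "B $ j $ j = 0"
      have "B *v axis j 1 = 0" by (rule psd_form_zero_imp_kernel[OF sym psd]) (use j form in auto)
      then have "r $ j = 0" using rv[of "axis j 1"] by (simp add: inner_axis)
      then show ?thesis by (simp add: B'_def j)
    qed
    then have sub: "{j. B' $ j $ j \<noteq> 0} \<subseteq> {j. B $ j $ j \<noteq> 0} - {i}" by blast
    have "card {j. B' $ j $ j \<noteq> 0} < card {j. B $ j $ j \<noteq> 0}"
      by (intro psubset_card_mono) (use sub i in auto)
    from less.hyps[OF this sym' psd'] obtain b where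
      b: "\<And>v. v \<bullet> (B' *v v) = (\<Sum>j\<in>{j. B' $ j $ j \<noteq> 0}. (b j \<bullet> v)\<^sup>2)" by blast
    \<comment> \<open>Indices whose diagonal entry became zero by accident receive the zero vector,
      so that the sum runs over the index set of B rather than that of B'.\<close>
    define c where "c j = (if j = i then (1 / sqrt (B $ i $ i)) *\<^sub>R r else if B' $ j $ j \<noteq> 0 then b j else 0)" for j
    have "v \<bullet> (B *v v) = (\<Sum>j\<in>{j. B $ j $ j \<noteq> 0}. (c j \<bullet> v)\<^sup>2)" for v
    proof -
      have "(\<Sum>j\<in>{j. B $ j $ j \<noteq> 0}. (c j \<bullet> v)\<^sup>2)
          = (c i \<bullet> v)\<^sup>2 + (\<Sum>j\<in>{j. B $ j $ j \<noteq> 0} - {i}. (c j \<bullet> v)\<^sup>2)"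
        using i by (subst sum.remove[of _ i]) auto
      also have "(\<Sum>j\<in>{j. B $ j $ j \<noteq> 0} - {i}. (c j \<bullet> v)\<^sup>2) = (\<Sum>j\<in>{j. B' $ j $ j \<noteq> 0}. (b j \<bullet> v)\<^sup>2)"
        by (rule sum.mono_neutral_cong_right) (use sub in \<open>auto simp: c_def\<close>)
      also have "(c i \<bullet> v)\<^sup>2 = (r \<bullet> v)\<^sup>2 / B $ i $ i"
        using ipos by (simp add: c_def power_divide)
      finally show ?thesis using B'form[of v] b[of v] by simp
    qed
    then show ?thesis by blast
  qed
qed

section \<open>The Lyapunov equation\<close>

lemma lyapunov_form:
  fixes H \<Phi> :: "real^'a::finite^'a"
  assumes "transpose H = H"
  shows "v \<bullet> ((H ** \<Phi> + \<Phi> ** H) *v v) = (H *v v) \<bullet> (\<Phi> *v v) + v \<bullet> (\<Phi> *v (H *v v))"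
proof -
  have "v \<bullet> (H *v (\<Phi> *v v)) = (H *v v) \<bullet> (\<Phi> *v v)"
    using inner_matrix_sym[OF assms, of v "\<Phi> *v v"] by (simp add: inner_commute)
  then show ?thesis
    by (simp add: matrix_vector_mult_add_rdistrib inner_add_right matrix_vector_mul_assoc[symmetric])
qed

text \<open>Pairing the equation with \<Psi> in the entrywise inner product of matrices gives two
  terms that are nonnegative because H is positive definite. Both vanish, and the second is a sum of
  values of the form of H at the rows of \<Psi>.\<close>

lemma lyapunov_kernel:
  fixes H \<Psi> :: "real^'a::finite^'a"
  assumes H: "sym_pos_def H" and eq: "H ** \<Psi> + \<Psi> ** H = 0"
  shows "\<Psi> = 0"
proof -
  have sym: "transpose H = H" and pos: "\<And>v. v \<noteq> 0 \<Longrightarrow> 0 < v \<bullet> (H *v v)"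
    using H by (auto simp: sym_pos_def_def)
  have nn: "0 \<le> v \<bullet> (H *v v)" for v using pos[of v] by (cases "v = 0") auto
  have row: "\<Psi> \<bullet> (\<Psi> ** H) = (\<Sum>i\<in>UNIV. \<Psi> $ i \<bullet> (H *v \<Psi> $ i))" for \<Psi>
  proof -
    have "(\<Psi> ** H) $ i = H *v \<Psi> $ i" for i
      using sym by (simp add: vec_eq_iff matrix_matrix_mult_def matrix_vector_mult_def transpose_def mult.commute)
    then show ?thesis by (simp add: inner_vec_def[of \<Psi>])
  qed
  have tr: "\<Psi> \<bullet> \<Theta> = transpose \<Psi> \<bullet> transpose \<Theta>" for \<Psi> \<Theta> :: "real^'a^'a"
    by (simp add: inner_vec_def transpose_def) (rule sum.swap)
  have nn2: "0 \<le> \<Psi> \<bullet> (\<Psi> ** H)" for \<Psi>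
    unfolding row by (intro sum_nonneg nn)
  have "0 = \<Psi> \<bullet> (H ** \<Psi>) + \<Psi> \<bullet> (\<Psi> ** H)"
    using eq by (metis inner_add_right inner_zero_right)
  moreover have "0 \<le> \<Psi> \<bullet> (H ** \<Psi>)"
    using nn2[of "transpose \<Psi>"] by (subst tr) (simp add: matrix_transpose_mul sym)
  ultimately have "\<Psi> \<bullet> (\<Psi> ** H) = 0" using nn2[of \<Psi>] by linarith
  then have "\<Psi> $ i \<bullet> (H *v \<Psi> $ i) = 0" for i
    unfolding row by (subst (asm) sum_nonneg_eq_0_iff) (auto intro: nn)
  then have "\<Psi> $ i = 0" for i using pos by force
  then show ?thesis by (simp add: vec_eq_iff)
qed

text \<open>The Lyapunov operator is an injective linear endomorphism of a finite-dimensional space,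
  hence bijective.\<close>

lemma lyapunov_solution_ex1:
  fixes H R :: "real^'a::finite^'a"
  assumes "sym_pos_def H"
  shows "\<exists>!\<Phi>. is_lyapunov_solution H R \<Phi>"
proof -
  define L where "L \<Phi> = H ** \<Phi> + \<Phi> ** H" for \<Phi>
  have L: "linear L"
  proof (rule linearI)
    show "L (X + Y) = L X + L Y" for X Y
      by (simp add: L_def vec_eq_iff matrix_matrix_mult_def sum.distrib distrib_left distrib_right)
    show "L (r *\<^sub>R X) = r *\<^sub>R L X" for r X
    proof -
      have "(r *\<^sub>R X) ** H = r *\<^sub>R (X ** H)" "H ** (r *\<^sub>R X) = r *\<^sub>R (H ** X)"
        by (auto simp: vec_eq_iff matrix_matrix_mult_def sum_distrib_left intro!: sum.cong)
      then show ?thesis by (simp add: L_def scaleR_add_right)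
    qed
  qed
  have "inj L"
    unfolding linear_injective_0[OF L] L_def by (blast intro: lyapunov_kernel[OF assms])
  moreover from this have "surj L" by (rule linear_inj_imp_surj[OF L])
  ultimately have LR: "L (inv L R) = R" "\<And>\<Psi>. L \<Psi> = R \<Longrightarrow> \<Psi> = inv L R"
    by (simp_all add: surj_f_inv_f inv_f_eq)
  show ?thesis
  proof (rule ex1I)
    show "is_lyapunov_solution H R (inv L R)"
      using LR(1) unfolding is_lyapunov_solution_def L_def .
    show "\<Psi> = inv L R" if "is_lyapunov_solution H R \<Psi>" for \<Psi>
      using that unfolding is_lyapunov_solution_def by (intro LR(2)) (simp add: L_def)
  qed
qed

text \<open>Transposition maps solutions to solutions, and the solution is unique.\<close>

lemma lyapunov_solution_sym:
  fixes H R :: "real^'a::finite^'a"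
  assumes H: "sym_pos_def H" and R: "transpose R = R" and "is_lyapunov_solution H R \<Phi>"
  shows "transpose \<Phi> = \<Phi>"
proof -
  have "transpose (H ** \<Phi> + \<Phi> ** H) = R" using assms by (simp add: is_lyapunov_solution_def)
  moreover have "transpose (X + Y) = transpose X + transpose Y" for X Y :: "real^'a^'a"
    by (simp add: transpose_def vec_eq_iff)
  ultimately have "is_lyapunov_solution H R (transpose \<Phi>)"
    using H by (simp add: is_lyapunov_solution_def matrix_transpose_mul sym_pos_def_def add.commute)
  then show ?thesis using lyapunov_solution_ex1[OF H, of R] assms(3) by blast
qed

text \<open>A minimiser e of the form of \<Phi> on the unit sphere is an eigenvector for the minimal
  value l. Testing the equation at e gives e \<bullet> R e = 2 l (e \<bullet> H e), so l has the
  sign of the left side.\<close>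

lemma lyapunov_solution_psd:
  fixes H R :: "real^'a::finite^'a"
  assumes H: "sym_pos_def H" and R: "transpose R = R" "\<And>v. 0 \<le> v \<bullet> (R *v v)"
    and sol: "is_lyapunov_solution H R \<Phi>"
  shows "0 \<le> v \<bullet> (\<Phi> *v v)"
proof -
  have sym: "transpose \<Phi> = \<Phi>" by (rule lyapunov_solution_sym[OF H R(1) sol])
  have "continuous_on (sphere 0 1) (\<lambda>v. v \<bullet> (\<Phi> *v v))"
    by (intro continuous_intros matrix_vector_mult_linear_continuous_on)
  then obtain e where e: "norm e = 1" "\<And>u. norm u = 1 \<Longrightarrow> e \<bullet> (\<Phi> *v e) \<le> u \<bullet> (\<Phi> *v u)"
    using continuous_attains_inf[OF compact_sphere, of "0::real^'a" 1 "\<lambda>v. v \<bullet> (\<Phi> *v v)"]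
    by (auto simp: dist_norm)
  define l where "l = e \<bullet> (\<Phi> *v e)"
  have min: "l * (norm u)\<^sup>2 \<le> u \<bullet> (\<Phi> *v u)" for u
  proof (cases "u = 0")
    case False
    have "l \<le> (u /\<^sub>R norm u) \<bullet> (\<Phi> *v (u /\<^sub>R norm u))"
      unfolding l_def by (rule e(2)) (use False in simp)
    also have "\<dots> = (u \<bullet> (\<Phi> *v u)) / (norm u)\<^sup>2"
      by (simp add: matrix_vector_mult_scaleR power2_eq_square field_simps)
    finally show ?thesis using False by (simp add: field_simps)
  qed simp
  define \<Psi> where "\<Psi> = \<Phi> - mat l"
  have lv: "mat l *v u = l *\<^sub>R u" for u :: "real^'a"
    by (simp add: vec_eq_iff matrix_vector_mult_def mat_def if_distrib if_distribR sum.delta' cong: if_cong)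
  have \<Psi>v: "\<Psi> *v u = \<Phi> *v u - l *\<^sub>R u" for u
    by (simp add: \<Psi>_def matrix_vector_mult_diff_rdistrib lv)
  \<comment> \<open>Minimality says that \<Phi> - l I is positive semidefinite with vanishing form
    at e, so e lies in its kernel.\<close>
  have "\<Psi> *v e = 0"
  proof (rule psd_form_zero_imp_kernel)
    have "transpose (mat l) = (mat l :: real^'a^'a)" by simp
    then show "transpose \<Psi> = \<Psi>"
      using sym unfolding \<Psi>_def by (simp add: vec_eq_iff transpose_def)
    show "0 \<le> u \<bullet> (\<Psi> *v u)" for u
      using min[of u] by (simp add: \<Psi>v inner_diff_right dot_square_norm)
    show "e \<bullet> (\<Psi> *v e) = 0"
      using e(1) by (simp add: \<Psi>v inner_diff_right dot_square_norm l_def[symmetric])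
  qed
  then have eig: "\<Phi> *v e = l *\<^sub>R e" by (simp add: \<Psi>v)
  have Hsym: "transpose H = H" using H by (simp add: sym_pos_def_def)
  have "e \<bullet> (R *v e) = (H *v e) \<bullet> (\<Phi> *v e) + e \<bullet> (\<Phi> *v (H *v e))"
    using sol lyapunov_form[OF Hsym, of e \<Phi>] by (simp add: is_lyapunov_solution_def)
  also have "e \<bullet> (\<Phi> *v (H *v e)) = (H *v e) \<bullet> (\<Phi> *v e)" by (rule inner_matrix_sym[OF sym])
  finally have "e \<bullet> (R *v e) = 2 * l * (e \<bullet> (H *v e))" by (simp add: eig inner_commute)
  moreover have "e \<noteq> 0" using e(1) by auto
  then have "0 < e \<bullet> (H *v e)" using H by (simp add: sym_pos_def_def)
  ultimately have "0 \<le> l" using R(2)[of e] by (simp add: zero_le_mult_iff)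
  then show ?thesis using min[of v] by (smt (verit) mult_nonneg_nonneg zero_le_power2)
qed

text \<open>The law is the image of a product of standard normals under z \<mapsto> \<Sum> z_i b_i,
  with the b_i from the sum of squares; its characteristic function factorises over i. A singular B
  has no density to start from.\<close>

lemma gaussian_law_exists:
  fixes B :: "real^'d::finite^'d"
  assumes "transpose B = B" "\<And>v. 0 \<le> v \<bullet> (B *v v)"
  obtains \<nu> where "gaussian_law \<nu> 0 B"
proof -
  obtain b where b: "\<And>v. v \<bullet> (B *v v) = (\<Sum>i\<in>{i. B $ i $ i \<noteq> 0}. (b i \<bullet> v)\<^sup>2)"
    using psd_sum_of_squares[OF assms] by blast
  define I where "I = {i. B $ i $ i \<noteq> 0}"
  interpret P: product_prob_space "\<lambda>_. std_normal_distribution" I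
    by (rule product_prob_spaceI) (rule real_dist_normal_dist[THEN real_distribution.axioms(1)])
  define N where "N = Pi\<^sub>M I (\<lambda>_. std_normal_distribution)"
  have prob: "prob_space N" unfolding N_def by unfold_locales
  define X where "X z = (\<Sum>i\<in>I. z i *\<^sub>R b i)" for z :: "'d \<Rightarrow> real"
  have [measurable]: "X \<in> borel_measurable N" unfolding X_def N_def by measurable
  have cf: "(CLINT x|distr N borel X. iexp (v \<bullet> x)) = exp (- of_real (v \<bullet> (B *v v) / 2))" for v
  proof -
    have "(CLINT x|distr N borel X. iexp (v \<bullet> x)) = (CLINT z|N. iexp (v \<bullet> X z))"
      by (subst integral_distr) measurable
    also have "\<dots> = (CLINT z|N. (\<Prod>i\<in>I. iexp ((b i \<bullet> v) * z i)))"
      by (simp add: X_def inner_sum_right sum_distrib_left exp_sum inner_commute mult.commute)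
    also have "\<dots> = (\<Prod>i\<in>I. CLINT x|std_normal_distribution. iexp ((b i \<bullet> v) * x))"
      unfolding N_def
    proof (rule P.product_integral_prod)
      fix i
      show "complex_integrable std_normal_distribution (\<lambda>x. iexp ((b i \<bullet> v) * x))"
        by (rule prob_space.integrable_iexp[OF real_dist_normal_dist[THEN real_distribution.axioms(1)]]) auto
    qed simp
    also have "\<dots> = (\<Prod>i\<in>I. complex_of_real (exp (- ((b i \<bullet> v)\<^sup>2) / 2)))"
      using char_std_normal_distribution by (simp add: char_def fun_eq_iff)
    also have "\<dots> = complex_of_real (exp (\<Sum>i\<in>I. - ((b i \<bullet> v)\<^sup>2) / 2))"
      by (simp add: exp_sum)
    also have "(\<Sum>i\<in>I. - ((b i \<bullet> v)\<^sup>2) / 2) = - (v \<bullet> (B *v v) / 2)"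
      by (simp add: b I_def sum_negf sum_divide_distrib)
    finally show ?thesis by (simp flip: exp_of_real)
  qed
  have "gaussian_law (distr N borel X) 0 B"
    unfolding gaussian_law_def using cf prob by (auto intro!: prob_space.prob_space_distr)
  then show ?thesis by (rule that)
qed

section \<open>Block vectors, and the Gaussian law carried from groups to agents\<close>

lemma blk_col [simp]: "blk (col x) k = x k"
  by (simp add: blk_def col_def vec_eq_iff)

lemma col_blk [simp]: "col (blk x) = x"
  by (simp add: blk_def col_def vec_eq_iff)

lemma linear_blk: "linear (\<lambda>x. blk x k)"
  by (rule linearI) (simp_all add: blk_def vec_eq_iff)

lemma linear_spread: "linear (spread grp)"
  by (rule linearI) (simp_all add: spread_def col_def blk_def vec_eq_iff)

text \<open>A linear image of a Gaussian law: with K the matrix of \<open>spread grp\<close>, the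
  matrix \<open>Pi_mat grp \<Phi>\<close> is K \<Phi> K^T, and the characteristic function at v is
  that of \<nu> at K^T v.\<close>

lemma gaussian_law_spread:
  fixes grp :: "'n::finite \<Rightarrow> 'g::finite" and \<Phi> :: "real^('g \<times> 'm::finite)^('g \<times> 'm)"
  assumes "gaussian_law \<nu> 0 \<Phi>"
  shows "gaussian_law (distr \<nu> borel (spread grp)) 0 (Pi_mat grp \<Phi> :: real^('n \<times> 'm)^('n \<times> 'm))"
proof -
  have sets: "sets \<nu> = sets borel" and prob: "prob_space \<nu>"
    and cf: "\<And>v. (CLINT x|\<nu>. iexp (v \<bullet> x)) = exp (- of_real (v \<bullet> (\<Phi> *v v) / 2))"
    using assms by (auto simp: gaussian_law_def)
  have [measurable]: "spread grp \<in> borel_measurable \<nu>"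
    unfolding measurable_cong_sets[OF sets refl]
    by (intro borel_measurable_continuous_onI linear_continuous_on linear_spread[unfolded linear_conv_bounded_linear])
  define K :: "real^('g \<times> 'm)^('n \<times> 'm)"
    where "K = (\<chi> a b. if b = (grp (fst a), snd a) then 1 else 0)"
  have K: "K *v x = spread grp x" for x
    by (simp add: vec_eq_iff K_def matrix_vector_mult_def spread_def col_def blk_def if_distrib if_distribR
        sum.delta cong: if_cong)
  have KP1: "(K ** X) $ a $ b = X $ (grp (fst a), snd a) $ b" for X :: "real^('g \<times> 'm)^('g \<times> 'm)" and a b
    by (simp add: K_def matrix_matrix_mult_def if_distrib if_distribR sum.delta cong: if_cong)
  have KP2: "(X ** transpose K) $ a $ b = X $ a $ (grp (fst b), snd b)" for X :: "real^('g \<times> 'm)^('n \<times> 'm)" and a b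
    by (simp add: K_def matrix_matrix_mult_def transpose_def if_distrib if_distribR sum.delta cong: if_cong)
  have KP: "Pi_mat grp \<Phi> = K ** \<Phi> ** transpose K"
    unfolding vec_eq_iff KP1 KP2 by (simp add: Pi_mat_def)
  have adj: "v \<bullet> (K *v x) = (transpose K *v v) \<bullet> x" for v x
    by (simp add: dot_lmul_matrix[symmetric])
  have "(CLINT x|distr \<nu> borel (spread grp). iexp (v \<bullet> x)) = exp (- of_real (v \<bullet> (Pi_mat grp \<Phi> *v v) / 2))" for v
  proof -
    have "(CLINT x|distr \<nu> borel (spread grp). iexp (v \<bullet> x)) = (CLINT x|\<nu>. iexp (v \<bullet> spread grp x))"
      by (subst integral_distr) measurable
    also have "\<dots> = exp (- of_real ((transpose K *v v) \<bullet> (\<Phi> *v (transpose K *v v)) / 2))"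
      using cf[of "transpose K *v v"] by (simp add: K[symmetric] adj)
    also have "(transpose K *v v) \<bullet> (\<Phi> *v (transpose K *v v)) = v \<bullet> (Pi_mat grp \<Phi> *v v)"
      by (simp add: KP adj matrix_vector_mul_assoc[symmetric] del: transpose_matrix_vector)
    finally show ?thesis .
  qed
  then show ?thesis using prob by (auto simp: gaussian_law_def intro!: prob_space.prob_space_distr)
qed

section \<open>Couplings from convergence of characteristic functions\<close>

text \<open>The density, relative to the product measure, of a coupling of two laws cut into pieces
  of masses a j and b j. From piece j the common mass m j is coupled inside the piece; what is left
  on both sides, of mass 1 - s each, is coupled independently. Two separate families h and k are
  used so that exchanging the measures yields the other marginal. Divisions by zero all return 0,
  which is the right value because m j vanishes with a j or b j.\<close>

lemma coupling_density_marginal: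
  fixes \<mu> :: "'a measure" and \<nu> :: "'b measure"
  assumes \<mu>: "prob_space \<mu>" and \<nu>: "prob_space \<nu>" and J: "finite J"
    and [measurable]: "\<And>j. j \<in> J \<Longrightarrow> h j \<in> borel_measurable \<mu>" "\<And>j. j \<in> J \<Longrightarrow> k j \<in> borel_measurable \<nu>"
    and h: "\<And>j x. j \<in> J \<Longrightarrow> 0 \<le> h j x" "\<And>x. (\<Sum>j\<in>J. h j x) = (1::real)"
    and k: "\<And>j y. j \<in> J \<Longrightarrow> 0 \<le> k j y" "\<And>y. (\<Sum>j\<in>J. k j y) = (1::real)"
    and a_def: "\<And>j. a j = (LINT x|\<mu>. h j x)" and b_def: "\<And>j. b j = (LINT y|\<nu>. k j y)"
    and m_def: "\<And>j. m j = min (a j) (b j)" and s_def: "s = (\<Sum>j\<in>J. m j)"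
  shows "AE x in \<mu>. (\<integral>\<^sup>+y. ennreal ((\<Sum>j\<in>J. h j x * k j y * (m j / (a j * b j)))
      + (\<Sum>j\<in>J. h j x * (1 - m j / a j)) * (\<Sum>j\<in>J. k j y * (1 - m j / b j)) / (1 - s)) \<partial>\<nu>) = 1"
    and "(LINT x|\<mu>. (\<Sum>j\<in>J. h j x * (1 - m j / a j))) = 1 - s" "s \<le> 1"
    and "\<And>j. j \<in> J \<Longrightarrow> 0 \<le> m j / a j" "\<And>j. j \<in> J \<Longrightarrow> m j / a j \<le> 1"
    and "\<And>j. j \<in> J \<Longrightarrow> 0 \<le> m j / b j" "\<And>j. j \<in> J \<Longrightarrow> m j / b j \<le> 1"
    and "\<And>j. j \<in> J \<Longrightarrow> 0 \<le> m j / (a j * b j)"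
proof -
  interpret \<mu>: prob_space \<mu> by fact
  interpret \<nu>: prob_space \<nu> by fact
  have h1: "h j x \<le> 1" if "j \<in> J" for j x
    unfolding h(2)[of x, symmetric] by (rule member_le_sum) (use that J h in auto)
  have k1: "k j y \<le> 1" if "j \<in> J" for j y
    unfolding k(2)[of y, symmetric] by (rule member_le_sum) (use that J k in auto)
  have int_h: "integrable \<mu> (h j)" if "j \<in> J" for j
    using that h h1 by (intro \<mu>.integrable_const_bound[where B = 1]) auto
  have int_k: "integrable \<nu> (k j)" if "j \<in> J" for j
    using that k k1 by (intro \<nu>.integrable_const_bound[where B = 1]) auto
  have a0: "0 \<le> a j" if "j \<in> J" for j unfolding a_def using h(1) that by (intro integral_nonneg_AE) auto
  have b0: "0 \<le> b j" if "j \<in> J" for j unfolding b_def using k(1) that by (intro integral_nonneg_AE) auto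
  have m0: "0 \<le> m j" if "j \<in> J" for j using a0 b0 that by (simp add: m_def)
  have suma: "(\<Sum>j\<in>J. a j) = 1"
    unfolding a_def by (subst Bochner_Integration.integral_sum[symmetric]) (simp_all add: int_h h(2) \<mu>.prob_space)
  have sumb: "(\<Sum>j\<in>J. b j) = 1"
    unfolding b_def by (subst Bochner_Integration.integral_sum[symmetric]) (simp_all add: int_k k(2) \<nu>.prob_space)
  show s1: "s \<le> 1" unfolding s_def suma[symmetric] m_def by (intro sum_mono) auto
  show ma0: "0 \<le> m j / a j" and mb0: "0 \<le> m j / b j" and mab0: "0 \<le> m j / (a j * b j)" if "j \<in> J" for j
    using a0 b0 that by (auto simp: m_def)
  show ma1: "m j / a j \<le> 1" and mb1: "m j / b j \<le> 1" if "j \<in> J" for j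
    using a0 b0 that by (auto simp: m_def divide_le_eq_1 less_le)
  have am: "a j * (m j / a j) = m j" and bm: "b j * (m j / b j) = m j" if "j \<in> J" for j
    using a0 b0 that by (auto simp: m_def)
  show rint: "(LINT x|\<mu>. (\<Sum>j\<in>J. h j x * (1 - m j / a j))) = 1 - s"
  proof -
    have "(LINT x|\<mu>. (\<Sum>j\<in>J. h j x * (1 - m j / a j))) = (\<Sum>j\<in>J. a j * (1 - m j / a j))"
      unfolding a_def[symmetric] by (subst Bochner_Integration.integral_sum) (simp_all add: int_h a_def)
    also have "\<dots> = 1 - s"
      proof -
      have "(\<Sum>j\<in>J. a j * (1 - m j / a j)) = (\<Sum>j\<in>J. a j - m j)"
        by (intro sum.cong) (auto simp: right_diff_distrib am simp del: times_divide_eq_right)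
      then show ?thesis by (simp add: sum_subtractf suma s_def)
    qed
    finally show ?thesis .
  qed
  have rint': "(LINT y|\<nu>. (\<Sum>j\<in>J. k j y * (1 - m j / b j))) = 1 - s"
  proof -
    have "(LINT y|\<nu>. (\<Sum>j\<in>J. k j y * (1 - m j / b j))) = (\<Sum>j\<in>J. b j * (1 - m j / b j))"
      unfolding b_def[symmetric] by (subst Bochner_Integration.integral_sum) (simp_all add: int_k b_def)
    also have "\<dots> = 1 - s"
      proof -
      have "(\<Sum>j\<in>J. b j * (1 - m j / b j)) = (\<Sum>j\<in>J. b j - m j)"
        by (intro sum.cong) (auto simp: right_diff_distrib bm simp del: times_divide_eq_right)
      then show ?thesis by (simp add: sum_subtractf sumb s_def)
    qed
    finally show ?thesis .
  qed
  \<comment> \<open>This serves the case s = 1: an index with a j = 0 has m j / a j = 0 instead of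
    1, so its contribution h j must vanish by itself.\<close>
  have null: "AE x in \<mu>. \<forall>j\<in>J. a j = 0 \<longrightarrow> h j x = 0"
  proof (rule AE_ball_countable'[OF _ countable_finite[OF J]])
    fix j assume j: "j \<in> J"
    show "AE x in \<mu>. a j = 0 \<longrightarrow> h j x = 0"
    proof (cases "a j = 0")
      case True
      then have "AE x in \<mu>. h j x = 0"
        using integral_nonneg_eq_0_iff_AE[OF int_h[OF j]] h(1)[OF j] by (simp add: a_def)
      then show ?thesis by simp
    qed simp
  qed
  show "AE x in \<mu>. (\<integral>\<^sup>+y. ennreal ((\<Sum>j\<in>J. h j x * k j y * (m j / (a j * b j)))
      + (\<Sum>j\<in>J. h j x * (1 - m j / a j)) * (\<Sum>j\<in>J. k j y * (1 - m j / b j)) / (1 - s)) \<partial>\<nu>) = 1"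
    using null
  proof eventually_elim
    case (elim x)
    let ?r = "\<Sum>j\<in>J. h j x * (1 - m j / a j)"
    let ?g = "\<lambda>y. (\<Sum>j\<in>J. h j x * k j y * (m j / (a j * b j)))
      + ?r * (\<Sum>j\<in>J. k j y * (1 - m j / b j)) / (1 - s)"
    have int1: "integrable \<nu> (\<lambda>y. \<Sum>j\<in>J. h j x * k j y * (m j / (a j * b j)))"
      by (intro Bochner_Integration.integrable_sum integrable_mult_left integrable_mult_right int_k)
    have int2: "integrable \<nu> (\<lambda>y. ?r * (\<Sum>j\<in>J. k j y * (1 - m j / b j)) / (1 - s))"
      by (intro integrable_divide integrable_mult_right Bochner_Integration.integrable_sum integrable_mult_left int_k)
    have nn: "0 \<le> ?g y" for y
      by (intro add_nonneg_nonneg sum_nonneg mult_nonneg_nonneg divide_nonneg_nonneg)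
        (simp_all add: h k m0 a0 b0 ma1 mb1 s1)
    have "(\<integral>\<^sup>+y. ennreal (?g y) \<partial>\<nu>) = ennreal (LINT y|\<nu>. ?g y)"
      by (rule nn_integral_eq_integral) (use int1 int2 nn in auto)
    also have "(LINT y|\<nu>. ?g y) = (\<Sum>j\<in>J. h j x * b j * (m j / (a j * b j))) + ?r * (1 - s) / (1 - s)"
      using int1 int2
      by (simp add: Bochner_Integration.integral_sum int_k b_def[symmetric] rint' del: times_divide_eq_right)
    also have "(\<Sum>j\<in>J. h j x * b j * (m j / (a j * b j))) = (\<Sum>j\<in>J. h j x * (m j / a j))"
      using a0 b0 by (intro sum.cong refl) (auto simp: m_def)
    also have "(\<Sum>j\<in>J. h j x * (m j / a j)) + ?r * (1 - s) / (1 - s) = 1"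
    proof (cases "s = 1")
      case False
      have "(\<Sum>j\<in>J. h j x * (m j / a j)) + ?r = (\<Sum>j\<in>J. h j x)"
        unfolding sum.distrib[symmetric] by (intro sum.cong) (auto simp: algebra_simps)
      then show ?thesis using False by (simp add: h(2))
    next
      \<comment> \<open>All mass is matched piece by piece; the remainder term is divided by 1 - s =
        0 and hence is 0.\<close>
      case True
      have "a j - m j = 0" if "j \<in> J" for j
      proof -
        have "(\<Sum>j\<in>J. a j - m j) = 0" using True suma by (simp add: sum_subtractf s_def)
        then show ?thesis
          by (subst (asm) sum_nonneg_eq_0_iff) (use J that in \<open>auto simp: m_def\<close>)
      qed
      then have "(\<Sum>j\<in>J. h j x * (m j / a j)) = (\<Sum>j\<in>J. h j x)"
        using elim by (intro sum.cong) auto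
      then show ?thesis using True by (simp add: h(2))
    qed
    finally show ?case by simp
  qed
qed

text \<open>Outside the matched part of the density, two points are paired at random. Pairs that
  share no piece can come only from that remainder, whose mass 1 - s is what the masses of the
  pieces fail to have in common.\<close>

lemma coupling_of_partition:
  fixes \<mu> \<nu> :: "'a measure"
  assumes \<mu>: "prob_space \<mu>" and \<nu>: "prob_space \<nu>" and sets: "sets \<mu> = sets \<nu>" and J: "finite J"
    and [measurable]: "\<And>j. j \<in> J \<Longrightarrow> h j \<in> borel_measurable \<mu>"
    and h: "\<And>j x. j \<in> J \<Longrightarrow> 0 \<le> h j x" "\<And>x. (\<Sum>j\<in>J. h j x) = (1::real)"
  obtains C where "is_coupling C \<mu> \<nu>"
    "measure C {z\<in>space (\<mu> \<Otimes>\<^sub>M \<nu>). \<forall>j\<in>J. h j (fst z) * h j (snd z) = 0}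
      \<le> (\<Sum>j\<in>J. \<bar>(LINT x|\<mu>. h j x) - (LINT x|\<nu>. h j x)\<bar>)"
proof -
  interpret \<mu>: prob_space \<mu> by fact
  interpret \<nu>: prob_space \<nu> by fact
  interpret pair_prob_space \<mu> \<nu> ..
  have [measurable]: "\<And>j. j \<in> J \<Longrightarrow> h j \<in> borel_measurable \<nu>"
    using assms(5) unfolding measurable_cong_sets[OF sets refl] by simp
  define a where "a j = (LINT x|\<mu>. h j x)" for j
  define b where "b j = (LINT x|\<nu>. h j x)" for j
  define m where "m j = min (a j) (b j)" for j
  define s where "s = (\<Sum>j\<in>J. m j)"
  define r where "r x = (\<Sum>j\<in>J. h j x * (1 - m j / a j))" for x
  define r' where "r' y = (\<Sum>j\<in>J. h j y * (1 - m j / b j))" for y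
  define g where "g x y = (\<Sum>j\<in>J. h j x * h j y * (m j / (a j * b j))) + r x * r' y / (1 - s)" for x y
  \<comment> \<open>The overlap in the order required for the second use of the marginal lemma, with
    \<mu> and \<nu> exchanged.\<close>
  have m': "m j = min (b j) (a j)" for j by (simp add: m_def min.commute)
  note marg = coupling_density_marginal[OF \<mu> \<nu> J _ _ h h a_def b_def m_def s_def]
  note marg' = coupling_density_marginal[OF \<nu> \<mu> J _ _ h h b_def a_def m' s_def]
  have margx: "AE x in \<mu>. (\<integral>\<^sup>+y. ennreal (g x y) \<partial>\<nu>) = 1"
    unfolding g_def r_def r'_def by (rule marg(1)) auto
  have margy: "AE y in \<nu>. (\<integral>\<^sup>+x. ennreal (g x y) \<partial>\<mu>) = 1"
  proof -
    have "AE y in \<nu>. (\<integral>\<^sup>+x. ennreal ((\<Sum>j\<in>J. h j y * h j x * (m j / (b j * a j))) + r' y * r x / (1 - s)) \<partial>\<mu>) = 1"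
      unfolding r_def r'_def by (rule marg'(1)) auto
    moreover have "(\<Sum>j\<in>J. h j y * h j x * (m j / (b j * a j))) + r' y * r x / (1 - s) = g x y" for x y
      by (simp add: g_def mult.commute)
    ultimately show ?thesis by simp
  qed
  have s1: "s \<le> 1" by (rule marg(3)) auto
  have r0: "0 \<le> r x" "0 \<le> r' x" for x
    unfolding r_def r'_def by (intro sum_nonneg mult_nonneg_nonneg; use marg(5,7) h in simp)+
  have [measurable]: "r \<in> borel_measurable \<mu>" "r' \<in> borel_measurable \<nu>" unfolding r_def r'_def by measurable
  have [measurable]: "(\<lambda>(x, y). g x y) \<in> borel_measurable (\<mu> \<Otimes>\<^sub>M \<nu>)" unfolding g_def by measurable
  define C where "C = density (\<mu> \<Otimes>\<^sub>M \<nu>) (\<lambda>(x, y). ennreal (g x y))"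
  have setsC: "sets C = sets (\<mu> \<Otimes>\<^sub>M \<nu>)" by (simp add: C_def)
  have Cfst: "distr C \<mu> fst = \<mu>"
  proof (rule measure_eqI)
    fix A assume "A \<in> sets (distr C \<mu> fst)"
    then have A[measurable]: "A \<in> sets \<mu>" by simp
    have "emeasure (distr C \<mu> fst) A = emeasure C (fst -` A \<inter> space C)"
      by (rule emeasure_distr) (simp_all add: C_def)
    also have "\<dots> = (\<integral>\<^sup>+z. (case z of (x, y) \<Rightarrow> ennreal (g x y)) * indicator (fst -` A \<inter> space (\<mu> \<Otimes>\<^sub>M \<nu>)) z \<partial>(\<mu> \<Otimes>\<^sub>M \<nu>))"
      unfolding C_def space_density by (rule emeasure_density) measurable
    also have "\<dots> = (\<integral>\<^sup>+z. (case z of (x, y) \<Rightarrow> ennreal (g x y) * indicator A x) \<partial>(\<mu> \<Otimes>\<^sub>M \<nu>))"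
      by (intro nn_integral_cong) (auto simp: indicator_def)
    also have "\<dots> = (\<integral>\<^sup>+x. \<integral>\<^sup>+y. ennreal (g x y) * indicator A x \<partial>\<nu> \<partial>\<mu>)"
      by (subst \<nu>.nn_integral_fst[symmetric]) auto
    also have "\<dots> = (\<integral>\<^sup>+x. (\<integral>\<^sup>+y. ennreal (g x y) \<partial>\<nu>) * indicator A x \<partial>\<mu>)"
      by (intro nn_integral_cong nn_integral_multc) measurable
    also have "\<dots> = (\<integral>\<^sup>+x. indicator A x \<partial>\<mu>)"
      by (intro nn_integral_cong_AE) (use margx in eventually_elim, simp)
    finally show "emeasure (distr C \<mu> fst) A = emeasure \<mu> A" by simp
  qed simp
  have Csnd: "distr C \<nu> snd = \<nu>"
  proof (rule measure_eqI)
    fix A assume "A \<in> sets (distr C \<nu> snd)"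
    then have A[measurable]: "A \<in> sets \<nu>" by simp
    have "emeasure (distr C \<nu> snd) A = emeasure C (snd -` A \<inter> space C)"
      by (rule emeasure_distr) (simp_all add: C_def)
    also have "\<dots> = (\<integral>\<^sup>+z. (case z of (x, y) \<Rightarrow> ennreal (g x y)) * indicator (snd -` A \<inter> space (\<mu> \<Otimes>\<^sub>M \<nu>)) z \<partial>(\<mu> \<Otimes>\<^sub>M \<nu>))"
      unfolding C_def space_density by (rule emeasure_density) measurable
    also have "\<dots> = (\<integral>\<^sup>+z. (case z of (x, y) \<Rightarrow> ennreal (g x y) * indicator A y) \<partial>(\<mu> \<Otimes>\<^sub>M \<nu>))"
      by (intro nn_integral_cong) (auto simp: indicator_def)
    also have "\<dots> = (\<integral>\<^sup>+y. \<integral>\<^sup>+x. ennreal (g x y) * indicator A y \<partial>\<mu> \<partial>\<nu>)"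
      by (subst nn_integral_snd[symmetric]) auto
    also have "\<dots> = (\<integral>\<^sup>+y. (\<integral>\<^sup>+x. ennreal (g x y) \<partial>\<mu>) * indicator A y \<partial>\<nu>)"
      by (intro nn_integral_cong nn_integral_multc) measurable
    also have "\<dots> = (\<integral>\<^sup>+y. indicator A y \<partial>\<nu>)"
      by (intro nn_integral_cong_AE) (use margy in eventually_elim, simp)
    finally show "emeasure (distr C \<nu> snd) A = emeasure \<nu> A" by simp
  qed simp
  have probC: "prob_space C"
  proof (rule prob_spaceI)
    have "emeasure C (space C) = emeasure (distr C \<mu> fst) (space \<mu>)"
      by (subst emeasure_distr) (auto simp: C_def space_pair_measure intro!: arg_cong[where f = "emeasure _"])
    then show "emeasure C (space C) = 1" unfolding Cfst by (simp add: \<mu>.emeasure_space_1)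
  qed
  interpret C: prob_space C by (rule probC)
  define bad where "bad = {z\<in>space (\<mu> \<Otimes>\<^sub>M \<nu>). \<forall>j\<in>J. h j (fst z) * h j (snd z) = 0}"
  have bad[measurable]: "bad \<in> sets (\<mu> \<Otimes>\<^sub>M \<nu>)"
    unfolding bad_def using J by measurable
  have r_nn: "(\<integral>\<^sup>+x. ennreal (r x) \<partial>\<mu>) = ennreal (1 - s)"
  proof -
    have int: "integrable \<mu> (h j)" if "j \<in> J" for j
    proof -
      have "h j x \<le> 1" for x
        unfolding h(2)[of x, symmetric] by (rule member_le_sum) (use that J h in auto)
      then show ?thesis using that h by (intro \<mu>.integrable_const_bound[where B = 1]) auto
    qed
    have "(LINT x|\<mu>. r x) = 1 - s" unfolding r_def by (rule marg(2)) auto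
    moreover have "integrable \<mu> r"
      unfolding r_def by (intro Bochner_Integration.integrable_sum integrable_mult_left int)
    ultimately show ?thesis using r0(1) by (subst nn_integral_eq_integral) auto
  qed
  have r'_nn: "(\<integral>\<^sup>+x. ennreal (r' x) \<partial>\<nu>) = ennreal (1 - s)"
  proof -
    have int: "integrable \<nu> (h j)" if "j \<in> J" for j
    proof -
      have "h j x \<le> 1" for x
        unfolding h(2)[of x, symmetric] by (rule member_le_sum) (use that J h in auto)
      then show ?thesis using that h by (intro \<nu>.integrable_const_bound[where B = 1]) auto
    qed
    have "(LINT x|\<nu>. r' x) = 1 - s" unfolding r'_def by (rule marg'(2)) auto
    moreover have "integrable \<nu> r'"
      unfolding r'_def by (intro Bochner_Integration.integrable_sum integrable_mult_left int)
    ultimately show ?thesis using r0(2) by (subst nn_integral_eq_integral) auto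
  qed
  \<comment> \<open>On \<open>bad\<close> every matched summand of g vanishes, so g reduces to r x *
    r' y / (1 - s), whose total mass is 1 - s. For s = 1 the bound is 0 = 0 by division by
    zero.\<close>
  have "emeasure C bad = (\<integral>\<^sup>+z. (case z of (x, y) \<Rightarrow> ennreal (g x y)) * indicator bad z \<partial>(\<mu> \<Otimes>\<^sub>M \<nu>))"
    unfolding C_def by (rule emeasure_density) measurable
  also have "\<dots> \<le> (\<integral>\<^sup>+z. (case z of (x, y) \<Rightarrow> ennreal (1 / (1 - s)) * (ennreal (r x) * ennreal (r' y))) \<partial>(\<mu> \<Otimes>\<^sub>M \<nu>))"
  proof (rule nn_integral_mono, clarify)
    fix x y
    show "ennreal (g x y) * indicator bad (x, y) \<le> ennreal (1 / (1 - s)) * (ennreal (r x) * ennreal (r' y))"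
    proof (cases "(x, y) \<in> bad")
      case True
      then have "(\<Sum>j\<in>J. h j x * h j y * (m j / (a j * b j))) = 0"
        by (intro sum.neutral) (auto simp: bad_def)
      then have "g x y = 1 / (1 - s) * (r x * r' y)" by (simp add: g_def)
      then show ?thesis using True r0 s1 by (simp add: ennreal_mult'[symmetric])
    qed simp
  qed
  also have "\<dots> = (\<integral>\<^sup>+x. \<integral>\<^sup>+y. ennreal (1 / (1 - s)) * (ennreal (r x) * ennreal (r' y)) \<partial>\<nu> \<partial>\<mu>)"
    by (subst \<nu>.nn_integral_fst[symmetric]) auto
  also have "\<dots> = ennreal (1 / (1 - s)) * (ennreal (1 - s) * ennreal (1 - s))"
    by (simp add: nn_integral_cmult nn_integral_multc r_nn r'_nn)
  also have "\<dots> = ennreal (1 - s)"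
    using s1 by (simp add: ennreal_mult'[symmetric])
  finally have "measure C bad \<le> 1 - s"
    using s1 by (simp add: C.emeasure_eq_measure)
  also have "1 - s \<le> (\<Sum>j\<in>J. \<bar>a j - b j\<bar>)"
  proof -
    have "(\<Sum>j\<in>J. a j) = (LINT x|\<mu>. (\<Sum>j\<in>J. h j x))"
      unfolding a_def
    proof (rule Bochner_Integration.integral_sum[symmetric])
      fix j assume j: "j \<in> J"
      have "h j x \<le> 1" for x
        unfolding h(2)[of x, symmetric] by (rule member_le_sum) (use j J h in auto)
      then show "integrable \<mu> (h j)" using j h by (intro \<mu>.integrable_const_bound[where B = 1]) auto
    qed
    then have "1 - s = (\<Sum>j\<in>J. a j - m j)" by (simp add: h(2) \<mu>.prob_space s_def sum_subtractf)
    also have "\<dots> \<le> (\<Sum>j\<in>J. \<bar>a j - b j\<bar>)" by (intro sum_mono) (auto simp: m_def)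
    finally show ?thesis .
  qed
  finally have "measure C bad \<le> (\<Sum>j\<in>J. \<bar>a j - b j\<bar>)" .
  moreover have "is_coupling C \<mu> \<nu>"
    using probC setsC Cfst Csnd by (simp add: is_coupling_def)
  ultimately show ?thesis using that unfolding bad_def a_def b_def by blast
qed

section \<open>Trigonometric polynomials and the torus\<close>

inductive trig_poly :: "('v::real_inner \<Rightarrow> real) \<Rightarrow> bool" where
  trig_poly_cos: "trig_poly (\<lambda>x. c * cos (u \<bullet> x + a))"
| trig_poly_add: "trig_poly f \<Longrightarrow> trig_poly g \<Longrightarrow> trig_poly (\<lambda>x. f x + g x)"

lemma trig_poly_const: "trig_poly (\<lambda>x. c)"
  using trig_poly_cos[of c 0 0] by simp

lemma trig_poly_sum:
  assumes "finite I" "\<And>i. i \<in> I \<Longrightarrow> trig_poly (f i)"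
  shows "trig_poly (\<lambda>x. \<Sum>i\<in>I. f i x)"
  using assms by (induction I rule: finite_induct) (auto intro: trig_poly_const trig_poly_add)

text \<open>Products of the generators reduce to generators by the product-to-sum formula. The free
  phase makes constants and sines special cases of one generator.\<close>

lemma trig_poly_mult:
  assumes "trig_poly f" "trig_poly g"
  shows "trig_poly (\<lambda>x. f x * g x)"
  using assms(1)
proof induction
  case (trig_poly_cos c u a)
  show ?case using assms(2)
  proof induction
    case (trig_poly_cos d v b)
    have "c * cos (u \<bullet> x + a) * (d * cos (v \<bullet> x + b))
        = (c * d / 2) * cos ((u - v) \<bullet> x + (a - b)) + (c * d / 2) * cos ((u + v) \<bullet> x + (a + b))" for x
      by (simp add: cos_times_cos inner_diff_left inner_add_left algebra_simps)
    then show ?case by (simp only:) (intro trig_poly.intros)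
  next
    case (trig_poly_add f g)
    then show ?case by (simp add: distrib_left trig_poly.trig_poly_add)
  qed
next
  case (trig_poly_add f g)
  then show ?case by (simp add: distrib_right trig_poly.trig_poly_add)
qed

text \<open>Wraps the space around a d-dimensional torus of period 2 pi L in each coordinate. The
  image is bounded, so polynomial approximation applies on a compact set although the space itself
  is not compact, and polynomials in the image are trigonometric polynomials of x.\<close>

definition torus_map :: "real \<Rightarrow> real^'d::finite \<Rightarrow> (real^'d) \<times> (real^'d)" where
  "torus_map L x = ((\<chi> k. cos (x $ k / L)), (\<chi> k. sin (x $ k / L)))"

lemma continuous_torus_map: "continuous_on UNIV (torus_map L)"
proof -
  have "continuous_on UNIV (\<lambda>x. (\<chi> k. cos (x $ k / L)))" "continuous_on UNIV (\<lambda>x. (\<chi> k. sin (x $ k / L)))"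
    for L :: real
    unfolding divide_inverse by (intro continuous_on_vec_lambda continuous_intros)+
  then show ?thesis unfolding torus_map_def by (intro continuous_on_Pair)
qed

lemma norm_torus_map: "norm (torus_map L (x::real^'d::finite)) = sqrt (real CARD('d))"
proof -
  have "torus_map L x \<bullet> torus_map L x = (\<Sum>k::'d\<in>UNIV. (cos (x $ k / L))\<^sup>2 + (sin (x $ k / L))\<^sup>2)"
    by (simp only: torus_map_def inner_vec_def sum.distrib power2_eq_square inner_Pair vec_lambda_beta inner_real_def)
  also have "\<dots> = real CARD('d)" by simp
  finally show ?thesis by (simp add: norm_eq_sqrt_inner)
qed

lemma sin_lower_half:
  assumes "0 \<le> x" "x \<le> (1::real)"
  shows "x / 2 \<le> sin x"
proof -
  have "1 / 2 \<le> cos y" if "0 \<le> y" "y \<le> 1" for y :: real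
  proof -
    have "cos (pi / 3) \<le> cos y"
      by (rule cos_monotone_0_pi_le) (use that pi_gt3 in auto)
    then show ?thesis by (simp add: cos_60)
  qed
  then have "sin 0 - 0 / 2 \<le> sin x - x / 2"
    by (intro DERIV_nonneg_imp_nondecreasing[where f = "\<lambda>x. sin x - x / 2"])
      (use assms in \<open>auto intro!: exI derivative_eq_intros\<close>)
  then show ?thesis by simp
qed

text \<open>Inside the ball of radius L the wrapping is injective with controlled inverse:
  coordinates differing by the angle 2 t have chord 2 sin t, and t \<le> 2 sin t as long as t \<le>
  1, which the radius guarantees.\<close>

lemma torus_map_dist:
  fixes x y :: "real^'d::finite"
  assumes L: "0 < L" and "norm x \<le> L" "norm y \<le> L"
  shows "dist x y \<le> 2 * L * dist (torus_map L x) (torus_map L y)"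
proof -
  define D where "D = torus_map L x - torus_map L y"
  have comp: "(x $ k - y $ k)\<^sup>2 \<le> (2 * L)\<^sup>2 * ((cos (x $ k / L) - cos (y $ k / L))\<^sup>2 + (sin (x $ k / L) - sin (y $ k / L))\<^sup>2)" for k
  proof -
    define t where "t = \<bar>x $ k - y $ k\<bar> / (2 * L)"
    have "\<bar>x $ k - y $ k\<bar> \<le> 2 * L"
      using component_le_norm_cart[of x k] component_le_norm_cart[of y k] assms by linarith
    then have t: "0 \<le> t" "t \<le> 1" using L by (auto simp: t_def)
    have "(cos (x $ k / L) - cos (y $ k / L))\<^sup>2 + (sin (x $ k / L) - sin (y $ k / L))\<^sup>2
        = ((cos (x $ k / L))\<^sup>2 + (sin (x $ k / L))\<^sup>2) + ((cos (y $ k / L))\<^sup>2 + (sin (y $ k / L))\<^sup>2)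
          - 2 * cos (x $ k / L - y $ k / L)"
      unfolding cos_diff by (simp only: power2_eq_square) (simp add: algebra_simps)
    also have "\<dots> = 2 - 2 * cos (2 * t)"
    proof -
      have "cos (x $ k / L - y $ k / L) = cos \<bar>x $ k / L - y $ k / L\<bar>" by simp
      also have "\<bar>x $ k / L - y $ k / L\<bar> = 2 * t" using L by (simp add: t_def diff_divide_distrib[symmetric])
      finally show ?thesis by simp
    qed
    also have "\<dots> = (2 * sin t)\<^sup>2"
      by (simp add: cos_double_sin power2_eq_square)
    also have "t\<^sup>2 \<le> (2 * sin t)\<^sup>2"
      using sin_lower_half[OF t] t by (intro power_mono) auto
    finally have "t\<^sup>2 \<le> (cos (x $ k / L) - cos (y $ k / L))\<^sup>2 + (sin (x $ k / L) - sin (y $ k / L))\<^sup>2" .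
    moreover have "(x $ k - y $ k)\<^sup>2 = (2 * L)\<^sup>2 * t\<^sup>2"
      using L by (simp add: t_def power_divide power_mult_distrib)
    ultimately show ?thesis by (metis mult_left_mono zero_le_power2)
  qed
  have "(dist x y)\<^sup>2 = (\<Sum>k\<in>UNIV. (x $ k - y $ k)\<^sup>2)"
    unfolding dist_norm power2_norm_eq_inner by (simp add: inner_vec_def power2_eq_square)
  also have "\<dots> \<le> (\<Sum>k\<in>UNIV. (2 * L)\<^sup>2 * ((cos (x $ k / L) - cos (y $ k / L))\<^sup>2 + (sin (x $ k / L) - sin (y $ k / L))\<^sup>2))"
    by (intro sum_mono comp)
  also have "\<dots> = (2 * L * dist (torus_map L x) (torus_map L y))\<^sup>2"
    unfolding power_mult_distrib[of _ "dist _ _"]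
    unfolding dist_norm power2_norm_eq_inner
    by (simp add: torus_map_def inner_vec_def sum_distrib_left[symmetric] sum.distrib power2_eq_square)
  finally show ?thesis by (rule power2_le_imp_le) (use L in simp)
qed

text \<open>A linear functional of the torus image is a combination of cosines and sines of single
  coordinates, a sine being a cosine with phase - pi / 2; the algebra operations are covered by
  closure of the class.\<close>

lemma trig_poly_torus_polynomial:
  assumes "real_polynomial_function g"
  shows "trig_poly (\<lambda>x::real^'d::finite. g (torus_map L x))"
  using assms
proof induction
  case (linear f)
  interpret bounded_linear f by fact
  have tm: "torus_map L x = (\<Sum>k\<in>UNIV. cos (x $ k / L) *\<^sub>R (axis k 1, 0) + sin (x $ k / L) *\<^sub>R (0, axis k 1))"
    for x :: "real^'d"
    by (simp add: torus_map_def prod_eq_iff fst_sum snd_sum vec_eq_iff axis_def if_distrib sum.delta' cong: if_cong)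
  have "f (torus_map L x) = (\<Sum>k\<in>UNIV. f (axis k 1, 0) * cos ((axis k (1 / L)) \<bullet> x + 0)
      + f (0, axis k 1) * cos ((axis k (1 / L)) \<bullet> x + (- pi / 2)))" for x :: "real^'d"
  proof -
    have "sin z = cos (z + (- pi / 2))" for z :: real
      by (simp add: cos_diff)
    then show ?thesis
      unfolding tm sum add scaleR inner_axis' by (simp add: mult.commute)
  qed
  then show ?case by (simp only:) (intro trig_poly_sum trig_poly.intros finite_class.finite_UNIV)
qed (auto intro: trig_poly_const trig_poly_add trig_poly_mult)

text \<open>The integral of a generator is the real part of a multiple of the characteristic
  function at u. Integrability is carried through the same induction because splitting the integral
  of a sum depends on it.\<close>

lemma trig_poly_integral_tendsto:
  fixes \<mu> :: "'i \<Rightarrow> (real^'d::finite) measure"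
  assumes \<mu>: "\<And>j. prob_space (\<mu> j)" "\<And>j. sets (\<mu> j) = sets borel"
    and \<nu>: "prob_space \<nu>" "sets \<nu> = sets borel"
    and cf: "\<And>u. ((\<lambda>j. CLINT x|\<mu> j. iexp (u \<bullet> x)) \<longlongrightarrow> (CLINT x|\<nu>. iexp (u \<bullet> x))) FF"
    and "trig_poly f"
  shows "((\<lambda>j. LINT x|\<mu> j. f x) \<longlongrightarrow> (LINT x|\<nu>. f x)) FF
    \<and> (\<forall>j. integrable (\<mu> j) f) \<and> integrable \<nu> f"
  using assms(6)
proof induction
  case (trig_poly_cos c u a)
  have *: "integrable M (\<lambda>x. c * cos (u \<bullet> x + a))"
    "(LINT x|M. c * cos (u \<bullet> x + a)) = Re (c * iexp a * (CLINT x|M. iexp (u \<bullet> x)))"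
    if M: "prob_space M" "sets M = sets borel" for M
  proof -
    interpret prob_space M by fact
    have [measurable_cong]: "sets M = sets borel" by fact
    show "integrable M (\<lambda>x. c * cos (u \<bullet> x + a))"
      by (intro integrable_mult_right integrable_const_bound[where B = 1]) auto
    have ie: "complex_integrable M (\<lambda>x. iexp (u \<bullet> x))"
      by (intro integrable_const_bound[where B = 1]) auto
    have "c * iexp a * (CLINT x|M. iexp (u \<bullet> x)) = (CLINT x|M. c * iexp a * iexp (u \<bullet> x))"
      by simp
    also have "Re \<dots> = (LINT x|M. Re (c * iexp a * iexp (u \<bullet> x)))"
      by (rule integral_Re[symmetric]) (intro integrable_mult_right ie)
    also have "\<dots> = (LINT x|M. c * cos (u \<bullet> x + a))"
      by (intro Bochner_Integration.integral_cong refl)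
        (simp add: Re_exp Im_exp cos_add algebra_simps)
    finally show "(LINT x|M. c * cos (u \<bullet> x + a)) = Re (c * iexp a * (CLINT x|M. iexp (u \<bullet> x)))" by simp
  qed
  show ?case
    unfolding *(2)[OF \<mu>] *(2)[OF \<nu>]
    using *(1)[OF \<mu>] *(1)[OF \<nu>] by (auto intro!: tendsto_intros cf)
next
  case (trig_poly_add f g)
  then show ?case by (auto intro!: tendsto_add)
qed

text \<open>Stone-Weierstrass on the ball containing the torus. The approximation is uniform, so
  replacing f by the polynomial costs at most e / 3 under every probability measure, hence uniformly
  in j.\<close>

lemma torus_function_integral_tendsto:
  fixes \<mu> :: "'i \<Rightarrow> (real^'d::finite) measure"
  assumes \<mu>: "\<And>j. prob_space (\<mu> j)" "\<And>j. sets (\<mu> j) = sets borel"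
    and \<nu>: "prob_space \<nu>" "sets \<nu> = sets borel"
    and cf: "\<And>u. ((\<lambda>j. CLINT x|\<mu> j. iexp (u \<bullet> x)) \<longlongrightarrow> (CLINT x|\<nu>. iexp (u \<bullet> x))) FF"
    and f: "continuous_on (cball 0 (sqrt (real CARD('d)))) (f :: _ \<Rightarrow> real)"
  shows "((\<lambda>j. LINT x|\<mu> j. f (torus_map L x)) \<longlongrightarrow> (LINT x|\<nu>. f (torus_map L x))) FF"
proof (rule tendstoI)
  fix e :: real assume e: "0 < e"
  let ?S = "cball (0 :: (real^'d) \<times> (real^'d)) (sqrt (real CARD('d)))"
  obtain g where g: "real_polynomial_function g" "\<And>x. x \<in> ?S \<Longrightarrow> \<bar>f x - g x\<bar> < e / 3"
    using Stone_Weierstrass_real_polynomial_function[OF compact_cball f, of "e / 3"] e by auto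
  have tS: "torus_map L x \<in> ?S" for x :: "real^'d" by (simp add: norm_torus_map)
  note tp = trig_poly_integral_tendsto[OF \<mu> \<nu> cf trig_poly_torus_polynomial[OF g(1)], of L]
  have close: "\<bar>(LINT x|M. f (torus_map L x)) - (LINT x|M. g (torus_map L x))\<bar> \<le> e / 3"
    if M: "prob_space M" "sets M = sets borel" and gi: "integrable M (\<lambda>x. g (torus_map L x))" for M
  proof -
    interpret prob_space M by fact
    have [measurable_cong]: "sets M = sets borel" by fact
    have "continuous_on UNIV (f \<circ> torus_map L)"
      by (rule continuous_on_compose[OF continuous_torus_map continuous_on_subset[OF f]]) (use tS in auto)
    then have [measurable]: "(\<lambda>x. f (torus_map L x)) \<in> borel_measurable borel"
      by (intro borel_measurable_continuous_onI) (simp add: o_def)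
    have "bounded (f ` ?S)" by (intro compact_imp_bounded compact_continuous_image[OF f compact_cball])
    then obtain B where B: "\<forall>y\<in>f ` ?S. norm y \<le> B" unfolding bounded_iff ..
    have fi: "integrable M (\<lambda>x. f (torus_map L x))"
      by (rule integrable_const_bound[where B = B]) (use B tS in auto)
    have "\<bar>(LINT x|M. f (torus_map L x)) - (LINT x|M. g (torus_map L x))\<bar>
        = \<bar>LINT x|M. f (torus_map L x) - g (torus_map L x)\<bar>"
      using fi gi by simp
    also have "\<dots> \<le> (LINT x|M. \<bar>f (torus_map L x) - g (torus_map L x)\<bar>)" by (rule integral_abs_bound)
    also have "\<dots> \<le> (LINT x|M. e / 3)"
      using fi gi g(2)[OF tS] by (intro integral_mono) (auto intro: less_imp_le)
    also have "\<dots> = e / 3" by (simp add: prob_space)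
    finally show ?thesis .
  qed
  have "\<forall>\<^sub>F j in FF. dist (LINT x|\<mu> j. g (torus_map L x)) (LINT x|\<nu>. g (torus_map L x)) < e / 3"
    using tp e by (intro tendstoD) auto
  then show "\<forall>\<^sub>F j in FF. dist (LINT x|\<mu> j. f (torus_map L x)) (LINT x|\<nu>. f (torus_map L x)) < e"
  proof eventually_elim
    case (elim j)
    show ?case
      using close[OF \<mu> tp[THEN conjunct2, THEN conjunct1, rule_format], of j]
        close[OF \<nu> tp[THEN conjunct2, THEN conjunct2]] elim unfolding dist_real_def by linarith
  qed
qed

section \<open>Couplings that are close in probability\<close>

lemma prob_tail_small:
  fixes \<nu> :: "('v::real_normed_vector) measure"
  assumes "prob_space \<nu>" "sets \<nu> = sets borel" "0 < e"
  obtains K where "0 < K" "measure \<nu> {x. K < norm x} \<le> e"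
proof -
  interpret prob_space \<nu> by fact
  have [measurable_cong]: "sets \<nu> = sets borel" by fact
  have sp: "space \<nu> = UNIV" using sets_eq_imp_space_eq[OF assms(2)] by simp
  define A where "A n = {x\<in>space \<nu>. real n < norm x}" for n
  have [measurable]: "A n \<in> sets \<nu>" for n unfolding A_def by measurable
  have "(\<lambda>n. measure \<nu> (A n)) \<longlonglongrightarrow> measure \<nu> (\<Inter>n. A n)"
    by (rule finite_Lim_measure_decseq) (auto simp: A_def decseq_def)
  also have "(\<Inter>n. A n) = {}"
  proof (rule equals0I)
    fix x assume x: "x \<in> (\<Inter>n. A n)"
    obtain n where "norm x \<le> real n" using real_arch_simple by blast
    moreover have "x \<in> A n" using x by blast
    ultimately show False by (simp add: A_def)
  qed
  finally have "\<forall>\<^sub>F n in sequentially. measure \<nu> (A n) < e"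
    by (rule order_tendstoD(2)) (use assms(3) in simp)
  then obtain n where n: "\<forall>m\<ge>n. measure \<nu> (A m) < e" unfolding eventually_sequentially ..
  have "measure \<nu> (A (Suc n)) \<le> e" by (intro less_imp_le n[rule_format]) simp
  then show ?thesis by (intro that[of "real (Suc n)"]) (simp_all add: A_def sp)
qed

text \<open>Tent functions around the centres of a finite \<delta>-net, divided by their sum. The
  sum is positive only where the net covers, hence continuity is claimed on the ball and the total
  is 1 at points of the torus.\<close>

lemma torus_partition_of_unity:
  fixes L \<delta> :: real
  assumes "0 < \<delta>"
  obtains T and h :: "(real^'d::finite) \<times> (real^'d) \<Rightarrow> (real^'d) \<times> (real^'d) \<Rightarrow> real"
  where "finite T"
    "\<And>u. u \<in> T \<Longrightarrow> continuous_on (cball 0 (sqrt (real CARD('d)))) (h u)"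
    "\<And>u z. 0 \<le> h u z"
    "\<And>x. (\<Sum>u\<in>T. h u (torus_map L x)) = 1"
    "\<And>u z. h u z \<noteq> 0 \<Longrightarrow> dist u z < \<delta>"
proof -
  let ?S = "cball (0 :: (real^'d) \<times> (real^'d)) (sqrt (real CARD('d)))"
  obtain T where T: "finite T" "?S \<subseteq> (\<Union>u\<in>T. ball u \<delta>)"
    using compact_eq_totally_bounded[THEN iffD1, OF compact_cball, THEN conjunct2, rule_format, OF assms] by blast
  define \<phi> where "\<phi> u z = max 0 (\<delta> - dist u z)" for u z :: "(real^'d) \<times> (real^'d)"
  define h where "h u z = \<phi> u z / (\<Sum>u\<in>T. \<phi> u z)" for u z
  have \<phi>0: "0 \<le> \<phi> u z" for u z by (simp add: \<phi>_def)
  have pos: "0 < (\<Sum>u\<in>T. \<phi> u z)" if z: "z \<in> ?S" for z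
  proof -
    obtain u where u: "u \<in> T" "dist u z < \<delta>" using T z by auto
    then have "0 < \<phi> u z" by (simp add: \<phi>_def)
    also have "\<dots> \<le> (\<Sum>u\<in>T. \<phi> u z)" by (rule member_le_sum) (use u T \<phi>0 in auto)
    finally show ?thesis .
  qed
  show ?thesis
  proof
    show "finite T" by (rule T)
    show "continuous_on ?S (h u)" for u
      unfolding h_def \<phi>_def
      by (intro continuous_intros ballI) (use pos in \<open>force simp: \<phi>_def\<close>)
    show "0 \<le> h u z" for u z by (auto simp: h_def \<phi>0 intro!: divide_nonneg_nonneg sum_nonneg)
    show "(\<Sum>u\<in>T. h u (torus_map L x)) = 1" for x
      using pos[of "torus_map L x"] by (simp add: h_def sum_divide_distrib[symmetric] norm_torus_map)
    show "dist u z < \<delta>" if "h u z \<noteq> 0" for u z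
      using that by (auto simp: h_def \<phi>_def max_def split: if_splits)
  qed
qed

text \<open>The pieces of the partition do not distinguish points that differ by a period, so a
  shared piece means proximity only inside a ball. Tightness makes the mass outside this ball small;
  its radius K serves also as the scale of the torus. The three thirds of e pay for unmatched mass
  and for the two tails.\<close>

lemma close_couplings:
  fixes \<mu> :: "'i \<Rightarrow> (real^'d::finite) measure"
  assumes \<mu>: "\<And>j. prob_space (\<mu> j)" "\<And>j. sets (\<mu> j) = sets borel"
    and \<nu>: "prob_space \<nu>" "sets \<nu> = sets borel"
    and cf: "\<And>u. ((\<lambda>j. CLINT x|\<mu> j. iexp (u \<bullet> x)) \<longlongrightarrow> (CLINT x|\<nu>. iexp (u \<bullet> x))) FF"
    and tight: "\<And>e. 0 < e \<Longrightarrow> \<exists>K. \<forall>\<^sub>F j in FF. measure (\<mu> j) {x. K < norm x} \<le> e"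
    and e: "0 < e"
  shows "\<forall>\<^sub>F j in FF. \<exists>C. is_coupling C (\<mu> j) \<nu> \<and> measure C {z. e \<le> dist (fst z) (snd z)} \<le> e"
proof -
  have e3: "0 < e / 3" using e by simp
  obtain K1 where K1: "0 < K1" "measure \<nu> {x. K1 < norm x} \<le> e / 3" by (rule prob_tail_small[OF \<nu> e3])
  obtain K2 where K2: "\<forall>\<^sub>F j in FF. measure (\<mu> j) {x. K2 < norm x} \<le> e / 3" using tight[OF e3] by blast
  define K where "K = max K1 K2"
  have K: "0 < K" using K1 by (simp add: K_def)
  \<comment> \<open>Two points in a common piece have torus images less than 2 \<delta> apart, hence
    are themselves less than 2 K * 2 \<delta> = e apart.\<close>
  define \<delta> where "\<delta> = e / (4 * K)"
  have \<delta>: "0 < \<delta>" using e K by (simp add: \<delta>_def)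
  obtain T and h :: "(real^'d) \<times> (real^'d) \<Rightarrow> (real^'d) \<times> (real^'d) \<Rightarrow> real"
    where T: "finite T"
    and hc: "\<And>u. u \<in> T \<Longrightarrow> continuous_on (cball 0 (sqrt (real CARD('d)))) (h u)"
    and h0: "\<And>u z. 0 \<le> h u z"
    and h1: "\<And>x. (\<Sum>u\<in>T. h u (torus_map K x)) = 1"
    and h\<delta>: "\<And>u z. h u z \<noteq> 0 \<Longrightarrow> dist u z < \<delta>"
    by (rule torus_partition_of_unity[OF \<delta>, where L = K]) blast
  have "((\<lambda>j. \<Sum>u\<in>T. \<bar>(LINT x|\<mu> j. h u (torus_map K x)) - (LINT x|\<nu>. h u (torus_map K x))\<bar>)
      \<longlongrightarrow> (\<Sum>u\<in>T. \<bar>(LINT x|\<nu>. h u (torus_map K x)) - (LINT x|\<nu>. h u (torus_map K x))\<bar>)) FF"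
    by (intro tendsto_intros torus_function_integral_tendsto[OF \<mu> \<nu> cf] hc)
  then have "\<forall>\<^sub>F j in FF. (\<Sum>u\<in>T. \<bar>(LINT x|\<mu> j. h u (torus_map K x)) - (LINT x|\<nu>. h u (torus_map K x))\<bar>) < e / 3"
    by (rule order_tendstoD(2)) (use e3 in simp)
  then show ?thesis using K2
  proof eventually_elim
    case (elim j)
    interpret \<mu>: prob_space "\<mu> j" by (rule \<mu>)
    interpret \<nu>: prob_space \<nu> by (rule \<nu>)
    have [measurable_cong]: "sets (\<mu> j) = sets borel" "sets \<nu> = sets borel" by (rule \<mu> \<nu>)+
    have sp: "space (\<mu> j) = UNIV" "space \<nu> = UNIV"
      using sets_eq_imp_space_eq[OF \<mu>(2)] sets_eq_imp_space_eq[OF \<nu>(2)] by simp_all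
    have hm: "(\<lambda>x. h u (torus_map K x)) \<in> borel_measurable (\<mu> j)" if "u \<in> T" for u
    proof -
      have "continuous_on UNIV (h u \<circ> torus_map K)"
        by (rule continuous_on_compose[OF continuous_torus_map continuous_on_subset[OF hc[OF that]]])
          (auto simp: norm_torus_map)
      then have "(\<lambda>x. h u (torus_map K x)) \<in> borel_measurable borel"
        by (intro borel_measurable_continuous_onI) (simp add: o_def)
      then show ?thesis by measurable
    qed
    obtain C where C: "is_coupling C (\<mu> j) \<nu>"
      and bad: "measure C {z\<in>space (\<mu> j \<Otimes>\<^sub>M \<nu>). \<forall>u\<in>T. h u (torus_map K (fst z)) * h u (torus_map K (snd z)) = 0}
        \<le> (\<Sum>u\<in>T. \<bar>(LINT x|\<mu> j. h u (torus_map K x)) - (LINT x|\<nu>. h u (torus_map K x))\<bar>)"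
      by (rule coupling_of_partition[OF \<mu>(1) \<nu>(1) _ T hm h0 h1]) (simp_all add: \<mu> \<nu>)
    interpret C: prob_space C using C by (simp add: is_coupling_def)
    have setsC[measurable_cong]: "sets C = sets (\<mu> j \<Otimes>\<^sub>M \<nu>)" using C by (simp add: is_coupling_def)
    have spC: "space C = UNIV" using sets_eq_imp_space_eq[OF setsC] by (simp add: space_pair_measure sp)
    define B where "B = {z\<in>space C. \<forall>u\<in>T. h u (torus_map K (fst z)) * h u (torus_map K (snd z)) = 0}"
    have hm': "(\<lambda>x. h u (torus_map K x)) \<in> borel_measurable \<nu>" if "u \<in> T" for u
      using hm[OF that] by (simp add: measurable_cong_sets[OF \<mu>(2) refl] measurable_cong_sets[OF \<nu>(2) refl])
    note [measurable] = hm hm'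
    have Bm[measurable]: "B \<in> sets C"
      unfolding B_def using T by measurable
    define U where "U = {z\<in>space C. K < norm (fst z)}"
    define V where "V = {z\<in>space C. K < norm (snd z)}"
    have [measurable]: "U \<in> sets C" "V \<in> sets C" unfolding U_def V_def by measurable
    have Bb: "measure C B \<le> e / 3"
      using bad elim(1) unfolding B_def spC by (simp add: space_pair_measure sp)
    have Ub: "measure C U \<le> e / 3"
    proof -
      have "measure C U = measure (distr C (\<mu> j) fst) {x\<in>space (\<mu> j). K < norm x}"
        by (subst measure_distr) (auto simp: U_def spC sp intro!: arg_cong[where f = "measure C"])
      also have "\<dots> = measure (\<mu> j) {x\<in>space (\<mu> j). K < norm x}" using C by (simp add: is_coupling_def)
      also have "\<dots> \<le> measure (\<mu> j) {x\<in>space (\<mu> j). K2 < norm x}"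
        by (intro \<mu>.finite_measure_mono) (auto simp: K_def)
      finally show ?thesis using elim by (simp add: sp)
    qed
    have Vb: "measure C V \<le> e / 3"
    proof -
      have "measure C V = measure (distr C \<nu> snd) {x\<in>space \<nu>. K < norm x}"
        by (subst measure_distr) (auto simp: V_def spC sp intro!: arg_cong[where f = "measure C"])
      also have "\<dots> = measure \<nu> {x\<in>space \<nu>. K < norm x}" using C by (simp add: is_coupling_def)
      also have "\<dots> \<le> measure \<nu> {x\<in>space \<nu>. K1 < norm x}"
        by (intro \<nu>.finite_measure_mono) (auto simp: K_def)
      finally show ?thesis using K1 by (simp add: sp)
    qed
    \<comment> \<open>Outside B some piece contains both torus images, and outside U and V both
      points lie in the ball of radius K on which the wrapping can be inverted.\<close>
    have "{z. e \<le> dist (fst z) (snd z)} \<subseteq> B \<union> U \<union> V"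
    proof
      fix z :: "(real^'d) \<times> (real^'d)" assume z: "z \<in> {z. e \<le> dist (fst z) (snd z)}"
      obtain x y where xy: "z = (x, y)" by (cases z)
      show "z \<in> B \<union> U \<union> V"
      proof (rule ccontr)
        assume n: "z \<notin> B \<union> U \<union> V"
        then have nx: "norm x \<le> K" "norm y \<le> K" by (auto simp: U_def V_def spC xy)
        from n obtain u where u: "h u (torus_map K x) \<noteq> 0" "h u (torus_map K y) \<noteq> 0"
          by (auto simp: B_def spC xy)
        have "dist (torus_map K x) (torus_map K y) < 2 * \<delta>"
          using h\<delta>[OF u(1)] h\<delta>[OF u(2)] dist_triangle3[of "torus_map K x" "torus_map K y" u] by linarith
        then have "2 * K * dist (torus_map K x) (torus_map K y) < 2 * K * (2 * \<delta>)"
          using K by (intro mult_strict_left_mono) auto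
        also have "\<dots> = e" using K by (simp add: \<delta>_def)
        finally have "dist x y < e" using torus_map_dist[OF K nx] by linarith
        then show False using z by (simp add: xy)
      qed
    qed
    then have "measure C {z. e \<le> dist (fst z) (snd z)} \<le> measure C (B \<union> U \<union> V)"
      by (intro C.finite_measure_mono) auto
    also have "\<dots> \<le> measure C B + measure C U + measure C V"
      using measure_Un_le[of "B \<union> U" C V] measure_Un_le[of B C U] by simp
    finally show ?case using Bb Ub Vb C by (intro exI[of _ C]) auto
  qed
qed

text \<open>For each fixed level e the previous lemma eventually gives a coupling of that level, but
  the coupling may depend on e. One coupling per j is obtained by going almost to the infimum of the
  attainable levels, with slack \<eta> j tending to 0; it then serves every f.\<close>

theorem couplings_of_char_convergence:
  fixes \<mu> :: "'i \<Rightarrow> (real^'d::finite) measure" and \<eta> :: "'i \<Rightarrow> real"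
  assumes \<mu>: "\<And>j. prob_space (\<mu> j)" "\<And>j. sets (\<mu> j) = sets borel"
    and \<nu>: "prob_space \<nu>" "sets \<nu> = sets borel"
    and cf: "\<And>u. ((\<lambda>j. CLINT x|\<mu> j. iexp (u \<bullet> x)) \<longlongrightarrow> (CLINT x|\<nu>. iexp (u \<bullet> x))) FF"
    and tight: "\<And>e. 0 < e \<Longrightarrow> \<exists>K. \<forall>\<^sub>F j in FF. measure (\<mu> j) {x. K < norm x} \<le> e"
    and \<eta>: "\<And>j. 0 < \<eta> j" "(\<eta> \<longlongrightarrow> 0) FF"
  obtains C where "\<And>j. is_coupling (C j) (\<mu> j) \<nu>"
    "\<And>f :: real^'d \<Rightarrow> real. continuous_on UNIV f \<Longrightarrow> bounded (range f) \<Longrightarrow>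
      ((\<lambda>j. LINT (x, y)|C j. \<bar>f x - f y\<bar>) \<longlongrightarrow> 0) FF"
proof -
  define D where "D j = {e. 0 < e \<and> (\<exists>C. is_coupling C (\<mu> j) \<nu> \<and> measure C {z. e \<le> dist (fst z) (snd z)} \<le> e)}" for j
  \<comment> \<open>Every coupling has level 1, and the trivial one-piece partition provides one. So
    the set of levels is nonempty for all j, including those where nothing is known yet.\<close>
  have D1: "1 \<in> D j" for j
  proof -
    obtain C where "is_coupling C (\<mu> j) \<nu>"
      by (rule coupling_of_partition[OF \<mu>(1) \<nu>(1), of j "{()}" "\<lambda>_ _. 1"]) (auto simp: \<mu> \<nu>)
    moreover from this interpret C: prob_space C by (simp add: is_coupling_def)
    have "measure C {z. 1 \<le> dist (fst z) (snd z)} \<le> 1" by simp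
    ultimately show ?thesis by (auto simp: D_def)
  qed
  have bdd: "bdd_below (D j)" for j by (rule bdd_belowI[of _ 0]) (auto simp: D_def)
  \<comment> \<open>The slack avoids having to attain the infimum.\<close>
  have "\<exists>e\<in>D j. e < Inf (D j) + \<eta> j" for j
    using cInf_lessD[of "D j" "Inf (D j) + \<eta> j"] D1 \<eta>(1)[of j] by auto
  then obtain e where e: "\<And>j. e j \<in> D j" "\<And>j. e j < Inf (D j) + \<eta> j" by metis
  then have "\<exists>C. is_coupling C (\<mu> j) \<nu> \<and> measure C {z. e j \<le> dist (fst z) (snd z)} \<le> e j" for j
    by (auto simp: D_def)
  then obtain C where C: "\<And>j. is_coupling (C j) (\<mu> j) \<nu>"
    and Ce: "\<And>j. measure (C j) {z. e j \<le> dist (fst z) (snd z)} \<le> e j" by metis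
  have e0: "0 < e j" for j using e(1)[of j] by (simp add: D_def)
  have elim0: "\<forall>\<^sub>F j in FF. e j < a" if a: "0 < a" for a
  proof -
    have "\<forall>\<^sub>F j in FF. \<eta> j < a / 2" using \<eta>(2) a by (intro order_tendstoD(2)[where a = "a / 2"]) auto
    moreover have "\<forall>\<^sub>F j in FF. a / 2 \<in> D j"
      using close_couplings[OF \<mu> \<nu> cf tight, of "a / 2"] a by (simp add: D_def)
    ultimately show ?thesis
    proof eventually_elim
      case (elim j)
      then show ?case using cInf_lower[OF elim(2) bdd] e(2)[of j] by linarith
    qed
  qed
  have "((\<lambda>j. LINT (x, y)|C j. \<bar>f x - f y\<bar>) \<longlongrightarrow> 0) FF"
    if f: "continuous_on UNIV f" "bounded (range f)" for f :: "real^'d \<Rightarrow> real"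
  proof (rule tendstoI)
    fix a :: real assume a: "0 < a"
    obtain B where B: "0 < B" "\<And>x. \<bar>f x\<bar> \<le> B"
      using f(2) unfolding bounded_pos by auto
    \<comment> \<open>The final estimate is b + 4 B b, which equals a (1 + 4 B) / (2 + 4 B) and so
      stays below a.\<close>
    define b where "b = a / (2 + 4 * B)"
    have b: "0 < b" using a B by (simp add: b_def)
    obtain K where K: "0 < K" "measure \<nu> {x. K < norm x} \<le> b" by (rule prob_tail_small[OF \<nu> b])
    \<comment> \<open>Radius K + 1: only the law \<nu> is truncated, at radius K, and the other
      point lies within e j < 1 of it.\<close>
    have "uniformly_continuous_on (cball 0 (K + 1)) f"
      by (intro compact_uniformly_continuous continuous_on_subset[OF f(1)]) auto
    then obtain d where d: "0 < d" "\<And>x y. norm x \<le> K + 1 \<Longrightarrow> norm y \<le> K + 1 \<Longrightarrow> dist x y < d \<Longrightarrow> \<bar>f x - f y\<bar> < b"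
      unfolding uniformly_continuous_on_def using b by (auto simp: dist_real_def dist_commute)
    have "\<forall>\<^sub>F j in FF. e j < min b (min d 1)" using b d by (intro elim0) auto
    then show "\<forall>\<^sub>F j in FF. dist (LINT (x, y)|C j. \<bar>f x - f y\<bar>) 0 < a"
    proof eventually_elim
      case (elim j)
      interpret C: prob_space "C j" using C by (simp add: is_coupling_def)
      have [measurable_cong]: "sets (\<mu> j) = sets borel" "sets \<nu> = sets borel" by (rule \<mu> \<nu>)+
      have sp: "space (\<mu> j) = UNIV" "space \<nu> = UNIV"
        using sets_eq_imp_space_eq[OF \<mu>(2)] sets_eq_imp_space_eq[OF \<nu>(2)] by simp_all
      have setsC[measurable_cong]: "sets (C j) = sets (\<mu> j \<Otimes>\<^sub>M \<nu>)" using C by (simp add: is_coupling_def)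
      have spC: "space (C j) = UNIV" using sets_eq_imp_space_eq[OF setsC] by (simp add: space_pair_measure sp)
      have [measurable]: "f \<in> borel_measurable borel" using f(1) by (rule borel_measurable_continuous_onI)
      define U where "U = {z\<in>space (C j). e j \<le> dist (fst z) (snd z)}"
      define V where "V = {z\<in>space (C j). K < norm (snd z)}"
      have [measurable]: "U \<in> sets (C j)" "V \<in> sets (C j)" unfolding U_def V_def by measurable
      have Ub: "measure (C j) U \<le> b" using Ce[of j] elim by (simp add: U_def spC)
      have Vb: "measure (C j) V \<le> b"
      proof -
        have "measure (C j) V = measure (distr (C j) \<nu> snd) {x\<in>space \<nu>. K < norm x}"
          by (subst measure_distr) (auto simp: V_def spC sp intro!: arg_cong[where f = "measure (C j)"])
        also have "\<dots> = measure \<nu> {x\<in>space \<nu>. K < norm x}" using C by (simp add: is_coupling_def)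
        finally show ?thesis using K by (simp add: sp)
      qed
      have ptw: "\<bar>f (fst z) - f (snd z)\<bar> \<le> b + 2 * B * indicator U z + 2 * B * indicator V z" for z
      proof (cases "z \<in> U \<union> V")
        case True
        have "\<bar>f (fst z) - f (snd z)\<bar> \<le> 2 * B" using B(2)[of "fst z"] B(2)[of "snd z"] by linarith
        then show ?thesis using True B b by (auto simp: indicator_def)
      next
        case False
        then have "dist (fst z) (snd z) < e j" "norm (snd z) \<le> K" by (auto simp: U_def V_def spC)
        moreover have "norm (fst z) \<le> norm (snd z) + dist (fst z) (snd z)"
          by (metis dist_norm norm_triangle_sub)
        ultimately have "\<bar>f (fst z) - f (snd z)\<bar> < b" using elim by (intro d) auto
        then show ?thesis using False by simp
      qed
      have "(LINT (x, y)|C j. \<bar>f x - f y\<bar>) = (LINT z|C j. \<bar>f (fst z) - f (snd z)\<bar>)"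
        by (simp add: case_prod_beta')
      also have "\<dots> \<le> (LINT z|C j. b + 2 * B * indicator U z + 2 * B * indicator V z)"
      proof (rule integral_mono)
        show "integrable (C j) (\<lambda>z. \<bar>f (fst z) - f (snd z)\<bar>)"
        proof (rule C.integrable_const_bound[where B = "2 * B"], rule AE_I2)
          show "norm \<bar>f (fst z) - f (snd z)\<bar> \<le> 2 * B" for z
            using B(2)[of "fst z"] B(2)[of "snd z"] by simp
        qed measurable
        show "integrable (C j) (\<lambda>z. b + 2 * B * indicator U z + 2 * B * indicator V z)"
          by (intro Bochner_Integration.integrable_add integrable_mult_right integrable_real_indicator)
            (auto simp: C.emeasure_eq_measure)
      qed (rule ptw)
      also have "\<dots> = b + 2 * B * measure (C j) U + 2 * B * measure (C j) V"
        by (simp add: C.prob_space C.emeasure_eq_measure)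
      also have "\<dots> \<le> b + 2 * B * b + 2 * B * b"
        using Ub Vb B by (intro add_mono mult_left_mono) auto
      also have "\<dots> = a * (1 + 4 * B) / (2 + 4 * B)" by (simp add: b_def algebra_simps add_divide_distrib)
      also have "\<dots> < a" using a B by (simp add: field_simps)
      finally have "(LINT (x, y)|C j. \<bar>f x - f y\<bar>) < a" .
      moreover have "0 \<le> (LINT (x, y)|C j. \<bar>f x - f y\<bar>)" by (simp add: case_prod_beta')
      ultimately show ?case by simp
    qed
  qed
  then show ?thesis using that C by blast
qed

section \<open>Conditional moments of the gradient noise\<close>

lemma power_le_one_plus_power4:
  fixes r :: real
  assumes "0 \<le> r" "k \<le> 4"
  shows "r ^ k \<le> 1 + r ^ 4"
proof (cases "r \<le> 1")
  case True
  then show ?thesis using power_le_one[of r k] assms by (smt (verit) zero_le_power)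
next
  case False
  then have "r ^ k \<le> r ^ 4" using assms by (intro power_increasing) auto
  then show ?thesis by simp
qed

lemma inner_matrix_entry_bound:
  fixes B :: "real^'d::finite^'d"
  shows "\<bar>u \<bullet> (B *v u)\<bar> \<le> (norm u)\<^sup>2 * (\<Sum>a\<in>UNIV. \<Sum>b\<in>UNIV. \<bar>B $ a $ b\<bar>)"
proof -
  have "norm (B *v u) \<le> (\<Sum>a\<in>UNIV. \<bar>(B *v u) $ a\<bar>)" by (rule norm_le_l1_cart)
  also have "\<dots> \<le> (\<Sum>a\<in>UNIV. \<Sum>b\<in>UNIV. \<bar>B $ a $ b\<bar> * norm u)"
  proof (rule sum_mono)
    fix a
    have "\<bar>(B *v u) $ a\<bar> \<le> (\<Sum>b\<in>UNIV. \<bar>B $ a $ b * u $ b\<bar>)"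
      unfolding matrix_vector_mult_def by (simp add: sum_abs)
    also have "\<dots> \<le> (\<Sum>b\<in>UNIV. \<bar>B $ a $ b\<bar> * norm u)"
      unfolding abs_mult by (intro sum_mono mult_left_mono component_le_norm_cart) simp
    finally show "\<bar>(B *v u) $ a\<bar> \<le> (\<Sum>b\<in>UNIV. \<bar>B $ a $ b\<bar> * norm u)" .
  qed
  also have "\<dots> = norm u * (\<Sum>a\<in>UNIV. \<Sum>b\<in>UNIV. \<bar>B $ a $ b\<bar>)"
    by (simp add: sum_distrib_left mult.commute)
  finally have *: "norm (B *v u) \<le> norm u * (\<Sum>a\<in>UNIV. \<Sum>b\<in>UNIV. \<bar>B $ a $ b\<bar>)" .
  have "\<bar>u \<bullet> (B *v u)\<bar> \<le> norm u * norm (B *v u)" by (rule Cauchy_Schwarz_ineq2)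
  also have "\<dots> \<le> norm u * (norm u * (\<Sum>a\<in>UNIV. \<Sum>b\<in>UNIV. \<bar>B $ a $ b\<bar>))"
    by (intro mult_left_mono *) simp
  finally show ?thesis by (simp add: power2_eq_square mult.assoc)
qed

lemma norm_le_opnorm: "norm (B *v u) \<le> opnorm B * norm u"
  unfolding opnorm_def by (rule onorm[OF matrix_vector_mul_bounded_linear])

lemma borel_measurable_vec_nth [measurable (raw)]:
  fixes f :: "'a \<Rightarrow> real^'d::finite"
  assumes "f \<in> borel_measurable M"
  shows "(\<lambda>x. f x $ a) \<in> borel_measurable M"
  unfolding cart_eq_inner_axis using assms by measurable

text \<open>A single iteration in isolation: x is the error entering it, s the noise at the current
  iterate and \<open>s\<^sub>o\<close> the noise at the minimiser. The assumption
  \<open>x_fourth\<close> provides integrability only; no bound on that moment that is uniform over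
  iterations is available.\<close>

locale noise_step = prob_space M for M :: "'a measure" +
  fixes F :: "'a measure" and s s\<^sub>o x :: "'a \<Rightarrow> real^'d::finite" and \<alpha> \<sigma> \<kappa> \<gamma> :: real
  assumes subalg: "subalgebra M F"
    and x_meas: "x \<in> borel_measurable F"
    and s_meas [measurable]: "s \<in> borel_measurable M" "s\<^sub>o \<in> borel_measurable M"
    and nonneg: "0 \<le> \<alpha>" "0 \<le> \<sigma>" "0 \<le> \<kappa>" "0 < \<gamma>"
    and centered: "\<And>a. AE \<omega> in M. real_cond_exp M F (\<lambda>\<omega>. s \<omega> $ a) \<omega> = 0"
    and fourth: "AE \<omega> in M. nn_cond_exp M F (\<lambda>\<omega>. ennreal (norm (s \<omega>) ^ 4)) \<omega>
        \<le> ennreal (\<alpha>\<^sup>2 * norm (x \<omega>) ^ 4 + \<sigma> ^ 4)"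
    and fourth_o: "AE \<omega> in M. nn_cond_exp M F (\<lambda>\<omega>. ennreal (norm (s\<^sub>o \<omega>) ^ 4)) \<omega> \<le> ennreal (\<sigma> ^ 4)"
    and cov_close: "AE \<omega> in M. opnorm (cond_second_moment M F s\<^sub>o \<omega> - cond_second_moment M F s \<omega>)
        \<le> \<kappa> * norm (x \<omega>) powr \<gamma>"
    and x_fourth: "integrable M (\<lambda>\<omega>. norm (x \<omega>) ^ 4)"
begin

sublocale finite_measure_subalgebra M F
  by unfold_locales (rule subalg)

lemma F_meas: "f \<in> borel_measurable F \<Longrightarrow> f \<in> borel_measurable M"
  by (rule measurable_from_subalg[OF subalg])

lemma x_measM [measurable]: "x \<in> borel_measurable M"
  by (rule F_meas[OF x_meas])

lemma fourth_nn:
  assumes [measurable]: "g \<in> borel_measurable F"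
  shows "(\<integral>\<^sup>+\<omega>. g \<omega> * ennreal (norm (s \<omega>) ^ 4) \<partial>M)
    \<le> (\<integral>\<^sup>+\<omega>. g \<omega> * ennreal (\<alpha>\<^sup>2 * norm (x \<omega>) ^ 4 + \<sigma> ^ 4) \<partial>M)"
proof -
  have "(\<integral>\<^sup>+\<omega>. g \<omega> * ennreal (norm (s \<omega>) ^ 4) \<partial>M)
      = (\<integral>\<^sup>+\<omega>. g \<omega> * nn_cond_exp M F (\<lambda>\<omega>. ennreal (norm (s \<omega>) ^ 4)) \<omega> \<partial>M)"
    by (rule nn_cond_exp_intg[symmetric]) measurable
  also have "\<dots> \<le> (\<integral>\<^sup>+\<omega>. g \<omega> * ennreal (\<alpha>\<^sup>2 * norm (x \<omega>) ^ 4 + \<sigma> ^ 4) \<partial>M)"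
    by (intro nn_integral_mono_AE) (use fourth in eventually_elim, simp add: mult_left_mono)
  finally show ?thesis .
qed

lemma s_fourth: "integrable M (\<lambda>\<omega>. norm (s \<omega>) ^ 4)"
proof (rule integrableI_nonneg)
  have "(\<integral>\<^sup>+\<omega>. ennreal (norm (s \<omega>) ^ 4) \<partial>M) \<le> (\<integral>\<^sup>+\<omega>. ennreal (\<alpha>\<^sup>2 * norm (x \<omega>) ^ 4 + \<sigma> ^ 4) \<partial>M)"
    using fourth_nn[of "\<lambda>_. 1"] by simp
  also have "\<dots> = ennreal (LINT \<omega>|M. \<alpha>\<^sup>2 * norm (x \<omega>) ^ 4 + \<sigma> ^ 4)"
    by (rule nn_integral_eq_integral) (use x_fourth in auto)
  finally show "(\<integral>\<^sup>+\<omega>. ennreal (norm (s \<omega>) ^ 4) \<partial>M) < \<infinity>" by (rule le_less_trans) simp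
qed auto

lemma power_integrable:
  fixes y :: "'a \<Rightarrow> 'v::{real_normed_vector, second_countable_topology}"
  assumes "integrable M (\<lambda>\<omega>. norm (y \<omega>) ^ 4)" and [measurable]: "y \<in> borel_measurable M" and "k \<le> 4"
  shows "integrable M (\<lambda>\<omega>. norm (y \<omega>) ^ k)"
proof (rule Bochner_Integration.integrable_bound)
  show "integrable M (\<lambda>\<omega>. 1 + norm (y \<omega>) ^ 4)" using assms by simp
  show "AE \<omega> in M. norm (norm (y \<omega>) ^ k) \<le> norm (1 + norm (y \<omega>) ^ 4)"
    by (simp add: power_le_one_plus_power4 \<open>k \<le> 4\<close>)
qed measurable

lemmas s_power = power_integrable[OF s_fourth s_meas(1)]
lemmas x_power = power_integrable[OF x_fourth x_measM]

lemma bounded_mult_integrable: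
  fixes f :: "'a \<Rightarrow> real"
  assumes f: "integrable M f" and [measurable]: "g \<in> borel_measurable M"
    and "\<And>\<omega>. norm (g \<omega>) \<le> B"
  shows "integrable M (\<lambda>\<omega>. g \<omega> * f \<omega>)"
proof (rule Bochner_Integration.integrable_bound)
  show "integrable M (\<lambda>\<omega>. B * f \<omega>)" using f by simp
  show "AE \<omega> in M. norm (g \<omega> * f \<omega>) \<le> norm (B * f \<omega>)"
  proof (rule AE_I2)
    fix \<omega>
    have "norm (g \<omega>) * norm (f \<omega>) \<le> \<bar>B\<bar> * norm (f \<omega>)"
      by (intro mult_right_mono order_trans[OF assms(3)]) auto
    then show "norm (g \<omega> * f \<omega>) \<le> norm (B * f \<omega>)" by (simp add: abs_mult)
  qed
  show "(\<lambda>\<omega>. g \<omega> * f \<omega>) \<in> borel_measurable M" using f by measurable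
qed

lemma fourth_weighted:
  assumes g: "g \<in> borel_measurable F" "\<And>\<omega>. 0 \<le> g \<omega>" "\<And>\<omega>. g \<omega> \<le> B"
  shows "(LINT \<omega>|M. g \<omega> * norm (s \<omega>) ^ 4) \<le> (LINT \<omega>|M. g \<omega> * (\<alpha>\<^sup>2 * norm (x \<omega>) ^ 4 + \<sigma> ^ 4))"
proof -
  note [measurable] = F_meas[OF g(1)] g(1)
  have gB: "norm (g \<omega>) \<le> B" for \<omega> using g by simp
  have i1: "integrable M (\<lambda>\<omega>. g \<omega> * norm (s \<omega>) ^ 4)"
    by (rule bounded_mult_integrable[OF s_fourth _ gB]) measurable
  have i2: "integrable M (\<lambda>\<omega>. g \<omega> * (\<alpha>\<^sup>2 * norm (x \<omega>) ^ 4 + \<sigma> ^ 4))"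
    by (rule bounded_mult_integrable[OF _ _ gB]) (use x_fourth in auto)
  have "ennreal (LINT \<omega>|M. g \<omega> * norm (s \<omega>) ^ 4) = (\<integral>\<^sup>+\<omega>. ennreal (g \<omega>) * ennreal (norm (s \<omega>) ^ 4) \<partial>M)"
    using i1 g by (subst nn_integral_eq_integral[symmetric]) (auto simp: ennreal_mult')
  also have "\<dots> \<le> (\<integral>\<^sup>+\<omega>. ennreal (g \<omega>) * ennreal (\<alpha>\<^sup>2 * norm (x \<omega>) ^ 4 + \<sigma> ^ 4) \<partial>M)"
    by (rule fourth_nn) measurable
  also have "\<dots> = ennreal (LINT \<omega>|M. g \<omega> * (\<alpha>\<^sup>2 * norm (x \<omega>) ^ 4 + \<sigma> ^ 4))"
    using i2 g nonneg by (subst nn_integral_eq_integral[symmetric]) (auto simp: ennreal_mult')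
  finally show ?thesis
    using g nonneg by (subst (asm) ennreal_le_iff) (auto intro!: integral_nonneg_AE)
qed

text \<open>Only the fourth moment is controlled; Young's inequality \<open>|s|\<^sup>2 \<le> |s|\<^sup>4 / (2 \<beta>) + \<beta> / 2\<close> with the
  predictable weight \<open>\<beta> = \<alpha> |x|\<^sup>2 + \<sigma>\<^sup>2 + 1\<close> replaces a conditional Jensen inequality.\<close>

lemma second_weighted:
  assumes g: "g \<in> borel_measurable F" "\<And>\<omega>. 0 \<le> g \<omega>" "\<And>\<omega>. g \<omega> \<le> 1"
  shows "(LINT \<omega>|M. g \<omega> * (norm (s \<omega>))\<^sup>2) \<le> (LINT \<omega>|M. g \<omega> * (\<alpha> * (norm (x \<omega>))\<^sup>2 + \<sigma>\<^sup>2 + 1))"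
proof -
  define \<beta> where "\<beta> \<omega> = \<alpha> * (norm (x \<omega>))\<^sup>2 + \<sigma>\<^sup>2 + 1" for \<omega>
  note [measurable] = F_meas[OF g(1)] g(1) x_meas
  \<comment> \<open>The summand 1 in \<beta> keeps it away from 0, so that g / (2 \<beta>) is again
    a bounded predictable weight. It is the origin of the + 1 in the second-moment bound.\<close>
  have \<beta>1: "1 \<le> \<beta> \<omega>" for \<omega> using nonneg by (simp add: \<beta>_def)
  have \<beta>m[measurable]: "\<beta> \<in> borel_measurable F" unfolding \<beta>_def by measurable
  note [measurable] = F_meas[OF \<beta>m]
  have g1: "norm (g \<omega>) \<le> 1" for \<omega> using g by simp
  have \<beta>i: "integrable M \<beta>" unfolding \<beta>_def using x_power[of 2] by simp
  have h: "0 \<le> g \<omega> / (2 * \<beta> \<omega>)" "g \<omega> / (2 * \<beta> \<omega>) \<le> 1" for \<omega>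
    using g(2,3)[of \<omega>] \<beta>1[of \<omega>] by (auto simp: divide_le_eq)
  have hn: "norm (g \<omega> / (2 * \<beta> \<omega>)) \<le> 1" for \<omega>
    using h[of \<omega>] by (simp only: real_norm_def abs_of_nonneg)
  have ih: "integrable M (\<lambda>\<omega>. g \<omega> / (2 * \<beta> \<omega>) * norm (s \<omega>) ^ 4)"
    by (intro bounded_mult_integrable[OF s_fourth _ hn]) measurable
  have ix: "integrable M (\<lambda>\<omega>. g \<omega> / (2 * \<beta> \<omega>) * (\<alpha>\<^sup>2 * norm (x \<omega>) ^ 4 + \<sigma> ^ 4))"
    by (intro bounded_mult_integrable[OF _ _ hn]) (use x_fourth in auto)
  have ig: "integrable M (\<lambda>\<omega>. g \<omega> * (\<beta> \<omega> / 2))"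
    by (intro bounded_mult_integrable[OF _ _ g1]) (use \<beta>i in auto)
  have "(LINT \<omega>|M. g \<omega> * (norm (s \<omega>))\<^sup>2)
      \<le> (LINT \<omega>|M. g \<omega> / (2 * \<beta> \<omega>) * norm (s \<omega>) ^ 4 + g \<omega> * (\<beta> \<omega> / 2))"
  proof (rule integral_mono)
    show "integrable M (\<lambda>\<omega>. g \<omega> * (norm (s \<omega>))\<^sup>2)"
      by (intro bounded_mult_integrable[OF s_power _ g1]) auto
    show "integrable M (\<lambda>\<omega>. g \<omega> / (2 * \<beta> \<omega>) * norm (s \<omega>) ^ 4 + g \<omega> * (\<beta> \<omega> / 2))"
      using ih ig by simp
    fix \<omega>
    have "(norm (s \<omega>))\<^sup>2 \<le> norm (s \<omega>) ^ 4 / (2 * \<beta> \<omega>) + \<beta> \<omega> / 2"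
    proof -
      have "0 \<le> ((norm (s \<omega>))\<^sup>2 - \<beta> \<omega>)\<^sup>2 / (2 * \<beta> \<omega>)" using \<beta>1[of \<omega>] by simp
      also have "\<dots> = norm (s \<omega>) ^ 4 / (2 * \<beta> \<omega>) + \<beta> \<omega> / 2 - (norm (s \<omega>))\<^sup>2"
        using \<beta>1[of \<omega>] by (simp add: field_simps power2_eq_square power4_eq_xxxx)
      finally show ?thesis by simp
    qed
    from mult_left_mono[OF this g(2)[of \<omega>]]
    show "g \<omega> * (norm (s \<omega>))\<^sup>2 \<le> g \<omega> / (2 * \<beta> \<omega>) * norm (s \<omega>) ^ 4 + g \<omega> * (\<beta> \<omega> / 2)"
      by (simp add: distrib_left)
  qed
  also have "\<dots> = (LINT \<omega>|M. g \<omega> / (2 * \<beta> \<omega>) * norm (s \<omega>) ^ 4) + (LINT \<omega>|M. g \<omega> * (\<beta> \<omega> / 2))"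
    by (rule Bochner_Integration.integral_add[OF ih ig])
  also have "(LINT \<omega>|M. g \<omega> / (2 * \<beta> \<omega>) * norm (s \<omega>) ^ 4)
      \<le> (LINT \<omega>|M. g \<omega> / (2 * \<beta> \<omega>) * (\<alpha>\<^sup>2 * norm (x \<omega>) ^ 4 + \<sigma> ^ 4))"
    by (rule fourth_weighted[OF _ h]) measurable
  \<comment> \<open>The conditional fourth moment is at most \<beta>^2, so this half of Young's
    inequality also contributes g \<beta> / 2.\<close>
  also have "\<dots> \<le> (LINT \<omega>|M. g \<omega> * (\<beta> \<omega> / 2))"
  proof (rule integral_mono[OF ix ig])
    fix \<omega>
    have "\<alpha>\<^sup>2 * norm (x \<omega>) ^ 4 + \<sigma> ^ 4 \<le> (\<alpha> * (norm (x \<omega>))\<^sup>2 + \<sigma>\<^sup>2)\<^sup>2"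
      using nonneg by (simp add: power2_sum power_mult_distrib flip: power_mult)
    also have "\<dots> \<le> (\<beta> \<omega>)\<^sup>2" using nonneg by (intro power_mono) (auto simp: \<beta>_def)
    finally have "g \<omega> / (2 * \<beta> \<omega>) * (\<alpha>\<^sup>2 * norm (x \<omega>) ^ 4 + \<sigma> ^ 4) \<le> g \<omega> / (2 * \<beta> \<omega>) * (\<beta> \<omega>)\<^sup>2"
      using h(1)[of \<omega>] by (intro mult_left_mono)
    also have "\<dots> = g \<omega> * (\<beta> \<omega> / 2)" using \<beta>1[of \<omega>] by (simp add: power2_eq_square)
    finally show "g \<omega> / (2 * \<beta> \<omega>) * (\<alpha>\<^sup>2 * norm (x \<omega>) ^ 4 + \<sigma> ^ 4) \<le> g \<omega> * (\<beta> \<omega> / 2)" .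
  qed
  also have "(LINT \<omega>|M. g \<omega> * (\<beta> \<omega> / 2)) + (LINT \<omega>|M. g \<omega> * (\<beta> \<omega> / 2)) = (LINT \<omega>|M. g \<omega> * \<beta> \<omega>)"
    by simp
  finally show ?thesis by (simp add: \<beta>_def)
qed

lemma s_second: "expectation (\<lambda>\<omega>. (norm (s \<omega>))\<^sup>2) \<le> \<alpha> * expectation (\<lambda>\<omega>. (norm (x \<omega>))\<^sup>2) + \<sigma>\<^sup>2 + 1"
  using second_weighted[of "\<lambda>_. 1"] x_power[of 2] by (simp add: prob_space)

text \<open>Orthogonality of the noise to every square-integrable vector known before it, obtained
  coordinatewise from the conditional mean. All cross terms below disappear through it.\<close>

lemma centered_inner:
  assumes G: "G \<in> borel_measurable F" and G2: "integrable M (\<lambda>\<omega>. (norm (G \<omega>))\<^sup>2)"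
  shows "integrable M (\<lambda>\<omega>. G \<omega> \<bullet> s \<omega>)" "expectation (\<lambda>\<omega>. G \<omega> \<bullet> s \<omega>) = 0"
proof -
  note [measurable] = F_meas[OF G] G
  have i: "integrable M (\<lambda>\<omega>. G \<omega> $ a * s \<omega> $ a)" for a
  proof (rule Bochner_Integration.integrable_bound)
    show "integrable M (\<lambda>\<omega>. (norm (G \<omega>))\<^sup>2 + (norm (s \<omega>))\<^sup>2)" using G2 s_power[of 2] by simp
    show "AE \<omega> in M. norm (G \<omega> $ a * s \<omega> $ a) \<le> norm ((norm (G \<omega>))\<^sup>2 + (norm (s \<omega>))\<^sup>2)"
    proof (rule AE_I2)
      fix \<omega>
      have "norm (G \<omega> $ a * s \<omega> $ a) \<le> norm (G \<omega>) * norm (s \<omega>)"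
        unfolding real_norm_def abs_mult by (intro mult_mono component_le_norm_cart) auto
      also have "\<dots> \<le> (norm (G \<omega>))\<^sup>2 + (norm (s \<omega>))\<^sup>2"
        using sum_squares_bound[of "norm (G \<omega>)" "norm (s \<omega>)"]
          mult_nonneg_nonneg[OF norm_ge_zero[of "G \<omega>"] norm_ge_zero[of "s \<omega>"]] by linarith
      finally show "norm (G \<omega> $ a * s \<omega> $ a) \<le> norm ((norm (G \<omega>))\<^sup>2 + (norm (s \<omega>))\<^sup>2)" by simp
    qed
  qed measurable
  show "integrable M (\<lambda>\<omega>. G \<omega> \<bullet> s \<omega>)"
    unfolding inner_vec_def inner_real_def by (intro Bochner_Integration.integrable_sum i)
  have "expectation (\<lambda>\<omega>. G \<omega> $ a * s \<omega> $ a) = 0" for a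
  proof -
    have "expectation (\<lambda>\<omega>. G \<omega> $ a * s \<omega> $ a) = expectation (\<lambda>\<omega>. G \<omega> $ a * real_cond_exp M F (\<lambda>\<omega>. s \<omega> $ a) \<omega>)"
      by (rule real_cond_exp_intg(2)[OF i, symmetric]) measurable
    also have "\<dots> = expectation (\<lambda>_. 0)"
      by (rule integral_cong_AE) (use centered[of a] in \<open>auto elim!: eventually_mono\<close>)
    finally show ?thesis by simp
  qed
  then show "expectation (\<lambda>\<omega>. G \<omega> \<bullet> s \<omega>) = 0"
    unfolding inner_vec_def inner_real_def by (simp add: i)
qed

text \<open>The entrywise sum of absolute values is chosen because the conditional covariance
  converges entry by entry and each entry is bounded by a constant, which is what dominated
  convergence asks for.\<close>

definition cov_gap :: "real^'d^'d \<Rightarrow> 'a \<Rightarrow> real" where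
  "cov_gap R \<omega> = (\<Sum>a\<in>UNIV. \<Sum>b\<in>UNIV. \<bar>cond_second_moment M F s\<^sub>o \<omega> $ a $ b - R $ a $ b\<bar>)"

text \<open>The real conditional expectation is the difference of those of the positive and negative
  parts. Each part is dominated by |s|^4 + 1, whose conditional expectation is controlled by the
  fourth-moment assumption at the minimiser.\<close>

lemma cond_so_bound:
  "AE \<omega> in M. \<bar>cond_second_moment M F s\<^sub>o \<omega> $ a $ b\<bar> \<le> \<sigma> ^ 4 + 1"
proof -
  have key: "AE \<omega> in M. nn_cond_exp M F (\<lambda>\<omega>. ennreal (f \<omega>)) \<omega> \<le> ennreal (\<sigma> ^ 4 + 1)"
    if [measurable]: "f \<in> borel_measurable M" and f: "\<And>\<omega>. f \<omega> \<le> norm (s\<^sub>o \<omega>) ^ 4 + 1" for f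
  proof -
    have "AE \<omega> in M. nn_cond_exp M F (\<lambda>\<omega>. ennreal (f \<omega>)) \<omega> \<le> nn_cond_exp M F (\<lambda>\<omega>. ennreal (norm (s\<^sub>o \<omega>) ^ 4) + 1) \<omega>"
      by (rule nn_cond_exp_mono) (use f in \<open>auto simp: ennreal_leI simp flip: ennreal_1 ennreal_plus\<close>)
    moreover have "AE \<omega> in M. nn_cond_exp M F (\<lambda>\<omega>. ennreal (norm (s\<^sub>o \<omega>) ^ 4) + 1) \<omega>
        = nn_cond_exp M F (\<lambda>\<omega>. ennreal (norm (s\<^sub>o \<omega>) ^ 4)) \<omega> + nn_cond_exp M F (\<lambda>\<omega>. 1) \<omega>"
      by (rule AE_symmetric[OF nn_cond_exp_sum]) auto
    moreover have "AE \<omega> in M. nn_cond_exp M F (\<lambda>\<omega>. 1) \<omega> = 1"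
      by (rule AE_symmetric[OF nn_cond_exp_F_meas]) auto
    ultimately show ?thesis using fourth_o
    proof eventually_elim
      case (elim \<omega>)
      then have "nn_cond_exp M F (\<lambda>\<omega>. ennreal (f \<omega>)) \<omega> \<le> ennreal (\<sigma> ^ 4) + 1"
        by (smt (verit) add_right_mono order_trans)
      also have "\<dots> = ennreal (\<sigma> ^ 4 + 1)" by (subst ennreal_plus) auto
      finally show ?case .
    qed
  qed
  have ab: "\<bar>s\<^sub>o \<omega> $ a * s\<^sub>o \<omega> $ b\<bar> \<le> norm (s\<^sub>o \<omega>) ^ 4 + 1" for \<omega>
  proof -
    have "\<bar>s\<^sub>o \<omega> $ a * s\<^sub>o \<omega> $ b\<bar> \<le> norm (s\<^sub>o \<omega>) * norm (s\<^sub>o \<omega>)"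
      unfolding abs_mult by (intro mult_mono component_le_norm_cart) auto
    also have "\<dots> \<le> norm (s\<^sub>o \<omega>) ^ 4 + 1"
      using power_le_one_plus_power4[of "norm (s\<^sub>o \<omega>)" 2] by (simp add: power2_eq_square)
    finally show ?thesis .
  qed
  have "AE \<omega> in M. nn_cond_exp M F (\<lambda>\<omega>. ennreal (s\<^sub>o \<omega> $ a * s\<^sub>o \<omega> $ b)) \<omega> \<le> ennreal (\<sigma> ^ 4 + 1)"
    by (rule key, measurable) (use ab in \<open>auto simp: abs_le_iff\<close>)
  moreover have "AE \<omega> in M. nn_cond_exp M F (\<lambda>\<omega>. ennreal (- (s\<^sub>o \<omega> $ a * s\<^sub>o \<omega> $ b))) \<omega> \<le> ennreal (\<sigma> ^ 4 + 1)"
    by (rule key, measurable) (use ab in \<open>auto simp: abs_le_iff\<close>)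
  ultimately show ?thesis
  proof eventually_elim
    case (elim \<omega>)
    have "enn2real y \<le> \<sigma> ^ 4 + 1" if "y \<le> ennreal (\<sigma> ^ 4 + 1)" for y
      by (rule enn2real_leI[OF _ that]) simp
    from this[OF elim(1)] this[OF elim(2)] show ?case
      using enn2real_nonneg[of "nn_cond_exp M F (\<lambda>x. ennreal (s\<^sub>o x $ a * s\<^sub>o x $ b)) \<omega>"]
        enn2real_nonneg[of "nn_cond_exp M F (\<lambda>x. ennreal (- (s\<^sub>o x $ a * s\<^sub>o x $ b))) \<omega>"]
      unfolding cond_second_moment_def real_cond_exp_def vec_lambda_beta abs_le_iff by linarith
  qed
qed

lemma cond_second_moment_meas [measurable]:
  "(\<lambda>\<omega>. cond_second_moment M F X \<omega> $ a $ b) \<in> borel_measurable F"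
  "(\<lambda>\<omega>. cond_second_moment M F X \<omega> $ a $ b) \<in> borel_measurable M"
  unfolding cond_second_moment_def by (simp_all add: F_meas)

lemma cov_gap_integrable: "integrable M (cov_gap R)"
  unfolding cov_gap_def[abs_def]
proof (intro Bochner_Integration.integrable_sum integrable_abs Bochner_Integration.integrable_diff)
  show "integrable M (\<lambda>\<omega>. cond_second_moment M F s\<^sub>o \<omega> $ a $ b)" for a b
    by (rule integrable_const_bound[where B = "\<sigma> ^ 4 + 1"]) (use cond_so_bound in auto)
qed simp

end

section \<open>Effect of one noise step on characteristic functions\<close>

context noise_step
begin

lemma s_prod_integrable: "integrable M (\<lambda>\<omega>. s \<omega> $ a * s \<omega> $ b)"
proof (rule Bochner_Integration.integrable_bound[OF s_power[of 2]])
  show "AE \<omega> in M. norm (s \<omega> $ a * s \<omega> $ b) \<le> norm ((norm (s \<omega>))\<^sup>2)"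
    by (auto simp: abs_mult power2_eq_square intro!: mult_mono component_le_norm_cart)
qed (simp, measurable)

text \<open>The form is expanded into entries, since conditional expectations are available for
  products of two coordinates only. In the application g is the cosine or sine of a predictable
  phase.\<close>

lemma quadratic_weighted:
  assumes g: "g \<in> borel_measurable F" and gb: "\<And>\<omega>. \<bar>g \<omega>\<bar> \<le> 1"
  shows "expectation (\<lambda>\<omega>. g \<omega> * (u \<bullet> s \<omega>)\<^sup>2)
      = expectation (\<lambda>\<omega>. g \<omega> * (u \<bullet> (cond_second_moment M F s \<omega> *v u)))"
    "integrable M (\<lambda>\<omega>. g \<omega> * (u \<bullet> (cond_second_moment M F s \<omega> *v u)))"
    "integrable M (\<lambda>\<omega>. g \<omega> * (u \<bullet> s \<omega>)\<^sup>2)"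
proof -
  note [measurable] = F_meas[OF g] g
  have i: "integrable M (\<lambda>\<omega>. (u $ a * u $ b * g \<omega>) * (s \<omega> $ a * s \<omega> $ b))" for a b
  proof (rule bounded_mult_integrable[OF s_prod_integrable])
    show "norm (u $ a * u $ b * g \<omega>) \<le> \<bar>u $ a * u $ b\<bar>" for \<omega>
      using mult_left_mono[OF gb, of "\<bar>u $ a * u $ b\<bar>" \<omega>] by (simp add: abs_mult)
  qed measurable
  have sq: "g \<omega> * (u \<bullet> s \<omega>)\<^sup>2 = (\<Sum>a\<in>UNIV. \<Sum>b\<in>UNIV. (u $ a * u $ b * g \<omega>) * (s \<omega> $ a * s \<omega> $ b))" for \<omega>
    unfolding inner_vec_def power2_eq_square sum_product by (simp add: sum_distrib_left algebra_simps)
  have cq: "g \<omega> * (u \<bullet> (C *v u)) = (\<Sum>a\<in>UNIV. \<Sum>b\<in>UNIV. (u $ a * u $ b * g \<omega>) * C $ a $ b)"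
    for \<omega> and C :: "real^'d^'d"
    unfolding inner_vec_def matrix_vector_mult_def by (simp add: sum_distrib_left algebra_simps)
  have cc: "cond_second_moment M F s \<omega> $ a $ b = real_cond_exp M F (\<lambda>\<omega>. s \<omega> $ a * s \<omega> $ b) \<omega>" for \<omega> a b
    by (simp add: cond_second_moment_def)
  have ci: "integrable M (\<lambda>\<omega>. (u $ a * u $ b * g \<omega>) * cond_second_moment M F s \<omega> $ a $ b)"
    "expectation (\<lambda>\<omega>. (u $ a * u $ b * g \<omega>) * cond_second_moment M F s \<omega> $ a $ b)
      = expectation (\<lambda>\<omega>. (u $ a * u $ b * g \<omega>) * (s \<omega> $ a * s \<omega> $ b))" for a b
    unfolding cc by (rule real_cond_exp_intg[OF i]; measurable)+
  show "expectation (\<lambda>\<omega>. g \<omega> * (u \<bullet> s \<omega>)\<^sup>2)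
      = expectation (\<lambda>\<omega>. g \<omega> * (u \<bullet> (cond_second_moment M F s \<omega> *v u)))"
    unfolding sq cq by (simp add: i ci)
  show "integrable M (\<lambda>\<omega>. g \<omega> * (u \<bullet> (cond_second_moment M F s \<omega> *v u)))"
    unfolding cq by (intro Bochner_Integration.integrable_sum ci)
  show "integrable M (\<lambda>\<omega>. g \<omega> * (u \<bullet> s \<omega>)\<^sup>2)"
    unfolding sq by (intro Bochner_Integration.integrable_sum i)
qed

definition entry_sum :: "real^'d^'d \<Rightarrow> real" where
  "entry_sum R = (\<Sum>a\<in>UNIV. \<Sum>b\<in>UNIV. \<bar>R $ a $ b\<bar>)"

text \<open>Chebyshev's argument: where |x| > \<eta>, both 1 and |x|^2 are at most |x|^2 / \<eta>^2,
  the latter because \<eta> \<le> 1.\<close>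

lemma small_region:
  assumes \<eta>: "0 < \<eta>" "\<eta> \<le> 1"
  shows "expectation (\<lambda>\<omega>. indicator {\<omega>. \<eta> < norm (x \<omega>)} \<omega> * (\<alpha> * (norm (x \<omega>))\<^sup>2 + \<sigma>\<^sup>2 + 1 + \<rho>))
      \<le> (\<alpha> + \<sigma>\<^sup>2 + 1 + \<bar>\<rho>\<bar>) / \<eta>\<^sup>2 * expectation (\<lambda>\<omega>. (norm (x \<omega>))\<^sup>2)"
proof -
  have "expectation (\<lambda>\<omega>. indicator {\<omega>. \<eta> < norm (x \<omega>)} \<omega> * (\<alpha> * (norm (x \<omega>))\<^sup>2 + \<sigma>\<^sup>2 + 1 + \<rho>))
      \<le> expectation (\<lambda>\<omega>. (\<alpha> + \<sigma>\<^sup>2 + 1 + \<bar>\<rho>\<bar>) / \<eta>\<^sup>2 * (norm (x \<omega>))\<^sup>2)"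
  proof (rule integral_mono_AE')
    show "integrable M (\<lambda>\<omega>. (\<alpha> + \<sigma>\<^sup>2 + 1 + \<bar>\<rho>\<bar>) / \<eta>\<^sup>2 * (norm (x \<omega>))\<^sup>2)" using x_power[of 2] by simp
    have "indicator {\<omega>. \<eta> < norm (x \<omega>)} \<omega> * (\<alpha> * (norm (x \<omega>))\<^sup>2 + \<sigma>\<^sup>2 + 1 + \<rho>)
        \<le> (\<alpha> + \<sigma>\<^sup>2 + 1 + \<bar>\<rho>\<bar>) / \<eta>\<^sup>2 * (norm (x \<omega>))\<^sup>2" for \<omega>
    proof (cases "\<eta> < norm (x \<omega>)")
      case True
      define q where "q = (norm (x \<omega>))\<^sup>2 / \<eta>\<^sup>2"
      have "\<eta>\<^sup>2 \<le> (norm (x \<omega>))\<^sup>2" using True \<eta> by (intro power_mono) auto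
      then have q1: "1 \<le> q" using \<eta> by (simp add: q_def)
      have "(norm (x \<omega>))\<^sup>2 \<le> q"
      proof -
        have "\<eta>\<^sup>2 * (norm (x \<omega>))\<^sup>2 \<le> 1 * (norm (x \<omega>))\<^sup>2"
          using \<eta> by (intro mult_right_mono power_le_one) auto
        then show ?thesis using \<eta> by (simp add: q_def field_simps)
      qed
      then have "\<alpha> * (norm (x \<omega>))\<^sup>2 \<le> \<alpha> * q" using nonneg by (intro mult_left_mono)
      moreover have "\<sigma>\<^sup>2 + 1 + \<rho> \<le> (\<sigma>\<^sup>2 + 1 + \<bar>\<rho>\<bar>) * q"
      proof -
        have "(\<sigma>\<^sup>2 + 1 + \<bar>\<rho>\<bar>) * 1 \<le> (\<sigma>\<^sup>2 + 1 + \<bar>\<rho>\<bar>) * q" by (intro mult_left_mono q1) simp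
        then show ?thesis by simp
      qed
      ultimately have "\<alpha> * (norm (x \<omega>))\<^sup>2 + \<sigma>\<^sup>2 + 1 + \<rho> \<le> (\<alpha> + \<sigma>\<^sup>2 + 1 + \<bar>\<rho>\<bar>) * q"
        by (simp add: algebra_simps)
      then show ?thesis using True by (simp add: q_def)
    qed (use nonneg in simp)
    then show "AE \<omega> in M. indicator {\<omega>. \<eta> < norm (x \<omega>)} \<omega> * (\<alpha> * (norm (x \<omega>))\<^sup>2 + \<sigma>\<^sup>2 + 1 + \<rho>)
        \<le> (\<alpha> + \<sigma>\<^sup>2 + 1 + \<bar>\<rho>\<bar>) / \<eta>\<^sup>2 * (norm (x \<omega>))\<^sup>2" by simp
    show "AE \<omega> in M. 0 \<le> (\<alpha> + \<sigma>\<^sup>2 + 1 + \<bar>\<rho>\<bar>) / \<eta>\<^sup>2 * (norm (x \<omega>))\<^sup>2" using nonneg by simp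
  qed
  then show ?thesis by simp
qed

text \<open>Where |x| \<le> \<eta>, the conditional covariance is compared with its value at the
  minimiser and that with R. Where |x| > \<eta>, nothing is compared: the conditional second moment
  and R are bounded separately and the region pays E |x|^2 / \<eta>^2. Integrating the Hoelder bound
  everywhere would require moments of x up to order \<gamma>.\<close>

lemma covariance_weighted:
  assumes g: "g \<in> borel_measurable F" and gb: "\<And>\<omega>. \<bar>g \<omega>\<bar> \<le> 1" and \<eta>: "0 < \<eta>" "\<eta> \<le> 1"
  shows "\<bar>expectation (\<lambda>\<omega>. g \<omega> * (u \<bullet> s \<omega>)\<^sup>2) - (u \<bullet> (R *v u)) * expectation g\<bar>
    \<le> (norm u)\<^sup>2 * (\<kappa> * \<eta> powr \<gamma> + expectation (cov_gap R)
        + (\<alpha> + \<sigma>\<^sup>2 + 1 + entry_sum R) / \<eta>\<^sup>2 * expectation (\<lambda>\<omega>. (norm (x \<omega>))\<^sup>2))"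
proof -
  note [measurable] = F_meas[OF g] g x_meas
  define g1 where "g1 \<omega> = g \<omega> * indicator {\<omega>. norm (x \<omega>) \<le> \<eta>} \<omega>" for \<omega>
  define g2 where "g2 \<omega> = g \<omega> * indicator {\<omega>. \<eta> < norm (x \<omega>)} \<omega>" for \<omega>
  have g12: "g \<omega> = g1 \<omega> + g2 \<omega>" for \<omega> by (simp add: g1_def g2_def indicator_def)
  have [measurable]: "g1 \<in> borel_measurable F" "g2 \<in> borel_measurable F"
    unfolding g1_def g2_def indicator_def by simp_all
  note [measurable] = F_meas[OF \<open>g1 \<in> borel_measurable F\<close>] F_meas[OF \<open>g2 \<in> borel_measurable F\<close>]
  have gb1: "\<bar>g1 \<omega>\<bar> \<le> 1" and gb2: "\<bar>g2 \<omega>\<bar> \<le> 1" for \<omega>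
    using gb[of \<omega>] by (auto simp: g1_def g2_def indicator_def)
  have gi: "integrable M g1" "integrable M g2"
    by (rule integrable_const_bound[where B = 1]; use gb1 gb2 in simp)+
  note q1 = quadratic_weighted[OF \<open>g1 \<in> borel_measurable F\<close> gb1]
  note q2 = quadratic_weighted[OF \<open>g2 \<in> borel_measurable F\<close> gb2]
  have gap0: "0 \<le> cov_gap R \<omega>" for \<omega> unfolding cov_gap_def by (intro sum_nonneg) auto
  have e1: "\<bar>expectation (\<lambda>\<omega>. g1 \<omega> * (u \<bullet> s \<omega>)\<^sup>2) - (u \<bullet> (R *v u)) * expectation g1\<bar>
      \<le> (norm u)\<^sup>2 * (\<kappa> * \<eta> powr \<gamma> + expectation (cov_gap R))"
  proof -
    let ?c = "\<lambda>\<omega>. cond_second_moment M F s \<omega>" and ?co = "\<lambda>\<omega>. cond_second_moment M F s\<^sub>o \<omega>"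
    have "expectation (\<lambda>\<omega>. g1 \<omega> * (u \<bullet> s \<omega>)\<^sup>2) - (u \<bullet> (R *v u)) * expectation g1
        = expectation (\<lambda>\<omega>. g1 \<omega> * (u \<bullet> (?c \<omega> *v u)) - (u \<bullet> (R *v u)) * g1 \<omega>)"
      unfolding q1(1) by (subst Bochner_Integration.integral_diff) (use q1 gi in auto)
    also have "\<bar>\<dots>\<bar> \<le> expectation (\<lambda>\<omega>. \<bar>g1 \<omega> * (u \<bullet> (?c \<omega> *v u)) - (u \<bullet> (R *v u)) * g1 \<omega>\<bar>)"
      by (rule integral_abs_bound)
    also have "\<dots> \<le> expectation (\<lambda>\<omega>. (norm u)\<^sup>2 * (\<kappa> * \<eta> powr \<gamma> + cov_gap R \<omega>))"
    proof (rule integral_mono_AE)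
      show "integrable M (\<lambda>\<omega>. \<bar>g1 \<omega> * (u \<bullet> (?c \<omega> *v u)) - (u \<bullet> (R *v u)) * g1 \<omega>\<bar>)"
        using q1 gi by simp
      show "integrable M (\<lambda>\<omega>. (norm u)\<^sup>2 * (\<kappa> * \<eta> powr \<gamma> + cov_gap R \<omega>))"
        using cov_gap_integrable by simp
      show "AE \<omega> in M. \<bar>g1 \<omega> * (u \<bullet> (?c \<omega> *v u)) - (u \<bullet> (R *v u)) * g1 \<omega>\<bar>
          \<le> (norm u)\<^sup>2 * (\<kappa> * \<eta> powr \<gamma> + cov_gap R \<omega>)"
        using cov_close
      proof eventually_elim
        case (elim \<omega>)
        show ?case
        proof (cases "norm (x \<omega>) \<le> \<eta>")
          case True
          have "\<bar>u \<bullet> ((?co \<omega> - ?c \<omega>) *v u)\<bar> \<le> norm u * norm ((?co \<omega> - ?c \<omega>) *v u)"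
            by (rule Cauchy_Schwarz_ineq2)
          also have "\<dots> \<le> norm u * (opnorm (?co \<omega> - ?c \<omega>) * norm u)"
            by (intro mult_left_mono norm_le_opnorm) simp
          also have "\<dots> = (norm u)\<^sup>2 * opnorm (?co \<omega> - ?c \<omega>)" by (simp add: power2_eq_square)
          also have "\<dots> \<le> (norm u)\<^sup>2 * (\<kappa> * \<eta> powr \<gamma>)"
          proof (rule mult_left_mono, rule order_trans[OF elim])
            show "\<kappa> * norm (x \<omega>) powr \<gamma> \<le> \<kappa> * \<eta> powr \<gamma>"
              using True nonneg by (intro mult_left_mono powr_mono2) auto
          qed auto
          finally have a: "\<bar>u \<bullet> ((?co \<omega> - ?c \<omega>) *v u)\<bar> \<le> (norm u)\<^sup>2 * (\<kappa> * \<eta> powr \<gamma>)" .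
          have b: "\<bar>u \<bullet> ((?co \<omega> - R) *v u)\<bar> \<le> (norm u)\<^sup>2 * cov_gap R \<omega>"
            using inner_matrix_entry_bound[of u "?co \<omega> - R"] by (simp add: cov_gap_def)
          have "\<bar>g1 \<omega> * (u \<bullet> (?c \<omega> *v u)) - (u \<bullet> (R *v u)) * g1 \<omega>\<bar>
              = \<bar>g1 \<omega>\<bar> * \<bar>u \<bullet> ((?co \<omega> - R) *v u) - u \<bullet> ((?co \<omega> - ?c \<omega>) *v u)\<bar>"
            unfolding abs_mult[symmetric]
            by (simp add: matrix_vector_mult_diff_rdistrib inner_diff_right algebra_simps)
          also have "\<dots> \<le> 1 * \<bar>u \<bullet> ((?co \<omega> - R) *v u) - u \<bullet> ((?co \<omega> - ?c \<omega>) *v u)\<bar>"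
            by (intro mult_right_mono gb1) simp
          finally show ?thesis using a b by (simp add: distrib_left)
        next
          case False
          then have "g1 \<omega> = 0" by (simp add: g1_def)
          then show ?thesis using gap0[of \<omega>] nonneg by simp
        qed
      qed
    qed
    also have "\<dots> = (norm u)\<^sup>2 * (\<kappa> * \<eta> powr \<gamma> + expectation (cov_gap R))"
      using cov_gap_integrable by (simp add: prob_space)
    finally show ?thesis .
  qed
  have es0: "0 \<le> entry_sum R" unfolding entry_sum_def by (intro sum_nonneg) auto
  have e2: "\<bar>expectation (\<lambda>\<omega>. g2 \<omega> * (u \<bullet> s \<omega>)\<^sup>2) - (u \<bullet> (R *v u)) * expectation g2\<bar>
      \<le> (norm u)\<^sup>2 * ((\<alpha> + \<sigma>\<^sup>2 + 1 + entry_sum R) / \<eta>\<^sup>2 * expectation (\<lambda>\<omega>. (norm (x \<omega>))\<^sup>2))"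
  proof -
    define h where "h \<omega> = (indicator {\<omega>. \<eta> < norm (x \<omega>)} \<omega> :: real)" for \<omega>
    have hF[measurable]: "h \<in> borel_measurable F" unfolding h_def indicator_def by simp
    note [measurable] = F_meas[OF hF]
    have h: "0 \<le> h \<omega>" "h \<omega> \<le> 1" "norm (h \<omega>) \<le> 1" for \<omega> by (auto simp: h_def indicator_def)
    have "expectation (\<lambda>\<omega>. g2 \<omega> * (u \<bullet> s \<omega>)\<^sup>2) - (u \<bullet> (R *v u)) * expectation g2
        = expectation (\<lambda>\<omega>. g2 \<omega> * (u \<bullet> s \<omega>)\<^sup>2 - (u \<bullet> (R *v u)) * g2 \<omega>)"
      by (subst Bochner_Integration.integral_diff) (use q2 gi in auto)
    also have "\<bar>\<dots>\<bar> \<le> expectation (\<lambda>\<omega>. \<bar>g2 \<omega> * (u \<bullet> s \<omega>)\<^sup>2 - (u \<bullet> (R *v u)) * g2 \<omega>\<bar>)"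
      by (rule integral_abs_bound)
    also have "\<dots> \<le> expectation (\<lambda>\<omega>. (norm u)\<^sup>2 * (h \<omega> * (norm (s \<omega>))\<^sup>2 + h \<omega> * entry_sum R))"
    proof (rule integral_mono)
      show "integrable M (\<lambda>\<omega>. \<bar>g2 \<omega> * (u \<bullet> s \<omega>)\<^sup>2 - (u \<bullet> (R *v u)) * g2 \<omega>\<bar>)"
        using q2 gi by simp
      show "integrable M (\<lambda>\<omega>. (norm u)\<^sup>2 * (h \<omega> * (norm (s \<omega>))\<^sup>2 + h \<omega> * entry_sum R))"
        by (intro integrable_mult_right Bochner_Integration.integrable_add bounded_mult_integrable[OF _ _ h(3)])
          (use s_power[of 2] in auto)
      fix \<omega>
      have "\<bar>u \<bullet> s \<omega>\<bar>\<^sup>2 \<le> (norm u * norm (s \<omega>))\<^sup>2"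
        by (intro power_mono Cauchy_Schwarz_ineq2) simp
      then have a: "\<bar>(u \<bullet> s \<omega>)\<^sup>2 - u \<bullet> (R *v u)\<bar> \<le> (norm u)\<^sup>2 * ((norm (s \<omega>))\<^sup>2 + entry_sum R)"
        using inner_matrix_entry_bound[of u R] mult_nonneg_nonneg[OF zero_le_power2[of "norm u"] zero_le_power2[of "norm (s \<omega>)"]]
          zero_le_power2[of "u \<bullet> s \<omega>"]
        unfolding entry_sum_def[symmetric] distrib_left power_mult_distrib abs_le_iff power2_abs by linarith
      have "\<bar>g2 \<omega> * (u \<bullet> s \<omega>)\<^sup>2 - (u \<bullet> (R *v u)) * g2 \<omega>\<bar> = \<bar>g \<omega>\<bar> * (h \<omega> * \<bar>(u \<bullet> s \<omega>)\<^sup>2 - u \<bullet> (R *v u)\<bar>)"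
        by (simp add: g2_def h_def indicator_def abs_mult[symmetric] algebra_simps)
      also have "\<dots> \<le> 1 * (h \<omega> * ((norm u)\<^sup>2 * ((norm (s \<omega>))\<^sup>2 + entry_sum R)))"
        by (intro mult_mono gb mult_left_mono a) (use h in auto)
      finally show "\<bar>g2 \<omega> * (u \<bullet> s \<omega>)\<^sup>2 - (u \<bullet> (R *v u)) * g2 \<omega>\<bar>
          \<le> (norm u)\<^sup>2 * (h \<omega> * (norm (s \<omega>))\<^sup>2 + h \<omega> * entry_sum R)"
        by (simp add: algebra_simps)
    qed
    also have "\<dots> = (norm u)\<^sup>2 * (expectation (\<lambda>\<omega>. h \<omega> * (norm (s \<omega>))\<^sup>2) + expectation (\<lambda>\<omega>. h \<omega> * entry_sum R))"
    proof -
      have "integrable M (\<lambda>\<omega>. h \<omega> * (norm (s \<omega>))\<^sup>2)" "integrable M (\<lambda>\<omega>. h \<omega> * entry_sum R)"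
        by (intro bounded_mult_integrable[OF _ _ h(3)]; use s_power[of 2] in simp)+
      then show ?thesis by simp
    qed
    also have "\<dots> \<le> (norm u)\<^sup>2 * (expectation (\<lambda>\<omega>. h \<omega> * (\<alpha> * (norm (x \<omega>))\<^sup>2 + \<sigma>\<^sup>2 + 1)) + expectation (\<lambda>\<omega>. h \<omega> * entry_sum R))"
      by (intro mult_left_mono add_right_mono second_weighted) (use h in auto)
    also have "expectation (\<lambda>\<omega>. h \<omega> * (\<alpha> * (norm (x \<omega>))\<^sup>2 + \<sigma>\<^sup>2 + 1)) + expectation (\<lambda>\<omega>. h \<omega> * entry_sum R)
        = expectation (\<lambda>\<omega>. h \<omega> * (\<alpha> * (norm (x \<omega>))\<^sup>2 + \<sigma>\<^sup>2 + 1 + entry_sum R))"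
    proof -
      have "integrable M (\<lambda>\<omega>. h \<omega> * (\<alpha> * (norm (x \<omega>))\<^sup>2 + \<sigma>\<^sup>2 + 1))" "integrable M (\<lambda>\<omega>. h \<omega> * entry_sum R)"
        by (intro bounded_mult_integrable[OF _ _ h(3)]; use x_power[of 2] in simp)+
      then show ?thesis by (subst Bochner_Integration.integral_add[symmetric]) (auto simp: distrib_left)
    qed
    also have "\<dots> \<le> (\<alpha> + \<sigma>\<^sup>2 + 1 + entry_sum R) / \<eta>\<^sup>2 * expectation (\<lambda>\<omega>. (norm (x \<omega>))\<^sup>2)"
      using small_region[OF \<eta>, of "entry_sum R"] es0 by (simp add: h_def)
    finally show ?thesis by (simp add: mult_left_mono)
  qed
  have "expectation (\<lambda>\<omega>. g \<omega> * (u \<bullet> s \<omega>)\<^sup>2) - (u \<bullet> (R *v u)) * expectation g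
      = (expectation (\<lambda>\<omega>. g1 \<omega> * (u \<bullet> s \<omega>)\<^sup>2) - (u \<bullet> (R *v u)) * expectation g1)
        + (expectation (\<lambda>\<omega>. g2 \<omega> * (u \<bullet> s \<omega>)\<^sup>2) - (u \<bullet> (R *v u)) * expectation g2)"
  proof -
    have "expectation (\<lambda>\<omega>. g \<omega> * (u \<bullet> s \<omega>)\<^sup>2)
        = expectation (\<lambda>\<omega>. g1 \<omega> * (u \<bullet> s \<omega>)\<^sup>2) + expectation (\<lambda>\<omega>. g2 \<omega> * (u \<bullet> s \<omega>)\<^sup>2)"
      by (subst Bochner_Integration.integral_add[symmetric]) (use q1 q2 in \<open>auto simp: g12 distrib_right\<close>)
    moreover have "expectation g = expectation g1 + expectation g2"
      by (subst Bochner_Integration.integral_add[symmetric]) (use gi in \<open>auto simp flip: g12\<close>)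
    ultimately show ?thesis by (simp add: algebra_simps)
  qed
  then show ?thesis using e1 e2 by (simp add: distrib_left)
qed

lemma iexp_taylor2: "cmod (iexp r - (1 + \<i> * r - r\<^sup>2 / 2)) \<le> \<bar>r\<bar> ^ 3 / 6"
  "cmod (iexp r - (1 + \<i> * r - r\<^sup>2 / 2)) \<le> r\<^sup>2"
proof -
  have e: "(\<Sum>k\<le>2. (\<i> * complex_of_real r) ^ k / fact k) = 1 + \<i> * r - r\<^sup>2 / 2"
    by (simp add: numeral_2_eq_2 power2_eq_square algebra_simps)
  show "cmod (iexp r - (1 + \<i> * r - r\<^sup>2 / 2)) \<le> \<bar>r\<bar> ^ 3 / 6"
    using iexp_approx1[of r 2] unfolding e by (simp add: eval_nat_numeral fact_numeral)
  show "cmod (iexp r - (1 + \<i> * r - r\<^sup>2 / 2)) \<le> r\<^sup>2"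
    using iexp_approx2[of r 2] unfolding e by (simp add: fact_numeral)
qed

text \<open>The cubic Taylor bound is used only where \<open>|x| \<le> \<eta>\<close>, since moments of \<open>x\<close> above the second are not
  controlled uniformly.\<close>

lemma char_noise:
  assumes \<theta>: "\<theta> \<in> borel_measurable F" and \<eta>: "0 < \<eta>" "\<eta> \<le> 1"
  shows "cmod ((CLINT \<omega>|M. iexp (\<theta> \<omega>) * iexp (u \<bullet> s \<omega>)) - (1 - (u \<bullet> (R *v u)) / 2) * (CLINT \<omega>|M. iexp (\<theta> \<omega>)))
    \<le> (norm u)\<^sup>2 * (\<kappa> * \<eta> powr \<gamma> + expectation (cov_gap R)
        + 2 * (\<alpha> + \<sigma>\<^sup>2 + 1 + entry_sum R) / \<eta>\<^sup>2 * expectation (\<lambda>\<omega>. (norm (x \<omega>))\<^sup>2))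
      + (norm u) ^ 3 * (\<alpha> + \<sigma>\<^sup>2 + 1 + \<alpha>\<^sup>2 + \<sigma> ^ 4)"
proof -
  note [measurable] = F_meas[OF \<theta>] \<theta> x_meas
  define e where "e r = iexp r - (1 + \<i> * r - r\<^sup>2 / 2)" for r
  define E2 where "E2 = expectation (\<lambda>\<omega>. (norm (x \<omega>))\<^sup>2)"
  define K where "K = \<alpha> + \<sigma>\<^sup>2 + 1 + \<alpha>\<^sup>2 + \<sigma> ^ 4"
  define err where "err = (norm u)\<^sup>2 * (\<kappa> * \<eta> powr \<gamma> + expectation (cov_gap R)
        + (\<alpha> + \<sigma>\<^sup>2 + 1 + entry_sum R) / \<eta>\<^sup>2 * E2)"
  have E20: "0 \<le> E2" unfolding E2_def by (intro integral_nonneg_AE) auto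
  have es0: "0 \<le> entry_sum R" unfolding entry_sum_def by (intro sum_nonneg) auto
  \<comment> \<open>The estimates for predictable weights are stated for real weights in [-1, 1], so
    the phase factor is split into cosine and sine.\<close>
  define cs sn where "cs \<omega> = cos (\<theta> \<omega>)" and "sn \<omega> = sin (\<theta> \<omega>)" for \<omega>
  have csF[measurable]: "cs \<in> borel_measurable F" "sn \<in> borel_measurable F" unfolding cs_def sn_def by measurable
  have csb: "\<bar>cs \<omega>\<bar> \<le> 1" "\<bar>sn \<omega>\<bar> \<le> 1" for \<omega> by (simp_all add: cs_def sn_def)
  have ie: "iexp (\<theta> \<omega>) = of_real (cs \<omega>) + \<i> * of_real (sn \<omega>)" for \<omega>
    by (simp add: complex_eq_iff Re_exp Im_exp cs_def sn_def)
  note csM[measurable] = F_meas[OF csF(1)] F_meas[OF csF(2)]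
  have csi: "integrable M cs" "integrable M sn"
    by (rule integrable_const_bound[where B = 1]; use csb in simp)+
  note qc = quadratic_weighted[OF csF(1) csb(1), of u] and qs = quadratic_weighted[OF csF(2) csb(2), of u]
  have lin: "integrable M (\<lambda>\<omega>. g \<omega> * (u \<bullet> s \<omega>))" "expectation (\<lambda>\<omega>. g \<omega> * (u \<bullet> s \<omega>)) = 0"
    if gF: "g \<in> borel_measurable F" and gb: "\<And>\<omega>. \<bar>g \<omega>\<bar> \<le> 1" for g
  proof -
    note [measurable] = gF F_meas[OF gF]
    have "integrable M (\<lambda>\<omega>. (norm (g \<omega> *\<^sub>R u))\<^sup>2)"
    proof (rule integrable_const_bound[where B = "(norm u)\<^sup>2"], rule AE_I2)
      show "norm ((norm (g \<omega> *\<^sub>R u))\<^sup>2) \<le> (norm u)\<^sup>2" for \<omega>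
        using mult_right_mono[OF gb, of "norm u" \<omega>] by (simp add: power_mono)
    qed measurable
    from centered_inner[OF _ this] gF
    show "integrable M (\<lambda>\<omega>. g \<omega> * (u \<bullet> s \<omega>))" "expectation (\<lambda>\<omega>. g \<omega> * (u \<bullet> s \<omega>)) = 0"
      by simp_all
  qed
  note lc = lin[OF csF(1) csb(1)] and ls = lin[OF csF(2) csb(2)]
  define z where "z g = complex_of_real (expectation g)" for g
  have main: "(CLINT \<omega>|M. iexp (\<theta> \<omega>) * (1 + \<i> * (u \<bullet> s \<omega>) - (u \<bullet> s \<omega>)\<^sup>2 / 2))
      = (z cs + \<i> * z sn) - (z (\<lambda>\<omega>. cs \<omega> * (u \<bullet> s \<omega>)\<^sup>2) + \<i> * z (\<lambda>\<omega>. sn \<omega> * (u \<bullet> s \<omega>)\<^sup>2)) / 2"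
    and main_int: "complex_integrable M (\<lambda>\<omega>. iexp (\<theta> \<omega>) * (1 + \<i> * (u \<bullet> s \<omega>) - (u \<bullet> s \<omega>)\<^sup>2 / 2))"
    and main0: "(CLINT \<omega>|M. iexp (\<theta> \<omega>)) = z cs + \<i> * z sn"
  proof -
    have eq: "iexp (\<theta> \<omega>) * (1 + \<i> * (u \<bullet> s \<omega>) - (u \<bullet> s \<omega>)\<^sup>2 / 2)
        = (of_real (cs \<omega>) + \<i> * of_real (sn \<omega>)) + (\<i> * of_real (cs \<omega> * (u \<bullet> s \<omega>)) - of_real (sn \<omega> * (u \<bullet> s \<omega>)))
          - (of_real (cs \<omega> * (u \<bullet> s \<omega>)\<^sup>2) + \<i> * of_real (sn \<omega> * (u \<bullet> s \<omega>)\<^sup>2)) / 2" for \<omega>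
      unfolding ie by (simp add: algebra_simps add_divide_distrib)
    show "complex_integrable M (\<lambda>\<omega>. iexp (\<theta> \<omega>) * (1 + \<i> * (u \<bullet> s \<omega>) - (u \<bullet> s \<omega>)\<^sup>2 / 2))"
      unfolding eq
      by (intro Bochner_Integration.integrable_add Bochner_Integration.integrable_diff integrable_divide
          integrable_mult_right integrable_of_real csi lc ls qc qs)
    show "(CLINT \<omega>|M. iexp (\<theta> \<omega>) * (1 + \<i> * (u \<bullet> s \<omega>) - (u \<bullet> s \<omega>)\<^sup>2 / 2))
      = (z cs + \<i> * z sn) - (z (\<lambda>\<omega>. cs \<omega> * (u \<bullet> s \<omega>)\<^sup>2) + \<i> * z (\<lambda>\<omega>. sn \<omega> * (u \<bullet> s \<omega>)\<^sup>2)) / 2"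
    proof -
      have i: "complex_integrable M (\<lambda>\<omega>. of_real (cs \<omega>) + \<i> * of_real (sn \<omega>))"
        "complex_integrable M (\<lambda>\<omega>. \<i> * of_real (cs \<omega> * (u \<bullet> s \<omega>)) - of_real (sn \<omega> * (u \<bullet> s \<omega>)))"
        "complex_integrable M (\<lambda>\<omega>. (of_real (cs \<omega> * (u \<bullet> s \<omega>)\<^sup>2) + \<i> * of_real (sn \<omega> * (u \<bullet> s \<omega>)\<^sup>2)) / 2)"
        by (intro Bochner_Integration.integrable_add Bochner_Integration.integrable_diff integrable_divide
            integrable_mult_right integrable_of_real csi lc ls qc qs)+
      have "(CLINT \<omega>|M. of_real (cs \<omega>) + \<i> * of_real (sn \<omega>)) = z cs + \<i> * z sn"
        unfolding z_def using csi by (subst Bochner_Integration.integral_add) (auto intro: integrable_of_real)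
      moreover have "(CLINT \<omega>|M. \<i> * of_real (cs \<omega> * (u \<bullet> s \<omega>)) - of_real (sn \<omega> * (u \<bullet> s \<omega>))) = 0"
        using lc ls
        by (subst Bochner_Integration.integral_diff)
          (auto simp del: of_real_mult intro!: integrable_of_real integrable_mult_right)
      moreover have "(CLINT \<omega>|M. (of_real (cs \<omega> * (u \<bullet> s \<omega>)\<^sup>2) + \<i> * of_real (sn \<omega> * (u \<bullet> s \<omega>)\<^sup>2)) / 2)
          = (z (\<lambda>\<omega>. cs \<omega> * (u \<bullet> s \<omega>)\<^sup>2) + \<i> * z (\<lambda>\<omega>. sn \<omega> * (u \<bullet> s \<omega>)\<^sup>2)) / 2"
        unfolding z_def integral_divide_zero using qc qs
        by (subst Bochner_Integration.integral_add)
          (auto simp del: of_real_mult of_real_power intro!: integrable_of_real integrable_mult_right)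
      ultimately show ?thesis
        unfolding eq using i by simp
    qed
    show "(CLINT \<omega>|M. iexp (\<theta> \<omega>)) = z cs + \<i> * z sn"
      unfolding ie z_def using csi by (subst Bochner_Integration.integral_add) (auto intro: integrable_of_real)
  qed
  have prodi: "complex_integrable M (\<lambda>\<omega>. iexp (\<theta> \<omega>) * iexp (u \<bullet> s \<omega>))"
    by (rule integrable_const_bound[where B = 1]) (auto simp: norm_mult)
  have remi: "complex_integrable M (\<lambda>\<omega>. iexp (\<theta> \<omega>) * e (u \<bullet> s \<omega>))"
    unfolding e_def right_diff_distrib[of "iexp _" "iexp _"]
    by (intro Bochner_Integration.integrable_diff prodi main_int)
  have split: "(CLINT \<omega>|M. iexp (\<theta> \<omega>) * iexp (u \<bullet> s \<omega>))
      = (CLINT \<omega>|M. iexp (\<theta> \<omega>) * (1 + \<i> * (u \<bullet> s \<omega>) - (u \<bullet> s \<omega>)\<^sup>2 / 2)) + (CLINT \<omega>|M. iexp (\<theta> \<omega>) * e (u \<bullet> s \<omega>))"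
    unfolding Bochner_Integration.integral_add[OF main_int remi, symmetric]
    by (simp add: e_def algebra_simps)
  have rem: "cmod (CLINT \<omega>|M. iexp (\<theta> \<omega>) * e (u \<bullet> s \<omega>)) \<le> (norm u) ^ 3 * K + (norm u)\<^sup>2 * ((\<alpha> + \<sigma>\<^sup>2 + 1) / \<eta>\<^sup>2 * E2)"
  proof -
    define h1 h2 where "h1 \<omega> = (indicator {\<omega>. norm (x \<omega>) \<le> \<eta>} \<omega> :: real)"
      and "h2 \<omega> = (indicator {\<omega>. \<eta> < norm (x \<omega>)} \<omega> :: real)" for \<omega>
    have hF[measurable]: "h1 \<in> borel_measurable F" "h2 \<in> borel_measurable F"
      unfolding h1_def h2_def indicator_def by simp_all
    note [measurable] = F_meas[OF hF(1)] F_meas[OF hF(2)]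
    have h: "0 \<le> h1 \<omega>" "h1 \<omega> \<le> 1" "0 \<le> h2 \<omega>" "h2 \<omega> \<le> 1" "norm (h1 \<omega>) \<le> 1" "norm (h2 \<omega>) \<le> 1" for \<omega>
      by (auto simp: h1_def h2_def indicator_def)
    have i1: "integrable M (\<lambda>\<omega>. h1 \<omega> * (norm (s \<omega>))\<^sup>2)" "integrable M (\<lambda>\<omega>. h1 \<omega> * norm (s \<omega>) ^ 4)"
      "integrable M (\<lambda>\<omega>. h2 \<omega> * (norm (s \<omega>))\<^sup>2)"
      by (rule bounded_mult_integrable[OF s_power _ h(5)] bounded_mult_integrable[OF s_power _ h(6)]; simp)+
    have "cmod (CLINT \<omega>|M. iexp (\<theta> \<omega>) * e (u \<bullet> s \<omega>)) \<le> expectation (\<lambda>\<omega>. cmod (iexp (\<theta> \<omega>) * e (u \<bullet> s \<omega>)))"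
      by (rule integral_norm_bound)
    also have "\<dots> \<le> expectation (\<lambda>\<omega>. (norm u) ^ 3 * (h1 \<omega> * (norm (s \<omega>))\<^sup>2 + h1 \<omega> * norm (s \<omega>) ^ 4)
        + (norm u)\<^sup>2 * (h2 \<omega> * (norm (s \<omega>))\<^sup>2))"
    proof (rule integral_mono)
      show "integrable M (\<lambda>\<omega>. cmod (iexp (\<theta> \<omega>) * e (u \<bullet> s \<omega>)))" using remi by (rule integrable_norm)
      show "integrable M (\<lambda>\<omega>. (norm u) ^ 3 * (h1 \<omega> * (norm (s \<omega>))\<^sup>2 + h1 \<omega> * norm (s \<omega>) ^ 4)
          + (norm u)\<^sup>2 * (h2 \<omega> * (norm (s \<omega>))\<^sup>2))" using i1 by simp
      fix \<omega>
      have cs: "\<bar>u \<bullet> s \<omega>\<bar> \<le> norm u * norm (s \<omega>)" by (rule Cauchy_Schwarz_ineq2)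
      show "cmod (iexp (\<theta> \<omega>) * e (u \<bullet> s \<omega>))
          \<le> (norm u) ^ 3 * (h1 \<omega> * (norm (s \<omega>))\<^sup>2 + h1 \<omega> * norm (s \<omega>) ^ 4) + (norm u)\<^sup>2 * (h2 \<omega> * (norm (s \<omega>))\<^sup>2)"
      proof (cases "norm (x \<omega>) \<le> \<eta>")
        case True
        have "cmod (e (u \<bullet> s \<omega>)) \<le> \<bar>u \<bullet> s \<omega>\<bar> ^ 3 / 6" unfolding e_def by (rule iexp_taylor2)
        also have "\<dots> \<le> \<bar>u \<bullet> s \<omega>\<bar> ^ 3" by simp
        also have "\<dots> \<le> (norm u * norm (s \<omega>)) ^ 3" by (intro power_mono cs) simp
        also have "\<dots> = (norm u) ^ 3 * norm (s \<omega>) ^ 3" by (rule power_mult_distrib)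
        \<comment> \<open>Weighted bounds are at hand for the second and fourth powers of the noise;
          the third power is squeezed between them.\<close>
        also have "norm (s \<omega>) ^ 3 \<le> (norm (s \<omega>))\<^sup>2 + norm (s \<omega>) ^ 4"
        proof -
          have "norm (s \<omega>) ^ 3 = (norm (s \<omega>))\<^sup>2 * norm (s \<omega>)" by (simp add: eval_nat_numeral)
          also have "\<dots> \<le> (norm (s \<omega>))\<^sup>2 * (1 + (norm (s \<omega>))\<^sup>2)"
          proof (rule mult_left_mono)
            show "norm (s \<omega>) \<le> 1 + (norm (s \<omega>))\<^sup>2"
              using sum_squares_bound[of 1 "norm (s \<omega>)"] norm_ge_zero[of "s \<omega>"]
              unfolding power_one mult_1_right by linarith
          qed simp
          also have "\<dots> = (norm (s \<omega>))\<^sup>2 + norm (s \<omega>) ^ 4"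
            by (simp add: distrib_left flip: power_add)
          finally show ?thesis .
        qed
        finally have "cmod (e (u \<bullet> s \<omega>)) \<le> (norm u) ^ 3 * ((norm (s \<omega>))\<^sup>2 + norm (s \<omega>) ^ 4)"
          by (simp add: mult_left_mono)
        then show ?thesis using True by (simp add: norm_mult h1_def h2_def)
      next
        case False
        have "cmod (e (u \<bullet> s \<omega>)) \<le> (u \<bullet> s \<omega>)\<^sup>2" unfolding e_def by (rule iexp_taylor2)
        also have "\<dots> = \<bar>u \<bullet> s \<omega>\<bar>\<^sup>2" by simp
        also have "\<dots> \<le> (norm u * norm (s \<omega>))\<^sup>2" by (intro power_mono cs) simp
        finally have "cmod (e (u \<bullet> s \<omega>)) \<le> (norm u)\<^sup>2 * (norm (s \<omega>))\<^sup>2" by (simp add: power_mult_distrib)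
        then show ?thesis using False by (simp add: norm_mult h1_def h2_def)
      qed
    qed
    also have "\<dots> = (norm u) ^ 3 * (expectation (\<lambda>\<omega>. h1 \<omega> * (norm (s \<omega>))\<^sup>2) + expectation (\<lambda>\<omega>. h1 \<omega> * norm (s \<omega>) ^ 4))
        + (norm u)\<^sup>2 * expectation (\<lambda>\<omega>. h2 \<omega> * (norm (s \<omega>))\<^sup>2)"
      using i1 by simp
    also have "\<dots> \<le> (norm u) ^ 3 * ((\<alpha> + \<sigma>\<^sup>2 + 1) + (\<alpha>\<^sup>2 + \<sigma> ^ 4)) + (norm u)\<^sup>2 * ((\<alpha> + \<sigma>\<^sup>2 + 1) / \<eta>\<^sup>2 * E2)"
    proof (intro add_mono mult_left_mono)
      have hx: "h1 \<omega> * norm (x \<omega>) ^ k \<le> 1" for \<omega> k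
        using \<eta> by (auto simp: h1_def indicator_def intro: power_le_one)
      have "expectation (\<lambda>\<omega>. h1 \<omega> * (norm (s \<omega>))\<^sup>2) \<le> expectation (\<lambda>\<omega>. h1 \<omega> * (\<alpha> * (norm (x \<omega>))\<^sup>2 + \<sigma>\<^sup>2 + 1))"
        by (rule second_weighted) (use h in auto)
      also have "\<dots> \<le> expectation (\<lambda>\<omega>. \<alpha> + \<sigma>\<^sup>2 + 1)"
      proof (rule integral_mono)
        show "integrable M (\<lambda>\<omega>. h1 \<omega> * (\<alpha> * (norm (x \<omega>))\<^sup>2 + \<sigma>\<^sup>2 + 1))"
          by (rule bounded_mult_integrable[OF _ _ h(5)]) (use x_power[of 2] in auto)
        fix \<omega>
        have "\<alpha> * (h1 \<omega> * (norm (x \<omega>))\<^sup>2) + (\<sigma>\<^sup>2 + 1) * h1 \<omega> \<le> \<alpha> * 1 + (\<sigma>\<^sup>2 + 1) * 1"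
          by (intro add_mono mult_left_mono hx h) (use nonneg in auto)
        then show "h1 \<omega> * (\<alpha> * (norm (x \<omega>))\<^sup>2 + \<sigma>\<^sup>2 + 1) \<le> \<alpha> + \<sigma>\<^sup>2 + 1" by (simp add: algebra_simps)
      qed simp
      finally show "expectation (\<lambda>\<omega>. h1 \<omega> * (norm (s \<omega>))\<^sup>2) \<le> \<alpha> + \<sigma>\<^sup>2 + 1" by (simp add: prob_space)
      have "expectation (\<lambda>\<omega>. h1 \<omega> * norm (s \<omega>) ^ 4) \<le> expectation (\<lambda>\<omega>. h1 \<omega> * (\<alpha>\<^sup>2 * norm (x \<omega>) ^ 4 + \<sigma> ^ 4))"
        by (rule fourth_weighted[where B = 1]) (use h in auto)
      also have "\<dots> \<le> expectation (\<lambda>\<omega>. \<alpha>\<^sup>2 + \<sigma> ^ 4)"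
      proof (rule integral_mono)
        show "integrable M (\<lambda>\<omega>. h1 \<omega> * (\<alpha>\<^sup>2 * norm (x \<omega>) ^ 4 + \<sigma> ^ 4))"
          by (rule bounded_mult_integrable[OF _ _ h(5)]) (use x_fourth in auto)
        fix \<omega>
        have "\<alpha>\<^sup>2 * (h1 \<omega> * norm (x \<omega>) ^ 4) + \<sigma> ^ 4 * h1 \<omega> \<le> \<alpha>\<^sup>2 * 1 + \<sigma> ^ 4 * 1"
          by (intro add_mono mult_left_mono hx h) (use nonneg in auto)
        then show "h1 \<omega> * (\<alpha>\<^sup>2 * norm (x \<omega>) ^ 4 + \<sigma> ^ 4) \<le> \<alpha>\<^sup>2 + \<sigma> ^ 4" by (simp add: algebra_simps)
      qed simp
      finally show "expectation (\<lambda>\<omega>. h1 \<omega> * norm (s \<omega>) ^ 4) \<le> \<alpha>\<^sup>2 + \<sigma> ^ 4" by (simp add: prob_space)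
      have "expectation (\<lambda>\<omega>. h2 \<omega> * (norm (s \<omega>))\<^sup>2) \<le> expectation (\<lambda>\<omega>. h2 \<omega> * (\<alpha> * (norm (x \<omega>))\<^sup>2 + \<sigma>\<^sup>2 + 1))"
        by (rule second_weighted) (use h in auto)
      also have "\<dots> \<le> (\<alpha> + \<sigma>\<^sup>2 + 1) / \<eta>\<^sup>2 * E2"
        using small_region[OF \<eta>, of 0] by (simp add: h2_def E2_def)
      finally show "expectation (\<lambda>\<omega>. h2 \<omega> * (norm (s \<omega>))\<^sup>2) \<le> (\<alpha> + \<sigma>\<^sup>2 + 1) / \<eta>\<^sup>2 * E2" .
    qed auto
    finally show ?thesis by (simp add: K_def add.assoc)
  qed
  define q where "q = u \<bullet> (R *v u)"
  have cov: "cmod (z (\<lambda>\<omega>. g \<omega> * (u \<bullet> s \<omega>)\<^sup>2) - q * z g) \<le> err"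
    if "g \<in> borel_measurable F" "\<And>\<omega>. \<bar>g \<omega>\<bar> \<le> 1" for g
  proof -
    have "z (\<lambda>\<omega>. g \<omega> * (u \<bullet> s \<omega>)\<^sup>2) - q * z g
        = of_real (expectation (\<lambda>\<omega>. g \<omega> * (u \<bullet> s \<omega>)\<^sup>2) - q * expectation g)" by (simp add: z_def)
    then show ?thesis
      using covariance_weighted[OF that \<eta>, of u R] unfolding err_def E2_def q_def by (simp only: norm_of_real)
  qed
  have "(CLINT \<omega>|M. iexp (\<theta> \<omega>) * iexp (u \<bullet> s \<omega>)) - (1 - q / 2) * (CLINT \<omega>|M. iexp (\<theta> \<omega>))
      = (CLINT \<omega>|M. iexp (\<theta> \<omega>) * e (u \<bullet> s \<omega>))
        - ((z (\<lambda>\<omega>. cs \<omega> * (u \<bullet> s \<omega>)\<^sup>2) - q * z cs) + \<i> * (z (\<lambda>\<omega>. sn \<omega> * (u \<bullet> s \<omega>)\<^sup>2) - q * z sn)) / 2"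
    unfolding split main main0 by (simp add: field_simps)
  also have "cmod \<dots> \<le> cmod (CLINT \<omega>|M. iexp (\<theta> \<omega>) * e (u \<bullet> s \<omega>))
      + (cmod (z (\<lambda>\<omega>. cs \<omega> * (u \<bullet> s \<omega>)\<^sup>2) - q * z cs) + cmod (z (\<lambda>\<omega>. sn \<omega> * (u \<bullet> s \<omega>)\<^sup>2) - q * z sn)) / 2"
    by (rule order_trans[OF norm_triangle_ineq4])
      (simp add: norm_divide, rule order_trans[OF norm_triangle_ineq], simp add: norm_mult)
  also have "\<dots> \<le> (norm u) ^ 3 * K + (norm u)\<^sup>2 * ((\<alpha> + \<sigma>\<^sup>2 + 1) / \<eta>\<^sup>2 * E2) + (err + err) / 2"
    by (intro add_mono rem divide_right_mono cov csF csb) simp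
  also have "\<dots> \<le> (norm u)\<^sup>2 * (\<kappa> * \<eta> powr \<gamma> + expectation (cov_gap R)
        + 2 * (\<alpha> + \<sigma>\<^sup>2 + 1 + entry_sum R) / \<eta>\<^sup>2 * E2) + (norm u) ^ 3 * K"
  proof -
    have "(\<alpha> + \<sigma>\<^sup>2 + 1) / \<eta>\<^sup>2 * E2 \<le> (\<alpha> + \<sigma>\<^sup>2 + 1 + entry_sum R) / \<eta>\<^sup>2 * E2"
      using es0 E20 by (intro mult_right_mono divide_right_mono) auto
    then have m: "(norm u)\<^sup>2 * ((\<alpha> + \<sigma>\<^sup>2 + 1) / \<eta>\<^sup>2 * E2) \<le> (norm u)\<^sup>2 * ((\<alpha> + \<sigma>\<^sup>2 + 1 + entry_sum R) / \<eta>\<^sup>2 * E2)"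
      by (rule mult_left_mono) simp
    \<comment> \<open>The factor 2 in the claim: the region |x| > \<eta> is paid for once in the
      Taylor remainder and once in the comparison of covariances.\<close>
    have eq2: "2 * (\<alpha> + \<sigma>\<^sup>2 + 1 + entry_sum R) / \<eta>\<^sup>2 * E2
        = (\<alpha> + \<sigma>\<^sup>2 + 1 + entry_sum R) / \<eta>\<^sup>2 * E2 + (\<alpha> + \<sigma>\<^sup>2 + 1 + entry_sum R) / \<eta>\<^sup>2 * E2"
      by simp
    have gen: "c + a + (p + b + (p + b)) / 2 \<le> p + (b + b) + c" if "a \<le> b" for a b c p :: real
      using that by (simp add: field_simps)
    show ?thesis
      unfolding err_def eq2 distrib_left[of "(norm u)\<^sup>2"] by (rule gen[OF m])
  qed
  finally show ?thesis unfolding q_def K_def E2_def by simp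
qed

end

text \<open>Dominated convergence upgrades the almost sure limit of the covariances to a limit in
  mean; the constant dominating function comes from \<open>cond_so_bound\<close>.\<close>

lemma cov_gap_tendsto_0:
  assumes ns: "\<And>i. noise_step M (F i) (s i) (s\<^sub>o i) (x i) \<alpha> \<sigma> \<kappa> \<gamma>"
    and lim: "AE \<omega> in M. (\<lambda>i. cond_second_moment M (F i) (s\<^sub>o i) \<omega>) \<longlonglongrightarrow> R"
  shows "(\<lambda>i. LINT \<omega>|M. noise_step.cov_gap M (F i) (s\<^sub>o i) R \<omega>) \<longlonglongrightarrow> 0"
proof -
  interpret prob_space M using ns noise_step.axioms(1) by blast
  define B where "B = (\<Sum>a\<in>UNIV. \<Sum>b\<in>UNIV. \<sigma> ^ 4 + 1 + \<bar>R $ a $ b\<bar>)"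
  have "(\<lambda>i. LINT \<omega>|M. noise_step.cov_gap M (F i) (s\<^sub>o i) R \<omega>) \<longlonglongrightarrow> (LINT \<omega>|M. 0)"
  proof (rule integral_dominated_convergence[where w = "\<lambda>_. B"])
    show "noise_step.cov_gap M (F i) (s\<^sub>o i) R \<in> borel_measurable M" for i
      using noise_step.cov_gap_integrable[OF ns] by (rule borel_measurable_integrable)
    show "AE \<omega> in M. (\<lambda>i. noise_step.cov_gap M (F i) (s\<^sub>o i) R \<omega>) \<longlonglongrightarrow> 0"
      using lim
    proof eventually_elim
      case (elim \<omega>)
      have "(\<lambda>i. noise_step.cov_gap M (F i) (s\<^sub>o i) R \<omega>) \<longlonglongrightarrow> (\<Sum>a\<in>UNIV. \<Sum>b\<in>UNIV. \<bar>R $ a $ b - R $ a $ b\<bar>)"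
        unfolding noise_step.cov_gap_def[OF ns] by (intro tendsto_intros elim)
      then show ?case by simp
    qed
    show "AE \<omega> in M. norm (noise_step.cov_gap M (F i) (s\<^sub>o i) R \<omega>) \<le> B" for i
    proof -
      have "AE \<omega> in M. \<forall>a\<in>UNIV. \<forall>b\<in>UNIV. \<bar>cond_second_moment M (F i) (s\<^sub>o i) \<omega> $ a $ b\<bar> \<le> \<sigma> ^ 4 + 1"
        by (intro AE_ball_countable'[OF _ countable_finite] noise_step.cond_so_bound[OF ns]) auto
      then show ?thesis
      proof eventually_elim
        case (elim \<omega>)
        have "noise_step.cov_gap M (F i) (s\<^sub>o i) R \<omega> \<le> B"
          unfolding noise_step.cov_gap_def[OF ns] B_def
        proof (intro sum_mono)
          fix a b
          show "\<bar>cond_second_moment M (F i) (s\<^sub>o i) \<omega> $ a $ b - R $ a $ b\<bar> \<le> \<sigma> ^ 4 + 1 + \<bar>R $ a $ b\<bar>"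
            using elim abs_triangle_ineq4[of "cond_second_moment M (F i) (s\<^sub>o i) \<omega> $ a $ b" "R $ a $ b"]
            by (meson UNIV_I add_right_mono order_trans)
        qed
        moreover have "0 \<le> noise_step.cov_gap M (F i) (s\<^sub>o i) R \<omega>"
          unfolding noise_step.cov_gap_def[OF ns] by (intro sum_nonneg) auto
        ultimately show ?case by simp
      qed
    qed
  qed simp_all
  then show ?thesis by simp
qed

section \<open>Mixing within groups\<close>

lemma sum_UNIV_prod: "(\<Sum>a\<in>UNIV. f (fst a) (snd a)) = (\<Sum>k\<in>UNIV. \<Sum>j\<in>UNIV. f k j)"
  for f :: "'a::finite \<Rightarrow> 'b::finite \<Rightarrow> 'c::comm_monoid_add"
  by (simp add: sum.cartesian_product case_prod_beta')

lemma norm_col_sq: "(norm (col f))\<^sup>2 = (\<Sum>k\<in>UNIV. (norm (f k))\<^sup>2)"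
  for f :: "'n::finite \<Rightarrow> real^'m::finite"
proof -
  have "(norm (col f))\<^sup>2 = (\<Sum>a\<in>UNIV. (f (fst a) $ snd a) * (f (fst a) $ snd a))"
    unfolding power2_norm_eq_inner inner_vec_def col_def by simp
  also have "\<dots> = (\<Sum>k\<in>UNIV. \<Sum>j\<in>UNIV. f k $ j * f k $ j)"
    by (rule sum_UNIV_prod)
  finally show ?thesis unfolding power2_norm_eq_inner inner_vec_def by simp
qed

lemma norm_sq_blk: "(norm x)\<^sup>2 = (\<Sum>k\<in>UNIV. (norm (blk x k))\<^sup>2)"
  for x :: "real^('n::finite \<times> 'm::finite)"
  using norm_col_sq[of "blk x"] by simp

lemma norm_blk_le: "norm (blk x k) \<le> norm x"
  for x :: "real^('n::finite \<times> 'm::finite)"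
proof -
  have "(norm (blk x k))\<^sup>2 \<le> (norm x)\<^sup>2"
    unfolding norm_sq_blk by (rule member_le_sum) auto
  then show ?thesis by (rule power2_le_imp_le) simp
qed

lemma inner_col: "col f \<bullet> y = (\<Sum>k\<in>UNIV. f k \<bullet> blk y k)"
  for f :: "'n::finite \<Rightarrow> real^'m::finite"
proof -
  have "col f \<bullet> y = (\<Sum>a\<in>UNIV. (f (fst a) $ snd a) * y $ a)"
    unfolding inner_vec_def col_def by simp
  also have "\<dots> = (\<Sum>k\<in>UNIV. \<Sum>j\<in>UNIV. f k $ j * y $ (k, j))"
    using sum_UNIV_prod[of "\<lambda>k j. f k $ j * y $ (k, j)"] by simp
  finally show ?thesis unfolding inner_vec_def by (simp add: blk_def)
qed

lemma blk_add [simp]: "blk (x + y) k = blk x k + blk y k"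
  and blk_diff [simp]: "blk (x - y) k = blk x k - blk y k"
  and blk_scaleR [simp]: "blk (c *\<^sub>R x) k = c *\<^sub>R blk x k"
  and blk_zero [simp]: "blk 0 k = 0"
  and blk_spread [simp]: "blk (spread grp z) l = blk z (grp l)"
  by (simp_all add: blk_def spread_def col_def vec_eq_iff)

lemma blk_eqI: "(\<And>k. blk x k = blk y k) \<Longrightarrow> x = y"
  by (simp add: blk_def vec_eq_iff)

lemma spread_zero [simp]: "spread grp 0 = 0"
  by (rule blk_eqI) simp

locale group_mixing =
  fixes Nb :: "'n::finite \<Rightarrow> 'n set" and grp :: "'n \<Rightarrow> 'g::finite"
    and A :: "real^'n^'n" and p :: "'n \<Rightarrow> real"
  assumes self: "k \<in> Nb k"
    and connected: "connected_in (grp -` {m}) (links Nb)"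
    and comb: "combination_matrix Nb grp A" and perron: "perron_vectors grp A p"
begin

lemma A_pos: "l \<in> Nb k \<Longrightarrow> grp l = grp k \<Longrightarrow> 0 < A $ l $ k"
  and A_zero: "\<not> (l \<in> Nb k \<and> grp l = grp k) \<Longrightarrow> A $ l $ k = 0"
  and A_sum: "(\<Sum>l\<in>UNIV. A $ l $ k) = 1"
  using comb unfolding combination_matrix_def by (metis, metis, metis)

lemma A_nonneg: "0 \<le> A $ l $ k"
  using A_pos[of l k] A_zero[of l k] by fastforce

lemma p_pos: "0 < p k" and p_group: "(\<Sum>k\<in>grp -` {m}. p k) = 1"
  using perron by (auto simp: perron_vectors_def)

lemma A_p: "(\<Sum>k\<in>UNIV. A $ l $ k * p k) = p l"
proof -
  have "(\<Sum>k\<in>UNIV. A $ l $ k * p k) = (\<Sum>k\<in>grp -` {grp l}. A $ l $ k * p k)"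
    by (rule sum.mono_neutral_right) (auto intro!: A_zero)
  also have "\<dots> = p l" using perron by (auto simp: perron_vectors_def)
  finally show ?thesis .
qed

lemma p_le_1: "p k \<le> 1"
  unfolding p_group[of "grp k", symmetric] by (rule member_le_sum) (auto intro: less_imp_le p_pos)

definition mix :: "real^('n \<times> 'm::finite) \<Rightarrow> real^('n \<times> 'm)" where
  "mix x = col (\<lambda>k. \<Sum>l\<in>UNIV. A $ l $ k *\<^sub>R blk x l)"

text \<open>The action of the transpose of \<open>Pmat grp p\<close>, as \<open>cent_inner\<close>
  shows.\<close>

definition cent :: "real^('n \<times> 'm::finite) \<Rightarrow> real^('g \<times> 'm)" where
  "cent x = col (\<lambda>m. \<Sum>k\<in>grp -` {m}. p k *\<^sub>R blk x k)"

definition dev :: "real^('n \<times> 'm::finite) \<Rightarrow> real^('n \<times> 'm)" where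
  "dev x = x - spread grp (cent x)"

text \<open>It presents the weighted form V as the squared norm of a linear image, so that the
  general facts on squared norms of linear maps apply to V.\<close>

definition rootp :: "real^('n \<times> 'm::finite) \<Rightarrow> real^('n \<times> 'm)" where
  "rootp x = col (\<lambda>k. sqrt (p k) *\<^sub>R blk x k)"

definition V :: "real^('n \<times> 'm::finite) \<Rightarrow> real" where
  "V x = (norm (rootp x))\<^sup>2"

text \<open>The variance of the blocks averaged by agent k, summed with weight p k: the gap in
  Jensen's inequality for the squared norm.\<close>

definition defect :: "real^('n \<times> 'm::finite) \<Rightarrow> real" where
  "defect x = (\<Sum>k\<in>UNIV. p k * (\<Sum>l\<in>UNIV. A $ l $ k * (norm (blk x l - blk (mix x) k))\<^sup>2))"

lemma blk_mix: "blk (mix x) k = (\<Sum>l\<in>UNIV. A $ l $ k *\<^sub>R blk x l)"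
  and blk_cent: "blk (cent x) m = (\<Sum>k\<in>grp -` {m}. p k *\<^sub>R blk x k)"
  and blk_dev: "blk (dev x) k = blk x k - blk (cent x) (grp k)"
  and blk_rootp: "blk (rootp x) k = sqrt (p k) *\<^sub>R blk x k"
  by (simp_all add: mix_def cent_def dev_def rootp_def)

lemma linear_mix: "linear mix"
  by (rule linearI; rule blk_eqI) (simp_all add: blk_mix sum.distrib scaleR_add_right scaleR_sum_right mult.commute)

lemma linear_cent: "linear cent"
  by (rule linearI; rule blk_eqI) (simp_all add: blk_cent sum.distrib scaleR_add_right scaleR_sum_right mult.commute)

lemma linear_dev: "linear dev"
  by (rule linearI; rule blk_eqI)
    (simp_all add: blk_dev linear_add[OF linear_cent] linear_scale[OF linear_cent] scaleR_diff_right)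

lemma linear_rootp: "linear rootp"
  by (rule linearI; rule blk_eqI) (simp_all add: blk_rootp scaleR_add_right mult.commute)

lemma V_sum: "V x = (\<Sum>k\<in>UNIV. p k * (norm (blk x k))\<^sup>2)"
  unfolding V_def norm_sq_blk blk_rootp using p_pos by (simp add: power_mult_distrib less_imp_le)

lemma V_nonneg: "0 \<le> V x" by (simp add: V_def)

lemma V_le: "V x \<le> (norm x)\<^sup>2"
  unfolding V_sum norm_sq_blk
  by (intro sum_mono) (simp add: mult_left_le_one_le p_le_1 less_imp_le[OF p_pos])

lemma V_ge: obtains c where "0 < c" "\<And>x. c * (norm x)\<^sup>2 \<le> V (x :: real^('n \<times> 'm::finite))"
proof
  show "0 < Min (range p)" using p_pos by (subst Min_gr_iff) auto
  show "Min (range p) * (norm x)\<^sup>2 \<le> V x" for x :: "real^('n \<times> 'm)"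
    unfolding V_sum norm_sq_blk sum_distrib_left
    by (intro sum_mono mult_right_mono Min_le) auto
qed

text \<open>Averaging is the transpose of A acting on blocks, and p is fixed by A; hence p-weighted
  group means are invariant.\<close>

lemma cent_mix: "cent (mix x) = cent x"
proof (rule blk_eqI)
  fix m
  have "blk (cent (mix x)) m = (\<Sum>k\<in>grp -` {m}. \<Sum>l\<in>UNIV. (A $ l $ k * p k) *\<^sub>R blk x l)"
    by (simp add: blk_cent blk_mix scaleR_sum_right mult.commute)
  also have "\<dots> = (\<Sum>l\<in>UNIV. \<Sum>k\<in>grp -` {m}. (A $ l $ k * p k) *\<^sub>R blk x l)" by (rule sum.swap)
  also have "\<dots> = (\<Sum>l\<in>UNIV. (if l \<in> grp -` {m} then p l else 0) *\<^sub>R blk x l)"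
  proof (rule sum.cong[OF refl])
    fix l
    have "(\<Sum>k\<in>grp -` {m}. A $ l $ k * p k) = (if l \<in> grp -` {m} then p l else 0)"
    proof (cases "l \<in> grp -` {m}")
      case True
      then show ?thesis using perron by (auto simp: perron_vectors_def)
    next
      case False
      then have "(\<Sum>k\<in>grp -` {m}. A $ l $ k * p k) = 0"
        by (intro sum.neutral ballI) (auto intro!: A_zero)
      then show ?thesis using False by simp
    qed
    then show "(\<Sum>k\<in>grp -` {m}. (A $ l $ k * p k) *\<^sub>R blk x l) = (if l \<in> grp -` {m} then p l else 0) *\<^sub>R blk x l"
      by (simp add: scaleR_sum_left[symmetric])
  qed
  also have "\<dots> = (\<Sum>l\<in>grp -` {m}. p l *\<^sub>R blk x l)"
    by (rule sum.mono_neutral_cong_right) auto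
  finally show "blk (cent (mix x)) m = blk (cent x) m" by (simp add: blk_cent)
qed

lemma mix_spread: "mix (spread grp z) = spread grp z"
proof (rule blk_eqI)
  fix k
  have "blk (mix (spread grp z)) k = (\<Sum>l\<in>UNIV. A $ l $ k *\<^sub>R blk z (grp k))"
    unfolding blk_mix blk_spread by (intro sum.cong refl) (metis A_zero scaleR_zero_left)
  then show "blk (mix (spread grp z)) k = blk (spread grp z) k"
    by (simp add: scaleR_sum_left[symmetric] A_sum)
qed

lemma cent_spread: "cent (spread grp z) = z"
  by (rule blk_eqI) (simp add: blk_cent scaleR_sum_left[symmetric] p_group)

lemma dev_mix: "dev (mix x) = mix (dev x)"
  by (simp add: dev_def cent_mix linear_diff[OF linear_mix] mix_spread)

lemma cent_dev: "cent (dev x) = 0"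
  by (simp add: dev_def linear_diff[OF linear_cent] cent_spread)

text \<open>For each agent, the mean of squares is the square of the mean plus the variance. Summing
  with weights p, the means of squares add up to V x again because A fixes p.\<close>

lemma V_mix: "V (mix x) = V x - defect x"
proof -
  have jensen: "(\<Sum>l\<in>UNIV. A $ l $ k * (norm (blk x l - blk (mix x) k))\<^sup>2)
      = (\<Sum>l\<in>UNIV. A $ l $ k * (norm (blk x l))\<^sup>2) - (norm (blk (mix x) k))\<^sup>2" for k
  proof -
    have "(\<Sum>l\<in>UNIV. A $ l $ k * (norm (blk x l - blk (mix x) k))\<^sup>2)
        = (\<Sum>l\<in>UNIV. A $ l $ k * (norm (blk x l))\<^sup>2 - 2 * ((A $ l $ k *\<^sub>R blk x l) \<bullet> blk (mix x) k)
            + A $ l $ k * (norm (blk (mix x) k))\<^sup>2)"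
      by (intro sum.cong refl)
        (simp add: power2_norm_eq_inner inner_diff_left inner_diff_right inner_commute algebra_simps)
    also have "\<dots> = (\<Sum>l\<in>UNIV. A $ l $ k * (norm (blk x l))\<^sup>2) - 2 * (blk (mix x) k \<bullet> blk (mix x) k)
          + (norm (blk (mix x) k))\<^sup>2"
      unfolding sum.distrib sum_subtractf sum_distrib_left[symmetric] sum_distrib_right[symmetric]
        inner_sum_left[symmetric] A_sum by (simp add: blk_mix)
    finally show ?thesis by (simp add: power2_norm_eq_inner)
  qed
  have "defect x = (\<Sum>k\<in>UNIV. \<Sum>l\<in>UNIV. A $ l $ k * p k * (norm (blk x l))\<^sup>2) - V (mix x)"
    unfolding defect_def jensen V_sum
    by (simp add: right_diff_distrib sum_subtractf sum_distrib_left mult.assoc mult.left_commute)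
  also have "(\<Sum>k\<in>UNIV. \<Sum>l\<in>UNIV. A $ l $ k * p k * (norm (blk x l))\<^sup>2)
      = (\<Sum>l\<in>UNIV. \<Sum>k\<in>UNIV. A $ l $ k * p k * (norm (blk x l))\<^sup>2)" by (rule sum.swap)
  also have "\<dots> = V x" unfolding V_sum by (simp add: sum_distrib_right[symmetric] A_p)
  finally show ?thesis by simp
qed

lemma defect_nonneg: "0 \<le> defect x"
  unfolding defect_def by (intro sum_nonneg mult_nonneg_nonneg A_nonneg less_imp_le[OF p_pos]) auto

lemma defect_dev: "defect (dev x) = defect x"
proof -
  have eq: "A $ l $ k * (norm (blk (dev x) l - blk (mix (dev x)) k))\<^sup>2
      = A $ l $ k * (norm (blk x l - blk (mix x) k))\<^sup>2" for k l
  proof (cases "grp l = grp k")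
    case True
    then show ?thesis unfolding dev_mix[symmetric] by (simp add: blk_dev cent_mix)
  qed (simp add: A_zero)
  show ?thesis unfolding defect_def eq ..
qed

text \<open>Zero variance makes each block averaged by k equal to the average; as k averages itself
  too, this common value is the block of k. Equality then spreads along the directed links of the
  group.\<close>

lemma defect_zero_imp:
  assumes "defect x = 0"
  shows "dev x = 0"
proof (rule blk_eqI)
  fix k
  have eq: "blk x l = blk x k" if "l \<in> Nb k" "grp l = grp k" for l k
  proof -
    have pz: "p k * (\<Sum>l\<in>UNIV. A $ l $ k * (norm (blk x l - blk (mix x) k))\<^sup>2) = 0" for k
      using assms unfolding defect_def
      by (subst (asm) sum_nonneg_eq_0_iff) (auto intro!: mult_nonneg_nonneg sum_nonneg A_nonneg less_imp_le[OF p_pos])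
    then have "(\<Sum>l\<in>UNIV. A $ l $ k * (norm (blk x l - blk (mix x) k))\<^sup>2) = 0"
      using pz[of k] p_pos[of k] unfolding mult_eq_0_iff by linarith
    then have "A $ l $ k * (norm (blk x l - blk (mix x) k))\<^sup>2 = 0" for l
      by (subst (asm) sum_nonneg_eq_0_iff) (auto intro!: mult_nonneg_nonneg A_nonneg)
    then have "blk x l = blk (mix x) k" if "l \<in> Nb k" "grp l = grp k" for l
      using A_pos[OF that] by (metis less_irrefl mult_eq_0_iff norm_eq_zero power_eq_0_iff right_minus_eq)
    then show ?thesis using that self by metis
  qed
  have const: "blk x l = blk x k" if "grp l = grp k" for l
  proof -
    have "(l, k) \<in> (links Nb \<inter> grp -` {grp k} \<times> grp -` {grp k})\<^sup>*"
      using connected[of "grp k"] that by (auto simp: connected_in_def)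
    then show ?thesis
    proof (induction rule: rtrancl_induct)
      case (step y z)
      then show ?case using eq[of y z] by (auto simp: links_def)
    qed simp
  qed
  have "blk (cent x) (grp k) = (\<Sum>l\<in>grp -` {grp k}. p l *\<^sub>R blk x k)"
    unfolding blk_cent by (rule sum.cong[OF refl], subst const) simp_all
  then show "blk (dev x) k = blk 0 k"
    by (simp add: blk_dev scaleR_sum_left[symmetric] p_group)
qed

lemma continuous_linear: "linear f \<Longrightarrow> continuous_on S f"
  for f :: "'v::euclidean_space \<Rightarrow> 'w::real_normed_vector"
  by (simp add: linear_continuous_on linear_linear)

text \<open>A spectral gap by compactness: adding the squared norm of the centroid part makes the
  defect positive definite, so it dominates a multiple of the squared norm; on deviations the added
  term is zero.\<close>

lemma defect_lower:
  obtains \<delta> where "0 < \<delta>" "\<delta> \<le> 1" "\<And>x. \<delta> * (norm (dev x))\<^sup>2 \<le> defect (x :: real^('n \<times> 'm::finite))"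
proof -
  define q where "q x = defect x + (norm (spread grp (cent x)))\<^sup>2" for x :: "real^('n \<times> 'm)"
  have lsp: "linear (\<lambda>x. spread grp (cent x))" for grp :: "'n \<Rightarrow> 'g"
    using linear_compose[OF linear_cent linear_spread] by (simp add: o_def)
  have lbm: "linear (\<lambda>x. blk (mix x) k)" for k
    using linear_compose[OF linear_mix linear_blk] by (simp add: o_def)
  obtain e where e: "0 < e" "\<And>x. e * (norm x)\<^sup>2 \<le> q x"
  proof (rule homogeneous_lower_bound[of q])
    show "continuous_on UNIV q"
      unfolding q_def defect_def
      by (intro continuous_intros continuous_linear linear_blk lbm lsp)
    show "q (c *\<^sub>R x) = c\<^sup>2 * q x" for c x
      unfolding q_def defect_def linear_scale[OF linear_mix] linear_scale[OF lsp] blk_scaleR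
        scaleR_diff_right[symmetric] norm_scaleR power_mult_distrib power2_abs
      by (simp add: sum_distrib_left distrib_left mult.left_commute)
    show "0 < q x" if "x \<noteq> 0" for x
    proof (rule ccontr)
      assume "\<not> 0 < q x"
      then have "defect x = 0" "(norm (spread grp (cent x)))\<^sup>2 = 0"
        using defect_nonneg[of x] unfolding q_def by (smt (verit) zero_le_power2)+
      then have "dev x = 0" "spread grp (cent x) = 0" using defect_zero_imp by auto
      then show False using that by (simp add: dev_def)
    qed
  qed blast
  show ?thesis
  proof
    \<comment> \<open>The cap at 1 lets 1 - \<delta> serve as a contraction factor later.\<close>
    show "0 < min e 1" "min e 1 \<le> 1" using e by auto
    show "min e 1 * (norm (dev x))\<^sup>2 \<le> defect x" for x :: "real^('n \<times> 'm)"
    proof -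
      have "min e 1 * (norm (dev x))\<^sup>2 \<le> e * (norm (dev x))\<^sup>2" by (intro mult_right_mono) auto
      also have "\<dots> \<le> q (dev x)" by (rule e)
      also have "\<dots> = defect x" by (simp add: q_def cent_dev defect_dev)
      finally show ?thesis .
    qed
  qed
qed

end

section \<open>Costs and the mean recursion\<close>

text \<open>Cauchy-Schwarz for the form, with B h in one slot, gives |B h|^4 \<le> u |B h|^2 * u
  |h|^2; a bound on the form thus becomes a bound on the map without eigenvalues.\<close>

lemma matrix_psd_norm_bound:
  fixes B :: "real^'a::finite^'a"
  assumes sym: "transpose B = B" and psd: "\<And>v. 0 \<le> v \<bullet> (B *v v)" and up: "\<And>v. v \<bullet> (B *v v) \<le> u * (norm v)\<^sup>2"
  shows "norm (B *v h) \<le> u * norm h"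
proof -
  have u0: "0 \<le> u * (norm v)\<^sup>2" for v :: "real^'a" using psd[of v] up[of v] by linarith
  define b where "b = norm (B *v h)"
  have "(b\<^sup>2)\<^sup>2 = ((B *v h) \<bullet> (B *v h))\<^sup>2" by (simp add: b_def power2_norm_eq_inner)
  also have "\<dots> \<le> ((B *v h) \<bullet> (B *v (B *v h))) * (h \<bullet> (B *v h))" by (rule psd_cauchy_schwarz[OF sym psd])
  also have "\<dots> \<le> (u * (norm (B *v h))\<^sup>2) * (u * (norm h)\<^sup>2)" by (intro mult_mono up psd u0)
  finally have *: "b\<^sup>2 * b\<^sup>2 \<le> b\<^sup>2 * (u * norm h)\<^sup>2"
    by (simp add: b_def power2_eq_square algebra_simps)
  show ?thesis
  proof (cases "h = 0")
    case False
    then have "0 \<le> u" using u0[of h] by (simp add: zero_le_mult_iff)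
    show ?thesis
    proof (cases "b = 0")
      case False
      then have "b\<^sup>2 \<le> (u * norm h)\<^sup>2" by (intro mult_left_le_imp_le[OF *]) simp
      then show ?thesis unfolding b_def by (rule power2_le_imp_le) (use \<open>0 \<le> u\<close> in simp)
    qed (use \<open>0 \<le> u\<close> in \<open>simp add: b_def\<close>)
  qed simp
qed

lemma mat_mult_vec: "mat c *v v = c *\<^sub>R v" for v :: "real^'a::finite"
  by (simp add: vec_eq_iff matrix_vector_mult_def mat_def if_distrib if_distribR sum.delta' cong: if_cong)

lemma blk_blockdiag: "blk (blockdiag B *v y) k = B k *v blk y k"
  for y :: "real^('k::finite \<times> 'm::finite)"
proof -
  have "(blockdiag B *v y) $ (k, i) = (B k *v blk y k) $ i" for i
  proof -
    have "(blockdiag B *v y) $ (k, i) = (\<Sum>a\<in>UNIV. (if k = fst a then B k $ i $ snd a else 0) * y $ (fst a, snd a))"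
      unfolding matrix_vector_mult_def blockdiag_def vec_lambda_beta fst_conv snd_conv prod.collapse ..
    also have "\<dots> = (\<Sum>l\<in>UNIV. \<Sum>j\<in>UNIV. (if k = l then B k $ i $ j else 0) * y $ (l, j))"
      using sum_UNIV_prod[of "\<lambda>l j. (if k = l then B k $ i $ j else 0) * y $ (l, j)"] by simp
    also have "\<dots> = (\<Sum>l\<in>UNIV. if k = l then (\<Sum>j\<in>UNIV. B k $ i $ j * y $ (l, j)) else 0)"
      by (intro sum.cong) auto
    also have "\<dots> = (B k *v blk y k) $ i" by (simp add: matrix_vector_mult_def blk_def)
    finally show ?thesis .
  qed
  then show ?thesis by (simp add: blk_def[of "blockdiag B *v y"] vec_eq_iff)
qed

text \<open>The constant c bounds the ratio of each step-size to the largest one from below, so that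
  no agent's step-size vanishes faster than the others.\<close>

locale diffusion = group_mixing Nb grp A p
  for Nb :: "'n::finite \<Rightarrow> 'n set" and grp :: "'n \<Rightarrow> 'g::finite" and A :: "real^'n^'n" and p +
  fixes J :: "'n \<Rightarrow> real^'m::finite \<Rightarrow> real" and wo :: "'n \<Rightarrow> real^'m"
    and lamL lamU :: "'n \<Rightarrow> real" and kappaH c :: real
  assumes minimizer: "unique_minimizer (J k) (wo k)"
    and costs: "cost_assumptions J grp lamL lamU kappaH" and c_pos: "0 < c"
begin

lemma gradient_has_derivative:
  "(gradient (J k) has_derivative (\<lambda>h. hessian (J k) y *v h)) (at y)"
proof -
  have "gradient (J k) differentiable (at y)"
    using costs by (simp add: cost_assumptions_def twice_differentiable_def)
  then have d: "(gradient (J k) has_derivative frechet_derivative (gradient (J k)) (at y)) (at y)"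
    by (simp add: frechet_derivative_works)
  have "frechet_derivative (gradient (J k)) (at y) = (\<lambda>h. hessian (J k) y *v h)"
    using has_derivative_linear[OF d] matrix_works[of "frechet_derivative (gradient (J k)) (at y)"]
    unfolding hessian_def linear_def scalar_mult_eq_scaleR by auto
  then show ?thesis using d by simp
qed

lemma gradient_continuous: "continuous_on UNIV (gradient (J k))"
  by (simp add: continuous_on_eq_continuous_at has_derivative_continuous[OF gradient_has_derivative])

lemma lamL_nonneg: "0 \<le> lamL k" and lamU_nonneg: "0 \<le> lamU k" and kappaH_nonneg: "0 \<le> kappaH"
  using costs unfolding cost_assumptions_def by (auto intro: order_trans)

lemma hessian_sym: "transpose (hessian (J k) y) = hessian (J k) y"
proof -
  have "transpose (hessian (J k) y - mat (lamL k)) = hessian (J k) y - mat (lamL k)"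
    using costs by (simp add: cost_assumptions_def loewner_le_def)
  moreover have "transpose (hessian (J k) y - mat (lamL k)) = transpose (hessian (J k) y) - transpose (mat (lamL k))"
    by (simp add: transpose_def vec_eq_iff)
  ultimately show ?thesis by (simp add: transpose_mat)
qed

lemma hessian_lower: "lamL k * (norm v)\<^sup>2 \<le> v \<bullet> (hessian (J k) y *v v)"
proof -
  have "0 \<le> v \<bullet> ((hessian (J k) y - mat (lamL k)) *v v)"
    using costs by (simp add: cost_assumptions_def loewner_le_def)
  then show ?thesis by (simp add: matrix_vector_mult_diff_rdistrib mat_mult_vec inner_diff_right power2_norm_eq_inner)
qed

lemma hessian_upper: "v \<bullet> (hessian (J k) y *v v) \<le> lamU k * (norm v)\<^sup>2"
proof -
  have "0 \<le> v \<bullet> ((mat (lamU k) - hessian (J k) y) *v v)"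
    using costs by (simp add: cost_assumptions_def loewner_le_def)
  then show ?thesis by (simp add: matrix_vector_mult_diff_rdistrib mat_mult_vec inner_diff_right power2_norm_eq_inner)
qed

lemma hessian_psd: "0 \<le> v \<bullet> (hessian (J k) y *v v)"
  using hessian_lower[of k v y] lamL_nonneg[of k] by (smt (verit) mult_nonneg_nonneg zero_le_power2)

definition lip :: real where "lip = (\<Sum>k\<in>UNIV. lamU k)"

lemma lip_nonneg: "0 \<le> lip" and lamU_le_lip: "lamU k \<le> lip"
  unfolding lip_def using lamU_nonneg by (auto intro: sum_nonneg member_le_sum)

lemma hessian_norm: "norm (hessian (J k) y *v h) \<le> lip * norm h"
proof -
  have "norm (hessian (J k) y *v h) \<le> lamU k * norm h"
    by (rule matrix_psd_norm_bound[OF hessian_sym hessian_psd hessian_upper])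
  also have "\<dots> \<le> lip * norm h" by (intro mult_right_mono lamU_le_lip) simp
  finally show ?thesis .
qed

text \<open>The assumption concerns the block-diagonal Hessian of all agents; placing vectors into
  block k and zeros elsewhere isolates a single agent.\<close>

lemma hessian_lipschitz: "norm (hessian (J k) y *v h - hessian (J k) z *v h) \<le> kappaH * norm (y - z) * norm h"
proof -
  define e where "e v = col (\<lambda>l. if l = k then v else 0)" for v :: "real^'m"
  have be: "blk (e v) k = v" "blk (e v) l = (if l = k then v else 0)" for v l by (auto simp: e_def)
  have ne: "norm (e v) = norm v" for v
  proof -
    have "(norm (e v))\<^sup>2 = (\<Sum>l\<in>UNIV. if l = k then (norm v)\<^sup>2 else 0)"
      unfolding e_def norm_col_sq by (intro sum.cong) auto
    then show ?thesis by simp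
  qed
  have ed: "e y - e z = e (y - z)" by (rule blk_eqI) (simp add: be)
  define D where "D = blockdiag (\<lambda>l. hessian (J l) (blk (e y) l)) - blockdiag (\<lambda>l. hessian (J l) (blk (e z) l))"
  have "opnorm D \<le> kappaH * norm (e y - e z)"
    using costs unfolding cost_assumptions_def D_def by blast
  then have D: "opnorm D \<le> kappaH * norm (y - z)" by (simp add: ed ne)
  have "norm (hessian (J k) y *v h - hessian (J k) z *v h) = norm (blk (D *v e h) k)"
    by (simp add: D_def matrix_vector_mult_diff_rdistrib blk_blockdiag be)
  also have "\<dots> \<le> norm (D *v e h)" by (rule norm_blk_le)
  also have "\<dots> \<le> opnorm D * norm (e h)" by (rule norm_le_opnorm)
  also have "\<dots> \<le> kappaH * norm (y - z) * norm h" unfolding ne by (intro mult_right_mono D) simp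
  finally show ?thesis .
qed

lemma gradient_minimizer: "gradient (J k) (wo k) = 0"
proof -
  have "J k differentiable (at (wo k))"
    using costs by (simp add: cost_assumptions_def twice_differentiable_def)
  then have d: "(J k has_derivative frechet_derivative (J k) (at (wo k))) (at (wo k))"
    by (simp add: frechet_derivative_works)
  have "frechet_derivative (J k) (at (wo k)) = (\<lambda>h. 0)"
  proof (rule differential_zero_maxmin[OF UNIV_I open_UNIV d])
    show "(\<forall>y\<in>UNIV. J k y \<le> J k (wo k)) \<or> (\<forall>y\<in>UNIV. J k (wo k) \<le> J k y)"
      using minimizer[of k] unfolding unique_minimizer_def by (metis less_imp_le order_refl)
  qed
  then show ?thesis by (simp add: gradient_def vec_eq_iff)
qed

text \<open>The gradient in error coordinates. The reversal of sign in the argument makes it a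
  decreasing map, so adding it to the error is dissipative.\<close>

definition grd :: "'n \<Rightarrow> real^'m \<Rightarrow> real^'m" where "grd k x = gradient (J k) (wo k - x)"

lemma grd_zero: "grd k 0 = 0" by (simp add: grd_def gradient_minimizer)

lemma grd_has_derivative: "(grd k has_derivative (\<lambda>h. - (hessian (J k) (wo k - x) *v h))) (at x within S)"
proof -
  have "((\<lambda>x. wo k - x) has_derivative (\<lambda>h. - h)) (at x within S)" by (auto intro!: derivative_eq_intros)
  from has_derivative_compose[OF this gradient_has_derivative]
  have "((\<lambda>x. gradient (J k) (wo k - x)) has_derivative (\<lambda>h. hessian (J k) (wo k - x) *v (- h))) (at x within S)" .
  then show ?thesis unfolding grd_def[abs_def] by (simp add: vec.neg)
qed

lemma grd_norm: "norm (grd k x) \<le> lip * norm x"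
proof -
  have "norm (grd k x - grd k 0) \<le> lip * norm (x - 0)"
  proof (rule differentiable_bound[OF convex_UNIV grd_has_derivative])
    show "onorm (\<lambda>h. - (hessian (J k) (wo k - y) *v h)) \<le> lip" for y
      by (rule onorm_bound) (simp_all add: hessian_norm lip_nonneg)
  qed auto
  then show ?thesis by (simp add: grd_zero)
qed

text \<open>Mean value theorem for r \<mapsto> x \<bullet> grd k (r x) on the segment from 0 to
  x.\<close>

lemma grd_monotone: "x \<bullet> grd k x \<le> - lamL k * (norm x)\<^sup>2"
proof -
  define f where "f r = x \<bullet> grd k (r *\<^sub>R x)" for r
  have f: "(f has_real_derivative - (x \<bullet> (hessian (J k) (wo k - r *\<^sub>R x) *v x))) (at r)" for r
  proof -
    have "((\<lambda>r. r *\<^sub>R x) has_derivative (\<lambda>h. h *\<^sub>R x)) (at r)" by (auto intro!: derivative_eq_intros)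
    from has_derivative_compose[OF this grd_has_derivative]
    have "((\<lambda>r. grd k (r *\<^sub>R x)) has_derivative (\<lambda>h. - (hessian (J k) (wo k - r *\<^sub>R x) *v (h *\<^sub>R x)))) (at r)" .
    from has_derivative_inner_right[OF this, of x] show ?thesis
      unfolding f_def[abs_def] has_field_derivative_def
      by (rule has_derivative_eq_rhs) (simp add: matrix_vector_mult_scaleR fun_eq_iff)
  qed
  obtain r where "f 1 - f 0 = (1 - 0) * - (x \<bullet> (hessian (J k) (wo k - r *\<^sub>R x) *v x))"
    using MVT2[of 0 1 f "\<lambda>r. - (x \<bullet> (hessian (J k) (wo k - r *\<^sub>R x) *v x))"] f by auto
  then show ?thesis using hessian_lower[of k x "wo k - r *\<^sub>R x"] by (simp add: f_def grd_zero)
qed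

text \<open>The derivative of the left side at y is a difference of Hessians at distance |y| \<le>
  |x|; the mean value inequality on the ball of radius |x| supplies the second factor |x|.\<close>

lemma grd_quadratic: "norm (grd k x + hessian (J k) (wo k) *v x) \<le> kappaH * (norm x)\<^sup>2"
proof -
  define f where "f y = grd k y + hessian (J k) (wo k) *v y" for y :: "real^'m"
  have "norm (f x - f 0) \<le> (kappaH * norm x) * norm (x - 0)"
  proof (rule differentiable_bound[OF convex_cball, of 0 "norm x"])
    fix y :: "real^'m" assume y: "y \<in> cball 0 (norm x)"
    show "(f has_derivative (\<lambda>h. - (hessian (J k) (wo k - y) *v h) + hessian (J k) (wo k) *v h)) (at y within cball 0 (norm x))"
      unfolding f_def[abs_def]
      by (intro has_derivative_add grd_has_derivative bounded_linear_imp_has_derivative matrix_vector_mul_bounded_linear)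
    show "onorm (\<lambda>h. - (hessian (J k) (wo k - y) *v h) + hessian (J k) (wo k) *v h) \<le> kappaH * norm x"
    proof (rule onorm_bound)
      fix h
      have "norm (- (hessian (J k) (wo k - y) *v h) + hessian (J k) (wo k) *v h)
          = norm (hessian (J k) (wo k) *v h - hessian (J k) (wo k - y) *v h)" by simp
      also have "\<dots> \<le> kappaH * norm (wo k - (wo k - y)) * norm h" by (rule hessian_lipschitz)
      also have "\<dots> \<le> kappaH * norm x * norm h"
        using y kappaH_nonneg by (intro mult_right_mono mult_left_mono) auto
      finally show "norm (- (hessian (J k) (wo k - y) *v h) + hessian (J k) (wo k) *v h) \<le> kappaH * norm x * norm h" .
    qed (use kappaH_nonneg in simp)
  qed auto
  then show ?thesis by (simp add: f_def grd_zero power2_eq_square mult.assoc)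
qed

definition drift :: "('n \<Rightarrow> real) \<Rightarrow> real^('n \<times> 'm) \<Rightarrow> real^('n \<times> 'm)" where
  "drift mu x = col (\<lambda>k. mu k *\<^sub>R grd k (blk x k))"

lemma blk_drift: "blk (drift mu x) k = mu k *\<^sub>R grd k (blk x k)"
  by (simp add: drift_def)

lemma continuous_drift: "continuous_on UNIV (drift mu)"
proof -
  have "continuous_on UNIV (\<lambda>x. gradient (J k) (wo k - blk x k))" for k
    by (rule continuous_on_compose2[OF gradient_continuous])
      (intro continuous_intros continuous_linear linear_blk, simp)
  then show ?thesis
    unfolding drift_def[abs_def] grd_def col_def
    by (intro continuous_on_vec_lambda continuous_on_component continuous_intros) auto
qed

lemma drift_norm:
  assumes "\<And>k. 0 \<le> mu k" "\<And>k. mu k \<le> t"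
  shows "norm (drift mu x) \<le> t * lip * norm x"
proof -
  have t: "0 \<le> t" using assms order_trans by blast
  have "(norm (drift mu x))\<^sup>2 \<le> (\<Sum>k\<in>UNIV. (t * lip)\<^sup>2 * (norm (blk x k))\<^sup>2)"
    unfolding norm_sq_blk[of "drift mu x"] blk_drift
  proof (rule sum_mono)
    fix k
    have "norm (mu k *\<^sub>R grd k (blk x k)) \<le> t * (lip * norm (blk x k))"
      using assms t grd_norm by (auto intro!: mult_mono)
    then have "(norm (mu k *\<^sub>R grd k (blk x k)))\<^sup>2 \<le> (t * (lip * norm (blk x k)))\<^sup>2" by (rule power_mono) simp
    then show "(norm (mu k *\<^sub>R grd k (blk x k)))\<^sup>2 \<le> (t * lip)\<^sup>2 * (norm (blk x k))\<^sup>2"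
      by (simp add: power_mult_distrib)
  qed
  also have "\<dots> = (t * lip * norm x)\<^sup>2" unfolding power_mult_distrib[of _ "norm x"] norm_sq_blk by (simp add: sum_distrib_left)
  finally show ?thesis by (rule power2_le_imp_le) (use t lip_nonneg in simp)
qed

end

section \<open>Block estimates and the matrices of the limiting recursion\<close>

lemma norm_le_sum_blk: "norm x \<le> (\<Sum>k\<in>UNIV. norm (blk x k))"
  for x :: "real^('n::finite \<times> 'm::finite)"
proof -
  have "norm x = L2_set (\<lambda>k. norm (blk x k)) UNIV"
    unfolding L2_set_def norm_sq_blk[symmetric] by simp
  also have "\<dots> \<le> (\<Sum>k\<in>UNIV. norm (blk x k))" by (rule L2_set_le_sum) simp
  finally show ?thesis .
qed

lemma norm_add_sq_le:
  fixes a b :: "'v::real_inner"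
  assumes "0 < e"
  shows "(norm (a + b))\<^sup>2 \<le> (1 + e) * (norm a)\<^sup>2 + (1 + 1 / e) * (norm b)\<^sup>2"
proof -
  have "2 * (norm a * norm b) \<le> e * (norm a)\<^sup>2 + (norm b)\<^sup>2 / e"
  proof -
    have "0 \<le> (e * norm a - norm b)\<^sup>2 / e" using assms by simp
    also have "\<dots> = e * (norm a)\<^sup>2 + (norm b)\<^sup>2 / e - 2 * (norm a * norm b)"
      using assms by (simp add: power2_eq_square field_simps)
    finally show ?thesis by simp
  qed
  moreover have "(norm (a + b))\<^sup>2 = (norm a)\<^sup>2 + 2 * (a \<bullet> b) + (norm b)\<^sup>2"
    by (simp add: power2_norm_eq_inner inner_add_left inner_add_right inner_commute)
  moreover have "a \<bullet> b \<le> norm a * norm b" by (rule norm_cauchy_schwarz)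
  ultimately show ?thesis by (simp add: algebra_simps)
qed

lemma Mmat_blk: "blk (Mmat mu *v x) k = mu k *\<^sub>R blk x k"
  for x :: "real^('n::finite \<times> 'm::finite)"
proof -
  have "(Mmat mu *v x) $ a = mu (fst a) * x $ a" for a
    by (simp add: matrix_vector_mult_def Mmat_def if_distrib if_distribR sum.delta cong: if_cong)
  then show ?thesis by (simp add: blk_def vec_eq_iff)
qed

lemma Mmat_sym: "transpose (Mmat mu) = Mmat mu"
  by (auto simp: transpose_def Mmat_def vec_eq_iff)

lemma Pmat_blk: "blk (Pmat grp p *v z) k = p k *\<^sub>R blk z (grp k)"
  for z :: "real^('g::finite \<times> 'm::finite)"
proof -
  have "(Pmat grp p *v z) $ a = p (fst a) * z $ (grp (fst a), snd a)" for a
  proof -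
    have "(Pmat grp p *v z) $ a = (\<Sum>b\<in>UNIV. if b = (grp (fst a), snd a) then p (fst a) * z $ b else 0)"
      unfolding matrix_vector_mult_def Pmat_def vec_lambda_beta by (rule sum.cong) (auto simp: prod_eq_iff)
    then show ?thesis by simp
  qed
  then show ?thesis by (simp add: blk_def vec_eq_iff)
qed

lemma matrix_sum_vector_mult: "finite S \<Longrightarrow> (\<Sum>k\<in>S. c k *\<^sub>R B k) *v v = (\<Sum>k\<in>S. c k *\<^sub>R (B k *v v))"
  for B :: "'k \<Rightarrow> real^'a::finite^'b::finite"
  by (induction S rule: finite_induct)
    (simp_all add: matrix_vector_mult_add_rdistrib scaleR_matrix_vector_assoc)

lemma Hbar_blk: "blk (Hbar J wo grp p mu *v z) m
    = (\<Sum>k\<in>grp -` {m}. (p k * mu k / mu_max mu) *\<^sub>R (hessian (J k) (wo k) *v blk z m))"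
  unfolding Hbar_def blk_blockdiag by (rule matrix_sum_vector_mult) simp

context group_mixing
begin

lemma V_add_le: "0 < e \<Longrightarrow> V (a + b) \<le> (1 + e) * V a + (1 + 1 / e) * V b"
  unfolding V_def linear_add[OF linear_rootp] by (rule norm_add_sq_le)

lemma V_add: "V (x + d) = V x + 2 * (\<Sum>k\<in>UNIV. p k * (blk x k \<bullet> blk d k)) + V d"
proof -
  have "p k * (norm (blk x k + blk d k))\<^sup>2
      = p k * (norm (blk x k))\<^sup>2 + 2 * (p k * (blk x k \<bullet> blk d k)) + p k * (norm (blk d k))\<^sup>2" for k
    by (simp add: power2_norm_eq_inner inner_add_left inner_add_right inner_commute algebra_simps)
  then show ?thesis unfolding V_sum blk_add by (simp add: sum.distrib sum_distrib_left)
qed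

lemma dev_bound: obtains K where "0 < K" "\<And>x. norm (dev (x :: real^('n \<times> 'm::finite))) \<le> K * norm x"
  using linear_bounded_pos[OF linear_dev] by blast

lemma cent_inner:
  fixes v :: "real^('g \<times> 'm::finite)"
  shows "v \<bullet> cent x = (Pmat grp p *v v) \<bullet> x"
proof -
  have "v \<bullet> cent x = (\<Sum>m\<in>UNIV. \<Sum>k\<in>grp -` {m}. p k * (blk v m \<bullet> blk x k))"
    using inner_col[of "blk v" "cent x"] by (simp add: blk_cent inner_sum_right)
  also have "\<dots> = (\<Sum>m\<in>UNIV. \<Sum>k\<in>{k \<in> UNIV. grp k = m}. p k * (blk v (grp k) \<bullet> blk x k))"
    by (intro sum.cong) auto
  also have "\<dots> = (\<Sum>k\<in>UNIV. p k * (blk v (grp k) \<bullet> blk x k))"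
    by (rule sum.group) auto
  also have "\<dots> = (Pmat grp p *v v) \<bullet> x"
    using inner_col[of "blk (Pmat grp p *v v)" x] by (simp add: Pmat_blk)
  finally show ?thesis .
qed

text \<open>The vector against which the raw noise is tested when the noise in the centroid is
  tested against v; its form under Rs is t^2 times that of \<open>Rbar\<close>.\<close>

definition probe :: "('n \<Rightarrow> real) \<Rightarrow> real^('g \<times> 'm::finite) \<Rightarrow> real^('n \<times> 'm)" where
  "probe mu v = Mmat mu *v (Pmat grp p *v v)"

lemma probe_inner: "v \<bullet> cent (Mmat mu *v s) = probe mu v \<bullet> s"
  unfolding cent_inner probe_def using inner_matrix_sym[OF Mmat_sym, of "Pmat grp p *v v" mu s]
  by (simp add: inner_commute)

lemma probe_norm:
  assumes "\<And>k. 0 \<le> mu k" "\<And>k. mu k \<le> t"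
  shows "norm (probe mu v) \<le> t * real CARD('n) * norm v"
proof -
  have t: "0 \<le> t" using assms order_trans by blast
  have "norm (probe mu v) \<le> (\<Sum>k\<in>UNIV. norm (blk (probe mu v) k))" by (rule norm_le_sum_blk)
  also have "\<dots> \<le> (\<Sum>k\<in>(UNIV::'n set). t * norm v)"
  proof (rule sum_mono)
    fix k
    have "norm (blk (probe mu v) k) = mu k * (p k * norm (blk v (grp k)))"
      using assms(1)[of k] p_pos[of k] by (simp add: probe_def Mmat_blk Pmat_blk)
    also have "\<dots> \<le> t * (1 * norm v)"
      using assms t p_pos[of k] p_le_1[of k] norm_blk_le[of v] by (intro mult_mono) (auto intro: less_imp_le)
    finally show "norm (blk (probe mu v) k) \<le> t * norm v" by simp
  qed
  also have "\<dots> = t * real CARD('n) * norm v" by simp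
  finally show ?thesis .
qed

lemma probe_form:
  assumes "mu_max mu = t" "0 < t"
  shows "probe mu v \<bullet> (Rs *v probe mu v) = t\<^sup>2 * (v \<bullet> (Rbar Rs grp p mu *v v))"
proof -
  let ?P = "Pmat grp p" and ?M = "Mmat mu"
  have "v \<bullet> ((transpose ?P ** ?M ** Rs ** ?M ** ?P) *v v) = v \<bullet> (transpose ?P *v (?M *v (Rs *v (?M *v (?P *v v)))))"
    by (simp only: matrix_vector_mul_assoc matrix_mul_assoc)
  also have "\<dots> = (?P *v v) \<bullet> (?M *v (Rs *v (?M *v (?P *v v))))"
    by (metis dot_lmul_matrix inner_commute transpose_matrix_vector transpose_transpose)
  also have "\<dots> = probe mu v \<bullet> (Rs *v probe mu v)"
    unfolding probe_def using inner_matrix_sym[OF Mmat_sym] by (metis inner_commute)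
  finally show ?thesis
    using assms by (simp add: Rbar_def scaleR_matrix_vector_assoc[symmetric])
qed

end

section \<open>One-step estimates for the mean recursion\<close>

context diffusion
begin

lemma strongly_convex_member: obtains k where "grp k = m" "0 < lamL k"
proof -
  have "\<exists>k\<in>grp -` {m}. 0 < lamL k" using costs unfolding cost_assumptions_def by blast
  then show ?thesis using that by auto
qed

text \<open>A nonzero v has a nonzero block for some group; this group contains a strongly convex
  cost, and its weight is positive thanks to the lower bound on the step-sizes.\<close>

lemma Hbar_spd:
  assumes "0 < t" "\<And>k. c * t \<le> mu k" "mu_max mu = t"
  shows "sym_pos_def (Hbar J wo grp p mu)"
proof -
  let ?w = "\<lambda>k. p k * mu k / mu_max mu"
  have mu: "0 < mu k" for k using assms c_pos by (smt (verit) mult_pos_pos)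
  have w: "0 < ?w k" for k using mu p_pos assms by simp
  have "transpose (Hbar J wo grp p mu) = Hbar J wo grp p mu"
  proof -
    have "hessian (J k) y $ i $ j = hessian (J k) y $ j $ i" for k y i j
      using arg_cong[OF hessian_sym[of k y], of "\<lambda>B. B $ j $ i"] by (simp add: transpose_def)
    then show ?thesis by (auto simp: Hbar_def transpose_def blockdiag_def vec_eq_iff)
  qed
  moreover have "0 < v \<bullet> (Hbar J wo grp p mu *v v)" if v0: "v \<noteq> 0" for v
  proof -
    have "v \<bullet> (Hbar J wo grp p mu *v v)
        = (\<Sum>m\<in>UNIV. \<Sum>k\<in>grp -` {m}. ?w k * (blk v m \<bullet> (hessian (J k) (wo k) *v blk v m)))"
      using inner_col[of "blk v" "Hbar J wo grp p mu *v v"] by (simp add: Hbar_blk inner_sum_right)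
    moreover have "0 < \<dots>"
    proof -
      obtain m where m: "blk v m \<noteq> 0" using v0 by (metis blk_eqI blk_zero)
      obtain k where "grp k = m" "0 < lamL k" by (rule strongly_convex_member)
      then have k: "k \<in> grp -` {m}" "0 < lamL k" by auto
      have nn: "0 \<le> ?w k * (blk v m \<bullet> (hessian (J k) (wo k) *v blk v m))" for k m
        using less_imp_le[OF w] hessian_psd by (intro mult_nonneg_nonneg)
      show ?thesis
      proof (rule sum_pos2[OF _ UNIV_I[of m]])
        show "0 < (\<Sum>k\<in>grp -` {m}. ?w k * (blk v m \<bullet> (hessian (J k) (wo k) *v blk v m)))"
        proof (rule sum_pos2[OF _ k(1)])
          have "0 < lamL k * (norm (blk v m))\<^sup>2" using k m by simp
          also have "\<dots> \<le> blk v m \<bullet> (hessian (J k) (wo k) *v blk v m)" by (rule hessian_lower)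
          finally show "0 < ?w k * (blk v m \<bullet> (hessian (J k) (wo k) *v blk v m))" using w by (intro mult_pos_pos)
        qed (use nn in auto)
      qed (use nn in \<open>auto intro!: sum_nonneg\<close>)
    qed
    ultimately show ?thesis by simp
  qed
  ultimately show ?thesis by (simp add: sym_pos_def_def)
qed

text \<open>Convexity controls the blocks of strongly convex agents only; the others are tied to
  them through the deviation, which the averaging step penalises. Together the two terms form a
  positive definite expression, giving dissipation of order t against an error of order t^2.\<close>

lemma mean_square_step:
  obtains \<eta> C where "0 < \<eta>" "0 < C"
    "\<And>mu t x. 0 < t \<Longrightarrow> t \<le> 1 \<Longrightarrow> \<forall>k. c * t \<le> mu k \<Longrightarrow> \<forall>k. mu k \<le> t \<Longrightarrow>
      V (mix (x + drift mu x)) \<le> V x - t * \<eta> * (norm x)\<^sup>2 + C * t\<^sup>2 * (norm x)\<^sup>2"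
proof -
  obtain \<delta> where \<delta>: "0 < \<delta>" "\<delta> \<le> 1" "\<And>x::real^('n \<times> 'm). \<delta> * (norm (dev x))\<^sup>2 \<le> defect x"
    by (rule defect_lower) blast
  obtain K where K: "0 < K" "\<And>x::real^('n \<times> 'm). norm (dev x) \<le> K * norm x" by (rule dev_bound) blast
  \<comment> \<open>First term: gain from the gradients after division by t. Second term: what is
    kept of the Jensen defect. If both vanish, all blocks of a group agree and one of them is
    0.\<close>
  define q where "q x = 2 * c * (\<Sum>k\<in>UNIV. p k * lamL k * (norm (blk x k))\<^sup>2) + \<delta> / 2 * (norm (dev x))\<^sup>2"
    for x :: "real^('n \<times> 'm)"
  obtain \<eta> where \<eta>: "0 < \<eta>" "\<And>x. \<eta> * (norm x)\<^sup>2 \<le> q x"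
  proof (rule homogeneous_lower_bound[of q])
    show "continuous_on UNIV q"
      unfolding q_def by (intro continuous_intros continuous_linear linear_blk linear_dev)
    show "q (r *\<^sub>R x) = r\<^sup>2 * q x" for r x
      unfolding q_def linear_scale[OF linear_dev] blk_scaleR norm_scaleR power_mult_distrib power2_abs
      by (simp add: sum_distrib_left distrib_left mult.left_commute)
    show "0 < q x" if "x \<noteq> 0" for x
    proof (rule ccontr)
      assume n: "\<not> 0 < q x"
      have s0: "0 \<le> p k * lamL k * (norm (blk x k))\<^sup>2" for k
        using less_imp_le[OF p_pos] lamL_nonneg by (intro mult_nonneg_nonneg) auto
      have "0 \<le> 2 * c * (\<Sum>k\<in>UNIV. p k * lamL k * (norm (blk x k))\<^sup>2)"
        using c_pos sum_nonneg[of UNIV "\<lambda>k. p k * lamL k * (norm (blk x k))\<^sup>2", OF s0] by simp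
      moreover have "0 \<le> \<delta> / 2 * (norm (dev x))\<^sup>2" using \<delta> by simp
      ultimately have z: "2 * c * (\<Sum>k\<in>UNIV. p k * lamL k * (norm (blk x k))\<^sup>2) = 0" "\<delta> / 2 * (norm (dev x))\<^sup>2 = 0"
        using n unfolding q_def by linarith+
      then have d0: "dev x = 0" using \<delta> by simp
      have "(\<Sum>k\<in>UNIV. p k * lamL k * (norm (blk x k))\<^sup>2) = 0" using z(1) c_pos by simp
      then have l0: "p k * lamL k * (norm (blk x k))\<^sup>2 = 0" for k
        by (subst (asm) sum_nonneg_eq_0_iff) (use s0 in auto)
      have "blk x l = 0" for l
      proof -
        obtain k where k: "grp k = grp l" "0 < lamL k" by (rule strongly_convex_member)
        have "blk x k = 0" using l0[of k] k p_pos[of k] by simp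
        moreover have "blk x k = blk (cent x) (grp k)" "blk x l = blk (cent x) (grp l)"
          using d0 blk_dev[of x k] blk_dev[of x l] by simp_all
        ultimately show ?thesis using k by simp
      qed
      then have "x = 0" by (intro blk_eqI) simp
      then show False using that by simp
    qed
  qed blast
  define C where "C = (1 + \<delta> * K\<^sup>2) * lip\<^sup>2 + 1"
  have C: "0 < C" unfolding C_def using \<delta> by (intro add_nonneg_pos mult_nonneg_nonneg) auto
  have step: "V (mix (x + drift mu x)) \<le> V x - t * \<eta> * (norm x)\<^sup>2 + C * t\<^sup>2 * (norm x)\<^sup>2"
    if t: "0 < t" "t \<le> 1" and mu: "\<And>k. c * t \<le> mu k" "\<And>k. mu k \<le> t" for mu t x
  proof -
    define d where "d = drift mu x"
    have mu0: "0 \<le> mu k" for k using mu(1)[of k] t c_pos by (smt (verit) mult_nonneg_nonneg)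
    have "norm d \<le> t * lip * norm x" unfolding d_def by (rule drift_norm[OF mu0 mu(2)])
    then have dn: "(norm d)\<^sup>2 \<le> t\<^sup>2 * lip\<^sup>2 * (norm x)\<^sup>2"
      using power_mono[OF _ norm_ge_zero, of d _ 2] by (fastforce simp: power_mult_distrib)
    have cross: "2 * (\<Sum>k\<in>UNIV. p k * (blk x k \<bullet> blk d k)) \<le> - t * (2 * c * (\<Sum>k\<in>UNIV. p k * lamL k * (norm (blk x k))\<^sup>2))"
    proof -
      have "p k * (blk x k \<bullet> blk d k) \<le> - t * c * (p k * lamL k * (norm (blk x k))\<^sup>2)" for k
      proof -
        have "blk x k \<bullet> blk d k = mu k * (blk x k \<bullet> grd k (blk x k))" by (simp add: d_def blk_drift)
        also have "\<dots> \<le> mu k * (- lamL k * (norm (blk x k))\<^sup>2)" by (intro mult_left_mono grd_monotone mu0)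
        also have "\<dots> \<le> c * t * (- lamL k * (norm (blk x k))\<^sup>2)"
          by (rule mult_right_mono_neg[OF mu(1)]) (simp add: lamL_nonneg mult_nonneg_nonneg)
        finally have "p k * (blk x k \<bullet> blk d k) \<le> p k * (c * t * (- lamL k * (norm (blk x k))\<^sup>2))"
          using p_pos[of k] by (intro mult_left_mono) auto
        then show ?thesis by (simp add: algebra_simps)
      qed
      then have "(\<Sum>k\<in>UNIV. p k * (blk x k \<bullet> blk d k)) \<le> (\<Sum>k\<in>UNIV. - t * c * (p k * lamL k * (norm (blk x k))\<^sup>2))"
        by (rule sum_mono)
      also have "\<dots> = - t * c * (\<Sum>k\<in>UNIV. p k * lamL k * (norm (blk x k))\<^sup>2)"
        by (rule sum_distrib_left[symmetric])
      finally have "(\<Sum>k\<in>UNIV. p k * (blk x k \<bullet> blk d k)) \<le> - t * c * (\<Sum>k\<in>UNIV. p k * lamL k * (norm (blk x k))\<^sup>2)" .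
      moreover have "a \<le> - t * c * r \<Longrightarrow> 2 * a \<le> - t * (2 * c * r)" for a r :: real
        by (simp add: ac_simps)
      ultimately show ?thesis by blast
    qed
    \<comment> \<open>The defect is measured after the drift has been added; |a|^2 \<le> 2 |a + b|^2
      + 2 |b|^2 moves it back to x at the expense of |d|^2, which is O(t^2) |x|^2.\<close>
    have dd: "(norm (dev x))\<^sup>2 / 2 - K\<^sup>2 * (norm d)\<^sup>2 \<le> (norm (dev (x + d)))\<^sup>2"
    proof -
      have "(norm (dev (x + d) + - dev d))\<^sup>2 \<le> (1 + 1) * (norm (dev (x + d)))\<^sup>2 + (1 + 1 / 1) * (norm (- dev d))\<^sup>2"
        by (rule norm_add_sq_le) simp
      moreover have "dev (x + d) + - dev d = dev x" by (simp add: linear_add[OF linear_dev])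
      moreover have "(norm (dev d))\<^sup>2 \<le> K\<^sup>2 * (norm d)\<^sup>2"
        using power_mono[OF K(2) norm_ge_zero, of d 2] by (simp add: power_mult_distrib)
      ultimately show ?thesis by simp
    qed
    have "V (mix (x + d)) = V (x + d) - defect (x + d)" by (rule V_mix)
    also have "\<dots> \<le> V (x + d) - \<delta> * (norm (dev (x + d)))\<^sup>2" by (rule diff_left_mono[OF \<delta>(3)])
    also have "\<dots> \<le> V (x + d) - \<delta> * ((norm (dev x))\<^sup>2 / 2 - K\<^sup>2 * (norm d)\<^sup>2)"
      by (rule diff_left_mono[OF mult_left_mono[OF dd less_imp_le[OF \<delta>(1)]]])
    also have "\<dots> \<le> V x - t * (2 * c * (\<Sum>k\<in>UNIV. p k * lamL k * (norm (blk x k))\<^sup>2)) + (norm d)\<^sup>2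
        - \<delta> * ((norm (dev x))\<^sup>2 / 2 - K\<^sup>2 * (norm d)\<^sup>2)"
      unfolding V_add using cross V_le[of d] by linarith
    \<comment> \<open>The defect has strength of order 1 while the gradients contribute order t. As
      t \<le> 1, its full strength may be lowered to t times it, which makes q appear.\<close>
    also have "\<dots> \<le> V x - t * q x + (1 + \<delta> * K\<^sup>2) * (norm d)\<^sup>2"
    proof -
      have gen: "v - t * r + e - \<delta> * (n / 2 - k * e) \<le> v - t * (r + \<delta> / 2 * n) + (1 + \<delta> * k) * e"
        if "t * (\<delta> / 2 * n) \<le> 1 * (\<delta> / 2 * n)" for v r e n k :: real
        using that by (simp add: algebra_simps)
      show ?thesis unfolding q_def
        by (rule gen) (rule mult_right_mono, use t \<delta>(1) in auto)
    qed
    also have "\<dots> \<le> V x - t * (\<eta> * (norm x)\<^sup>2) + (1 + \<delta> * K\<^sup>2) * (t\<^sup>2 * lip\<^sup>2 * (norm x)\<^sup>2)"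
    proof (intro add_mono diff_left_mono mult_left_mono dn \<eta>(2))
      show "0 \<le> t" "0 \<le> 1 + \<delta> * K\<^sup>2" using t \<delta>(1) by auto
    qed
    also have "\<dots> \<le> V x - t * \<eta> * (norm x)\<^sup>2 + C * t\<^sup>2 * (norm x)\<^sup>2"
    proof -
      have "0 \<le> t\<^sup>2 * (norm x)\<^sup>2" by simp
      then show ?thesis unfolding C_def by (simp add: algebra_simps)
    qed
    finally show ?thesis unfolding d_def .
  qed
  show ?thesis by (rule that[OF \<eta>(1) C]) (rule step; blast)
qed

text \<open>The contraction factor comes from averaging alone and does not depend on t, whereas the
  drift enters squared, with t^2. The stationary size of the deviation is therefore O(t^2) in mean
  square.\<close>

lemma deviation_step:
  obtains \<delta> C where "0 < \<delta>" "\<delta> \<le> 1" "0 < C"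
    "\<And>mu t x. \<forall>k. 0 \<le> mu k \<Longrightarrow> \<forall>k. mu k \<le> t \<Longrightarrow>
      V (dev (mix (x + drift mu x))) \<le> (1 - \<delta>) * V (dev x) + C * t\<^sup>2 * (norm x)\<^sup>2"
proof -
  obtain \<delta> where \<delta>: "0 < \<delta>" "\<delta> \<le> 1" "\<And>x::real^('n \<times> 'm). \<delta> * (norm (dev x))\<^sup>2 \<le> defect x"
    by (rule defect_lower) blast
  obtain K where K: "0 < K" "\<And>x::real^('n \<times> 'm). norm (dev x) \<le> K * norm x" by (rule dev_bound) blast
  define C where "C = (1 + 2 / \<delta>) * K\<^sup>2 * lip\<^sup>2 + 1"
  have C: "0 < C" unfolding C_def using \<delta> by (intro add_nonneg_pos mult_nonneg_nonneg) auto
  have "V (dev (mix (x + drift mu x))) \<le> (1 - \<delta> / 2) * V (dev x) + C * t\<^sup>2 * (norm x)\<^sup>2"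
    if mu: "\<And>k. 0 \<le> mu k" "\<And>k. mu k \<le> t" for mu t x
  proof -
    define d where "d = drift mu x"
    have "norm d \<le> t * lip * norm x" unfolding d_def by (rule drift_norm[OF mu])
    then have dn: "(norm d)\<^sup>2 \<le> t\<^sup>2 * lip\<^sup>2 * (norm x)\<^sup>2"
      using power_mono[OF _ norm_ge_zero, of d _ 2] by (fastforce simp: power_mult_distrib)
    have "V (dev d) \<le> (norm (dev d))\<^sup>2" by (rule V_le)
    also have "\<dots> \<le> K\<^sup>2 * (norm d)\<^sup>2"
      using power_mono[OF K(2) norm_ge_zero, of d 2] by (simp add: power_mult_distrib)
    also have "\<dots> \<le> K\<^sup>2 * (t\<^sup>2 * lip\<^sup>2 * (norm x)\<^sup>2)" by (intro mult_left_mono dn) simp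
    finally have Vd: "V (dev d) \<le> K\<^sup>2 * (t\<^sup>2 * lip\<^sup>2 * (norm x)\<^sup>2)" .
    have "V (dev (mix (x + d))) = V (dev (x + d)) - defect (dev (x + d))" by (simp add: dev_mix V_mix)
    also have "\<dots> \<le> V (dev (x + d)) - \<delta> * V (dev (x + d))"
    proof -
      have "\<delta> * V (dev (x + d)) \<le> \<delta> * (norm (dev (x + d)))\<^sup>2" using \<delta> V_le by (intro mult_left_mono) auto
      also have "\<dots> \<le> defect (dev (x + d))" using \<delta>(3)[of "x + d"] by (simp add: defect_dev)
      finally show ?thesis by simp
    qed
    also have "\<dots> = (1 - \<delta>) * V (dev x + dev d)" by (simp add: linear_add[OF linear_dev] algebra_simps)
    \<comment> \<open>Young's parameter \<delta> / 2 is small enough to leave a contraction: (1 -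
      \<delta>) (1 + \<delta> / 2) \<le> 1 - \<delta> / 2.\<close>
    also have "\<dots> \<le> (1 - \<delta>) * ((1 + \<delta> / 2) * V (dev x) + (1 + 1 / (\<delta> / 2)) * V (dev d))"
      using \<delta> by (intro mult_left_mono V_add_le) auto
    also have "\<dots> = (1 - \<delta>) * (1 + \<delta> / 2) * V (dev x) + (1 - \<delta>) * ((1 + 2 / \<delta>) * V (dev d))"
      by (simp add: algebra_simps)
    also have "\<dots> \<le> (1 - \<delta> / 2) * V (dev x) + 1 * ((1 + 2 / \<delta>) * (K\<^sup>2 * (t\<^sup>2 * lip\<^sup>2 * (norm x)\<^sup>2)))"
    proof (intro add_mono mult_mono)
      show "0 \<le> (1 + 2 / \<delta>) * V (dev d)" using \<delta> V_nonneg by (intro mult_nonneg_nonneg) auto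
      have "(1 - \<delta>) * (1 + \<delta> / 2) = 1 - \<delta> / 2 - \<delta>\<^sup>2 / 2" by (simp add: power2_eq_square field_simps)
      then show "(1 - \<delta>) * (1 + \<delta> / 2) \<le> 1 - \<delta> / 2" by simp
    qed (use \<delta> Vd V_nonneg in auto)
    also have "\<dots> \<le> (1 - \<delta> / 2) * V (dev x) + C * t\<^sup>2 * (norm x)\<^sup>2"
      by (simp add: C_def algebra_simps)
    finally show ?thesis unfolding d_def .
  qed
  then show ?thesis using that[of "\<delta> / 2" C] \<delta> C by auto
qed

text \<open>Linearising each gradient at its minimiser costs the square of the error, by the
  Lipschitz Hessian; replacing each agent's error by its group centroid costs the deviation.\<close>

lemma centroid_step:
  obtains C where "0 < C"
    "\<And>mu t x. 0 < t \<Longrightarrow> \<forall>k. 0 \<le> mu k \<Longrightarrow> \<forall>k. mu k \<le> t \<Longrightarrow> mu_max mu = t \<Longrightarrow>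
      norm (cent (drift mu x) + t *\<^sub>R (Hbar J wo grp p mu *v cent x)) \<le> C * t * (norm (dev x) + (norm x)\<^sup>2)"
proof -
  define C where "C = real CARD('n) * (kappaH + lip) + 1"
  have C: "0 < C" unfolding C_def using kappaH_nonneg lip_nonneg by (intro add_nonneg_pos) auto
  have "norm (cent (drift mu x) + t *\<^sub>R (Hbar J wo grp p mu *v cent x)) \<le> C * t * (norm (dev x) + (norm x)\<^sup>2)"
    if t: "0 < t" and mu: "\<And>k. 0 \<le> mu k" "\<And>k. mu k \<le> t" and max: "mu_max mu = t" for mu t x
  proof -
    define e where "e = cent (drift mu x) + t *\<^sub>R (Hbar J wo grp p mu *v cent x)"
    \<comment> \<open>The error of agent k in both replacements; block m of e is the sum of these
      with weights p k * mu k over the group.\<close>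
    define r where "r k = grd k (blk x k) + hessian (J k) (wo k) *v blk (cent x) (grp k)" for k
    have r: "norm (r k) \<le> kappaH * (norm x)\<^sup>2 + lip * norm (dev x)" for k
    proof -
      have "r k = (grd k (blk x k) + hessian (J k) (wo k) *v blk x k) - hessian (J k) (wo k) *v blk (dev x) k"
        by (simp add: r_def blk_dev vec.diff)
      then have "norm (r k) \<le> norm (grd k (blk x k) + hessian (J k) (wo k) *v blk x k) + norm (hessian (J k) (wo k) *v blk (dev x) k)"
        by (simp only:) (rule norm_triangle_ineq4)
      also have "\<dots> \<le> kappaH * (norm (blk x k))\<^sup>2 + lip * norm (blk (dev x) k)"
        by (intro add_mono grd_quadratic hessian_norm)
      also have "\<dots> \<le> kappaH * (norm x)\<^sup>2 + lip * norm (dev x)"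
        by (intro add_mono mult_left_mono power_mono norm_blk_le kappaH_nonneg lip_nonneg) simp
      finally show ?thesis .
    qed
    have be: "blk e m = (\<Sum>k\<in>grp -` {m}. (p k * mu k) *\<^sub>R r k)" for m
    proof -
      have "t *\<^sub>R blk (Hbar J wo grp p mu *v cent x) m
          = (\<Sum>k\<in>grp -` {m}. (p k * mu k) *\<^sub>R (hessian (J k) (wo k) *v blk (cent x) m))"
        unfolding Hbar_blk max scaleR_sum_right using t by (intro sum.cong) auto
      moreover have "(\<Sum>k\<in>grp -` {m}. (p k * mu k) *\<^sub>R r k)
          = (\<Sum>k\<in>grp -` {m}. (p k * mu k) *\<^sub>R grd k (blk x k) + (p k * mu k) *\<^sub>R (hessian (J k) (wo k) *v blk (cent x) m))"
        by (intro sum.cong) (auto simp: r_def scaleR_add_right)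
      ultimately show ?thesis by (simp add: e_def blk_cent blk_drift sum.distrib)
    qed
    have "norm e \<le> (\<Sum>m\<in>UNIV. norm (blk e m))" by (rule norm_le_sum_blk)
    also have "\<dots> \<le> (\<Sum>m\<in>UNIV. \<Sum>k\<in>{k \<in> UNIV. grp k = m}. t * (kappaH * (norm x)\<^sup>2 + lip * norm (dev x)))"
    proof (rule sum_mono)
      fix m
      have "norm (blk e m) \<le> (\<Sum>k\<in>grp -` {m}. norm ((p k * mu k) *\<^sub>R r k))" unfolding be by (rule norm_sum)
      also have "\<dots> \<le> (\<Sum>k\<in>grp -` {m}. t * (kappaH * (norm x)\<^sup>2 + lip * norm (dev x)))"
      proof (rule sum_mono)
        fix k
        have "p k * mu k \<le> 1 * t" using p_le_1 mu less_imp_le[OF p_pos] by (intro mult_mono) auto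
        then have "\<bar>p k * mu k\<bar> \<le> t" using p_pos[of k] mu(1)[of k] by simp
        then show "norm ((p k * mu k) *\<^sub>R r k) \<le> t * (kappaH * (norm x)\<^sup>2 + lip * norm (dev x))"
          unfolding norm_scaleR using r t by (intro mult_mono) auto
      qed
      also have "grp -` {m} = {k \<in> UNIV. grp k = m}" by auto
      finally show "norm (blk e m) \<le> (\<Sum>k\<in>{k \<in> UNIV. grp k = m}. t * (kappaH * (norm x)\<^sup>2 + lip * norm (dev x)))" .
    qed
    also have "\<dots> = (\<Sum>k\<in>(UNIV::'n set). t * (kappaH * (norm x)\<^sup>2 + lip * norm (dev x)))"
      by (rule sum.group) auto
    also have "\<dots> = real CARD('n) * t * (kappaH * (norm x)\<^sup>2 + lip * norm (dev x))" by simp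
    also have "\<dots> \<le> real CARD('n) * t * ((kappaH + lip) * (norm (dev x) + (norm x)\<^sup>2))"
      using t kappaH_nonneg lip_nonneg by (intro mult_left_mono) (auto simp: algebra_simps)
    also have "\<dots> \<le> C * t * (norm (dev x) + (norm x)\<^sup>2)"
      using t by (simp add: C_def algebra_simps)
    finally show ?thesis unfolding e_def .
  qed
  then show ?thesis using that C by blast
qed

end

section \<open>Iterated limits and the Lyapunov fixed point\<close>

text \<open>The iterated limit as one filter: how large i must be may depend on t. A nonnegative
  function tends to 0 along it exactly when its limsup over i tends to 0 with t, and the general
  facts on limits and the coupling theorem apply to it directly.\<close>

definition small_step :: "(real \<times> nat) filter" where
  "small_step = Abs_filter (\<lambda>P. \<forall>\<^sub>F t in at_right 0. \<forall>\<^sub>F i in sequentially. P (t, i))"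

lemma eventually_small_step:
  "eventually P small_step \<longleftrightarrow> (\<forall>\<^sub>F t in at_right 0. \<forall>\<^sub>F i in sequentially. P (t, i))"
  unfolding small_step_def
proof (rule eventually_Abs_filter, rule is_filter.intro)
  show "\<forall>\<^sub>F t in at_right (0::real). \<forall>\<^sub>F i in sequentially. True" by simp
next
  fix P Q :: "real \<times> nat \<Rightarrow> bool"
  assume "\<forall>\<^sub>F t in at_right 0. \<forall>\<^sub>F i in sequentially. P (t, i)"
    "\<forall>\<^sub>F t in at_right 0. \<forall>\<^sub>F i in sequentially. Q (t, i)"
  then show "\<forall>\<^sub>F t in at_right 0. \<forall>\<^sub>F i in sequentially. P (t, i) \<and> Q (t, i)"
    by eventually_elim (rule eventually_conj)
next
  fix P Q :: "real \<times> nat \<Rightarrow> bool"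
  assume i: "\<forall>x. P x \<longrightarrow> Q x" and "\<forall>\<^sub>F t in at_right 0. \<forall>\<^sub>F i in sequentially. P (t, i)"
  from this(2) show "\<forall>\<^sub>F t in at_right 0. \<forall>\<^sub>F i in sequentially. Q (t, i)"
    by eventually_elim (use i in \<open>auto elim: eventually_mono\<close>)
qed

lemma eventually_small_stepI:
  assumes "0 < t0" "\<And>t. 0 < t \<Longrightarrow> t < t0 \<Longrightarrow> \<forall>\<^sub>F i in sequentially. P (t, i)"
  shows "eventually P small_step"
  unfolding eventually_small_step eventually_at_right_field using assms by blast

lemma small_step_fst_tendsto: "((\<lambda>(t, i). f t) \<longlongrightarrow> l) small_step" if "(f \<longlongrightarrow> l) (at_right 0)"
proof (rule topological_tendstoI)
  fix S assume "open S" "l \<in> S"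
  then have "\<forall>\<^sub>F t in at_right 0. f t \<in> S" using that by (rule topological_tendstoD[rotated 1])
  then show "\<forall>\<^sub>F x in small_step. (case x of (t, i) \<Rightarrow> f t) \<in> S"
    unfolding eventually_small_step by eventually_elim simp
qed

lemma small_step_snd_tendsto:
  assumes "\<And>t. 0 < t \<Longrightarrow> (f t \<longlongrightarrow> l) sequentially"
  shows "((\<lambda>(t, i). f t i) \<longlongrightarrow> l) small_step"
proof (rule topological_tendstoI)
  fix S assume S: "open S" "l \<in> S"
  show "\<forall>\<^sub>F x in small_step. (case x of (t, i) \<Rightarrow> f t i) \<in> S"
    by (rule eventually_small_stepI[of 1]) (use topological_tendstoD[OF assms S] in auto)
qed

text \<open>Shifting i is harmless since i goes to infinity for each t; this absorbs the shifted
  time index of \<open>atc\<close>.\<close>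

lemma small_step_Suc:
  assumes "eventually P small_step"
  shows "\<forall>\<^sub>F x in small_step. P (fst x, Suc (snd x))"
  using assms unfolding eventually_small_step
  by eventually_elim (simp add: eventually_sequentially_Suc[of "\<lambda>i. P (_, i)"])

lemma small_step_tendsto_Suc:
  assumes "((\<lambda>(t, i). f t i) \<longlongrightarrow> l) small_step"
  shows "((\<lambda>(t, i). f t (Suc i)) \<longlongrightarrow> l) small_step"
proof (rule topological_tendstoI)
  fix S assume S: "open S" "l \<in> S"
  from small_step_Suc[OF topological_tendstoD[OF assms S]]
  show "\<forall>\<^sub>F x in small_step. (case x of (t, i) \<Rightarrow> f t (Suc i)) \<in> S" by (simp add: case_prod_beta)
qed

text \<open>Distances to the fixed point b / r shrink geometrically. The recursion is assumed for
  large i only, because the inputs that make up b are themselves controlled only there.\<close>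

lemma affine_recursion_eventually:
  fixes a :: "nat \<Rightarrow> real"
  assumes rec: "\<forall>\<^sub>F i in sequentially. a (Suc i) \<le> (1 - r) * a i + b"
    and r: "0 < r" "r \<le> 1" and e: "0 < e"
  shows "\<forall>\<^sub>F i in sequentially. a i \<le> b / r + e"
proof -
  obtain N where N: "\<And>i. N \<le> i \<Longrightarrow> a (Suc i) \<le> (1 - r) * a i + b"
    using rec unfolding eventually_sequentially by blast
  have bound: "a (N + i) \<le> b / r + (1 - r) ^ i * (a N - b / r)" for i
  proof (induction i)
    case (Suc i)
    have "a (N + Suc i) \<le> (1 - r) * a (N + i) + b" using N[of "N + i"] by simp
    also have "\<dots> \<le> (1 - r) * (b / r + (1 - r) ^ i * (a N - b / r)) + b"
      using r by (intro add_right_mono mult_left_mono Suc.IH) simp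
    also have "\<dots> = b / r + (1 - r) ^ Suc i * (a N - b / r)"
      using r by (simp add: field_simps)
    finally show ?case .
  qed simp
  have "(\<lambda>i. b / r + (1 - r) ^ i * (a N - b / r)) \<longlonglongrightarrow> b / r + 0 * (a N - b / r)"
    by (intro tendsto_intros LIMSEQ_power_zero) (use r in simp)
  then have "\<forall>\<^sub>F i in sequentially. b / r + (1 - r) ^ i * (a N - b / r) < b / r + e"
    by (rule order_tendstoD(2)) (use e in simp)
  then have "\<forall>\<^sub>F i in sequentially. a (N + i) \<le> b / r + e"
  proof eventually_elim
    case (elim i)
    then show ?case using bound[of i] by linarith
  qed
  then show ?thesis
    unfolding eventually_sequentially by (metis add_leE le_add_diff_inverse nat_add_left_cancel_le)
qed

text \<open>Pythagoras: moving B to the other side by its adjoint makes the cross term an inner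
  product of the noise with a predictable vector, which has mean 0.\<close>

lemma (in noise_step) second_moment_add:
  fixes S :: "real^'d \<Rightarrow> real^'e::finite" and B :: "real^'d \<Rightarrow> real^'e"
  assumes S: "linear S" and B: "linear B"
    and y: "y \<in> borel_measurable F" and y2: "integrable M (\<lambda>\<omega>. (norm (y \<omega>))\<^sup>2)"
  shows "integrable M (\<lambda>\<omega>. (norm (S (y \<omega>)))\<^sup>2)" "integrable M (\<lambda>\<omega>. (norm (B (s \<omega>)))\<^sup>2)"
    "integrable M (\<lambda>\<omega>. (norm (S (y \<omega>) + B (s \<omega>)))\<^sup>2)"
    "expectation (\<lambda>\<omega>. (norm (S (y \<omega>) + B (s \<omega>)))\<^sup>2)
      = expectation (\<lambda>\<omega>. (norm (S (y \<omega>)))\<^sup>2) + expectation (\<lambda>\<omega>. (norm (B (s \<omega>)))\<^sup>2)"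
proof -
  have meas: "(\<lambda>\<omega>. L (z \<omega>)) \<in> borel_measurable N"
    if "linear L" "z \<in> borel_measurable N" for L :: "real^'d \<Rightarrow> real^'e" and z and N :: "'a measure"
    using measurable_compose[OF that(2) borel_measurable_continuous_onI[OF linear_continuous_on[OF that(1)[unfolded linear_conv_bounded_linear]]]] .
  have int: "integrable M (\<lambda>\<omega>. (norm (L (z \<omega>)))\<^sup>2)"
    if L: "linear L" and z: "z \<in> borel_measurable M" and z2: "integrable M (\<lambda>\<omega>. (norm (z \<omega>))\<^sup>2)"
    for L :: "real^'d \<Rightarrow> real^'e" and z
  proof -
    obtain K where K: "0 < K" "\<And>x. norm (L x) \<le> K * norm x" using linear_bounded_pos[OF L] by blast
    note [measurable] = meas[OF L z]
    show ?thesis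
    proof (rule Bochner_Integration.integrable_bound)
      show "integrable M (\<lambda>\<omega>. K\<^sup>2 * (norm (z \<omega>))\<^sup>2)" using z2 by simp
      show "AE \<omega> in M. norm ((norm (L (z \<omega>)))\<^sup>2) \<le> norm (K\<^sup>2 * (norm (z \<omega>))\<^sup>2)"
        using power_mono[OF K(2) norm_ge_zero, of _ 2] by (simp add: power_mult_distrib)
    qed measurable
  qed
  note ym = F_meas[OF y]
  show i1: "integrable M (\<lambda>\<omega>. (norm (S (y \<omega>)))\<^sup>2)" by (rule int[OF S ym y2])
  show i2: "integrable M (\<lambda>\<omega>. (norm (B (s \<omega>)))\<^sup>2)" by (rule int[OF B s_meas(1)]) (use s_power[of 2] in simp)
  define G where "G \<omega> = adjoint B (S (y \<omega>))" for \<omega>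
  have G: "S (y \<omega>) \<bullet> B (s \<omega>) = G \<omega> \<bullet> s \<omega>" for \<omega>
    using adjoint_works[OF B, of "s \<omega>" "S (y \<omega>)"] by (simp add: G_def inner_commute)
  have GF: "G \<in> borel_measurable F"
    unfolding G_def[abs_def]
    by (rule measurable_compose[OF meas[OF S y] borel_measurable_continuous_onI])
      (intro linear_continuous_on adjoint_linear[OF B, unfolded linear_conv_bounded_linear])
  have G2: "integrable M (\<lambda>\<omega>. (norm (G \<omega>))\<^sup>2)"
  proof -
    obtain K where K: "0 < K" "\<And>x. norm (adjoint B x) \<le> K * norm x"
      using linear_bounded_pos[OF adjoint_linear[OF B]] by blast
    note [measurable] = F_meas[OF GF]
    show ?thesis
    proof (rule Bochner_Integration.integrable_bound)
      show "integrable M (\<lambda>\<omega>. K\<^sup>2 * (norm (S (y \<omega>)))\<^sup>2)" using i1 by simp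
      show "AE \<omega> in M. norm ((norm (G \<omega>))\<^sup>2) \<le> norm (K\<^sup>2 * (norm (S (y \<omega>)))\<^sup>2)"
        using power_mono[OF K(2) norm_ge_zero, of _ 2] by (simp add: power_mult_distrib G_def)
    qed measurable
  qed
  note c = centered_inner[OF GF G2]
  have eq: "(norm (S (y \<omega>) + B (s \<omega>)))\<^sup>2 = (norm (S (y \<omega>)))\<^sup>2 + 2 * (G \<omega> \<bullet> s \<omega>) + (norm (B (s \<omega>)))\<^sup>2" for \<omega>
    unfolding G[symmetric] by (simp add: power2_norm_eq_inner inner_add_left inner_add_right inner_commute)
  show "integrable M (\<lambda>\<omega>. (norm (S (y \<omega>) + B (s \<omega>)))\<^sup>2)" unfolding eq using i1 i2 c by simp
  show "expectation (\<lambda>\<omega>. (norm (S (y \<omega>) + B (s \<omega>)))\<^sup>2)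
      = expectation (\<lambda>\<omega>. (norm (S (y \<omega>)))\<^sup>2) + expectation (\<lambda>\<omega>. (norm (B (s \<omega>)))\<^sup>2)"
    unfolding eq using i1 i2 c by simp
qed

section \<open>The Gaussian as an approximate fixed point, and contraction of the argument\<close>

lemma exp_step_bound:
  fixes a b :: real
  assumes "a \<le> 1" "0 \<le> b"
  shows "\<bar>exp (a - b) * (1 - a) - 1\<bar> \<le> a\<^sup>2 + b + \<bar>a\<bar> * b"
proof -
  \<comment> \<open>Both sides rest on 1 + z \<le> exp z: here at - a, giving the upper bound 1, and
    below at a - b.\<close>
  have "exp (a - b) * (1 - a) \<le> exp a * exp (- a)"
    using assms exp_ge_add_one_self[of "- a"] by (intro mult_mono) auto
  then have up: "exp (a - b) * (1 - a) \<le> 1" by (simp flip: exp_add)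
  have "(1 + (a - b)) * (1 - a) \<le> exp (a - b) * (1 - a)"
    using assms exp_ge_add_one_self[of "a - b"] by (intro mult_right_mono) auto
  moreover have "(1 + (a - b)) * (1 - a) - 1 = - a\<^sup>2 - b + a * b" by (simp add: power2_eq_square algebra_simps)
  moreover have "- (\<bar>a\<bar> * b) \<le> a * b" using assms by (simp add: abs_if split: if_splits)
  ultimately have "- (a\<^sup>2 + b + \<bar>a\<bar> * b) \<le> exp (a - b) * (1 - a) - 1" by linarith
  moreover have "0 \<le> a\<^sup>2 + b + \<bar>a\<bar> * b" using assms by simp
  ultimately show ?thesis using up by (simp add: abs_le_iff)
qed

lemma matrix_norm_bound:
  fixes B :: "real^'a::finite^'b::finite"
  obtains L where "0 < L" "\<And>v. norm (B *v v) \<le> L * norm v"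
  using linear_bounded_pos[OF matrix_vector_mul_linear[of B]] by blast

text \<open>The Lyapunov equation makes \<open>exp (- v \<bullet> \<Phi> v / 2)\<close> a fixed point, up to \<open>O(t\<^sup>2)\<close>, of the
  one-step map of characteristic functions.\<close>

lemma gaussian_step:
  fixes H R \<Phi> :: "real^'a::finite^'a"
  assumes H: "transpose H = H" and \<Phi>: "transpose \<Phi> = \<Phi>" "\<And>v. 0 \<le> v \<bullet> (\<Phi> *v v)"
    and sol: "is_lyapunov_solution H R \<Phi>" and R: "\<And>v. 0 \<le> v \<bullet> (R *v v)" and K: "0 < K"
  obtains C t0 where "0 < C" "0 < t0" "t0 \<le> 1"
    "\<And>t v. 0 < t \<Longrightarrow> t < t0 \<Longrightarrow> norm v \<le> K \<Longrightarrow>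
      0 \<le> 1 - t * (v \<bullet> (R *v v)) / 2 \<and> 1 - t * (v \<bullet> (R *v v)) / 2 \<le> 1 \<and>
      \<bar>exp (- ((v - t *\<^sub>R (H *v v)) \<bullet> (\<Phi> *v (v - t *\<^sub>R (H *v v))) / 2)) * (1 - t * (v \<bullet> (R *v v)) / 2)
        - exp (- (v \<bullet> (\<Phi> *v v) / 2))\<bar> \<le> C * t\<^sup>2 * norm v"
proof -
  obtain LR where LR: "0 < LR" "\<And>v. norm (R *v v) \<le> LR * norm v" by (rule matrix_norm_bound) blast
  obtain LH where LH: "0 < LH" "\<And>v. norm (H *v v) \<le> LH * norm v" by (rule matrix_norm_bound) blast
  obtain L\<Phi> where L\<Phi>: "0 < L\<Phi>" "\<And>v. norm (\<Phi> *v v) \<le> L\<Phi> * norm v" by (rule matrix_norm_bound) blast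
  have form: "u \<bullet> (B *v u) \<le> L * (norm u)\<^sup>2" if "\<And>v. norm (B *v v) \<le> L * norm v" for L and B :: "real^'a^'a" and u
  proof -
    have "u \<bullet> (B *v u) \<le> norm u * norm (B *v u)" by (rule norm_cauchy_schwarz)
    also have "\<dots> \<le> norm u * (L * norm u)" by (intro mult_left_mono that) simp
    finally show ?thesis by (simp add: power2_eq_square algebra_simps)
  qed
  \<comment> \<open>What remains after t^2 |v| has been taken out of (t LR |v|^2)^2 + 2 t^2 L\<Phi>
    LH^2 |v|^2, with the surplus powers of |v| replaced by K. The bound on t below ensures a \<le>
    1.\<close>
  define C where "C = LR\<^sup>2 * K ^ 3 + 2 * L\<Phi> * LH\<^sup>2 * K"
  define t0 where "t0 = min 1 (1 / (LR * K\<^sup>2))"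
  have C: "0 < C" unfolding C_def using LR LH L\<Phi> K by (intro add_pos_pos mult_pos_pos) auto
  have t0: "0 < t0" "t0 \<le> 1" using LR K by (auto simp: t0_def)
  have "0 \<le> 1 - t * (v \<bullet> (R *v v)) / 2 \<and> 1 - t * (v \<bullet> (R *v v)) / 2 \<le> 1 \<and>
      \<bar>exp (- ((v - t *\<^sub>R (H *v v)) \<bullet> (\<Phi> *v (v - t *\<^sub>R (H *v v))) / 2)) * (1 - t * (v \<bullet> (R *v v)) / 2)
        - exp (- (v \<bullet> (\<Phi> *v v) / 2))\<bar> \<le> C * t\<^sup>2 * norm v"
    if t: "0 < t" "t < t0" and v: "norm v \<le> K" for t v
  proof -
    define a b where "a = t * (v \<bullet> (R *v v)) / 2" and "b = t\<^sup>2 * ((H *v v) \<bullet> (\<Phi> *v (H *v v))) / 2"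
    have b0: "0 \<le> b" using \<Phi>(2)[of "H *v v"] by (simp add: b_def)
    have a0: "0 \<le> a" using R t by (simp add: a_def)
    have va: "a \<le> t * LR * (norm v)\<^sup>2"
    proof -
      have "t * (v \<bullet> (R *v v)) \<le> t * (LR * (norm v)\<^sup>2)" using t by (intro mult_left_mono form LR) simp
      moreover have "a \<le> t * (v \<bullet> (R *v v))" using a0 by (simp add: a_def)
      ultimately show ?thesis by simp
    qed
    also have "\<dots> \<le> t * LR * K\<^sup>2" using t LR v by (intro mult_left_mono power_mono) auto
    also have "\<dots> \<le> 1" using t LR K by (simp add: t0_def field_simps)
    finally have a1: "a \<le> 1" .
    have vb: "b \<le> t\<^sup>2 * (L\<Phi> * LH\<^sup>2 * (norm v)\<^sup>2)"
    proof -
      have "(H *v v) \<bullet> (\<Phi> *v (H *v v)) \<le> L\<Phi> * (norm (H *v v))\<^sup>2" by (rule form[OF L\<Phi>(2)])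
      also have "\<dots> \<le> L\<Phi> * (LH * norm v)\<^sup>2" using L\<Phi> LH by (intro mult_left_mono power_mono) auto
      finally have "b \<le> t\<^sup>2 * (L\<Phi> * (LH * norm v)\<^sup>2) / 2"
        unfolding b_def by (intro divide_right_mono mult_left_mono) auto
      also have "\<dots> \<le> t\<^sup>2 * (L\<Phi> * (LH * norm v)\<^sup>2)" using L\<Phi> by simp
      finally show ?thesis by (simp add: power_mult_distrib mult.assoc)
    qed
    \<comment> \<open>Expanding the form at v - t H v, the term linear in t is - t (v \<bullet> R v)
      by the Lyapunov equation. In the exponent it becomes + a, which cancels the factor 1 - a to
      first order.\<close>
    have expo: "- ((v - t *\<^sub>R (H *v v)) \<bullet> (\<Phi> *v (v - t *\<^sub>R (H *v v))) / 2) = - (v \<bullet> (\<Phi> *v v) / 2) + (a - b)"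
    proof -
      have "v \<bullet> (R *v v) = (H *v v) \<bullet> (\<Phi> *v v) + v \<bullet> (\<Phi> *v (H *v v))"
        using sol lyapunov_form[OF H, of v \<Phi>] by (simp add: is_lyapunov_solution_def)
      then show ?thesis
        by (simp add: a_def b_def matrix_vector_mult_diff_distrib matrix_vector_mult_scaleR inner_diff_left
            inner_diff_right power2_eq_square algebra_simps diff_divide_distrib add_divide_distrib)
    qed
    have "exp (- ((v - t *\<^sub>R (H *v v)) \<bullet> (\<Phi> *v (v - t *\<^sub>R (H *v v))) / 2)) * (1 - a) - exp (- (v \<bullet> (\<Phi> *v v) / 2))
        = exp (- (v \<bullet> (\<Phi> *v v) / 2)) * (exp (a - b) * (1 - a) - 1)"
      unfolding expo exp_add by (simp add: algebra_simps)
    then have "\<bar>exp (- ((v - t *\<^sub>R (H *v v)) \<bullet> (\<Phi> *v (v - t *\<^sub>R (H *v v))) / 2)) * (1 - a) - exp (- (v \<bullet> (\<Phi> *v v) / 2))\<bar>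
        = exp (- (v \<bullet> (\<Phi> *v v) / 2)) * \<bar>exp (a - b) * (1 - a) - 1\<bar>" by (simp add: abs_mult)
    also have "\<dots> \<le> 1 * (a\<^sup>2 + b + \<bar>a\<bar> * b)"
      by (intro mult_mono exp_step_bound a1 b0) (use \<Phi>(2) in auto)
    also have "\<dots> \<le> a\<^sup>2 + 2 * b" using mult_right_mono[OF a1 b0] a0 by simp
    also have "\<dots> \<le> (t * LR * (norm v)\<^sup>2)\<^sup>2 + 2 * (t\<^sup>2 * (L\<Phi> * LH\<^sup>2 * (norm v)\<^sup>2))"
      using va vb a0 by (intro add_mono power_mono) auto
    also have "\<dots> = t\<^sup>2 * norm v * (LR\<^sup>2 * norm v ^ 3 + 2 * L\<Phi> * LH\<^sup>2 * norm v)"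
      by (simp add: power_mult_distrib eval_nat_numeral algebra_simps)
    also have "\<dots> \<le> t\<^sup>2 * norm v * C"
      unfolding C_def using v LR LH L\<Phi> by (intro mult_left_mono add_mono power_mono) auto
    finally show ?thesis using a0 a1 by (simp add: a_def mult.commute mult.left_commute)
  qed
  then show ?thesis using that C t0 by blast
qed

text \<open>The square |v - t H v|^2 loses 2 t e |v|^2 and gains at most t^2 L^2 |v|^2; for t L^2
  \<le> e half of the loss survives, which amounts to the rate e / 2 for the norm.\<close>

lemma spd_contraction:
  fixes H :: "real^'a::finite^'a"
  assumes "sym_pos_def H"
  obtains l t0 where "0 < l" "0 < t0" "\<And>t v. 0 < t \<Longrightarrow> t < t0 \<Longrightarrow> norm (v - t *\<^sub>R (H *v v)) \<le> (1 - t * l) * norm v"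
    "t0 * l \<le> 1"
proof -
  obtain e where e: "0 < e" "\<And>v. e * (norm v)\<^sup>2 \<le> v \<bullet> (H *v v)"
  proof (rule homogeneous_lower_bound[of "\<lambda>v. v \<bullet> (H *v v)"])
    show "continuous_on UNIV (\<lambda>v. v \<bullet> (H *v v))"
      by (intro continuous_intros matrix_vector_mult_linear_continuous_on)
    show "(c *\<^sub>R x) \<bullet> (H *v (c *\<^sub>R x)) = c\<^sup>2 * (x \<bullet> (H *v x))" for c x
      by (simp add: matrix_vector_mult_scaleR power2_eq_square)
  qed (use assms in \<open>auto simp: sym_pos_def_def\<close>)
  obtain L where L: "0 < L" "\<And>v. norm (H *v v) \<le> L * norm v" by (rule matrix_norm_bound) blast
  \<comment> \<open>First bound: the quadratic term is absorbed. Second bound: the factor 1 - t e /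
    2 stays nonnegative.\<close>
  define t0 where "t0 = min (e / L\<^sup>2) (2 / e)"
  have "norm (v - t *\<^sub>R (H *v v)) \<le> (1 - t * (e / 2)) * norm v" if t: "0 < t" "t < t0" for t v
  proof -
    have te: "t * (e / 2) \<le> 1" and tL: "t * L\<^sup>2 \<le> e" using t e L by (auto simp: t0_def field_simps)
    have "(norm (v - t *\<^sub>R (H *v v)))\<^sup>2 = (norm v)\<^sup>2 - 2 * t * (v \<bullet> (H *v v)) + t\<^sup>2 * (norm (H *v v))\<^sup>2"
      unfolding power2_norm_eq_inner
      by (simp add: inner_diff_left inner_diff_right inner_commute power2_eq_square algebra_simps)
    also have "\<dots> \<le> (norm v)\<^sup>2 - 2 * t * (e * (norm v)\<^sup>2) + t\<^sup>2 * (L * norm v)\<^sup>2"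
      using t e(2)[of v] power_mono[OF L(2) norm_ge_zero, of v 2]
      by (intro add_mono diff_left_mono mult_left_mono) auto
    also have "\<dots> = (norm v)\<^sup>2 * (1 - 2 * t * e + t * (t * L\<^sup>2))" by (simp add: power2_eq_square algebra_simps)
    also have "\<dots> \<le> (norm v)\<^sup>2 * (1 - t * (e / 2))\<^sup>2"
    proof (rule mult_left_mono)
      have "t * (t * L\<^sup>2) \<le> t * e" using t tL by (intro mult_left_mono) auto
      moreover have "(1 - t * (e / 2))\<^sup>2 = 1 - t * e + (t * (e / 2))\<^sup>2" by (simp add: power2_eq_square algebra_simps)
      ultimately show "1 - 2 * t * e + t * (t * L\<^sup>2) \<le> (1 - t * (e / 2))\<^sup>2"
        using zero_le_power2[of "t * (e / 2)"] by linarith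
    qed simp
    finally have "(norm (v - t *\<^sub>R (H *v v)))\<^sup>2 \<le> ((1 - t * (e / 2)) * norm v)\<^sup>2"
      by (simp add: power_mult_distrib mult.commute)
    then show ?thesis by (rule power2_le_imp_le) (use te in simp)
  qed
  moreover have "0 < t0" "t0 * (e / 2) \<le> 1" using e L by (auto simp: t0_def min_def field_simps)
  ultimately show ?thesis using that[of "e / 2" t0] e by auto
qed

section \<open>The error process for a fixed step-size\<close>

lemma linear_borel_measurable:
  fixes L :: "'v::euclidean_space \<Rightarrow> 'w::real_normed_vector"
  assumes "linear L" "z \<in> borel_measurable N"
  shows "(\<lambda>\<omega>. L (z \<omega>)) \<in> borel_measurable N"
  using measurable_compose[OF assms(2) borel_measurable_continuous_onI[OF linear_continuous_on[OF assms(1)[unfolded linear_conv_bounded_linear]]]] .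

lemma Mmat_norm:
  fixes x :: "real^('n::finite \<times> 'm::finite)"
  assumes "\<And>k. 0 \<le> mu k" "\<And>k. mu k \<le> t"
  shows "norm (Mmat mu *v x) \<le> t * norm x"
proof -
  have t: "0 \<le> t" using assms order_trans by blast
  have "(norm (Mmat mu *v x))\<^sup>2 \<le> (\<Sum>k\<in>UNIV. t\<^sup>2 * (norm (blk x k))\<^sup>2)"
    unfolding norm_sq_blk[of "Mmat mu *v x"] Mmat_blk norm_scaleR power_mult_distrib power2_abs
    by (intro sum_mono mult_right_mono power_mono assms) simp
  also have "\<dots> = (t * norm x)\<^sup>2" unfolding power_mult_distrib norm_sq_blk[of x] by (rule sum_distrib_left[symmetric])
  finally show ?thesis by (rule power2_le_imp_le) (use t in simp)
qed

locale diffusion_run = diffusion Nb grp A p J wo lamL lamU kappaH c + prob_space M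
  for Nb :: "'n::finite \<Rightarrow> 'n set" and grp :: "'n \<Rightarrow> 'g::finite" and A :: "real^'n^'n" and p
    and J :: "'n \<Rightarrow> real^'m::finite \<Rightarrow> real" and wo :: "'n \<Rightarrow> real^'m"
    and lamL lamU :: "'n \<Rightarrow> real" and kappaH c :: real and M :: "'a measure" +
  fixes F :: "nat \<Rightarrow> 'a measure" and ghat :: "'n \<Rightarrow> nat \<Rightarrow> 'a \<Rightarrow> real^'m \<Rightarrow> real^'m"
    and mu :: "'n \<Rightarrow> real" and t :: real and Rs :: "real^('n \<times> 'm)^('n \<times> 'm)" and \<alpha> \<sigma> \<kappa> \<gamma> :: real
  assumes wo_group: "grp k = grp l \<Longrightarrow> wo k = wo l"
    and ghat_meas: "(\<lambda>(\<omega>, x). ghat k i \<omega> x) \<in> borel_measurable (M \<Otimes>\<^sub>M borel)"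
    and t_pos: "0 < t" and mu_lower: "c * t \<le> mu k" and mu_max_t: "mu_max mu = t"
    and noise: "noise_assumptions M F J ghat (col wo) \<alpha> \<sigma> \<kappa> \<gamma> Rs"
    and adapted: "(\<lambda>\<omega>. col (atc Nb grp A ghat mu i \<omega>)) \<in> borel_measurable (F i)"
begin

text \<open>With the time shift of \<open>atc\<close>, this is the error entering iteration i;
  \<open>err 0\<close> is the error of the zero start.\<close>

definition err :: "nat \<Rightarrow> 'a \<Rightarrow> real^('n \<times> 'm)" where
  "err i \<omega> = col wo - col (atc Nb grp A ghat mu i \<omega>)"

definition ns :: "nat \<Rightarrow> 'a \<Rightarrow> real^('n \<times> 'm)" where
  "ns i \<omega> = grad_noise J ghat i (col (atc Nb grp A ghat mu i \<omega>)) \<omega>"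

definition nso :: "nat \<Rightarrow> 'a \<Rightarrow> real^('n \<times> 'm)" where
  "nso i \<omega> = grad_noise J ghat i (col wo) \<omega>"

lemma mu_upper: "mu k \<le> t" and mu_nonneg: "0 \<le> mu k"
proof -
  show "mu k \<le> t" unfolding mu_max_t[symmetric] mu_max_def by (rule Max_ge) auto
  have "0 \<le> c * t" using c_pos t_pos by simp
  then show "0 \<le> mu k" using mu_lower[of k] by linarith
qed

text \<open>The minimiser is constant on groups and hence reproduced by averaging, so the error
  satisfies a recursion of its own. Across groups the weights vanish and nothing has to be
  compared.\<close>

lemma err_Suc: "err (Suc i) \<omega> = mix (err i \<omega> + drift mu (err i \<omega>) + Mmat mu *v ns i \<omega>)"
proof (rule blk_eqI)
  fix k
  define w where "w = atc Nb grp A ghat mu i \<omega>"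
  have each: "A $ l $ k *\<^sub>R blk (err i \<omega> + drift mu (err i \<omega>) + Mmat mu *v ns i \<omega>) l
      = A $ l $ k *\<^sub>R wo k - A $ l $ k *\<^sub>R (w l - mu l *\<^sub>R ghat l i \<omega> (w l))" for l
  proof (cases "grp l = grp k")
    case True
    have b: "blk (err i \<omega>) l = wo l - w l" by (simp add: err_def w_def)
    have "blk (err i \<omega> + drift mu (err i \<omega>) + Mmat mu *v ns i \<omega>) l
        = wo l - w l + mu l *\<^sub>R gradient (J l) (w l) + mu l *\<^sub>R (ghat l i \<omega> (w l) - gradient (J l) (w l))"
      by (simp add: blk_drift Mmat_blk b grd_def ns_def grad_noise_def w_def[symmetric])
    also have "\<dots> = wo k - (w l - mu l *\<^sub>R ghat l i \<omega> (w l))"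
      using wo_group[OF True] by (simp add: scaleR_diff_right)
    finally show ?thesis by (simp add: scaleR_diff_right)
  next
    case False
    then show ?thesis using A_zero[of l k] by simp
  qed
  have "blk (mix (err i \<omega> + drift mu (err i \<omega>) + Mmat mu *v ns i \<omega>)) k
      = (\<Sum>l\<in>UNIV. A $ l $ k) *\<^sub>R wo k - (\<Sum>l\<in>UNIV. A $ l $ k *\<^sub>R (w l - mu l *\<^sub>R ghat l i \<omega> (w l)))"
    unfolding blk_mix each sum_subtractf by (simp add: scaleR_sum_left)
  also have "(\<Sum>l\<in>UNIV. A $ l $ k *\<^sub>R (w l - mu l *\<^sub>R ghat l i \<omega> (w l)))
      = (\<Sum>l\<in>Nb k \<inter> grp -` {grp k}. A $ l $ k *\<^sub>R (w l - mu l *\<^sub>R ghat l i \<omega> (w l)))"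
    by (rule sum.mono_neutral_right) (auto simp: A_zero)
  also have "(\<Sum>l\<in>UNIV. A $ l $ k) *\<^sub>R wo k - \<dots> = blk (err (Suc i) \<omega>) k"
    by (simp add: A_sum err_def Let_def w_def)
  finally show "blk (err (Suc i) \<omega>) k = blk (mix (err i \<omega> + drift mu (err i \<omega>) + Mmat mu *v ns i \<omega>)) k" by simp
qed

lemma F_sub: "subalgebra M (F i)"
  using noise by (simp add: noise_assumptions_def)

lemma err_F: "err i \<in> borel_measurable (F i)"
  unfolding err_def[abs_def] using adapted by (intro borel_measurable_diff) auto

lemma err_M [measurable]: "err i \<in> borel_measurable M"
  by (rule measurable_from_subalg[OF F_sub err_F])

text \<open>Joint measurability of the oracle allows a random point to be inserted. The stacked
  vector is written as a sum of embedded blocks so that only linear maps and sums remain.\<close>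

lemma grad_noise_meas:
  assumes "W \<in> borel_measurable M"
  shows "(\<lambda>\<omega>. grad_noise J ghat i (W \<omega>) \<omega>) \<in> borel_measurable M"
proof -
  have bW: "(\<lambda>\<omega>. blk (W \<omega>) k) \<in> borel_measurable M" for k
    by (rule linear_borel_measurable[OF linear_blk assms])
  have g: "(\<lambda>\<omega>. ghat k i \<omega> (blk (W \<omega>) k)) \<in> borel_measurable M" for k
    using measurable_compose[OF measurable_Pair[OF measurable_ident_sets[OF refl] bW[of k]] ghat_meas[of k i]] by simp
  have gr: "(\<lambda>\<omega>. gradient (J k) (blk (W \<omega>) k)) \<in> borel_measurable M" for k
    using measurable_compose[OF bW borel_measurable_continuous_onI[OF gradient_continuous]] .
  have lc: "linear (\<lambda>v. col (\<lambda>l. if l = k then v else 0))" for k :: 'n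
    by (rule linearI; rule blk_eqI) auto
  have "grad_noise J ghat i (W \<omega>) \<omega> = (\<Sum>k\<in>UNIV. col (\<lambda>l. if l = k then
      ghat k i \<omega> (blk (W \<omega>) k) - gradient (J k) (blk (W \<omega>) k) else 0))" for \<omega>
  proof (rule blk_eqI)
    fix l
    have "blk (\<Sum>k\<in>UNIV. y k) l = (\<Sum>k\<in>UNIV. blk (y k) l)" for y :: "'n \<Rightarrow> real^('n \<times> 'm)"
      by (rule linear_sum[OF linear_blk])
    then show "blk (grad_noise J ghat i (W \<omega>) \<omega>) l = blk (\<Sum>k\<in>UNIV. col (\<lambda>l. if l = k then
      ghat k i \<omega> (blk (W \<omega>) k) - gradient (J k) (blk (W \<omega>) k) else 0)) l"
      by (simp add: grad_noise_def)
  qed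
  then show ?thesis
    by (simp only:) (intro borel_measurable_sum linear_borel_measurable[OF lc] borel_measurable_diff g gr)
qed

lemma ns_meas: "ns i \<in> borel_measurable M" and nso_meas: "nso i \<in> borel_measurable M"
  unfolding ns_def[abs_def] nso_def[abs_def]
  using grad_noise_meas[OF measurable_from_subalg[OF F_sub adapted]] grad_noise_meas[of "\<lambda>_. col wo"] by simp_all

text \<open>The noise assumptions are used at two predictable points: the current iterate, and the
  constant minimiser, where the bound on the fourth moment loses its dependence on the
  state.\<close>

lemma noise_stepI:
  assumes "integrable M (\<lambda>\<omega>. norm (err i \<omega>) ^ 4)"
  shows "noise_step M (F i) (ns i) (nso i) (err i) \<alpha> \<sigma> \<kappa> \<gamma>"
proof -
  have n: "0 \<le> \<alpha>" "0 \<le> \<sigma>" "0 \<le> \<kappa>" "0 < \<gamma>" using noise by (simp_all add: noise_assumptions_def)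
  have at: "\<forall>W\<in>borel_measurable (F i).
        let s = (\<lambda>\<omega>. grad_noise J ghat i (W \<omega>) \<omega>);
            s\<^sub>o = (\<lambda>\<omega>. grad_noise J ghat i (col wo) \<omega>)
        in (\<forall>a. AE \<omega> in M. real_cond_exp M (F i) (\<lambda>\<omega>'. s \<omega>' $ a) \<omega> = 0) \<and>
           (AE \<omega> in M. nn_cond_exp M (F i) (\<lambda>\<omega>'. ennreal (norm (s \<omega>') ^ 4)) \<omega>
              \<le> ennreal (\<alpha>\<^sup>2 * norm (col wo - W \<omega>) ^ 4 + \<sigma> ^ 4)) \<and>
           (AE \<omega> in M. opnorm (cond_second_moment M (F i) s\<^sub>o \<omega> - cond_second_moment M (F i) s \<omega>)
              \<le> \<kappa> * norm (col wo - W \<omega>) powr \<gamma>)"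
    using noise by (simp add: noise_assumptions_def)
  note c = at[rule_format, OF adapted, unfolded Let_def, folded ns_def nso_def err_def]
  have 1: "AE \<omega> in M. real_cond_exp M (F i) (\<lambda>\<omega>. ns i \<omega> $ a) \<omega> = 0" for a
    by (rule c[THEN conjunct1, rule_format])
  have 2: "AE \<omega> in M. nn_cond_exp M (F i) (\<lambda>\<omega>. ennreal (norm (ns i \<omega>) ^ 4)) \<omega> \<le> ennreal (\<alpha>\<^sup>2 * norm (err i \<omega>) ^ 4 + \<sigma> ^ 4)"
    by (rule c[THEN conjunct2, THEN conjunct1])
  have 3: "AE \<omega> in M. opnorm (cond_second_moment M (F i) (nso i) \<omega> - cond_second_moment M (F i) (ns i) \<omega>)
        \<le> \<kappa> * norm (err i \<omega>) powr \<gamma>"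
  proof -
    have "nso i = grad_noise J ghat i (col wo)" by (simp add: nso_def fun_eq_iff)
    then show ?thesis by (simp only:) (rule c[THEN conjunct2, THEN conjunct2])
  qed
  have "(\<lambda>_. col wo) \<in> borel_measurable (F i)" by simp
  from at[rule_format, OF this]
  have 4: "AE \<omega> in M. nn_cond_exp M (F i) (\<lambda>\<omega>. ennreal (norm (nso i \<omega>) ^ 4)) \<omega> \<le> ennreal (\<sigma> ^ 4)"
    unfolding Let_def nso_def[abs_def] by simp
  show ?thesis
    by (intro noise_step.intro noise_step_axioms.intro prob_space_axioms F_sub err_F ns_meas nso_meas n 1 2 3 4 assms)
qed

text \<open>Finiteness propagates: it makes iteration i a \<open>noise_step\<close>, which bounds
  the fourth moment of its noise, which bounds the next error. No uniformity in i is
  claimed.\<close>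

lemma err_fourth: "integrable M (\<lambda>\<omega>. norm (err i \<omega>) ^ 4)"
proof (induction i)
  case 0
  show ?case by (simp add: err_def)
next
  case (Suc i)
  interpret noise_step M "F i" "ns i" "nso i" "err i" \<alpha> \<sigma> \<kappa> \<gamma> by (rule noise_stepI[OF Suc])
  obtain K where K: "0 < K" "\<And>x::real^('n \<times> 'm). norm (mix x) \<le> K * norm x"
    using linear_bounded_pos[OF linear_mix] by blast
  define B where "B = K * (1 + t * lip + t)"
  have B: "0 \<le> B" using K t_pos lip_nonneg by (simp add: B_def)
  have bound: "norm (err (Suc i) \<omega>) ^ 4 \<le> B ^ 4 * (8 * (norm (err i \<omega>) ^ 4 + norm (ns i \<omega>) ^ 4))" for \<omega>
  proof -
    have "norm (err (Suc i) \<omega>) \<le> K * norm (err i \<omega> + drift mu (err i \<omega>) + Mmat mu *v ns i \<omega>)"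
      unfolding err_Suc by (rule K)
    also have "\<dots> \<le> K * (norm (err i \<omega>) + t * lip * norm (err i \<omega>) + t * norm (ns i \<omega>))"
      using K by (intro mult_left_mono norm_triangle_le add_mono drift_norm Mmat_norm mu_nonneg mu_upper order_refl) auto
    also have "\<dots> \<le> B * (norm (err i \<omega>) + norm (ns i \<omega>))"
    proof -
      have "norm (err i \<omega>) + t * lip * norm (err i \<omega>) + t * norm (ns i \<omega>)
          \<le> (1 + t * lip + t) * (norm (err i \<omega>) + norm (ns i \<omega>))"
        using t_pos lip_nonneg by (simp add: algebra_simps)
      from mult_left_mono[OF this, of K] K show ?thesis unfolding B_def by (simp only: mult.assoc)
    qed
    finally have "norm (err (Suc i) \<omega>) ^ 4 \<le> (B * (norm (err i \<omega>) + norm (ns i \<omega>))) ^ 4" by (rule power_mono) simp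
    also have "\<dots> = B ^ 4 * (norm (err i \<omega>) + norm (ns i \<omega>)) ^ 4" by (rule power_mult_distrib)
    also have "\<dots> \<le> B ^ 4 * (8 * (norm (err i \<omega>) ^ 4 + norm (ns i \<omega>) ^ 4))"
    proof (rule mult_left_mono)
      have sq: "(a + b)\<^sup>2 \<le> 2 * (a\<^sup>2 + b\<^sup>2)" for a b :: real
        using sum_squares_bound[of a b] by (simp add: power2_sum)
      have "(norm (err i \<omega>) + norm (ns i \<omega>)) ^ 4 = ((norm (err i \<omega>) + norm (ns i \<omega>))\<^sup>2)\<^sup>2" by simp
      also have "\<dots> \<le> (2 * ((norm (err i \<omega>))\<^sup>2 + (norm (ns i \<omega>))\<^sup>2))\<^sup>2" by (intro power_mono sq) simp
      also have "\<dots> = 4 * ((norm (err i \<omega>))\<^sup>2 + (norm (ns i \<omega>))\<^sup>2)\<^sup>2"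
        unfolding power_mult_distrib by simp
      also have "\<dots> \<le> 4 * (2 * (((norm (err i \<omega>))\<^sup>2)\<^sup>2 + ((norm (ns i \<omega>))\<^sup>2)\<^sup>2))" by (intro mult_left_mono sq) simp
      finally show "(norm (err i \<omega>) + norm (ns i \<omega>)) ^ 4 \<le> 8 * (norm (err i \<omega>) ^ 4 + norm (ns i \<omega>) ^ 4)" by simp
    qed (use B in simp)
    finally show ?thesis .
  qed
  show ?case
  proof (rule Bochner_Integration.integrable_bound)
    show "integrable M (\<lambda>\<omega>. B ^ 4 * (8 * (norm (err i \<omega>) ^ 4 + norm (ns i \<omega>) ^ 4)))"
      using Suc s_fourth by simp
    show "AE \<omega> in M. norm (norm (err (Suc i) \<omega>) ^ 4) \<le> norm (B ^ 4 * (8 * (norm (err i \<omega>) ^ 4 + norm (ns i \<omega>) ^ 4)))"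
      using bound B by (intro AE_I2) (simp add: abs_of_nonneg)
  qed measurable
qed

lemma noise_step_run: "noise_step M (F i) (ns i) (nso i) (err i) \<alpha> \<sigma> \<kappa> \<gamma>"
  by (rule noise_stepI[OF err_fourth])

section \<open>Recursions for second moments\<close>

definition m2 :: "nat \<Rightarrow> real" where "m2 i = expectation (\<lambda>\<omega>. (norm (err i \<omega>))\<^sup>2)"
definition mV :: "nat \<Rightarrow> real" where "mV i = expectation (\<lambda>\<omega>. V (err i \<omega>))"
definition mD :: "nat \<Rightarrow> real" where "mD i = expectation (\<lambda>\<omega>. V (dev (err i \<omega>)))"

lemma err_sq_int: "integrable M (\<lambda>\<omega>. (norm (err i \<omega>))\<^sup>2)"
  by (rule noise_step.x_power[OF noise_step_run]) simp

lemma err_norm_int: "integrable M (\<lambda>\<omega>. norm (err i \<omega>))"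
  using noise_step.x_power[OF noise_step_run, of 1] by simp

lemma linear_sq_int: "linear L \<Longrightarrow> integrable M (\<lambda>\<omega>. (norm (L (err i \<omega>)))\<^sup>2)"
  for L :: "real^('n \<times> 'm) \<Rightarrow> real^'e::finite"
  using noise_step.second_moment_add(1)[OF noise_step_run _ _ err_F err_sq_int] by blast

lemma linear_rootp_dev: "linear (\<lambda>x. rootp (dev x))"
  using linear_compose[OF linear_dev linear_rootp] by (simp add: o_def)

lemma V_err_int: "integrable M (\<lambda>\<omega>. V (err i \<omega>))" "integrable M (\<lambda>\<omega>. V (dev (err i \<omega>)))"
  unfolding V_def by (rule linear_sq_int[OF linear_rootp], rule linear_sq_int[OF linear_rootp_dev])

lemma mV_le_m2: "mV i \<le> m2 i"
  unfolding mV_def m2_def by (intro integral_mono V_err_int err_sq_int V_le)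

lemma m2_nonneg: "0 \<le> m2 i" unfolding m2_def by simp

lemma y_meas: "(\<lambda>\<omega>. err i \<omega> + drift mu (err i \<omega>)) \<in> borel_measurable (F i)"
  using measurable_compose[OF err_F borel_measurable_continuous_onI[OF continuous_drift[of mu]]] err_F
  by (intro borel_measurable_add)

lemma y_sq: "integrable M (\<lambda>\<omega>. (norm (err i \<omega> + drift mu (err i \<omega>)))\<^sup>2)"
proof (rule Bochner_Integration.integrable_bound)
  show "integrable M (\<lambda>\<omega>. (1 + t * lip)\<^sup>2 * (norm (err i \<omega>))\<^sup>2)" using err_sq_int by simp
  have "(norm (err i \<omega> + drift mu (err i \<omega>)))\<^sup>2 \<le> (1 + t * lip)\<^sup>2 * (norm (err i \<omega>))\<^sup>2" for \<omega>
  proof -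
    have "norm (err i \<omega> + drift mu (err i \<omega>)) \<le> norm (err i \<omega>) + t * lip * norm (err i \<omega>)"
      by (intro norm_triangle_le add_left_mono drift_norm mu_nonneg mu_upper)
    then have "norm (err i \<omega> + drift mu (err i \<omega>)) \<le> (1 + t * lip) * norm (err i \<omega>)" by (simp add: algebra_simps)
    from power_mono[OF this norm_ge_zero, of 2] show ?thesis by (simp only: power_mult_distrib)
  qed
  then show "AE \<omega> in M. norm ((norm (err i \<omega> + drift mu (err i \<omega>)))\<^sup>2) \<le> norm ((1 + t * lip)\<^sup>2 * (norm (err i \<omega>))\<^sup>2)"
    by simp
  show "(\<lambda>\<omega>. (norm (err i \<omega> + drift mu (err i \<omega>)))\<^sup>2) \<in> borel_measurable M"
    using measurable_from_subalg[OF F_sub y_meas] by measurable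
qed

text \<open>The common core of the two recursions that follow, with L the map behind V after
  averaging, or behind V of the deviation after averaging. The noise contributes additively because
  the cross term has mean 0.\<close>

lemma quadratic_rec:
  fixes L :: "real^('n \<times> 'm) \<Rightarrow> real^'e::finite"
  assumes L: "linear L" and int: "integrable M f"
    and step: "\<And>\<omega>. (norm (L (err i \<omega> + drift mu (err i \<omega>))))\<^sup>2 \<le> f \<omega>"
    and K: "\<And>x. (norm (L (Mmat mu *v x)))\<^sup>2 \<le> K * (norm x)\<^sup>2" "0 \<le> K"
  shows "expectation (\<lambda>\<omega>. (norm (L (err i \<omega> + drift mu (err i \<omega>) + Mmat mu *v ns i \<omega>)))\<^sup>2)
    \<le> expectation f + K * (\<alpha> * m2 i + \<sigma>\<^sup>2 + 1)"
proof -
  interpret noise_step M "F i" "ns i" "nso i" "err i" \<alpha> \<sigma> \<kappa> \<gamma> by (rule noise_step_run)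
  have LM: "linear (\<lambda>x. L (Mmat mu *v x))"
    using linear_compose[OF matrix_vector_mul_linear L] by (simp add: o_def)
  note sm = second_moment_add[OF L LM y_meas y_sq]
  have "expectation (\<lambda>\<omega>. (norm (L (err i \<omega> + drift mu (err i \<omega>) + Mmat mu *v ns i \<omega>)))\<^sup>2)
      = expectation (\<lambda>\<omega>. (norm (L (err i \<omega> + drift mu (err i \<omega>))))\<^sup>2) + expectation (\<lambda>\<omega>. (norm (L (Mmat mu *v ns i \<omega>)))\<^sup>2)"
    unfolding linear_add[OF L, of "_ + _"] by (rule sm(4))
  also have "\<dots> \<le> expectation f + expectation (\<lambda>\<omega>. K * (norm (ns i \<omega>))\<^sup>2)"
    by (intro add_mono integral_mono sm(1,2) int step K integrable_mult_right s_power) simp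
  also have "\<dots> \<le> expectation f + K * (\<alpha> * m2 i + \<sigma>\<^sup>2 + 1)"
    using mult_left_mono[OF s_second K(2)] by (simp add: m2_def)
  finally show ?thesis .
qed

lemma mean_square_rec:
  assumes "\<And>x. V (mix (x + drift mu x)) \<le> V x - t * \<eta> * (norm x)\<^sup>2 + C * t\<^sup>2 * (norm x)\<^sup>2"
  shows "mV (Suc i) \<le> mV i - t * \<eta> * m2 i + C * t\<^sup>2 * m2 i + t\<^sup>2 * (\<alpha> * m2 i + \<sigma>\<^sup>2 + 1)"
proof -
  let ?f = "\<lambda>\<omega>. V (err i \<omega>) - t * \<eta> * (norm (err i \<omega>))\<^sup>2 + C * t\<^sup>2 * (norm (err i \<omega>))\<^sup>2"
  have L: "linear (\<lambda>x. rootp (mix x))" using linear_compose[OF linear_mix linear_rootp] by (simp add: o_def)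
  have "mV (Suc i) \<le> expectation ?f + t\<^sup>2 * (\<alpha> * m2 i + \<sigma>\<^sup>2 + 1)"
    unfolding mV_def err_Suc V_def[of "mix _"]
  proof (rule quadratic_rec[OF L])
    show "integrable M ?f" using V_err_int err_sq_int by simp
    show "(norm (rootp (mix (err i \<omega> + drift mu (err i \<omega>)))))\<^sup>2 \<le> ?f \<omega>" for \<omega>
      using assms[of "err i \<omega>"] by (simp add: V_def)
    show "(norm (rootp (mix (Mmat mu *v x))))\<^sup>2 \<le> t\<^sup>2 * (norm x)\<^sup>2" for x
    proof -
      have "V (mix (Mmat mu *v x)) \<le> V (Mmat mu *v x)" using V_mix[of "Mmat mu *v x"] defect_nonneg[of "Mmat mu *v x"] by simp
      also have "\<dots> \<le> (norm (Mmat mu *v x))\<^sup>2" by (rule V_le)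
      also have "\<dots> \<le> (t * norm x)\<^sup>2" by (intro power_mono Mmat_norm mu_nonneg mu_upper) simp
      finally show ?thesis by (simp add: V_def power_mult_distrib)
    qed
  qed simp
  also have "expectation ?f = mV i - t * \<eta> * m2 i + C * t\<^sup>2 * m2 i"
    using V_err_int err_sq_int by (simp add: mV_def m2_def)
  finally show ?thesis .
qed

lemma deviation_rec:
  assumes "\<And>x. V (dev (mix (x + drift mu x))) \<le> (1 - \<delta>) * V (dev x) + C * t\<^sup>2 * (norm x)\<^sup>2"
    and K: "0 < K" "\<And>x::real^('n \<times> 'm). norm (dev x) \<le> K * norm x"
  shows "mD (Suc i) \<le> (1 - \<delta>) * mD i + C * t\<^sup>2 * m2 i + (K * t)\<^sup>2 * (\<alpha> * m2 i + \<sigma>\<^sup>2 + 1)"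
proof -
  let ?f = "\<lambda>\<omega>. (1 - \<delta>) * V (dev (err i \<omega>)) + C * t\<^sup>2 * (norm (err i \<omega>))\<^sup>2"
  have L: "linear (\<lambda>x. rootp (dev (mix x)))" using linear_compose[OF linear_mix linear_rootp_dev] by (simp add: o_def)
  have "mD (Suc i) \<le> expectation ?f + (K * t)\<^sup>2 * (\<alpha> * m2 i + \<sigma>\<^sup>2 + 1)"
    unfolding mD_def err_Suc V_def[of "dev (mix _)"]
  proof (rule quadratic_rec[OF L])
    show "integrable M ?f" using V_err_int err_sq_int by simp
    show "(norm (rootp (dev (mix (err i \<omega> + drift mu (err i \<omega>))))))\<^sup>2 \<le> ?f \<omega>" for \<omega>
      using assms(1)[of "err i \<omega>"] by (simp add: V_def)
    show "(norm (rootp (dev (mix (Mmat mu *v x)))))\<^sup>2 \<le> (K * t)\<^sup>2 * (norm x)\<^sup>2" for x :: "real^('n \<times> 'm)"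
    proof -
      have "V (dev (mix (Mmat mu *v x))) \<le> V (dev (Mmat mu *v x))"
        using V_mix[of "dev (Mmat mu *v x)"] defect_nonneg[of "dev (Mmat mu *v x)"] by (simp add: dev_mix)
      also have "\<dots> \<le> (norm (dev (Mmat mu *v x)))\<^sup>2" by (rule V_le)
      also have "\<dots> \<le> (K * (t * norm x))\<^sup>2"
      proof (rule power_mono)
        show "norm (dev (Mmat mu *v x)) \<le> K * (t * norm x)"
        proof -
          have "norm (dev (Mmat mu *v x)) \<le> K * norm (Mmat mu *v x)" by (rule K)
          also have "\<dots> \<le> K * (t * norm x)"
            using K(1) by (intro mult_left_mono Mmat_norm mu_nonneg mu_upper) simp
          finally show ?thesis .
        qed
      qed simp
      finally show ?thesis by (simp add: V_def power_mult_distrib)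
    qed
  qed simp
  also have "expectation ?f = (1 - \<delta>) * mD i + C * t\<^sup>2 * m2 i"
    using V_err_int err_sq_int by (simp add: mD_def m2_def)
  finally show ?thesis .
qed

end

section \<open>The characteristic function of the normalised centroid\<close>

lemma cmod_iexp_diff: "cmod (iexp (a + r) - iexp a) \<le> \<bar>r\<bar>"
proof -
  have "iexp (a + r) - iexp a = iexp a * (iexp r - 1)" by (simp add: exp_add algebra_simps)
  also have "cmod \<dots> = cmod (iexp r - 1)" by (simp add: norm_mult)
  also have "\<dots> \<le> \<bar>r\<bar>" using iexp_approx1[of r 0] by simp
  finally show ?thesis .
qed

lemma (in prob_space) iexp_integrable:
  "f \<in> borel_measurable M \<Longrightarrow> complex_integrable M (\<lambda>\<omega>. iexp (f \<omega>))"
  by (rule integrable_const_bound[where B = 1]) auto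

lemma (in prob_space) char_perturb:
  assumes [measurable]: "f \<in> borel_measurable M" "g \<in> borel_measurable M"
    and int: "integrable M h" and bound: "\<And>\<omega>. \<bar>f \<omega> - g \<omega>\<bar> \<le> h \<omega>"
  shows "cmod ((CLINT \<omega>|M. iexp (f \<omega>)) - (CLINT \<omega>|M. iexp (g \<omega>))) \<le> expectation h"
proof -
  have "(CLINT \<omega>|M. iexp (f \<omega>)) - (CLINT \<omega>|M. iexp (g \<omega>)) = (CLINT \<omega>|M. iexp (f \<omega>) - iexp (g \<omega>))"
    by (rule Bochner_Integration.integral_diff[symmetric]) (intro iexp_integrable; measurable)+
  also have "cmod \<dots> \<le> expectation (\<lambda>\<omega>. cmod (iexp (f \<omega>) - iexp (g \<omega>)))" by (rule integral_norm_bound)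
  also have "\<dots> \<le> expectation h"
  proof (rule integral_mono[OF _ int])
    show "integrable M (\<lambda>\<omega>. cmod (iexp (f \<omega>) - iexp (g \<omega>)))"
      by (intro integrable_norm Bochner_Integration.integrable_diff iexp_integrable) measurable
    show "cmod (iexp (f \<omega>) - iexp (g \<omega>)) \<le> h \<omega>" for \<omega>
      using cmod_iexp_diff[of "g \<omega>" "f \<omega> - g \<omega>"] bound[of \<omega>] by simp
  qed
  finally show ?thesis .
qed

context diffusion_run
begin

definition phi :: "nat \<Rightarrow> real^('g \<times> 'm) \<Rightarrow> complex" where
  "phi i v = (CLINT \<omega>|M. iexp (v \<bullet> cent (err i \<omega>) / sqrt t))"

definition mE :: "nat \<Rightarrow> real" where "mE i = expectation (\<lambda>\<omega>. norm (dev (err i \<omega>)))"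

definition gap :: "nat \<Rightarrow> real" where "gap i = expectation (noise_step.cov_gap M (F i) (nso i) Rs)"

lemma linear_err_meas: "linear L \<Longrightarrow> (\<lambda>\<omega>. L (err i \<omega>)) \<in> borel_measurable M"
  for L :: "real^('n \<times> 'm) \<Rightarrow> 'w::real_normed_vector"
  by (rule linear_borel_measurable[OF _ err_M])

lemma dev_int: "integrable M (\<lambda>\<omega>. norm (dev (err i \<omega>)))"
proof -
  obtain K where K: "0 < K" "\<And>x::real^('n \<times> 'm). norm (dev x) \<le> K * norm x" by (rule dev_bound) blast
  show ?thesis
  proof (rule Bochner_Integration.integrable_bound)
    show "integrable M (\<lambda>\<omega>. K * norm (err i \<omega>))" using err_norm_int by simp
    show "(\<lambda>\<omega>. norm (dev (err i \<omega>))) \<in> borel_measurable M" using linear_err_meas[OF linear_dev] by measurable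
  qed (use K in auto)
qed

lemma mE_nonneg: "0 \<le> mE i" unfolding mE_def by simp

text \<open>The inequality |d| \<le> |d|^2 / t + t is balanced at |d| = t, the expected size of the
  deviation, so a second moment of order t^2 yields a mean of order t.\<close>

lemma mE_le:
  assumes "0 < c0" "\<And>x::real^('n \<times> 'm). c0 * (norm x)\<^sup>2 \<le> V x"
  shows "mE i \<le> mD i / (c0 * t) + t"
proof -
  have "mE i \<le> expectation (\<lambda>\<omega>. V (dev (err i \<omega>)) / (c0 * t) + t)"
    unfolding mE_def
  proof (rule integral_mono[OF dev_int])
    show "integrable M (\<lambda>\<omega>. V (dev (err i \<omega>)) / (c0 * t) + t)" using V_err_int by simp
    fix \<omega>
    have "norm (dev (err i \<omega>)) * t \<le> (norm (dev (err i \<omega>)))\<^sup>2 + t * t"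
      using sum_squares_bound[of "norm (dev (err i \<omega>))" t] t_pos
        mult_nonneg_nonneg[OF norm_ge_zero[of "dev (err i \<omega>)"] less_imp_le[OF t_pos]]
      unfolding power2_eq_square by linarith
    then have "norm (dev (err i \<omega>)) \<le> (norm (dev (err i \<omega>)))\<^sup>2 / t + t" using t_pos by (simp add: field_simps)
    also have "\<dots> \<le> V (dev (err i \<omega>)) / c0 / t + t"
      using assms t_pos by (intro add_right_mono divide_right_mono) (auto simp: field_simps)
    finally show "norm (dev (err i \<omega>)) \<le> V (dev (err i \<omega>)) / (c0 * t) + t" by simp
  qed
  also have "\<dots> = mD i / (c0 * t) + t" using V_err_int by (simp add: mD_def prob_space)
  finally show ?thesis .
qed

text \<open>The new phase is a predictable part, plus the noise tested against u, plus the error of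
  linearising the drift. The three terms of the bound stem from the linearisation, from the
  covariance of the noise, and from its Taylor remainder of third order.\<close>

lemma char_step:
  assumes cen: "\<And>x. norm (cent (drift mu x) + t *\<^sub>R (Hbar J wo grp p mu *v cent x)) \<le> C * t * (norm (dev x) + (norm x)\<^sup>2)"
    and \<eta>: "0 < \<eta>" "\<eta> \<le> 1"
    and Hsym: "transpose (Hbar J wo grp p mu) = Hbar J wo grp p mu"
  shows "cmod (phi (Suc i) v - (1 - t * (v \<bullet> (Rbar Rs grp p mu *v v)) / 2) * phi i (v - t *\<^sub>R (Hbar J wo grp p mu *v v)))
    \<le> norm v * C * sqrt t * (mE i + m2 i)
      + t * (real CARD('n) * norm v)\<^sup>2 * (\<kappa> * \<eta> powr \<gamma> + gap i + 2 * (\<alpha> + \<sigma>\<^sup>2 + 1 + noise_step.entry_sum Rs) / \<eta>\<^sup>2 * m2 i)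
      + t * sqrt t * (real CARD('n) * norm v) ^ 3 * (\<alpha> + \<sigma>\<^sup>2 + 1 + \<alpha>\<^sup>2 + \<sigma> ^ 4)"
proof -
  interpret noise_step M "F i" "ns i" "nso i" "err i" \<alpha> \<sigma> \<kappa> \<gamma> by (rule noise_step_run)
  let ?H = "Hbar J wo grp p mu" and ?R = "Rbar Rs grp p mu"
  \<comment> \<open>The predictable phase with the symmetric map I - t H moved from the centroid
    onto v; therefore \<open>phi i\<close> is evaluated at v - t H v.\<close>
  define \<theta> where "\<theta> \<omega> = (v - t *\<^sub>R (?H *v v)) \<bullet> cent (err i \<omega>) / sqrt t" for \<omega>
  define u where "u = (1 / sqrt t) *\<^sub>R probe mu v"
  define e where "e \<omega> = cent (drift mu (err i \<omega>)) + t *\<^sub>R (?H *v cent (err i \<omega>))" for \<omega>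
  have st: "0 < sqrt t" "sqrt t * sqrt t = t" using t_pos by auto
  have eq: "v \<bullet> cent (err (Suc i) \<omega>) / sqrt t - (\<theta> \<omega> + u \<bullet> ns i \<omega>) = v \<bullet> e \<omega> / sqrt t" for \<omega>
  proof -
    have "v \<bullet> (?H *v cent (err i \<omega>)) = (?H *v v) \<bullet> cent (err i \<omega>)"
      using inner_matrix_sym[OF Hsym] by (metis inner_commute)
    then have "v \<bullet> cent (err (Suc i) \<omega>)
        = (v - t *\<^sub>R (?H *v v)) \<bullet> cent (err i \<omega>) + v \<bullet> e \<omega> + probe mu v \<bullet> ns i \<omega>"
      unfolding err_Suc cent_mix linear_add[OF linear_cent] e_def probe_inner[symmetric]
      by (simp add: inner_add_right inner_diff_left)
    then show ?thesis by (simp add: \<theta>_def u_def add_divide_distrib)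
  qed
  have \<theta>F: "\<theta> \<in> borel_measurable (F i)"
  proof -
    have "(\<lambda>\<omega>. cent (err i \<omega>)) \<in> borel_measurable (F i)" by (rule linear_borel_measurable[OF linear_cent err_F])
    then show ?thesis unfolding \<theta>_def[abs_def] by measurable
  qed
  note [measurable] = F_meas[OF \<theta>F] linear_err_meas[OF linear_cent]
  have p1: "cmod (phi (Suc i) v - (CLINT \<omega>|M. iexp (\<theta> \<omega> + u \<bullet> ns i \<omega>))) \<le> norm v * C * sqrt t * (mE i + m2 i)"
  proof -
    have "cmod (phi (Suc i) v - (CLINT \<omega>|M. iexp (\<theta> \<omega> + u \<bullet> ns i \<omega>)))
        \<le> expectation (\<lambda>\<omega>. norm v * C * sqrt t * (norm (dev (err i \<omega>)) + (norm (err i \<omega>))\<^sup>2))"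
      unfolding phi_def
    proof (rule char_perturb)
      show "(\<lambda>\<omega>. v \<bullet> cent (err (Suc i) \<omega>) / sqrt t) \<in> borel_measurable M" by measurable
      show "(\<lambda>\<omega>. \<theta> \<omega> + u \<bullet> ns i \<omega>) \<in> borel_measurable M" by measurable
      show "integrable M (\<lambda>\<omega>. norm v * C * sqrt t * (norm (dev (err i \<omega>)) + (norm (err i \<omega>))\<^sup>2))"
        using dev_int err_sq_int by simp
      fix \<omega>
      have "\<bar>v \<bullet> e \<omega>\<bar> \<le> norm v * norm (e \<omega>)" by (rule Cauchy_Schwarz_ineq2)
      also have "\<dots> \<le> norm v * (C * t * (norm (dev (err i \<omega>)) + (norm (err i \<omega>))\<^sup>2))"
        unfolding e_def by (intro mult_left_mono cen) simp
      finally have "\<bar>v \<bullet> e \<omega> / sqrt t\<bar> \<le> norm v * (C * t * (norm (dev (err i \<omega>)) + (norm (err i \<omega>))\<^sup>2)) / sqrt t"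
        using st by (simp add: divide_right_mono)
      also have "\<dots> = norm v * C * (t / sqrt t) * (norm (dev (err i \<omega>)) + (norm (err i \<omega>))\<^sup>2)"
        by simp
      also have "t / sqrt t = sqrt t" using t_pos by (simp add: real_div_sqrt)
      finally show "\<bar>v \<bullet> cent (err (Suc i) \<omega>) / sqrt t - (\<theta> \<omega> + u \<bullet> ns i \<omega>)\<bar>
          \<le> norm v * C * sqrt t * (norm (dev (err i \<omega>)) + (norm (err i \<omega>))\<^sup>2)"
        unfolding eq .
    qed
    then show ?thesis using dev_int err_sq_int by (simp add: mE_def m2_def)
  qed
  have p2: "cmod ((CLINT \<omega>|M. iexp (\<theta> \<omega> + u \<bullet> ns i \<omega>)) - (1 - t * (v \<bullet> (?R *v v)) / 2) * phi i (v - t *\<^sub>R (?H *v v)))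
      \<le> (norm u)\<^sup>2 * (\<kappa> * \<eta> powr \<gamma> + gap i + 2 * (\<alpha> + \<sigma>\<^sup>2 + 1 + entry_sum Rs) / \<eta>\<^sup>2 * m2 i)
        + (norm u) ^ 3 * (\<alpha> + \<sigma>\<^sup>2 + 1 + \<alpha>\<^sup>2 + \<sigma> ^ 4)"
  proof -
    have "u \<bullet> (Rs *v u) = (1 / (sqrt t * sqrt t)) * (probe mu v \<bullet> (Rs *v probe mu v))"
      by (simp add: u_def matrix_vector_mult_scaleR)
    also have "\<dots> = t * (v \<bullet> (?R *v v))"
      unfolding st probe_form[OF mu_max_t t_pos] using t_pos by (simp add: power2_eq_square)
    finally have q: "u \<bullet> (Rs *v u) = t * (v \<bullet> (?R *v v))" .
    show ?thesis
      using char_noise[OF \<theta>F \<eta>, of u Rs] unfolding q phi_def \<theta>_def[symmetric] gap_def m2_def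
      by (simp add: exp_add distrib_left)
  qed
  \<comment> \<open>The probe is O(t |v|) and is divided by \<surd>t, so its second and third powers
    supply the factors t and t \<surd>t of the claim.\<close>
  have un: "norm u \<le> sqrt t * (real CARD('n) * norm v)"
  proof -
    have "norm u = norm (probe mu v) / sqrt t" using st by (simp add: u_def)
    also have "\<dots> \<le> (t * real CARD('n) * norm v) / sqrt t"
      using st by (intro divide_right_mono probe_norm mu_nonneg mu_upper) simp
    also have "\<dots> = (t / sqrt t) * (real CARD('n) * norm v)" by simp
    also have "t / sqrt t = sqrt t" using t_pos by (simp add: real_div_sqrt)
    finally show ?thesis .
  qed
  have u2: "(norm u)\<^sup>2 \<le> t * (real CARD('n) * norm v)\<^sup>2"
    using power_mono[OF un norm_ge_zero, of 2] t_pos by (simp only: power_mult_distrib) simp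
  have u3: "(norm u) ^ 3 \<le> t * sqrt t * (real CARD('n) * norm v) ^ 3"
  proof -
    have "sqrt t ^ 3 = t * sqrt t" using st by (simp add: eval_nat_numeral)
    then show ?thesis using power_mono[OF un norm_ge_zero, of 3] by (simp only: power_mult_distrib)
  qed
  have es0: "0 \<le> entry_sum Rs" unfolding entry_sum_def by (intro sum_nonneg) auto
  have gap0: "0 \<le> gap i"
    unfolding gap_def cov_gap_def by (intro integral_nonneg_AE AE_I2 sum_nonneg) auto
  have "cmod (phi (Suc i) v - (1 - t * (v \<bullet> (?R *v v)) / 2) * phi i (v - t *\<^sub>R (?H *v v)))
      \<le> norm v * C * sqrt t * (mE i + m2 i)
        + ((norm u)\<^sup>2 * (\<kappa> * \<eta> powr \<gamma> + gap i + 2 * (\<alpha> + \<sigma>\<^sup>2 + 1 + entry_sum Rs) / \<eta>\<^sup>2 * m2 i)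
        + (norm u) ^ 3 * (\<alpha> + \<sigma>\<^sup>2 + 1 + \<alpha>\<^sup>2 + \<sigma> ^ 4))"
    using norm_triangle_le[OF add_mono[OF p1 p2]] by simp
  also have "\<dots> \<le> norm v * C * sqrt t * (mE i + m2 i)
      + (t * (real CARD('n) * norm v)\<^sup>2 * (\<kappa> * \<eta> powr \<gamma> + gap i + 2 * (\<alpha> + \<sigma>\<^sup>2 + 1 + entry_sum Rs) / \<eta>\<^sup>2 * m2 i)
      + t * sqrt t * (real CARD('n) * norm v) ^ 3 * (\<alpha> + \<sigma>\<^sup>2 + 1 + \<alpha>\<^sup>2 + \<sigma> ^ 4))"
  proof (intro add_left_mono add_mono mult_right_mono u2 u3)
    show "0 \<le> \<kappa> * \<eta> powr \<gamma> + gap i + 2 * (\<alpha> + \<sigma>\<^sup>2 + 1 + entry_sum Rs) / \<eta>\<^sup>2 * m2 i"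
      using nonneg gap0 es0 m2_nonneg[of i]
      by (intro add_nonneg_nonneg mult_nonneg_nonneg divide_nonneg_nonneg) auto
    show "0 \<le> \<alpha> + \<sigma>\<^sup>2 + 1 + \<alpha>\<^sup>2 + \<sigma> ^ 4" using nonneg by simp
  qed
  finally show ?thesis by (simp add: add.assoc)
qed

lemma gap_tendsto_0: "gap \<longlonglongrightarrow> 0"
proof -
  have "AE \<omega> in M. (\<lambda>i. cond_second_moment M (F i) (\<lambda>\<omega>'. grad_noise J ghat i (col wo) \<omega>') \<omega>) \<longlonglongrightarrow> Rs"
    using noise by (simp add: noise_assumptions_def)
  then have "AE \<omega> in M. (\<lambda>i. cond_second_moment M (F i) (nso i) \<omega>) \<longlonglongrightarrow> Rs"
    by (simp add: nso_def[abs_def])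
  from cov_gap_tendsto_0[OF noise_step_run this] show ?thesis
    unfolding gap_def[abs_def] .
qed

lemma gap_nonneg: "0 \<le> gap i"
  unfolding gap_def noise_step.cov_gap_def[OF noise_step_run] by (intro integral_nonneg_AE AE_I2 sum_nonneg) auto

text \<open>The start is deterministic, at a distance from 0 that grows like 1 / \<surd>t after
  normalisation. What matters is the proportionality to |v|; the constant is forgotten later for
  each fixed t.\<close>

lemma phi_0_bound: "cmod (phi 0 v - 1) \<le> norm v * (norm (cent (col wo)) / sqrt t)"
proof -
  have "err 0 \<omega> = col wo" for \<omega> by (rule blk_eqI) (simp add: err_def)
  then have "phi 0 v = iexp (0 + v \<bullet> cent (col wo) / sqrt t)" by (simp add: phi_def prob_space)
  then have "cmod (phi 0 v - 1) \<le> \<bar>v \<bullet> cent (col wo) / sqrt t\<bar>"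
    using cmod_iexp_diff[of 0 "v \<bullet> cent (col wo) / sqrt t"] by simp
  also have "\<dots> \<le> norm v * norm (cent (col wo)) / sqrt t"
    using t_pos Cauchy_Schwarz_ineq2[of v "cent (col wo)"] by (simp add: divide_right_mono)
  finally show ?thesis by simp
qed

text \<open>The error is its centroid part plus the deviation. The adjoint of
  \<open>spread grp\<close> carries u to the groups, and the deviation of mean order t disappears
  after division by \<surd>t.\<close>

lemma char_error_bound:
  "cmod ((CLINT \<omega>|M. iexp (u \<bullet> ((1 / sqrt t) *\<^sub>R err i \<omega>))) - phi i (adjoint (spread grp) u)) \<le> norm u * mE i / sqrt t"
proof -
  have "cmod ((CLINT \<omega>|M. iexp (u \<bullet> ((1 / sqrt t) *\<^sub>R err i \<omega>))) - phi i (adjoint (spread grp) u))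
      \<le> expectation (\<lambda>\<omega>. norm u * norm (dev (err i \<omega>)) / sqrt t)"
    unfolding phi_def
  proof (rule char_perturb)
    show "(\<lambda>\<omega>. u \<bullet> ((1 / sqrt t) *\<^sub>R err i \<omega>)) \<in> borel_measurable M" by measurable
    note [measurable] = linear_err_meas[OF linear_cent]
    show "(\<lambda>\<omega>. adjoint (spread grp) u \<bullet> cent (err i \<omega>) / sqrt t) \<in> borel_measurable M" by measurable
    show "integrable M (\<lambda>\<omega>. norm u * norm (dev (err i \<omega>)) / sqrt t)" using dev_int by simp
    fix \<omega>
    have "adjoint (spread grp) u \<bullet> cent (err i \<omega>) = u \<bullet> spread grp (cent (err i \<omega>))"
      using adjoint_works[OF linear_spread, of "cent (err i \<omega>)" grp u] by (simp add: inner_commute)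
    then have "u \<bullet> ((1 / sqrt t) *\<^sub>R err i \<omega>) - adjoint (spread grp) u \<bullet> cent (err i \<omega>) / sqrt t = u \<bullet> dev (err i \<omega>) / sqrt t"
      by (simp add: dev_def inner_diff_right diff_divide_distrib)
    then show "\<bar>u \<bullet> ((1 / sqrt t) *\<^sub>R err i \<omega>) - adjoint (spread grp) u \<bullet> cent (err i \<omega>) / sqrt t\<bar>
        \<le> norm u * norm (dev (err i \<omega>)) / sqrt t"
      using t_pos Cauchy_Schwarz_ineq2[of u "dev (err i \<omega>)"] by (simp add: divide_right_mono)
  qed
  then show ?thesis using dev_int by (simp add: mE_def)
qed

lemma markov_error:
  assumes K: "0 < K"
  shows "measure (distr M borel (\<lambda>\<omega>. (1 / sqrt t) *\<^sub>R err i \<omega>)) {x. K < norm x} \<le> m2 i / (t * K\<^sup>2)"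
proof -
  have "measure (distr M borel (\<lambda>\<omega>. (1 / sqrt t) *\<^sub>R err i \<omega>)) {x. K < norm x}
      = measure M {\<omega> \<in> space M. K < norm ((1 / sqrt t) *\<^sub>R err i \<omega>)}"
    by (subst measure_distr) (auto intro!: arg_cong[where f = "measure M"])
  also have "\<dots> \<le> measure M {\<omega> \<in> space M. t * K\<^sup>2 \<le> (norm (err i \<omega>))\<^sup>2}"
  proof (rule finite_measure_mono)
    show "{\<omega> \<in> space M. K < norm ((1 / sqrt t) *\<^sub>R err i \<omega>)} \<subseteq> {\<omega> \<in> space M. t * K\<^sup>2 \<le> (norm (err i \<omega>))\<^sup>2}"
    proof safe
      fix \<omega> assume "K < norm ((1 / sqrt t) *\<^sub>R err i \<omega>)"
      then have "K * sqrt t \<le> norm (err i \<omega>)" using t_pos by (simp add: field_simps)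
      then have "(K * sqrt t)\<^sup>2 \<le> (norm (err i \<omega>))\<^sup>2" using K t_pos by (intro power_mono) auto
      then show "t * K\<^sup>2 \<le> (norm (err i \<omega>))\<^sup>2" using t_pos by (simp add: power_mult_distrib mult.commute)
    qed
  qed measurable
  also have "\<dots> \<le> m2 i / (t * K\<^sup>2)"
    unfolding m2_def by (rule integral_Markov_inequality_measure[OF err_sq_int, of "{}"]) (use K t_pos in auto)
  finally show ?thesis .
qed

end

section \<open>Vanishing step-sizes\<close>

lemma small_step_linear_tendsto:
  assumes t0: "0 < t0"
    and bound: "\<And>t. 0 < t \<Longrightarrow> t < t0 \<Longrightarrow> \<forall>\<^sub>F i in sequentially. f t i \<le> B * t"
    and nonneg: "\<And>t i. 0 < t \<Longrightarrow> 0 \<le> f t i"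
  shows "((\<lambda>(t, i). f t i / sqrt t) \<longlongrightarrow> 0) small_step"
proof (rule tendsto_sandwich)
  show "\<forall>\<^sub>F x in small_step. 0 \<le> (case x of (t, i) \<Rightarrow> f t i / sqrt t)"
    by (rule eventually_small_stepI[OF t0]) (simp add: nonneg)
  show "\<forall>\<^sub>F x in small_step. (case x of (t, i) \<Rightarrow> f t i / sqrt t) \<le> (case x of (t, i) \<Rightarrow> B * sqrt t)"
  proof (rule eventually_small_stepI[OF t0])
    fix t :: real assume t: "0 < t" "t < t0"
    from bound[OF t]
    show "\<forall>\<^sub>F i in sequentially. (case (t, i) of (t, i) \<Rightarrow> f t i / sqrt t) \<le> (case (t, i) of (t, i) \<Rightarrow> B * sqrt t)"
    proof eventually_elim
      case (elim i)
      have "f t i / sqrt t \<le> B * t / sqrt t" using elim t by (intro divide_right_mono) auto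
      also have "\<dots> = B * sqrt t" using t real_div_sqrt[of t] by (metis less_imp_le times_divide_eq_right)
      finally show ?case by simp
    qed
  qed
  have "((\<lambda>t. B * sqrt t) \<longlongrightarrow> B * sqrt 0) (at_right 0)"
    by (intro tendsto_intros)
  from small_step_fst_tendsto[OF this] show "((\<lambda>(t, i). B * sqrt t) \<longlongrightarrow> 0) small_step" by simp
qed simp

text \<open>Probability space and gradient oracle are common to all t, while the filtration may vary
  with t, as the iterates it has to accommodate do.\<close>

locale diffusion_family = diffusion Nb grp A p J wo lamL lamU kappaH c
  for Nb :: "'n::finite \<Rightarrow> 'n set" and grp :: "'n \<Rightarrow> 'g::finite" and A :: "real^'n^'n" and p
    and J :: "'n \<Rightarrow> real^'m::finite \<Rightarrow> real" and wo :: "'n \<Rightarrow> real^'m"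
    and lamL lamU :: "'n \<Rightarrow> real" and kappaH c :: real +
  fixes M :: "'a measure" and F :: "real \<Rightarrow> nat \<Rightarrow> 'a measure" and ghat :: "'n \<Rightarrow> nat \<Rightarrow> 'a \<Rightarrow> real^'m \<Rightarrow> real^'m"
    and mu :: "real \<Rightarrow> 'n \<Rightarrow> real" and Rs :: "real^('n \<times> 'm)^('n \<times> 'm)" and \<alpha> \<sigma> \<kappa> \<gamma> :: real
    and H R :: "real^('g \<times> 'm)^('g \<times> 'm)"
  assumes run: "0 < t \<Longrightarrow> diffusion_run Nb grp A p J wo lamL lamU kappaH c M (F t) ghat (mu t) t Rs \<alpha> \<sigma> \<kappa> \<gamma>"
    and H_eq: "0 < t \<Longrightarrow> Hbar J wo grp p (mu t) = H" and R_eq: "0 < t \<Longrightarrow> Rbar Rs grp p (mu t) = R"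
    and Rs_spd: "sym_pos_def Rs" and noise_nonneg: "0 \<le> \<alpha>" "0 \<le> \<sigma>" "0 \<le> \<kappa>" "0 < \<gamma>"
begin

abbreviation "Err t \<equiv> diffusion_run.err Nb grp A wo ghat (mu t)"
abbreviation "M2 t \<equiv> diffusion_run.m2 Nb grp A wo M ghat (mu t)"
abbreviation "MV t \<equiv> diffusion_run.mV Nb grp A p wo M ghat (mu t)"
abbreviation "MD t \<equiv> diffusion_run.mD Nb grp A p wo M ghat (mu t)"
abbreviation "ME t \<equiv> diffusion_run.mE Nb grp A p wo M ghat (mu t)"
abbreviation "Gap t \<equiv> diffusion_run.gap J wo M (F t) ghat Rs"
abbreviation "Phi t \<equiv> diffusion_run.phi Nb grp A p wo M ghat (mu t) t"

text \<open>Noise injects t^2 per step and the dissipation removes a fraction of order t, so the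
  balance is of order t.\<close>

lemma M2_bound:
  obtains B t0 where "0 < B" "0 < t0" "t0 \<le> 1"
    "\<And>t. 0 < t \<Longrightarrow> t < t0 \<Longrightarrow> \<forall>\<^sub>F i in sequentially. M2 t i \<le> B * t"
proof -
  obtain \<eta> C where \<eta>: "0 < \<eta>" "0 < C"
    and step: "\<And>mu t x. 0 < t \<Longrightarrow> t \<le> 1 \<Longrightarrow> \<forall>k. c * t \<le> mu k \<Longrightarrow> \<forall>k. mu k \<le> t \<Longrightarrow>
      V (mix (x + drift mu x)) \<le> V x - t * \<eta> * (norm x)\<^sup>2 + C * t\<^sup>2 * (norm x)\<^sup>2"
    by (rule mean_square_step) blast
  obtain c0 where c0: "0 < c0" "\<And>x::real^('n \<times> 'm). c0 * (norm x)\<^sup>2 \<le> V x" by (rule V_ge) blast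
  \<comment> \<open>The second entry lets half of the dissipation absorb all terms t^2 E |x|^2; the
    third keeps the contraction factor nonnegative. In B, the stationary value 2 t (\<sigma>^2 + 1)
    / \<eta> and a slack t are converted from V to the norm by c0.\<close>
  define t0 where "t0 = min 1 (min (\<eta> / (2 * (C + \<alpha>))) (2 / \<eta>))"
  define B where "B = (2 * (\<sigma>\<^sup>2 + 1) / \<eta> + 1) / c0"
  have Ca: "0 < C + \<alpha>" using \<eta> noise_nonneg by simp
  have t0: "0 < t0" "t0 \<le> 1" using \<eta> Ca by (auto simp: t0_def)
  have B: "0 < B" unfolding B_def using \<eta> c0 by (intro divide_pos_pos add_nonneg_pos) auto
  have "\<forall>\<^sub>F i in sequentially. M2 t i \<le> B * t" if t: "0 < t" "t < t0" for t
  proof -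
    interpret R: diffusion_run Nb grp A p J wo lamL lamU kappaH c M "F t" ghat "mu t" t Rs \<alpha> \<sigma> \<kappa> \<gamma>
      by (rule run[OF t(1)])
    have tC: "t * (C + \<alpha>) \<le> \<eta> / 2" using t Ca by (simp add: t0_def field_simps)
    have r: "0 < t * (\<eta> / 2)" "t * (\<eta> / 2) \<le> 1" using t \<eta> by (auto simp: t0_def field_simps)
    have rec: "R.mV (Suc i) \<le> (1 - t * (\<eta> / 2)) * R.mV i + t\<^sup>2 * (\<sigma>\<^sup>2 + 1)" for i
    proof -
      have "R.mV (Suc i) \<le> R.mV i - t * \<eta> * R.m2 i + C * t\<^sup>2 * R.m2 i + t\<^sup>2 * (\<alpha> * R.m2 i + \<sigma>\<^sup>2 + 1)"
        by (rule R.mean_square_rec) (use step[OF t(1) _ allI[OF R.mu_lower] allI[OF R.mu_upper]] t t0 in simp)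
      also have "\<dots> = R.mV i - t * R.m2 i * \<eta> + t * R.m2 i * (t * (C + \<alpha>)) + t\<^sup>2 * (\<sigma>\<^sup>2 + 1)"
        by (simp add: power2_eq_square algebra_simps)
      also have "\<dots> \<le> R.mV i - t * R.m2 i * \<eta> + t * R.m2 i * (\<eta> / 2) + t\<^sup>2 * (\<sigma>\<^sup>2 + 1)"
        using tC t R.m2_nonneg[of i] by (intro add_right_mono add_left_mono mult_left_mono) auto
      also have "\<dots> = R.mV i - t * (\<eta> / 2) * R.m2 i + t\<^sup>2 * (\<sigma>\<^sup>2 + 1)" by (simp add: field_simps)
      also have "\<dots> \<le> R.mV i - t * (\<eta> / 2) * R.mV i + t\<^sup>2 * (\<sigma>\<^sup>2 + 1)"
        using R.mV_le_m2[of i] r by (intro add_right_mono diff_left_mono mult_left_mono) auto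
      finally show ?thesis by (simp add: algebra_simps)
    qed
    have "\<forall>\<^sub>F i in sequentially. R.mV i \<le> t\<^sup>2 * (\<sigma>\<^sup>2 + 1) / (t * (\<eta> / 2)) + t"
      by (rule affine_recursion_eventually[OF _ r t(1)], rule always_eventually, rule allI, rule rec)
    then show ?thesis
    proof eventually_elim
      case (elim i)
      have "c0 * R.m2 i = R.expectation (\<lambda>\<omega>. c0 * (norm (R.err i \<omega>))\<^sup>2)" by (simp add: R.m2_def)
      also have "\<dots> \<le> R.mV i"
        unfolding R.mV_def by (intro integral_mono integrable_mult_right R.err_sq_int R.V_err_int c0)
      also have "\<dots> \<le> t\<^sup>2 * (\<sigma>\<^sup>2 + 1) / (t * (\<eta> / 2)) + t" by (rule elim)
      also have "\<dots> = c0 * (B * t)" using t \<eta> c0 by (simp add: B_def field_simps power2_eq_square)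
      finally show ?case using c0 by simp
    qed
  qed
  then show ?thesis using that B t0 by blast
qed

text \<open>The deviation contracts at a rate independent of t under a forcing of order t^2, so its
  second moment is O(t^2) and its mean O(t), one order of \<surd>t below the centroid.\<close>

lemma ME_bound:
  obtains B t0 where "0 < B" "0 < t0" "\<And>t. 0 < t \<Longrightarrow> t < t0 \<Longrightarrow> \<forall>\<^sub>F i in sequentially. ME t i \<le> B * t"
proof -
  obtain B2 t0 where B2: "0 < B2" "0 < t0" "t0 \<le> 1"
    "\<And>t. 0 < t \<Longrightarrow> t < t0 \<Longrightarrow> \<forall>\<^sub>F i in sequentially. M2 t i \<le> B2 * t" by (rule M2_bound) blast
  obtain \<delta> C where \<delta>: "0 < \<delta>" "\<delta> \<le> 1" "0 < C"
    and step: "\<And>mu t x. \<forall>k. 0 \<le> mu k \<Longrightarrow> \<forall>k. mu k \<le> t \<Longrightarrow>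
      V (dev (mix (x + drift mu x))) \<le> (1 - \<delta>) * V (dev x) + C * t\<^sup>2 * (norm x)\<^sup>2"
    by (rule deviation_step) blast
  obtain c0 where c0: "0 < c0" "\<And>x::real^('n \<times> 'm). c0 * (norm x)\<^sup>2 \<le> V x" by (rule V_ge) blast
  obtain K where K: "0 < K" "\<And>x::real^('n \<times> 'm). norm (dev x) \<le> K * norm x" by (rule dev_bound) blast
  define Q where "Q = C * B2 + K\<^sup>2 * (\<alpha> * B2 + \<sigma>\<^sup>2 + 1)"
  define B where "B = (Q / \<delta> + 1) / c0 + 1"
  have Q: "0 \<le> Q" unfolding Q_def using \<delta> B2 noise_nonneg by (intro add_nonneg_nonneg mult_nonneg_nonneg) auto
  have B: "0 < B" unfolding B_def using Q \<delta> c0 by (intro add_nonneg_pos divide_nonneg_nonneg add_nonneg_nonneg) auto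
  have "\<forall>\<^sub>F i in sequentially. ME t i \<le> B * t" if t: "0 < t" "t < t0" for t
  proof -
    interpret R: diffusion_run Nb grp A p J wo lamL lamU kappaH c M "F t" ghat "mu t" t Rs \<alpha> \<sigma> \<kappa> \<gamma>
      by (rule run[OF t(1)])
    have "\<forall>\<^sub>F i in sequentially. R.mD (Suc i) \<le> (1 - \<delta>) * R.mD i + t\<^sup>2 * Q"
      using B2(4)[OF t]
    proof eventually_elim
      case (elim i)
      \<comment> \<open>The crude bound is enough, since the forcing already carries t^2.\<close>
      have m: "R.m2 i \<le> B2"
        using elim mult_left_le[of t B2] t B2 by (smt (verit) mult.commute)
      have "R.mD (Suc i) \<le> (1 - \<delta>) * R.mD i + C * t\<^sup>2 * R.m2 i + (K * t)\<^sup>2 * (\<alpha> * R.m2 i + \<sigma>\<^sup>2 + 1)"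
        by (rule R.deviation_rec[OF step[OF allI[OF R.mu_nonneg] allI[OF R.mu_upper]] K])
      also have "\<dots> \<le> (1 - \<delta>) * R.mD i + C * t\<^sup>2 * B2 + (K * t)\<^sup>2 * (\<alpha> * B2 + \<sigma>\<^sup>2 + 1)"
        using m \<delta> noise_nonneg by (intro add_mono mult_left_mono) auto
      also have "\<dots> = (1 - \<delta>) * R.mD i + t\<^sup>2 * Q" by (simp add: Q_def power_mult_distrib algebra_simps)
      finally show ?case .
    qed
    then have "\<forall>\<^sub>F i in sequentially. R.mD i \<le> t\<^sup>2 * Q / \<delta> + t\<^sup>2"
      by (rule affine_recursion_eventually[OF _ \<delta>(1,2)]) (use t in simp)
    then show ?thesis
    proof eventually_elim
      case (elim i)
      have "R.mE i \<le> R.mD i / (c0 * t) + t" by (rule R.mE_le[OF c0])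
      also have "\<dots> \<le> (t\<^sup>2 * Q / \<delta> + t\<^sup>2) / (c0 * t) + t"
        using elim c0 t by (intro add_right_mono divide_right_mono) auto
      also have "\<dots> = B * t" using c0 t \<delta> by (simp add: B_def field_simps power2_eq_square)
      finally show ?case .
    qed
  qed
  then show ?thesis using that B B2 by blast
qed

lemma M2_tendsto: "((\<lambda>(t, i). M2 t i / sqrt t) \<longlongrightarrow> 0) small_step"
proof -
  obtain B t0 where B: "0 < B" "0 < t0" "t0 \<le> 1"
    "\<And>t. 0 < t \<Longrightarrow> t < t0 \<Longrightarrow> \<forall>\<^sub>F i in sequentially. M2 t i \<le> B * t" by (rule M2_bound) blast
  show ?thesis
    by (rule small_step_linear_tendsto[OF B(2,4)]) (auto intro: diffusion_run.m2_nonneg run)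
qed

lemma ME_tendsto: "((\<lambda>(t, i). ME t i / sqrt t) \<longlongrightarrow> 0) small_step"
proof -
  obtain B t0 where B: "0 < B" "0 < t0"
    "\<And>t. 0 < t \<Longrightarrow> t < t0 \<Longrightarrow> \<forall>\<^sub>F i in sequentially. ME t i \<le> B * t" by (rule ME_bound) blast
  show ?thesis
    by (rule small_step_linear_tendsto[OF B(2,3)]) (auto intro: diffusion_run.mE_nonneg run)
qed

section \<open>Convergence of the characteristic function of the centroid\<close>

lemma H_spd: "sym_pos_def H"
proof -
  \<comment> \<open>The matrix H does not depend on t, so it may be read off at any step-size; t = 1
    is taken.\<close>
  interpret R: diffusion_run Nb grp A p J wo lamL lamU kappaH c M "F 1" ghat "mu 1" 1 Rs \<alpha> \<sigma> \<kappa> \<gamma>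
    by (rule run) simp
  show ?thesis using Hbar_spd[of 1 "mu 1"] R.mu_lower R.mu_max_t H_eq[of 1] by simp
qed

lemma R_psd: "0 \<le> v \<bullet> (R *v v)"
proof -
  interpret R: diffusion_run Nb grp A p J wo lamL lamU kappaH c M "F 1" ghat "mu 1" 1 Rs \<alpha> \<sigma> \<kappa> \<gamma>
    by (rule run) simp
  have "v \<bullet> (R *v v) = probe (mu 1) v \<bullet> (Rs *v probe (mu 1) v)"
    using probe_form[OF R.mu_max_t, of v Rs] R_eq[of 1] by simp
  moreover have "0 \<le> u \<bullet> (Rs *v u)" for u
    using Rs_spd unfolding sym_pos_def_def by (cases "u = 0") (auto intro: less_imp_le)
  ultimately show ?thesis by simp
qed

lemma R_sym: "transpose R = R"
proof -
  have Rs: "transpose Rs = Rs" using Rs_spd by (simp add: sym_pos_def_def)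
  have sc: "transpose (r *\<^sub>R B) = r *\<^sub>R transpose B" for r and B :: "real^('g \<times> 'm)^('g \<times> 'm)"
    by (simp add: transpose_def vec_eq_iff)
  show ?thesis
    unfolding R_eq[of 1, symmetric, OF zero_less_one] Rbar_def sc
    by (simp add: matrix_transpose_mul Rs Mmat_sym matrix_mul_assoc)
qed

text \<open>The error of one step per unit of t |v|, with the threshold \<eta> = t^(1/4): then
  \<eta>^\<gamma> tends to 0, and so does E |x|^2 / \<eta>^2 = E |x|^2 / \<surd>t because the second
  moment is O(t). Surplus powers of |v| are replaced by K.\<close>

definition eps :: "real \<Rightarrow> real \<Rightarrow> real \<Rightarrow> nat \<Rightarrow> real" where
  "eps C K t i = C * (ME t i / sqrt t + M2 t i / sqrt t)
    + (real CARD('n))\<^sup>2 * K * (\<kappa> * sqrt (sqrt t) powr \<gamma> + Gap t i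
        + 2 * (\<alpha> + \<sigma>\<^sup>2 + 1 + noise_step.entry_sum Rs) * (M2 t i / sqrt t))
    + sqrt t * ((real CARD('n)) ^ 3 * K\<^sup>2 * (\<alpha> + \<sigma>\<^sup>2 + 1 + \<alpha>\<^sup>2 + \<sigma> ^ 4))"

lemma eps_tendsto: "((\<lambda>(t, i). eps C K t i) \<longlongrightarrow> 0) small_step"
proof -
  have s: "((\<lambda>(t, i). sqrt t) \<longlongrightarrow> sqrt 0) small_step"
    by (rule small_step_fst_tendsto) (intro tendsto_intros)
  have q: "((\<lambda>(t, i). sqrt (sqrt t) powr \<gamma>) \<longlongrightarrow> 0) small_step"
  proof (rule small_step_fst_tendsto)
    have "((\<lambda>t. sqrt (sqrt t)) \<longlongrightarrow> sqrt (sqrt 0)) (at_right 0)" by (intro tendsto_intros)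
    then have "((\<lambda>t. sqrt (sqrt t)) \<longlongrightarrow> 0) (at_right 0)" by simp
    moreover have "\<forall>\<^sub>F t in at_right 0. 0 \<le> sqrt (sqrt t)"
      unfolding eventually_at_right_field by (intro exI[of _ 1]) auto
    ultimately show "((\<lambda>t. sqrt (sqrt t) powr \<gamma>) \<longlongrightarrow> 0) (at_right 0)"
      using tendsto_powr2[of "\<lambda>t. sqrt (sqrt t)" 0 "at_right 0" "\<lambda>_. \<gamma>" \<gamma>] noise_nonneg by simp
  qed
  have g: "((\<lambda>(t, i). Gap t i) \<longlongrightarrow> 0) small_step"
    by (rule small_step_snd_tendsto) (rule diffusion_run.gap_tendsto_0[OF run])
  have "((\<lambda>x. C * ((case x of (t, i) \<Rightarrow> ME t i / sqrt t) + (case x of (t, i) \<Rightarrow> M2 t i / sqrt t))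
    + (real CARD('n))\<^sup>2 * K * (\<kappa> * (case x of (t, i) \<Rightarrow> sqrt (sqrt t) powr \<gamma>) + (case x of (t, i) \<Rightarrow> Gap t i)
        + 2 * (\<alpha> + \<sigma>\<^sup>2 + 1 + noise_step.entry_sum Rs) * (case x of (t, i) \<Rightarrow> M2 t i / sqrt t))
    + (case x of (t, i) \<Rightarrow> sqrt t) * ((real CARD('n)) ^ 3 * K\<^sup>2 * (\<alpha> + \<sigma>\<^sup>2 + 1 + \<alpha>\<^sup>2 + \<sigma> ^ 4)))
    \<longlongrightarrow> C * (0 + 0) + (real CARD('n))\<^sup>2 * K * (\<kappa> * 0 + 0 + 2 * (\<alpha> + \<sigma>\<^sup>2 + 1 + noise_step.entry_sum Rs) * 0)
      + sqrt 0 * ((real CARD('n)) ^ 3 * K\<^sup>2 * (\<alpha> + \<sigma>\<^sup>2 + 1 + \<alpha>\<^sup>2 + \<sigma> ^ 4))) small_step"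
    by (intro tendsto_intros ME_tendsto M2_tendsto s q g)
  then show ?thesis by (simp add: eps_def case_prod_beta' cong: prod.case_cong)
qed

text \<open>All terms of \<open>char_step\<close> carry at least one factor |v|, which is kept
  because the contraction argument divides by it.\<close>

lemma Phi_step:
  obtains C where "0 < C"
    "\<And>K t i v. 0 < K \<Longrightarrow> 0 < t \<Longrightarrow> t < 1 \<Longrightarrow> norm v \<le> K \<Longrightarrow>
      cmod (Phi t (Suc i) v - (1 - t * (v \<bullet> (R *v v)) / 2) * Phi t i (v - t *\<^sub>R (H *v v))) \<le> t * norm v * eps C K t i"
proof -
  obtain C where C: "0 < C"
    and cen: "\<And>mu t x. 0 < t \<Longrightarrow> \<forall>k. 0 \<le> mu k \<Longrightarrow> \<forall>k. mu k \<le> t \<Longrightarrow> mu_max mu = t \<Longrightarrow>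
      norm (cent (drift mu x) + t *\<^sub>R (Hbar J wo grp p mu *v cent x)) \<le> C * t * (norm (dev x) + (norm x)\<^sup>2)"
    by (rule centroid_step) blast
  have "cmod (Phi t (Suc i) v - (1 - t * (v \<bullet> (R *v v)) / 2) * Phi t i (v - t *\<^sub>R (H *v v))) \<le> t * norm v * eps C K t i"
    if K: "0 < K" and t: "0 < t" "t < 1" and v: "norm v \<le> K" for K t i v
  proof -
    interpret R: diffusion_run Nb grp A p J wo lamL lamU kappaH c M "F t" ghat "mu t" t Rs \<alpha> \<sigma> \<kappa> \<gamma>
      by (rule run[OF t(1)])
    let ?N = "real CARD('n)" and ?E = "\<alpha> + \<sigma>\<^sup>2 + 1 + noise_step.entry_sum Rs" and ?T = "\<alpha> + \<sigma>\<^sup>2 + 1 + \<alpha>\<^sup>2 + \<sigma> ^ 4"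
    let ?X = "\<kappa> * sqrt (sqrt t) powr \<gamma> + R.gap i + 2 * ?E * (R.m2 i / sqrt t)"
    have es0: "0 \<le> noise_step.entry_sum Rs"
      unfolding noise_step.entry_sum_def[OF R.noise_step_run[of 0]] by (intro sum_nonneg) auto
    have X0: "0 \<le> ?X"
      using noise_nonneg es0 R.gap_nonneg R.m2_nonneg t by (intro add_nonneg_nonneg mult_nonneg_nonneg divide_nonneg_nonneg) auto
    have T0: "0 \<le> ?T" using noise_nonneg by simp
    have ss: "(sqrt (sqrt t))\<^sup>2 = sqrt t" using t by simp
    have "cmod (R.phi (Suc i) v - (1 - t * (v \<bullet> (R *v v)) / 2) * R.phi i (v - t *\<^sub>R (H *v v)))
        \<le> norm v * C * sqrt t * (R.mE i + R.m2 i)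
          + t * (?N * norm v)\<^sup>2 * (\<kappa> * sqrt (sqrt t) powr \<gamma> + R.gap i + 2 * ?E / (sqrt (sqrt t))\<^sup>2 * R.m2 i)
          + t * sqrt t * (?N * norm v) ^ 3 * ?T"
    proof (rule R.char_step[unfolded H_eq[OF t(1)] R_eq[OF t(1)]])
      show "norm (cent (drift (mu t) x) + t *\<^sub>R (H *v cent x)) \<le> C * t * (norm (dev x) + (norm x)\<^sup>2)" for x
        using cen[OF t(1) allI[OF R.mu_nonneg] allI[OF R.mu_upper] R.mu_max_t, of x] unfolding H_eq[OF t(1)] .
      show "0 < sqrt (sqrt t)" "sqrt (sqrt t) \<le> 1" using t by auto
      show "transpose H = H" using H_spd by (simp add: sym_pos_def_def)
    qed
    also have "\<dots> \<le> t * norm v * (C * (R.mE i / sqrt t + R.m2 i / sqrt t))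
        + t * norm v * (?N\<^sup>2 * K * ?X) + t * norm v * (sqrt t * (?N ^ 3 * K\<^sup>2 * ?T))"
    proof (intro add_mono)
      have "sqrt t = t / sqrt t" using t by (simp add: real_div_sqrt)
      then have "norm v * C * sqrt t * (R.mE i + R.m2 i) = norm v * C * (t / sqrt t) * (R.mE i + R.m2 i)" by simp
      also have "\<dots> = t * norm v * (C * (R.mE i / sqrt t + R.m2 i / sqrt t))"
        by (simp add: add_divide_distrib algebra_simps)
      finally show "norm v * C * sqrt t * (R.mE i + R.m2 i) \<le> t * norm v * (C * (R.mE i / sqrt t + R.m2 i / sqrt t))"
        by (rule eq_refl)
      have "t * (?N * norm v)\<^sup>2 * ?X = t * norm v * (?N\<^sup>2 * norm v * ?X)" by (simp add: power2_eq_square)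
      also have "\<dots> \<le> t * norm v * (?N\<^sup>2 * K * ?X)"
        using v t X0 by (intro mult_left_mono mult_right_mono) auto
      finally show "t * (?N * norm v)\<^sup>2 * (\<kappa> * sqrt (sqrt t) powr \<gamma> + R.gap i + 2 * ?E / (sqrt (sqrt t))\<^sup>2 * R.m2 i)
          \<le> t * norm v * (?N\<^sup>2 * K * ?X)" unfolding ss by simp
      have "t * sqrt t * (?N * norm v) ^ 3 * ?T = t * norm v * (sqrt t * (?N ^ 3 * (norm v)\<^sup>2 * ?T))"
        by (simp add: eval_nat_numeral)
      also have "\<dots> \<le> t * norm v * (sqrt t * (?N ^ 3 * K\<^sup>2 * ?T))"
        using v t T0 by (intro mult_left_mono mult_right_mono power_mono) auto
      finally show "t * sqrt t * (?N * norm v) ^ 3 * ?T \<le> t * norm v * (sqrt t * (?N ^ 3 * K\<^sup>2 * ?T))" .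
    qed
    also have "\<dots> = t * norm v * eps C K t i" unfolding eps_def by (simp only: distrib_left)
    finally show ?thesis .
  qed
  then show ?thesis using that C by blast
qed

text \<open>The factor 1 - t (v \<bullet> R v) / 2 is only bounded by 1; the contraction stems from
  the argument, as a bound B |w'| at w' = w - t H w is at most (1 - t l) B |w|. The constants B thus
  obey an affine recursion whose inhomogeneity is t times a small number.\<close>

lemma Phi_tendsto:
  assumes sol: "is_lyapunov_solution H R \<Phi>"
  shows "((\<lambda>(t, i). Phi t i v) \<longlongrightarrow> exp (- of_real (v \<bullet> (\<Phi> *v v) / 2))) small_step"
proof -
  \<comment> \<open>The added 1 keeps the radius positive for v = 0.\<close>
  define K where "K = norm v + 1"
  have K: "0 < K" "norm v \<le> K" by (auto simp: K_def add_nonneg_pos)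
  have Hsym: "transpose H = H" using H_spd by (simp add: sym_pos_def_def)
  have \<Phi>sym: "transpose \<Phi> = \<Phi>" by (rule lyapunov_solution_sym[OF H_spd R_sym sol])
  have \<Phi>psd: "0 \<le> v \<bullet> (\<Phi> *v v)" for v by (rule lyapunov_solution_psd[OF H_spd R_sym R_psd sol])
  define G where "G w = exp (- (w \<bullet> (\<Phi> *v w) / 2))" for w
  obtain C where C: "0 < C"
    and step: "\<And>K t i v. 0 < K \<Longrightarrow> 0 < t \<Longrightarrow> t < 1 \<Longrightarrow> norm v \<le> K \<Longrightarrow>
      cmod (Phi t (Suc i) v - (1 - t * (v \<bullet> (R *v v)) / 2) * Phi t i (v - t *\<^sub>R (H *v v))) \<le> t * norm v * eps C K t i"
    by (rule Phi_step) blast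
  obtain Cg t1 where Cg: "0 < Cg" "0 < t1" "t1 \<le> 1"
    and gs: "\<And>t v. 0 < t \<Longrightarrow> t < t1 \<Longrightarrow> norm v \<le> K \<Longrightarrow>
      0 \<le> 1 - t * (v \<bullet> (R *v v)) / 2 \<and> 1 - t * (v \<bullet> (R *v v)) / 2 \<le> 1 \<and>
      \<bar>exp (- ((v - t *\<^sub>R (H *v v)) \<bullet> (\<Phi> *v (v - t *\<^sub>R (H *v v))) / 2)) * (1 - t * (v \<bullet> (R *v v)) / 2)
        - exp (- (v \<bullet> (\<Phi> *v v) / 2))\<bar> \<le> Cg * t\<^sup>2 * norm v"
    by (rule gaussian_step[OF Hsym \<Phi>sym \<Phi>psd sol R_psd K(1)]) blast
  obtain l t2 where l: "0 < l" "0 < t2" "t2 * l \<le> 1"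
    and con: "\<And>t v. 0 < t \<Longrightarrow> t < t2 \<Longrightarrow> norm (v - t *\<^sub>R (H *v v)) \<le> (1 - t * l) * norm v"
    by (rule spd_contraction[OF H_spd]) blast
  obtain L where L: "0 < L" "\<And>v. norm (\<Phi> *v v) \<le> L * norm v" by (rule matrix_norm_bound) blast
  \<comment> \<open>Stated for the whole ball of radius K, since each step evaluates the previous
    function at another point, which the contraction keeps in the ball. The first summand of B 0 is
    the deterministic start, the second bounds 1 - G w.\<close>
  have inv: "cmod (Phi t i w - of_real (G w)) \<le> B i * norm w"
    if t: "0 < t" "t < t1" "t < t2" and B0: "B 0 = norm (cent (col wo)) / sqrt t + L * K"
      and BS: "\<And>i. B (Suc i) = (1 - t * l) * B i + t * (eps C K t i + Cg * t)" and "norm w \<le> K"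
    for t i B w
  proof -
    interpret R: diffusion_run Nb grp A p J wo lamL lamU kappaH c M "F t" ghat "mu t" t Rs \<alpha> \<sigma> \<kappa> \<gamma>
      by (rule run[OF t(1)])
    show ?thesis using \<open>norm w \<le> K\<close>
    proof (induction i arbitrary: w)
      case 0
      have "\<bar>1 - G w\<bar> \<le> L * K * norm w"
      proof -
        have g1: "G w \<le> 1" using \<Phi>psd by (simp add: G_def)
        have "1 - w \<bullet> (\<Phi> *v w) / 2 \<le> G w" using exp_ge_add_one_self[of "- (w \<bullet> (\<Phi> *v w) / 2)"] by (simp add: G_def)
        then have "1 - G w \<le> w \<bullet> (\<Phi> *v w)" using \<Phi>psd[of w] by simp
        also have "\<dots> \<le> norm w * norm (\<Phi> *v w)" by (rule norm_cauchy_schwarz)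
        also have "\<dots> \<le> norm w * (L * norm w)" by (intro mult_left_mono L) simp
        also have "\<dots> \<le> norm w * (L * K)" using 0 L by (intro mult_left_mono) auto
        finally show ?thesis using g1 by (simp add: mult.commute)
      qed
      then have "cmod (1 - of_real (G w)) \<le> L * K * norm w"
        by (metis norm_of_real of_real_1 of_real_diff)
      moreover have "cmod (R.phi 0 w - of_real (G w)) \<le> cmod (R.phi 0 w - 1) + cmod (1 - of_real (G w))"
        using norm_triangle_ineq[of "R.phi 0 w - 1" "1 - of_real (G w)"] by simp
      ultimately show ?case using R.phi_0_bound[of w] by (simp add: B0 algebra_simps)
    next
      case (Suc i)
      define w' where "w' = w - t *\<^sub>R (H *v w)"
      define q where "q = 1 - t * (w \<bullet> (R *v w)) / 2"
      have q: "0 \<le> q" "q \<le> 1" and gw: "\<bar>G w' * q - G w\<bar> \<le> Cg * t\<^sup>2 * norm w"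
        using gs[OF t(1,2) Suc.prems] by (auto simp: q_def G_def w'_def)
      have w': "norm w' \<le> (1 - t * l) * norm w" unfolding w'_def by (rule con[OF t(1,3)])
      also have "\<dots> \<le> 1 * norm w" using t l by (intro mult_right_mono) auto
      finally have w'K: "norm w' \<le> K" using Suc.prems by simp
      have Bi: "0 \<le> B i"
      \<comment> \<open>Nonnegativity of B i is read off from the induction hypothesis at a vector
        of norm K > 0, so the sign of \<open>eps\<close> never has to be discussed.\<close>
      proof -
        obtain a :: "real^('g \<times> 'm)" where a: "norm a = K"
          using vector_choose_size[OF less_imp_le[OF K(1)]] .
        have "0 \<le> B i * norm a" by (rule order_trans[OF norm_ge_zero Suc.IH]) (simp add: a)
        then show ?thesis using a K(1) by (simp add: zero_le_mult_iff)
      qed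
      have "R.phi (Suc i) w - of_real (G w)
          = (R.phi (Suc i) w - of_real q * R.phi i w') + of_real q * (R.phi i w' - of_real (G w')) + of_real (G w' * q - G w)"
        by (simp add: algebra_simps)
      also have "cmod \<dots> \<le> cmod (R.phi (Suc i) w - of_real q * R.phi i w') + cmod (of_real q * (R.phi i w' - of_real (G w')))
          + cmod (of_real (G w' * q - G w))"
        by (intro norm_triangle_le add_mono order_refl)
      also have "\<dots> \<le> t * norm w * eps C K t i + B i * ((1 - t * l) * norm w) + Cg * t\<^sup>2 * norm w"
      proof (intro add_mono)
        show "cmod (R.phi (Suc i) w - of_real q * R.phi i w') \<le> t * norm w * eps C K t i"
          using step[OF K(1) t(1) _ Suc.prems] t Cg unfolding q_def w'_def by simp
        have "cmod (of_real q * (R.phi i w' - of_real (G w'))) \<le> 1 * (B i * norm w')"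
          unfolding norm_mult using q Suc.IH[OF w'K] by (intro mult_mono) auto
        also have "\<dots> \<le> B i * ((1 - t * l) * norm w)" using w' Bi by (intro order_trans[OF eq_refl[OF mult_1] mult_left_mono])
        finally show "cmod (of_real q * (R.phi i w' - of_real (G w'))) \<le> B i * ((1 - t * l) * norm w)" .
        show "cmod (of_real (G w' * q - G w)) \<le> Cg * t\<^sup>2 * norm w" unfolding norm_of_real by (rule gw)
      qed
      also have "\<dots> = B (Suc i) * norm w" by (simp add: BS power2_eq_square algebra_simps)
      finally show ?case .
    qed
  qed
  show ?thesis
  proof (rule tendstoI)
    fix a :: real assume a: "0 < a"
    \<comment> \<open>The limiting bound is K ((e + Cg t) / l + e): the last e is the slack in the
      recursion. This e makes the share of both e terms a / 4, and the bound in t3 makes the share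
      of Cg t at most a / 4.\<close>
    define e where "e = a / (4 * K * (1 / l + 1))"
    have e: "0 < e" using a K l by (simp add: e_def add_pos_pos)
    define t3 where "t3 = min t1 (min t2 (a * l / (4 * K * Cg)))"
    have t3: "0 < t3" using a K l Cg by (simp add: t3_def)
    have "\<forall>\<^sub>F x in small_step. (case x of (t, i) \<Rightarrow> eps C K t i) < e"
      using eps_tendsto e by (rule order_tendstoD(2))
    then have "\<forall>\<^sub>F t in at_right 0. \<forall>\<^sub>F i in sequentially. eps C K t i < e"
      by (simp add: eventually_small_step)
    moreover have "\<forall>\<^sub>F t in at_right 0. 0 < t \<and> t < t3"
      unfolding eventually_at_right_field using t3 by blast
    ultimately have "\<forall>\<^sub>F t in at_right 0. \<forall>\<^sub>F i in sequentially. cmod (Phi t i v - of_real (G v)) < a"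
    proof eventually_elim
      case (elim t)
      then have t: "0 < t" "t < t1" "t < t2" and ta: "t \<le> a * l / (4 * K * Cg)" by (auto simp: t3_def)
      have tl: "0 < t * l" "t * l \<le> 1" using t l by (auto intro: order_trans[OF mult_right_mono[of t t2 l]])
      define B where "B = rec_nat (norm (cent (col wo)) / sqrt t + L * K) (\<lambda>i b. (1 - t * l) * b + t * (eps C K t i + Cg * t))"
      have ev: "\<forall>\<^sub>F i in sequentially. eps C K t i \<le> e" using elim(1) by eventually_elim simp
      have "\<forall>\<^sub>F i in sequentially. B (Suc i) \<le> (1 - t * l) * B i + t * (e + Cg * t)"
        using ev by eventually_elim (use t in \<open>simp add: B_def\<close>)
      then have "\<forall>\<^sub>F i in sequentially. B i \<le> t * (e + Cg * t) / (t * l) + e"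
        by (rule affine_recursion_eventually[OF _ tl e])
      then show ?case
      proof eventually_elim
        case (elim i)
        have Bi: "B i \<le> (e + Cg * t) / l + e" using elim t by simp
        have "cmod (Phi t i v - of_real (G v)) \<le> B i * norm v"
          by (rule inv[OF t _ _ K(2)]) (simp_all add: B_def)
        also have "\<dots> \<le> ((e + Cg * t) / l + e) * norm v" by (intro mult_right_mono Bi) simp
        also have "\<dots> \<le> ((e + Cg * t) / l + e) * K"
          using K e Cg t l by (intro mult_left_mono add_nonneg_nonneg divide_nonneg_nonneg) auto
        also have "\<dots> = K * (1 / l + 1) * e + K * Cg / l * t" using l by (simp add: field_simps)
        also have "\<dots> \<le> a / 4 + K * Cg / l * (a * l / (4 * K * Cg))"
        proof (intro add_mono mult_left_mono ta)
          have "0 < 1 / l + 1" using l by (simp add: add_pos_pos)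
          moreover have "K * r * (a / (4 * K * r)) \<le> a / 4" if "0 < r" for r using K that by simp
          ultimately show "K * (1 / l + 1) * e \<le> a / 4" unfolding e_def by blast
        qed (use K Cg l in simp)
        also have "\<dots> < a" using a K Cg l by simp
        finally show ?case .
      qed
    qed
    moreover have "complex_of_real (G v) = exp (- of_real (v \<bullet> (\<Phi> *v v) / 2))"
      by (simp add: G_def flip: exp_of_real)
    ultimately show "\<forall>\<^sub>F x in small_step. dist (case x of (t, i) \<Rightarrow> Phi t i v) (exp (- of_real (v \<bullet> (\<Phi> *v v) / 2))) < a"
      unfolding eventually_small_step dist_norm by simp
  qed
qed

end

section \<open>Convergence in law of the normalised network error\<close>

context diffusion_family
begin

text \<open>The centroid limit is transported by the adjoint of \<open>spread grp\<close>. The index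
  Suc i is that of the error after iteration i.\<close>

lemma error_char_tendsto:
  assumes "is_lyapunov_solution H R \<Phi>"
  defines "v \<equiv> \<lambda>u. adjoint (spread grp) u"
  shows "((\<lambda>(t, i). CLINT \<omega>|M. iexp (u \<bullet> ((1 / sqrt t) *\<^sub>R Err t (Suc i) \<omega>)))
    \<longlongrightarrow> exp (- of_real (v u \<bullet> (\<Phi> *v v u) / 2))) small_step"
proof -
  let ?f = "\<lambda>(t, i). CLINT \<omega>|M. iexp (u \<bullet> ((1 / sqrt t) *\<^sub>R Err t (Suc i) \<omega>))"
  have P: "((\<lambda>(t, i). Phi t (Suc i) (v u)) \<longlongrightarrow> exp (- of_real (v u \<bullet> (\<Phi> *v v u) / 2))) small_step"
    by (rule small_step_tendsto_Suc[OF Phi_tendsto[OF assms(1)]])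
  have "((\<lambda>(t, i). ME t (Suc i) / sqrt t) \<longlongrightarrow> 0) small_step"
    by (rule small_step_tendsto_Suc[OF ME_tendsto])
  then have E: "((\<lambda>x. norm u * (case x of (t, i) \<Rightarrow> ME t (Suc i) / sqrt t)) \<longlongrightarrow> 0) small_step"
    by (rule tendsto_mult_right_zero)
  have "((\<lambda>x. ?f x - (case x of (t, i) \<Rightarrow> Phi t (Suc i) (v u))) \<longlongrightarrow> 0) small_step"
  proof (rule Lim_null_comparison[OF _ E])
    show "\<forall>\<^sub>F x in small_step. norm (?f x - (case x of (t, i) \<Rightarrow> Phi t (Suc i) (v u)))
        \<le> norm u * (case x of (t, i) \<Rightarrow> ME t (Suc i) / sqrt t)"
    proof (rule eventually_small_stepI[of 1])
      fix t :: real assume "0 < t"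
      from diffusion_run.char_error_bound[OF run[OF this], of u]
      show "\<forall>\<^sub>F i in sequentially. norm (?f (t, i) - (case (t, i) of (t, i) \<Rightarrow> Phi t (Suc i) (v u)))
        \<le> norm u * (case (t, i) of (t, i) \<Rightarrow> ME t (Suc i) / sqrt t)"
        by (intro always_eventually allI) (simp add: v_def)
    qed simp
  qed
  from tendsto_add[OF this P] show ?thesis by (simp add: case_prod_beta')
qed

text \<open>Markov's inequality with the O(t) second moment: after normalisation the tail beyond K
  is at most B / K^2, which equals e for the K chosen.\<close>

lemma error_tight:
  assumes e: "0 < e"
  shows "\<exists>K. \<forall>\<^sub>F x in small_step.
    measure (distr M borel (\<lambda>\<omega>. (1 / sqrt (fst x)) *\<^sub>R Err (fst x) (Suc (snd x)) \<omega>)) {y. K < norm y} \<le> e"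
proof -
  obtain B t0 where B: "0 < B" "0 < t0" "t0 \<le> 1"
    "\<And>t. 0 < t \<Longrightarrow> t < t0 \<Longrightarrow> \<forall>\<^sub>F i in sequentially. M2 t i \<le> B * t" by (rule M2_bound) blast
  define K where "K = sqrt (B / e)"
  have K: "0 < K" "K\<^sup>2 = B / e" using B e by (auto simp: K_def)
  have "\<forall>\<^sub>F x in small_step.
    measure (distr M borel (\<lambda>\<omega>. (1 / sqrt (fst x)) *\<^sub>R Err (fst x) (Suc (snd x)) \<omega>)) {y. K < norm y} \<le> e"
  proof (rule eventually_small_stepI[OF B(2)])
    fix t assume t: "0 < t" "t < t0"
    have "\<forall>\<^sub>F i in sequentially. M2 t (Suc i) \<le> B * t"
      using B(4)[OF t] by (simp add: eventually_sequentially_Suc[of "\<lambda>i. M2 t i \<le> B * t"])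
    then show "\<forall>\<^sub>F i in sequentially. measure (distr M borel
        (\<lambda>\<omega>. (1 / sqrt (fst (t, i))) *\<^sub>R Err (fst (t, i)) (Suc (snd (t, i))) \<omega>)) {y. K < norm y} \<le> e"
    proof eventually_elim
      case (elim i)
      have "measure (distr M borel (\<lambda>\<omega>. (1 / sqrt t) *\<^sub>R Err t (Suc i) \<omega>)) {y. K < norm y} \<le> M2 t (Suc i) / (t * K\<^sup>2)"
        by (rule diffusion_run.markov_error[OF run[OF t(1)] K(1)])
      also have "\<dots> \<le> B * t / (t * K\<^sup>2)" using elim t by (intro divide_right_mono) auto
      also have "\<dots> = e" using t B e by (simp add: K)
      finally show ?case by simp
    qed
  qed
  then show ?thesis by blast
qed

end

text \<open>Convergence of characteristic functions and tightness enter the coupling theorem along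
  \<open>small_step\<close>; the resulting couplings precede the choice of f, and the limit along
  the filter is then unfolded into a limit of limsups. Uniqueness and positivity of \<Phi> come from
  the Lyapunov section, with H and R read off from a single run.\<close>

theorem theorem3:
  fixes M :: "'a measure"
    and Nb :: "'n::finite \<Rightarrow> 'n set"
    and cl :: "'n \<Rightarrow> 'q::finite"
    and grp :: "'n \<Rightarrow> 'g::finite"
    and J :: "'n \<Rightarrow> real^'m::finite \<Rightarrow> real"
    and wstar :: "'q \<Rightarrow> real^'m"
    and wo :: "'n \<Rightarrow> real^'m"
    and lamL lamU :: "'n \<Rightarrow> real"
    and kappaH :: real
    and A :: "real^'n^'n"
    and p :: "'n \<Rightarrow> real"
    and ghat :: "'n \<Rightarrow> nat \<Rightarrow> 'a \<Rightarrow> real^'m \<Rightarrow> real^'m"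
    and mu :: "real \<Rightarrow> 'n \<Rightarrow> real"
    and F :: "real \<Rightarrow> nat \<Rightarrow> 'a measure"
    and alpha sig kappa gam c :: real
    and Rs :: "real^('n \<times> 'm)^('n \<times> 'm)"
    and H R :: "real^('g \<times> 'm)^('g \<times> 'm)"
    and w :: "real \<Rightarrow> nat \<Rightarrow> 'a \<Rightarrow> real^('n \<times> 'm)"
    and X :: "real \<Rightarrow> nat \<Rightarrow> 'a \<Rightarrow> real^('n \<times> 'm)"
  defines "w \<equiv> \<lambda>t i \<omega>. col (atc Nb grp A ghat (mu t) i \<omega>)"
    and "X \<equiv> \<lambda>t i \<omega>. (1 / sqrt t) *\<^sub>R (col wo - w t (Suc i) \<omega>)"
  assumes "prob_space M"
    and network: "clustered_network Nb cl grp"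
    and minimizers: "\<And>k. unique_minimizer (J k) (wo k)" "\<And>k. wo k = wstar (cl k)"
    and costs: "cost_assumptions J grp lamL lamU kappaH"
    and combination: "combination_matrix Nb grp A" "perron_vectors grp A p"
    and gradients: "\<And>k i. (\<lambda>(\<omega>, x). ghat k i \<omega> x) \<in> borel_measurable (M \<Otimes>\<^sub>M borel)"
    and step_sizes: "0 < c" "\<And>t k. 0 < t \<Longrightarrow> c * t \<le> mu t k" "\<And>t. 0 < t \<Longrightarrow> mu_max (mu t) = t"
    and const_limits: "\<And>t. 0 < t \<Longrightarrow> Hbar J wo grp p (mu t) = H" "\<And>t. 0 < t \<Longrightarrow> Rbar Rs grp p (mu t) = R"
    and noise: "\<And>t. 0 < t \<Longrightarrow> noise_assumptions M (F t) J ghat (col wo) alpha sig kappa gam Rs"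
    and adapted: "\<And>t i. 0 < t \<Longrightarrow> w t i \<in> borel_measurable (F t i)"
  shows "\<exists>\<Phi> \<nu>. is_lyapunov_solution H R \<Phi> \<and> (\<forall>\<Psi>. is_lyapunov_solution H R \<Psi> \<longrightarrow> \<Psi> = \<Phi>) \<and>
    gaussian_law \<nu> 0 \<Phi> \<and>
    gaussian_law (distr \<nu> borel (spread grp)) 0 (Pi_mat grp \<Phi>) \<and>
    (\<exists>C. (\<forall>t>0. \<forall>i. is_coupling (C t i) (distr M borel (X t i)) (distr \<nu> borel (spread grp))) \<and>
      (\<forall>f :: real^('n \<times> 'm) \<Rightarrow> real. continuous_on UNIV f \<and> bounded (range f) \<longrightarrow>
        ((\<lambda>t. limsup (\<lambda>i. ereal (LINT (x, \<zeta>)|C t i. \<bar>f x - f \<zeta>\<bar>))) \<longlongrightarrow> 0) (at_right 0)))"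
proof -
  interpret M: prob_space M by fact
  have nz: "noise_assumptions M (F 1) J ghat (col wo) alpha sig kappa gam Rs" by (rule noise) simp
  have self: "k \<in> Nb k" and conn: "connected_in (grp -` {m}) (links Nb)"
    and grp_cl: "grp k = grp l \<Longrightarrow> cl k = cl l" for k l m
    using network unfolding clustered_network_def by blast+
  have wo_grp: "wo k = wo l" if "grp k = grp l" for k l
    unfolding minimizers(2) grp_cl[OF that] ..
  have diff: "diffusion Nb grp A p J wo lamL lamU kappaH c"
    by (intro diffusion.intro group_mixing.intro diffusion_axioms.intro self conn combination minimizers(1) costs step_sizes(1))
  have run: "diffusion_run Nb grp A p J wo lamL lamU kappaH c M (F t) ghat (mu t) t Rs alpha sig kappa gam"
    if t: "0 < t" for t
    by (intro diffusion_run.intro diffusion_run_axioms.intro diff M.prob_space_axioms wo_grp gradients t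
        step_sizes(2,3)[OF t] noise[OF t] adapted[OF t, unfolded w_def])
  have nz_facts: "sym_pos_def Rs" "0 \<le> alpha" "0 \<le> sig" "0 \<le> kappa" "0 < gam"
    using nz unfolding noise_assumptions_def by blast+
  interpret D: diffusion_family Nb grp A p J wo lamL lamU kappaH c M F ghat mu Rs alpha sig kappa gam H R
    by (intro diffusion_family.intro diffusion_family_axioms.intro diff run const_limits nz_facts)
  obtain \<Phi> where sol: "is_lyapunov_solution H R \<Phi>" and uniq: "\<And>\<Psi>. is_lyapunov_solution H R \<Psi> \<Longrightarrow> \<Psi> = \<Phi>"
    using lyapunov_solution_ex1[OF D.H_spd, of R] by blast
  obtain \<nu> where \<nu>: "gaussian_law \<nu> 0 \<Phi>"
    by (rule gaussian_law_exists[OF lyapunov_solution_sym[OF D.H_spd D.R_sym sol]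
          lyapunov_solution_psd[OF D.H_spd D.R_sym D.R_psd sol]])
  define N :: "(real^('n \<times> 'm)) measure" where "N = distr \<nu> borel (spread grp)"
  have \<nu>p: "prob_space \<nu>" and \<nu>s: "sets \<nu> = sets borel" using \<nu> by (simp_all add: gaussian_law_def)
  have sm: "(spread grp :: _ \<Rightarrow> real^('n \<times> 'm)) \<in> borel_measurable \<nu>"
    unfolding measurable_cong_sets[OF \<nu>s refl]
    by (intro borel_measurable_continuous_onI linear_continuous_on linear_spread[unfolded linear_conv_bounded_linear])
  have N: "prob_space N" "sets N = sets borel"
    unfolding N_def using prob_space.prob_space_distr[OF \<nu>p sm] by simp_all
  have Ncf: "(CLINT x|N. iexp (u \<bullet> x))
      = exp (- of_real (adjoint (spread grp) u \<bullet> (\<Phi> *v adjoint (spread grp) u) / 2))" for u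
  proof -
    have "(CLINT x|N. iexp (u \<bullet> x)) = (CLINT x|\<nu>. iexp (u \<bullet> spread grp x))"
      unfolding N_def by (rule integral_distr[OF sm]) measurable
    also have "\<dots> = (CLINT x|\<nu>. iexp (adjoint (spread grp) u \<bullet> x))"
      using adjoint_works[OF linear_spread, of _ grp u] by (simp add: inner_commute)
    also have "\<dots> = exp (- of_real (adjoint (spread grp) u \<bullet> (\<Phi> *v adjoint (spread grp) u) / 2))"
      using \<nu> by (simp add: gaussian_law_def)
    finally show ?thesis .
  qed
  \<comment> \<open>The coupling theorem wants a probability law for every index, so indices with t
    \<le> 0, which the filter ignores, receive a point mass.\<close>
  define \<mu> where "\<mu> j = (if 0 < fst j then distr M borel (X (fst j) (snd j)) else return borel 0)" for j :: "real \<times> nat"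
  have XE: "X t i = (\<lambda>\<omega>. (1 / sqrt t) *\<^sub>R D.Err t (Suc i) \<omega>)" if "0 < t" for t i
    unfolding X_def w_def diffusion_run.err_def[OF run[OF that]] ..
  have Xm: "X t i \<in> borel_measurable M" if "0 < t" for t i
    unfolding XE[OF that] using diffusion_run.err_M[OF run[OF that], of "Suc i"] by measurable
  have \<mu>: "prob_space (\<mu> j)" "sets (\<mu> j) = sets borel" for j
    using M.prob_space_distr[OF Xm] by (auto simp: \<mu>_def prob_space_return)
  have cf: "((\<lambda>j. CLINT x|\<mu> j. iexp (u \<bullet> x)) \<longlongrightarrow> (CLINT x|N. iexp (u \<bullet> x))) small_step" for u
  proof (rule Lim_transform_eventually)
    show "((\<lambda>(t, i). CLINT \<omega>|M. iexp (u \<bullet> ((1 / sqrt t) *\<^sub>R D.Err t (Suc i) \<omega>))) \<longlongrightarrow> (CLINT x|N. iexp (u \<bullet> x))) small_step"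
      unfolding Ncf by (rule D.error_char_tendsto[OF sol])
    show "\<forall>\<^sub>F j in small_step. (case j of (t, i) \<Rightarrow> CLINT \<omega>|M. iexp (u \<bullet> ((1 / sqrt t) *\<^sub>R D.Err t (Suc i) \<omega>)))
        = (CLINT x|\<mu> j. iexp (u \<bullet> x))"
    proof (rule eventually_small_stepI[of 1])
      fix t :: real assume t: "0 < t"
      have "(CLINT x|\<mu> (t, i). iexp (u \<bullet> x)) = (CLINT \<omega>|M. iexp (u \<bullet> X t i \<omega>))" for i
        using t Xm[OF t, of i] by (simp add: \<mu>_def integral_distr)
      then show "\<forall>\<^sub>F i in sequentially. (case (t, i) of (t, i) \<Rightarrow> CLINT \<omega>|M. iexp (u \<bullet> ((1 / sqrt t) *\<^sub>R D.Err t (Suc i) \<omega>)))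
        = (CLINT x|\<mu> (t, i). iexp (u \<bullet> x))" by (simp add: XE[OF t])
    qed simp
  qed
  have tight: "\<exists>K. \<forall>\<^sub>F j in small_step. measure (\<mu> j) {x. K < norm x} \<le> e" if e: "0 < e" for e
  proof -
    obtain K where "\<forall>\<^sub>F x in small_step.
      measure (distr M borel (\<lambda>\<omega>. (1 / sqrt (fst x)) *\<^sub>R D.Err (fst x) (Suc (snd x)) \<omega>)) {y. K < norm y} \<le> e"
      using D.error_tight[OF e] by blast
    moreover have "\<forall>\<^sub>F x in small_step. 0 < fst x" by (rule eventually_small_stepI[of 1]) simp_all
    ultimately have "\<forall>\<^sub>F j in small_step. measure (\<mu> j) {x. K < norm x} \<le> e"
      by eventually_elim (simp add: \<mu>_def XE)
    then show ?thesis by blast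
  qed
  \<comment> \<open>The slack is t itself; the value 1 elsewhere keeps it positive for all
    indices.\<close>
  define \<eta> where "\<eta> j = (if 0 < fst j then fst j else 1 :: real)" for j :: "real \<times> nat"
  have \<eta>0: "0 < \<eta> j" for j by (simp add: \<eta>_def)
  have \<eta>lim: "(\<eta> \<longlongrightarrow> 0) small_step"
  proof (rule Lim_transform_eventually)
    show "((\<lambda>(t, i). t) \<longlongrightarrow> 0) small_step" by (rule small_step_fst_tendsto) (rule tendsto_ident_at)
    show "\<forall>\<^sub>F j in small_step. (case j of (t, i) \<Rightarrow> t) = \<eta> j"
      by (rule eventually_small_stepI[of 1]) (simp_all add: \<eta>_def)
  qed
  obtain C where C: "\<And>j. is_coupling (C j) (\<mu> j) N"
    and Clim: "\<And>f :: real^('n \<times> 'm) \<Rightarrow> real. continuous_on UNIV f \<Longrightarrow> bounded (range f) \<Longrightarrow>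
      ((\<lambda>j. LINT (x, y)|C j. \<bar>f x - f y\<bar>) \<longlongrightarrow> 0) small_step"
    using couplings_of_char_convergence[OF \<mu> N cf tight \<eta>0 \<eta>lim] by blast
  have "\<forall>t>0. \<forall>i. is_coupling (C (t, i)) (distr M borel (X t i)) N"
    using C by (metis \<mu>_def fst_conv snd_conv)
  moreover have "((\<lambda>t. limsup (\<lambda>i. ereal (LINT (x, \<zeta>)|C (t, i). \<bar>f x - f \<zeta>\<bar>))) \<longlongrightarrow> 0) (at_right 0)"
    if f: "continuous_on UNIV f" "bounded (range f)" for f :: "real^('n \<times> 'm) \<Rightarrow> real"
  proof (rule order_tendstoI)
    let ?E = "\<lambda>t i. LINT (x, \<zeta>)|C (t, i). \<bar>f x - f \<zeta>\<bar>"
    have nn: "0 \<le> limsup (\<lambda>i. ereal (?E t i))" for t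
    proof -
      have "0 \<le> ?E t i" for i by (simp add: case_prod_beta')
      then have "limsup (\<lambda>i. 0) \<le> limsup (\<lambda>i. ereal (?E t i))" by (intro Limsup_mono always_eventually) simp
      then show ?thesis by (simp add: Limsup_const)
    qed
    show "\<forall>\<^sub>F t in at_right 0. a < limsup (\<lambda>i. ereal (?E t i))" if "a < 0" for a
      using less_le_trans[OF that nn] by (intro always_eventually) blast
    show "\<forall>\<^sub>F t in at_right 0. limsup (\<lambda>i. ereal (?E t i)) < a" if a: "0 < a" for a
    proof -
      \<comment> \<open>The bound a may be infinite and the integrals are real, so a real number r
        is inserted; r < a also restores the strict inequality lost in passing to the
        limsup.\<close>
      obtain r where r: "0 < ereal r" "ereal r < a" using ereal_dense2[OF a] by blast
      have "\<forall>\<^sub>F j in small_step. (LINT (x, y)|C j. \<bar>f x - f y\<bar>) < r"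
        using Clim[OF f] r(1) by (intro order_tendstoD(2)[where a = r]) auto
      then have "\<forall>\<^sub>F t in at_right 0. \<forall>\<^sub>F i in sequentially. ?E t i < r"
        unfolding eventually_small_step .
      then show ?thesis
      proof eventually_elim
        case (elim t)
        have "limsup (\<lambda>i. ereal (?E t i)) \<le> ereal r"
          by (rule Limsup_bounded) (use elim in eventually_elim, simp)
        then show ?case using r(2) by (rule le_less_trans)
      qed
    qed
  qed
  ultimately have "\<exists>C. (\<forall>t>0. \<forall>i. is_coupling (C t i) (distr M borel (X t i)) (distr \<nu> borel (spread grp))) \<and>
      (\<forall>f :: real^('n \<times> 'm) \<Rightarrow> real. continuous_on UNIV f \<and> bounded (range f) \<longrightarrow>
        ((\<lambda>t. limsup (\<lambda>i. ereal (LINT (x, \<zeta>)|C t i. \<bar>f x - f \<zeta>\<bar>))) \<longlongrightarrow> 0) (at_right 0))"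
    unfolding N_def by (intro exI[of _ "\<lambda>t i. C (t, i)"]) blast
  then show ?thesis using sol uniq \<nu> gaussian_law_spread[OF \<nu>, of grp] by blast
qed

end
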